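(* Let $\Omega\subset\mathbb{C}^n$ be an irreducible bounded symmetric domain, $\gamma>-1$, $p\in[1,\infty]$, and let $M=M_V\subset A^2(\Omega,dv_\gamma)$ be the weighted Bergman submodule determined by an analytic variety $V$ in $\Omega$. Let $\phi=(\phi_1,\dots,\phi_n):(\Omega,w)\to(\Omega,z)$ be an automorphism with $z=\phi(w)$. Then: (1) The $\mathbb{C}[w]$-module $(\phi^*(M^\perp),S_w)$ is $p$-essentially normal if and only if the $\mathbb{C}[z]$-module $(M^\perp,S_z)$ is $p$-essentially normal. (2) The following two statements are equivalent: (a) $[S_{w_i},S_{w_j}^*]\in\mathcal{L}^p(M^\perp)$ for all $i,j=1,\dots,n$; (b) $[S_{\phi_i},S_{\phi_j}^*]\in\mathcal{L}^p(M^\perp)$ for all $i,j=1,\dots,n$.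
   Context: $\Omega$ is realized as the open unit ball of $\mathbb{C}^n$ in the spectral norm of the associated Hermitian Jordan triple. $N$ is its genus and $\Delta(z,w)$ its Jordan triple determinant (generic polynomial): the polynomial in $z,\bar w$ with $\Delta(0,0)=1$ such that the Bergman kernel of $\Omega$ for the normalized Lebesgue measure $dv$ is $\Delta(z,w)^{-N}$. For $\gamma>-1$, $dv_\gamma(w)=c_\gamma\Delta(w,w)^\gamma dv(w)$ is normalized to be a probability measure, and $A^2(\Omega,dv_\gamma)$ is the space of square-integrable holomorphic functions. An analytic variety $V$ in $\Omega$ is a nonempty closed subset of $\Omega$ that is locally the common zero set of finitely many holomorphic functions; $M_V=\{f\in A^2(\Omega,dv_\gamma): f|_V=0\}$, a closed subspace invariant under multiplication by polynomials. $(\Omega,w)$ and $(\Omega,z)$ both denote the domain $\Omega$, with coordinates named $w$ and $z$ respectively. The pullback is $\phi^*(f)=f\circ\phi$. It is a unitary from $A^2(\Omega,dv_\gamma)$ onto $A^2(\Omega,\phi^*(dv_\gamma))$, where $\phi^*(dv_\gamma)(w)=c_\gamma\Delta(\phi(w),\phi(w))^\gamma dv(\phi(w))$; and $\phi^*(M^\perp)=(\phi^*(M))^\perp$ in $A^2(\Omega,\phi^*(dv_\gamma))$. For $f$ holomorphic on $\Omega$ and continuous on $\overline\Omega$, the truncated Toeplitz operator $S_f$ on $M^\perp$ is $S_fh=P_{M^\perp}(fh)$; likewise on $\phi^*(M^\perp)$, $S_fh=P_{\phi^*(M^\perp)}(fh)$ with the projection taken in $A^2(\Omega,\phi^*(dv_\gamma))$.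 $S_z=(S_{z_1},\dots,S_{z_n})$ on $M^\perp$ and $S_w=(S_{w_1},\dots,S_{w_n})$ on $\phi^*(M^\perp)$ are given by the coordinate functions. In (2), all operators act on $M^\perp$: $S_{w_i}$ is the truncated Toeplitz operator on $M^\perp$ whose symbol is the $i$-th coordinate function and $S_{\phi_i}$ the one whose symbol is $\phi_i$. A Hilbert space $L$ with commuting bounded operators $(A_1,\dots,A_n)$ is $p$-essentially normal if $[A_i,A_j^*]\in\mathcal{L}^p(L)$ for all $i,j$, where $\mathcal{L}^p(L)$ is the Schatten $p$-class ($p<\infty$) and $\mathcal{L}^\infty(L)$ the compact operators. *)

theory Defs
  imports "HOL-Probability.Probability"
begin

section \<open>Holomorphic maps and bounded symmetric domains\<close>

definition holo_fun :: "(complex^'n \<Rightarrow> complex) \<Rightarrow> (complex^'n) set \<Rightarrow> bool" where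
  "holo_fun f U \<longleftrightarrow>
     (\<forall>z\<in>U. \<exists>D. (f has_derivative D) (at z) \<and> Vector_Spaces.linear (*s) (*) D)"

definition holo_map :: "(complex^'n \<Rightarrow> complex^'n) \<Rightarrow> (complex^'n) set \<Rightarrow> bool" where
  "holo_map \<phi> U \<longleftrightarrow> (\<forall>i. holo_fun (\<lambda>z. \<phi> z $ i) U)"

definition biholo :: "(complex^'n) set \<Rightarrow> (complex^'n) set \<Rightarrow> (complex^'n \<Rightarrow> complex^'n) \<Rightarrow> bool" where
  "biholo U W \<phi> \<longleftrightarrow> bij_betw \<phi> U W \<and> holo_map \<phi> U \<and> holo_map (the_inv_into U \<phi>) W"

abbreviation automorphism :: "(complex^'n) set \<Rightarrow> (complex^'n \<Rightarrow> complex^'n) \<Rightarrow> bool" where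
  "automorphism \<Omega> \<phi> \<equiv> biholo \<Omega> \<Omega> \<phi>"

definition bounded_domain :: "(complex^'n) set \<Rightarrow> bool" where
  "bounded_domain \<Omega> \<longleftrightarrow> \<Omega> \<noteq> {} \<and> open \<Omega> \<and> connected \<Omega> \<and> bounded \<Omega>"

definition bounded_symmetric_domain :: "(complex^'n) set \<Rightarrow> bool" where
  "bounded_symmetric_domain \<Omega> \<longleftrightarrow> bounded_domain \<Omega> \<and>
     (\<forall>a\<in>\<Omega>. \<exists>s. automorphism \<Omega> s \<and> (\<forall>z\<in>\<Omega>. s (s z) = z) \<and> s a = a \<and>
        (\<exists>U. open U \<and> a \<in> U \<and> (\<forall>z\<in>U \<inter> \<Omega>. s z = z \<longrightarrow> z = a)))"

text \<open>
  A domain in a product of two complex coordinate spaces of positive dimension with total dimension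
  \<open>CARD('n)\<close> is, after labelling the coordinates by a partition of \<open>'n\<close> into two nonempty
  sets \<open>I\<close> and \<open>- I\<close>, a subset of \<open>complex^'n\<close>. It is a product of a set of
  \<open>I\<close>-coordinates with a set of \<open>- I\<close>-coordinates iff it is closed under
  exchanging the \<open>I\<close>-coordinates of its points.
\<close>

definition product_set :: "'n set \<Rightarrow> (complex^'n) set \<Rightarrow> bool" where
  "product_set I D \<longleftrightarrow> (\<forall>x\<in>D. \<forall>y\<in>D. (\<chi> i. if i \<in> I then x $ i else y $ i) \<in> D)"

definition irreducible_bsd :: "(complex^'n) set \<Rightarrow> bool" where
  "irreducible_bsd \<Omega> \<longleftrightarrow> bounded_symmetric_domain \<Omega> \<and>
     \<not> (\<exists>I D \<psi>. I \<noteq> {} \<and> I \<noteq> UNIV \<and> bounded_domain D \<and> product_set I D \<and> biholo \<Omega> D \<psi>)"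


section \<open>Positive Hermitian Jordan triples\<close>

type_synonym 'n triple = "complex^'n \<Rightarrow> complex^'n \<Rightarrow> complex^'n \<Rightarrow> complex^'n"

text \<open>
  Here \<open>T x y z\<close> is the triple product \<open>{x y z}\<close>, antilinear in the middle variable. Positivity is
  positivity of the trace form, the trace of the complex linear map \<open>T x x\<close>.
\<close>

definition positive_hermitian_jordan_triple :: "('n::finite) triple \<Rightarrow> bool" where
  "positive_hermitian_jordan_triple T \<longleftrightarrow>
     (\<forall>y z. Vector_Spaces.linear (*s) (*s) (\<lambda>x. T x y z)) \<and>
     (\<forall>x z y y'. T x (y + y') z = T x y z + T x y' z) \<and>
     (\<forall>x z y a. T x (a *s y) z = cnj a *s T x y z) \<and>
     (\<forall>x y z. T x y z = T z y x) \<and>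
     (\<forall>x y u v z. T x y (T u v z) - T u v (T x y z) = T (T x y u) v z - T u (T v x y) z) \<and>
     (\<forall>x. x \<noteq> 0 \<longrightarrow> (let t = (\<Sum>i\<in>UNIV. T x x (axis i 1) $ i) in Im t = 0 \<and> 0 < Re t))"

definition tripotent :: "('n::finite) triple \<Rightarrow> complex^'n \<Rightarrow> bool" where
  "tripotent T e \<longleftrightarrow> T e e e = e"

definition triple_orthogonal :: "('n::finite) triple \<Rightarrow> complex^'n \<Rightarrow> complex^'n \<Rightarrow> bool" where
  "triple_orthogonal T e f \<longleftrightarrow> (\<forall>z. T e f z = 0)"

definition spectral_decomposition ::
    "('n::finite) triple \<Rightarrow> complex^'n \<Rightarrow> nat \<Rightarrow> (nat \<Rightarrow> real) \<Rightarrow> (nat \<Rightarrow> complex^'n) \<Rightarrow> bool" where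
  "spectral_decomposition T x k l e \<longleftrightarrow>
     (\<forall>i<k. tripotent T (e i) \<and> e i \<noteq> 0 \<and> l i > 0) \<and>
     (\<forall>i<k. \<forall>j<k. i < j \<longrightarrow> l j < l i \<and> triple_orthogonal T (e i) (e j)) \<and>
     x = (\<Sum>i<k. l i *\<^sub>R e i)"

definition spectral_norm :: "('n::finite) triple \<Rightarrow> complex^'n \<Rightarrow> real" where
  "spectral_norm T x =
     (THE r. \<exists>k l e. spectral_decomposition T x k l e \<and> r = Max (insert 0 (l ` {..<k})))"

definition primitive_tripotent :: "('n::finite) triple \<Rightarrow> complex^'n \<Rightarrow> bool" where
  "primitive_tripotent T e \<longleftrightarrow> tripotent T e \<and> e \<noteq> 0 \<and>
     \<not> (\<exists>f g. tripotent T f \<and> tripotent T g \<and> f \<noteq> 0 \<and> g \<noteq> 0 \<and> triple_orthogonal T f g \<and> e = f + g)"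

definition jordan_frame :: "('n::finite) triple \<Rightarrow> nat \<Rightarrow> (nat \<Rightarrow> complex^'n) \<Rightarrow> bool" where
  "jordan_frame T r e \<longleftrightarrow>
     (\<forall>i<r. primitive_tripotent T (e i)) \<and>
     (\<forall>i<r. \<forall>j<r. i \<noteq> j \<longrightarrow> triple_orthogonal T (e i) (e j)) \<and>
     \<not> (\<exists>f. tripotent T f \<and> f \<noteq> 0 \<and> (\<forall>i<r. triple_orthogonal T (e i) f))"

text \<open>
  The joint Peirce space of the frame \<open>e\<close> for the eigenvalues \<open>m k / 2\<close> of the maps
  \<open>T (e k) (e k)\<close>. The indices \<open>m k = of_bool (k = i) + of_bool (k = j)\<close> with \<open>i \<noteq> j\<close> give the
  space usually denoted \<open>V_ij\<close>, and \<open>m k = of_bool (k = i)\<close> gives \<open>V_0i\<close>.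
\<close>

definition joint_peirce ::
    "('n::finite) triple \<Rightarrow> nat \<Rightarrow> (nat \<Rightarrow> complex^'n) \<Rightarrow> (nat \<Rightarrow> complex) \<Rightarrow> (complex^'n) set" where
  "joint_peirce T r e m = {x. \<forall>k<r. T (e k) (e k) x = (m k / 2) *s x}"

text \<open>
  The genus \<open>2 + a (r - 1) + b\<close>, where \<open>r\<close> is the rank and \<open>a\<close>, \<open>b\<close> are the characteristic
  multiplicities. For rank one there is no \<open>V_ij\<close>, so \<open>a\<close> is arbitrary, but then \<open>a (r - 1) = 0\<close>.
\<close>

definition has_genus :: "('n::finite) triple \<Rightarrow> nat \<Rightarrow> bool" where
  "has_genus T N \<longleftrightarrow> (\<exists>r e a b. jordan_frame T r e \<and>
     (\<forall>i<r. \<forall>j<r. i \<noteq> j \<longrightarrow>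
        vec.dim (joint_peirce T r e (\<lambda>k. of_bool (k = i) + of_bool (k = j))) = a) \<and>
     (\<forall>i<r. vec.dim (joint_peirce T r e (\<lambda>k. of_bool (k = i))) = b) \<and>
     N = 2 + a * (r - 1) + b)"


section \<open>Bergman spaces\<close>

text \<open>
  Measures on \<open>\<Omega>\<close> have \<open>\<Omega>\<close> as their underlying space. Elements of the Bergman space are extended
  by \<open>0\<close> outside of \<open>\<Omega>\<close>, so that equality of functions is equality on \<open>\<Omega>\<close>.
\<close>

definition normalized_lebesgue :: "(complex^'n) set \<Rightarrow> (complex^'n) measure" where
  "normalized_lebesgue \<Omega> = uniform_measure (restrict_space lborel \<Omega>) \<Omega>"

definition bergman_space :: "(complex^'n) set \<Rightarrow> (complex^'n) measure \<Rightarrow> (complex^'n \<Rightarrow> complex) set" where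
  "bergman_space \<Omega> \<mu> =
     {f. holo_fun f \<Omega> \<and> integrable \<mu> (\<lambda>z. (cmod (f z))\<^sup>2) \<and> (\<forall>z. z \<notin> \<Omega> \<longrightarrow> f z = 0)}"

definition l2_inner :: "'a measure \<Rightarrow> ('a \<Rightarrow> complex) \<Rightarrow> ('a \<Rightarrow> complex) \<Rightarrow> complex" where
  "l2_inner \<mu> f g = (LINT z|\<mu>. f z * cnj (g z))"

definition l2_norm :: "'a measure \<Rightarrow> ('a \<Rightarrow> complex) \<Rightarrow> real" where
  "l2_norm \<mu> f = sqrt (LINT z|\<mu>. (cmod (f z))\<^sup>2)"

definition is_bergman_kernel ::
    "(complex^'n) set \<Rightarrow> (complex^'n) measure \<Rightarrow> (complex^'n \<Rightarrow> complex^'n \<Rightarrow> complex) \<Rightarrow> bool" where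
  "is_bergman_kernel \<Omega> \<mu> K \<longleftrightarrow> (\<forall>w\<in>\<Omega>.
     (\<lambda>z. if z \<in> \<Omega> then K z w else 0) \<in> bergman_space \<Omega> \<mu> \<and>
     (\<forall>f\<in>bergman_space \<Omega> \<mu>. f w = l2_inner \<mu> f (\<lambda>z. K z w)))"

definition polynomial_in_z_wbar :: "(complex^'n \<Rightarrow> complex^'n \<Rightarrow> complex) \<Rightarrow> bool" where
  "polynomial_in_z_wbar \<Delta> \<longleftrightarrow> (\<exists>A (c :: ('n \<Rightarrow> nat) \<times> ('n \<Rightarrow> nat) \<Rightarrow> complex). finite A \<and>
     (\<forall>z w. \<Delta> z w =
        (\<Sum>(a, b)\<in>A. c (a, b) * (\<Prod>i\<in>UNIV. (z $ i) ^ a i) * (\<Prod>i\<in>UNIV. cnj (w $ i) ^ b i))))"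

definition jordan_triple_determinant ::
    "(complex^'n) set \<Rightarrow> nat \<Rightarrow> (complex^'n \<Rightarrow> complex^'n \<Rightarrow> complex) \<Rightarrow> bool" where
  "jordan_triple_determinant \<Omega> N \<Delta> \<longleftrightarrow> polynomial_in_z_wbar \<Delta> \<and> \<Delta> 0 0 = 1 \<and>
     (\<forall>z\<in>\<Omega>. \<forall>w\<in>\<Omega>. \<Delta> z w \<noteq> 0) \<and>
     is_bergman_kernel \<Omega> (normalized_lebesgue \<Omega>) (\<lambda>z w. 1 / \<Delta> z w ^ N)"

text \<open>
  On \<open>\<Omega>\<close> the weight \<open>D w = \<Delta> w w\<close> takes positive real values, being an
  \<open>N\<close>-th root of the reciprocal of the Bergman kernel on the diagonal.
\<close>

definition weighted_measure ::
    "real \<Rightarrow> real \<Rightarrow> ('a \<Rightarrow> complex) \<Rightarrow> 'a measure \<Rightarrow> 'a measure" where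
  "weighted_measure c \<gamma> D v = density v (\<lambda>w. ennreal (c * Re (D w) powr \<gamma>))"

text \<open>The measure \<open>dv(\<phi>(w))\<close>, which maps \<open>B\<close> to the measure of \<open>\<phi> ` B\<close>.\<close>

definition pullback_measure :: "'a set \<Rightarrow> ('a \<Rightarrow> 'a) \<Rightarrow> 'a measure \<Rightarrow> 'a measure" where
  "pullback_measure \<Omega> \<phi> v = distr v v (the_inv_into \<Omega> \<phi>)"

definition pullback :: "'a set \<Rightarrow> ('a \<Rightarrow> 'a) \<Rightarrow> ('a \<Rightarrow> complex) \<Rightarrow> 'a \<Rightarrow> complex" where
  "pullback \<Omega> \<phi> f = (\<lambda>w. if w \<in> \<Omega> then f (\<phi> w) else 0)"

definition analytic_variety :: "(complex^'n) set \<Rightarrow> (complex^'n) set \<Rightarrow> bool" where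
  "analytic_variety \<Omega> V \<longleftrightarrow> V \<noteq> {} \<and> closedin (top_of_set \<Omega>) V \<and>
     (\<forall>a\<in>V. \<exists>U F. open U \<and> a \<in> U \<and> U \<subseteq> \<Omega> \<and> finite F \<and> (\<forall>f\<in>F. holo_fun f U) \<and>
        V \<inter> U = {z\<in>U. \<forall>f\<in>F. f z = 0})"

definition variety_submodule ::
    "(complex^'n) set \<Rightarrow> (complex^'n) measure \<Rightarrow> (complex^'n) set \<Rightarrow> (complex^'n \<Rightarrow> complex) set" where
  "variety_submodule \<Omega> \<mu> V = {f\<in>bergman_space \<Omega> \<mu>. \<forall>z\<in>V. f z = 0}"

definition bergman_perp ::
    "(complex^'n) set \<Rightarrow> (complex^'n) measure \<Rightarrow> (complex^'n \<Rightarrow> complex) set \<Rightarrow> (complex^'n \<Rightarrow> complex) set" where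
  "bergman_perp \<Omega> \<mu> M = {h\<in>bergman_space \<Omega> \<mu>. \<forall>f\<in>M. l2_inner \<mu> h f = 0}"


section \<open>Operators on closed subspaces of the Bergman space\<close>

text \<open>
  A Hilbert space is given by a set \<open>L\<close> of square-integrable functions (no two of which agree
  almost everywhere) with the inner product of \<open>L\<^sup>2(\<mu>)\<close>. Only the values of an operator on \<open>L\<close>
  are relevant.
\<close>

type_synonym 'a operator = "('a \<Rightarrow> complex) \<Rightarrow> ('a \<Rightarrow> complex)"

definition orth_proj :: "'a measure \<Rightarrow> ('a \<Rightarrow> complex) set \<Rightarrow> 'a operator" where
  "orth_proj \<mu> L u = (THE g. g \<in> L \<and> (\<forall>k\<in>L. l2_inner \<mu> (\<lambda>z. u z - g z) k = 0))"

definition truncated_toeplitz ::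
    "'a measure \<Rightarrow> ('a \<Rightarrow> complex) set \<Rightarrow> ('a \<Rightarrow> complex) \<Rightarrow> 'a operator" where
  "truncated_toeplitz \<mu> L f h = orth_proj \<mu> L (\<lambda>z. f z * h z)"

definition bounded_operator :: "'a measure \<Rightarrow> ('a \<Rightarrow> complex) set \<Rightarrow> 'a operator \<Rightarrow> bool" where
  "bounded_operator \<mu> L A \<longleftrightarrow> (\<forall>h\<in>L. A h \<in> L) \<and>
     (\<forall>h\<in>L. \<forall>k\<in>L. A (\<lambda>z. h z + k z) = (\<lambda>z. A h z + A k z)) \<and>
     (\<forall>h\<in>L. \<forall>a. A (\<lambda>z. a * h z) = (\<lambda>z. a * A h z)) \<and>
     (\<exists>C. \<forall>h\<in>L. l2_norm \<mu> (A h) \<le> C * l2_norm \<mu> h)"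

definition op_adjoint :: "'a measure \<Rightarrow> ('a \<Rightarrow> complex) set \<Rightarrow> 'a operator \<Rightarrow> 'a operator" where
  "op_adjoint \<mu> L A h = (THE g. g \<in> L \<and> (\<forall>k\<in>L. l2_inner \<mu> (A k) h = l2_inner \<mu> k g))"

definition op_commutator :: "'a operator \<Rightarrow> 'a operator \<Rightarrow> 'a operator" where
  "op_commutator A B h = (\<lambda>z. A (B h) z - B (A h) z)"

definition compact_operator :: "'a measure \<Rightarrow> ('a \<Rightarrow> complex) set \<Rightarrow> 'a operator \<Rightarrow> bool" where
  "compact_operator \<mu> L A \<longleftrightarrow> bounded_operator \<mu> L A \<and>
     (\<forall>h :: nat \<Rightarrow> 'a \<Rightarrow> complex. (\<forall>k. h k \<in> L \<and> l2_norm \<mu> (h k) \<le> 1) \<longrightarrow>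
        (\<exists>r g. strict_mono r \<and> g \<in> L \<and>
           (\<lambda>k. l2_norm \<mu> (\<lambda>z. A (h (r k)) z - g z)) \<longlonglongrightarrow> 0))"

text \<open>
  The family \<open>s k\<close>, \<open>k \<in> J\<close>, lists the nonzero singular values of \<open>A\<close> with multiplicity: their
  squares are the nonzero eigenvalues of \<open>A\<^sup>* A\<close>, whose eigenvectors \<open>e k\<close> span
  the orthogonal complement of the kernel of \<open>A\<close>. The index set \<open>J\<close> may be finite.
\<close>

definition singular_values ::
    "'a measure \<Rightarrow> ('a \<Rightarrow> complex) set \<Rightarrow> 'a operator \<Rightarrow> nat set \<Rightarrow> (nat \<Rightarrow> real) \<Rightarrow> bool" where
  "singular_values \<mu> L A J s \<longleftrightarrow> (\<exists>e :: nat \<Rightarrow> 'a \<Rightarrow> complex.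
     (\<forall>j\<in>J. e j \<in> L) \<and> (\<forall>j\<in>J. \<forall>k\<in>J. l2_inner \<mu> (e j) (e k) = of_bool (j = k)) \<and>
     (\<forall>j\<in>J. s j > 0 \<and> op_adjoint \<mu> L A (A (e j)) = (\<lambda>z. complex_of_real ((s j)\<^sup>2) * e j z)) \<and>
     (\<forall>h\<in>L. (\<forall>j\<in>J. l2_inner \<mu> h (e j) = 0) \<longrightarrow> A h = (\<lambda>z. 0)))"

definition schatten_class :: "ennreal \<Rightarrow> 'a measure \<Rightarrow> ('a \<Rightarrow> complex) set \<Rightarrow> 'a operator set" where
  "schatten_class p \<mu> L = {A. compact_operator \<mu> L A \<and>
     (p \<noteq> \<infinity> \<longrightarrow> (\<exists>J s. singular_values \<mu> L A J s \<and> (\<lambda>k. s k powr enn2real p) summable_on J))}"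

definition p_essentially_normal ::
    "ennreal \<Rightarrow> 'a measure \<Rightarrow> ('a \<Rightarrow> complex) set \<Rightarrow> ('n \<Rightarrow> 'a operator) \<Rightarrow> bool" where
  "p_essentially_normal p \<mu> L A \<longleftrightarrow>
     (\<forall>i. bounded_operator \<mu> L (A i)) \<and>
     (\<forall>i j. \<forall>h\<in>L. A i (A j h) = A j (A i h)) \<and>
     (\<forall>i j. op_commutator (A i) (op_adjoint \<mu> L (A j)) \<in> schatten_class p \<mu> L)"

end

theory Submission
  imports Defs "HOL-Complex_Analysis.Cauchy_Integral_Formula"
begin

text \<open>
  Comparing the transformation rule of the Bergman kernel \<open>\<Delta>\<^sup>-\<^sup>N\<close> under an automorphism \<open>\<phi>\<close> with its value
  at \<open>a = \<phi>\<inverse> 0\<close> removes the Jacobian and leaves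
  \<open>\<Delta> (\<phi> z) (\<phi> w) * \<Delta> z a * \<Delta> a w = \<Delta> z w * \<Delta> a a\<close>, up to an \<open>N\<close>-th root of unity that is constant because
  \<open>\<Omega>\<close> is connected. The coordinate functions are linear combinations of functions \<open>\<lambda>z. \<Delta> z u\<close>: otherwise
  the kernel would agree with a constant to second order in some direction, contradicting the reproducing
  property. Hence each component of \<open>\<phi>\<close> is a polynomial divided by \<open>\<lambda>z. \<Delta> z a\<close>, which is bounded away
  from zero on \<open>\<Omega>\<close>.

  On the orthogonal complement of the submodule the map from bounded holomorphic symbols to truncated Toeplitz
  operators is multiplicative. The operators that commute with a given operator modulo the Schatten ideal form
  an algebra that is closed under inverses. Since the components of \<open>\<phi>\<close> and the coordinates generate each other
  by sums, products and bounded inverses, the two conditions in (2) are equivalent. The pullback is a unitary that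
  carries the operator with symbol \<open>w\<^sub>i\<close> to the one whose symbol is the \<open>i\<close>-th component of \<open>\<phi>\<inverse>\<close>, so (1)
  is (2) for \<open>\<phi>\<inverse>\<close>.
\<close>

section \<open>Hilbert spaces of square-integrable functions\<close>

text \<open>All information about \<open>\<phi>\<close> is extracted from the kernel, and
  \<open>\<phi>\<close> turns out to be rational with a denominator that stays away from zero. This
  lower bound is what allows division: the operator whose symbol is the inverse of
  \<open>\<Delta> z a\<close> has to be bounded. The bound comes from the determinant identity at w
  = 0, where the cofactor is a polynomial on a bounded set. The Schatten classes are described by
  singular values, so even closure under sums has to be earned. It is obtained by counting: if
  \<open>A\<close> is bounded by t off n vectors and \<open>B\<close> off m vectors, then the sum is
  bounded by 2t off n + m vectors. This loses constant factors, which membership in the class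
  tolerates. The change of variables theorem concerns real maps, so the absolute determinant of a
  real matrix of twice the size has to be recognized as the squared modulus of the complex
  determinant. Both are nonnegative, multiplicative and equal on scalar matrices, and elimination
  shows that these properties leave no freedom.\<close>

lemma integrable_mult_cnj:
  fixes f g :: "'a \<Rightarrow> complex"
  assumes [measurable]: "f \<in> borel_measurable \<mu>" "g \<in> borel_measurable \<mu>"
    and f: "integrable \<mu> (\<lambda>z. (cmod (f z))\<^sup>2)" and g: "integrable \<mu> (\<lambda>z. (cmod (g z))\<^sup>2)"
  shows "integrable \<mu> (\<lambda>z. f z * cnj (g z))"
proof (rule Bochner_Integration.integrable_bound)
  show "integrable \<mu> (\<lambda>z. (cmod (f z))\<^sup>2 + (cmod (g z))\<^sup>2)" using f g by simp
  have "cmod (f z) * cmod (g z) \<le> (cmod (f z))\<^sup>2 + (cmod (g z))\<^sup>2" for z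
  proof -
    have "2 * (cmod (f z) * cmod (g z)) \<le> (cmod (f z))\<^sup>2 + (cmod (g z))\<^sup>2"
      using sum_squares_bound[of "cmod (f z)" "cmod (g z)"] by (simp add: mult.assoc)
    moreover have "0 \<le> cmod (f z) * cmod (g z)" by simp
    ultimately show ?thesis by linarith
  qed
  then show "AE z in \<mu>. norm (f z * cnj (g z)) \<le> norm ((cmod (f z))\<^sup>2 + (cmod (g z))\<^sup>2)"
    by (simp add: norm_mult)
  have "(\<lambda>z. cnj (g z)) \<in> borel_measurable \<mu>"
    using measurable_compose[OF assms(2) borel_measurable_continuous_onI[of cnj]] by (simp add: continuous_intros)
  then show "(\<lambda>z. f z * cnj (g z)) \<in> borel_measurable \<mu>" by measurable
qed

text \<open>The vectors are genuine functions: \<open>L_definite\<close> takes the place of passing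
  to classes modulo null sets, so that operators can be compared by equality of functions. The
  locale is abstract because the Bergman space, the complement of the submodule and the pulled back
  complement are all instances of it.\<close>

locale l2_space =
  fixes \<mu> :: "'a measure" and L :: "('a \<Rightarrow> complex) set"
  assumes L_meas: "f \<in> L \<Longrightarrow> f \<in> borel_measurable \<mu>"
    and L_int: "f \<in> L \<Longrightarrow> integrable \<mu> (\<lambda>z. (cmod (f z))\<^sup>2)"
    and L_zero [simp]: "(\<lambda>z. 0) \<in> L"
    and L_add [simp]: "f \<in> L \<Longrightarrow> g \<in> L \<Longrightarrow> (\<lambda>z. f z + g z) \<in> L"
    and L_scale [simp]: "f \<in> L \<Longrightarrow> (\<lambda>z. a * f z) \<in> L"
    and L_definite: "f \<in> L \<Longrightarrow> (LINT z|\<mu>. (cmod (f z))\<^sup>2) = 0 \<Longrightarrow> f = (\<lambda>z. 0)"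
    and L_complete: "\<And>X. (\<And>n. X n \<in> L) \<Longrightarrow>
          (\<And>e. e > 0 \<Longrightarrow> \<exists>N. \<forall>m\<ge>N. \<forall>n\<ge>N. l2_norm \<mu> (\<lambda>z. X m z - X n z) < e) \<Longrightarrow>
          \<exists>g\<in>L. (\<lambda>n::nat. l2_norm \<mu> (\<lambda>z. X n z - g z)) \<longlonglongrightarrow> 0"
begin

abbreviation ip where "ip \<equiv> l2_inner \<mu>"
abbreviation nm where "nm \<equiv> l2_norm \<mu>"
abbreviation bop where "bop \<equiv> bounded_operator \<mu> L"
abbreviation adj where "adj \<equiv> op_adjoint \<mu> L"

lemma L_uminus [simp]: "f \<in> L \<Longrightarrow> (\<lambda>z. - f z) \<in> L"
  using L_scale[of f "-1"] by simp

lemma L_diff [simp]: "f \<in> L \<Longrightarrow> g \<in> L \<Longrightarrow> (\<lambda>z. f z - g z) \<in> L"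
  using L_add[of f "\<lambda>z. - g z"] by simp

lemma L_sum: "finite S \<Longrightarrow> (\<And>j. j \<in> S \<Longrightarrow> f j \<in> L) \<Longrightarrow> (\<lambda>z. \<Sum>j\<in>S. f j z) \<in> L"
  by (induction S rule: finite_induct) (auto intro: L_add[where f = "f _"])

lemma integrable_ip: "f \<in> L \<Longrightarrow> g \<in> L \<Longrightarrow> integrable \<mu> (\<lambda>z. f z * cnj (g z))"
  by (rule integrable_mult_cnj) (auto intro: L_meas L_int)

lemma ip_add_left: "f \<in> L \<Longrightarrow> g \<in> L \<Longrightarrow> h \<in> L \<Longrightarrow> ip (\<lambda>z. f z + g z) h = ip f h + ip g h"
  by (simp add: l2_inner_def distrib_right integrable_ip)

lemma ip_scale_left: "ip (\<lambda>z. a * f z) h = a * ip f h"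
  by (simp add: l2_inner_def mult.assoc)

lemma ip_cnj: "ip g f = cnj (ip f g)"
proof -
  have "cnj (ip f g) = (LINT z|\<mu>. cnj (f z * cnj (g z)))"
    unfolding l2_inner_def by (rule Bochner_Integration.integral_cnj[symmetric])
  then show ?thesis by (simp add: l2_inner_def mult.commute)
qed

lemma ip_diff_left: "f \<in> L \<Longrightarrow> g \<in> L \<Longrightarrow> h \<in> L \<Longrightarrow> ip (\<lambda>z. f z - g z) h = ip f h - ip g h"
  by (simp add: l2_inner_def left_diff_distrib integrable_ip)

lemma ip_add_right: "f \<in> L \<Longrightarrow> g \<in> L \<Longrightarrow> h \<in> L \<Longrightarrow> ip h (\<lambda>z. f z + g z) = ip h f + ip h g"
  by (simp add: ip_cnj[of h] ip_add_left)

lemma ip_diff_right: "f \<in> L \<Longrightarrow> g \<in> L \<Longrightarrow> h \<in> L \<Longrightarrow> ip h (\<lambda>z. f z - g z) = ip h f - ip h g"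
  by (simp add: ip_cnj[of h] ip_diff_left)

lemma ip_scale_right: "ip h (\<lambda>z. a * f z) = cnj a * ip h f"
  by (simp add: ip_cnj[of h] ip_scale_left)

lemma ip_zero [simp]: "ip (\<lambda>z. 0) f = 0" "ip f (\<lambda>z. 0) = 0"
  by (simp_all add: l2_inner_def)

lemma ip_sum_left:
  "finite S \<Longrightarrow> (\<And>j. j \<in> S \<Longrightarrow> f j \<in> L) \<Longrightarrow> h \<in> L \<Longrightarrow>
    ip (\<lambda>z. \<Sum>j\<in>S. f j z) h = (\<Sum>j\<in>S. ip (f j) h)"
proof (induction S rule: finite_induct)
  case (insert x F)
  then show ?case
    using ip_add_left[of "f x" "\<lambda>z. \<Sum>j\<in>F. f j z" h] L_sum[of F f] by simp
qed simp

lemmas ip_simps = ip_add_left ip_add_right ip_diff_left ip_diff_right ip_scale_left ip_scale_right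

lemma nm_nonneg [simp]: "0 \<le> nm f"
  by (simp add: l2_norm_def)

lemma nm_sq: "(nm f)\<^sup>2 = (LINT z|\<mu>. (cmod (f z))\<^sup>2)"
  by (simp add: l2_norm_def)

lemma ip_self: "ip f f = complex_of_real ((nm f)\<^sup>2)"
  unfolding nm_sq l2_inner_def integral_complex_of_real[symmetric] by (simp add: complex_norm_square del: of_real_power)

lemma Re_ip_self: "Re (ip f f) = (nm f)\<^sup>2"
  by (simp add: ip_self)

lemma nm_zero [simp]: "nm (\<lambda>z. 0) = 0"
  by (simp add: l2_norm_def)

lemma nm_eq_0: "f \<in> L \<Longrightarrow> nm f = 0 \<Longrightarrow> f = (\<lambda>z. 0)"
  using L_definite[of f] nm_sq[of f] by simp

lemma nm_scale: "nm (\<lambda>z. a * f z) = cmod a * nm f"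
  by (simp add: l2_norm_def norm_mult power_mult_distrib real_sqrt_mult)

lemma nm_add_sq: "f \<in> L \<Longrightarrow> g \<in> L \<Longrightarrow> (nm (\<lambda>z. f z + g z))\<^sup>2 = (nm f)\<^sup>2 + (nm g)\<^sup>2 + 2 * Re (ip f g)"
  unfolding Re_ip_self[symmetric] by (simp add: ip_simps ip_cnj[of g f])

lemma nm_diff_sq: "f \<in> L \<Longrightarrow> g \<in> L \<Longrightarrow> (nm (\<lambda>z. f z - g z))\<^sup>2 = (nm f)\<^sup>2 + (nm g)\<^sup>2 - 2 * Re (ip f g)"
  unfolding Re_ip_self[symmetric] by (simp add: ip_simps ip_cnj[of g f])

lemma nm_diff_commute: "nm (\<lambda>z. f z - g z) = nm (\<lambda>z. g z - f z)"
  by (simp add: l2_norm_def norm_minus_commute)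

lemma cauchy_schwarz:
  assumes f: "f \<in> L" and g: "g \<in> L"
  shows "cmod (ip f g) \<le> nm f * nm g"
proof (cases "nm g = 0")
  case True
  then have "g = (\<lambda>z. 0)" using nm_eq_0 g by blast
  then show ?thesis by simp
next
  case False
  define a where "a = ip f g / complex_of_real ((nm g)\<^sup>2)"
  have "0 \<le> (nm (\<lambda>z. f z - a * g z))\<^sup>2" by simp
  also have "\<dots> = (nm f)\<^sup>2 + (cmod a * nm g)\<^sup>2 - 2 * Re (cnj a * ip f g)"
    using nm_diff_sq[of f "\<lambda>z. a * g z"] f g by (simp add: nm_scale ip_scale_right)
  also have "cnj a * ip f g = complex_of_real ((cmod (ip f g))\<^sup>2 / (nm g)\<^sup>2)"
    unfolding a_def using complex_norm_square[of "ip f g"] by (simp add: mult.commute)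
  also have "(cmod a * nm g)\<^sup>2 = (cmod (ip f g))\<^sup>2 / (nm g)\<^sup>2"
    unfolding a_def using False by (simp add: norm_divide power2_eq_square norm_mult field_simps)
  finally have "(cmod (ip f g))\<^sup>2 / (nm g)\<^sup>2 \<le> (nm f)\<^sup>2" by simp
  then have "(cmod (ip f g))\<^sup>2 \<le> (nm f * nm g)\<^sup>2"
    using False by (simp add: power_mult_distrib divide_le_eq)
  then show ?thesis by (rule power2_le_imp_le) simp
qed

lemma nm_triangle:
  assumes f: "f \<in> L" and g: "g \<in> L"
  shows "nm (\<lambda>z. f z + g z) \<le> nm f + nm g"
proof (rule power2_le_imp_le)
  have "Re (ip f g) \<le> nm f * nm g"
    using cauchy_schwarz[OF f g] complex_Re_le_cmod[of "ip f g"] by linarith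
  then show "(nm (\<lambda>z. f z + g z))\<^sup>2 \<le> (nm f + nm g)\<^sup>2"
    using nm_add_sq[OF f g] by (simp add: power2_sum)
qed simp

lemma nm_triangle_diff:
  assumes "f \<in> L" "g \<in> L" "h \<in> L"
  shows "nm (\<lambda>z. f z - h z) \<le> nm (\<lambda>z. f z - g z) + nm (\<lambda>z. g z - h z)"
  using nm_triangle[of "\<lambda>z. f z - g z" "\<lambda>z. g z - h z"] assms by simp

lemma nm_diff_le: "f \<in> L \<Longrightarrow> g \<in> L \<Longrightarrow> nm f - nm g \<le> nm (\<lambda>z. f z - g z)"
  using nm_triangle[of "\<lambda>z. f z - g z" g] by simp

lemma tendsto_nm:
  assumes X: "\<And>n. X n \<in> L" and g: "g \<in> L" and lim: "(\<lambda>n. nm (\<lambda>z. X n z - g z)) \<longlonglongrightarrow> 0"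
  shows "(\<lambda>n. nm (X n)) \<longlonglongrightarrow> nm g"
proof -
  have "(\<lambda>n. nm (X n) - nm g) \<longlonglongrightarrow> 0"
  proof (rule Lim_null_comparison[OF _ lim], rule always_eventually, rule allI)
    fix n
    show "norm (nm (X n) - nm g) \<le> nm (\<lambda>z. X n z - g z)"
      using nm_diff_le[OF X[of n] g] nm_diff_le[OF g X[of n]] nm_diff_commute[of g "X n"]
      by (simp add: abs_le_iff)
  qed
  then show ?thesis by (simp add: LIM_zero_iff)
qed

lemma tendsto_ip:
  assumes X: "\<And>n. X n \<in> L" and g: "g \<in> L" and lim: "(\<lambda>n. nm (\<lambda>z. X n z - g z)) \<longlonglongrightarrow> 0"
    and h: "h \<in> L"
  shows "(\<lambda>n. ip (X n) h) \<longlonglongrightarrow> ip g h"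
proof -
  have "(\<lambda>n. ip (X n) h - ip g h) \<longlonglongrightarrow> 0"
  proof (rule Lim_null_comparison)
    show "(\<lambda>n. nm (\<lambda>z. X n z - g z) * nm h) \<longlonglongrightarrow> 0" using tendsto_mult_left_zero[OF lim] .
    show "\<forall>\<^sub>F n in sequentially. norm (ip (X n) h - ip g h) \<le> nm (\<lambda>z. X n z - g z) * nm h"
      using cauchy_schwarz[of "\<lambda>z. X _ z - g z" h] X g h
      by (auto intro!: always_eventually simp: ip_diff_left)
  qed
  then show ?thesis by (simp add: LIM_zero_iff)
qed

lemma ip_eqI: "f \<in> L \<Longrightarrow> g \<in> L \<Longrightarrow> (\<And>k. k \<in> L \<Longrightarrow> ip k f = ip k g) \<Longrightarrow> f = g"
proof -
  assume f: "f \<in> L" and g: "g \<in> L" and eq: "\<And>k. k \<in> L \<Longrightarrow> ip k f = ip k g"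
  have "ip (\<lambda>z. f z - g z) (\<lambda>z. f z - g z) = 0"
    using f g eq[of "\<lambda>z. f z - g z"] by (simp only: ip_diff_right L_diff) simp
  then have "nm (\<lambda>z. f z - g z) = 0" by (simp add: ip_self)
  then have "(\<lambda>z. f z - g z) = (\<lambda>z. 0)" using nm_eq_0 f g L_diff by blast
  then show "f = g" by (simp add: fun_eq_iff)
qed

text \<open>The functional \<open>\<parallel>g\<parallel>\<^sup>2 - 2 Re (F g)\<close> is bounded below, and by the parallelogram law a
  minimizing sequence is a Cauchy sequence.\<close>
lemma riesz_representation:
  assumes F_add: "\<And>f g. f \<in> L \<Longrightarrow> g \<in> L \<Longrightarrow> F (\<lambda>z. f z + g z) = F f + F g"
    and F_scale: "\<And>a f. f \<in> L \<Longrightarrow> F (\<lambda>z. a * f z) = a * F f"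
    and F_bound: "\<And>f. f \<in> L \<Longrightarrow> cmod (F f) \<le> C * nm f"
  shows "\<exists>g\<in>L. \<forall>k\<in>L. F k = ip k g"
proof -
  define J where "J g = (nm g)\<^sup>2 - 2 * Re (F g)" for g
  have F_diff: "F (\<lambda>z. f z - g z) = F f - F g" if "f \<in> L" "g \<in> L" for f g
    using F_add[of f "\<lambda>z. (-1) * g z"] F_scale[of g "-1"] L_scale[of g "-1"] that by simp
  \<comment> \<open>The functional dominates (n - C)^2 - C^2, where n is the norm of
    \<open>g\<close>.\<close>
  have low: "- (C\<^sup>2) \<le> J g" if "g \<in> L" for g
  proof -
    have "Re (F g) \<le> C * nm g" using F_bound[OF that] complex_Re_le_cmod[of "F g"] by linarith
    moreover have "0 \<le> (nm g - C)\<^sup>2" by simp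
    ultimately show ?thesis unfolding J_def power2_diff by (simp add: mult.commute[of C])
  qed
  define d where "d = Inf (J ` L)"
  have bdd: "bdd_below (J ` L)" using low by (auto simp: bdd_below_def)
  have d_le: "d \<le> J g" if "g \<in> L" for g
    unfolding d_def by (rule cInf_lower[OF _ bdd]) (use that in auto)
  have ne: "J ` L \<noteq> {}" using L_zero by blast
  have "\<exists>g\<in>L. J g < d + 1 / real (Suc n)" for n
  proof -
    have "d < d + 1 / real (Suc n)" by simp
    then show ?thesis unfolding d_def using cInf_lessD[OF ne] by fastforce
  qed
  then obtain X where X: "\<And>n. X n \<in> L" and JX: "\<And>n. J (X n) < d + 1 / real (Suc n)" by metis
  have close: "(nm (\<lambda>z. X m z - X n z))\<^sup>2 \<le> 2 / real (Suc m) + 2 / real (Suc n)" for m n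
  proof -
    let ?h = "\<lambda>z. (1/2) * (X m z + X n z)"
    have h: "?h \<in> L" using X by (intro L_scale L_add)
    have n: "(nm ?h)\<^sup>2 = (1/4) * (nm (\<lambda>z. X m z + X n z))\<^sup>2"
      unfolding nm_scale power_mult_distrib by (simp add: norm_divide power_divide)
    have Fh: "F ?h = (1/2) * (F (X m) + F (X n))"
      using F_scale[of "\<lambda>z. X m z + X n z" "1/2"] F_add[of "X m" "X n"] X by simp
    have "4 * J ?h = (nm (\<lambda>z. X m z + X n z))\<^sup>2 - 4 * Re (F (X m)) - 4 * Re (F (X n))"
      unfolding J_def n Fh by (simp add: algebra_simps)
    also have "\<dots> = 2 * J (X m) + 2 * J (X n) - (nm (\<lambda>z. X m z - X n z))\<^sup>2"
      unfolding J_def using nm_add_sq[OF X X, of m n] nm_diff_sq[OF X X, of m n] by argo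
    finally have "(nm (\<lambda>z. X m z - X n z))\<^sup>2 = 2 * J (X m) + 2 * J (X n) - 4 * J ?h" by simp
    then have "(nm (\<lambda>z. X m z - X n z))\<^sup>2 \<le> 2 * (d + 1 / real (Suc m)) + 2 * (d + 1 / real (Suc n)) - 4 * d"
      using d_le[OF h] JX[of m] JX[of n] by argo
    then show ?thesis by argo
  qed
  have "\<exists>N. \<forall>m\<ge>N. \<forall>n\<ge>N. nm (\<lambda>z. X m z - X n z) < e" if e: "e > 0" for e
  proof -
    obtain N where N: "4 / e\<^sup>2 < real N" using reals_Archimedean2 by blast
    have "nm (\<lambda>z. X m z - X n z) < e" if "m \<ge> N" "n \<ge> N" for m n
    proof (rule power2_less_imp_less)
      have 4: "4 / e\<^sup>2 < real (Suc N)" using N by simp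
      have N4: "4 / real (Suc N) < e\<^sup>2"
        using 4 e by (simp add: divide_less_eq mult.commute)
      have "2 / real (Suc m) \<le> 2 / real (Suc N)" "2 / real (Suc n) \<le> 2 / real (Suc N)"
        using that by (auto intro!: divide_left_mono)
      then show "(nm (\<lambda>z. X m z - X n z))\<^sup>2 < e\<^sup>2"
        using close[of m n] N4 by linarith
    qed (use e in simp)
    then show ?thesis by blast
  qed
  from L_complete[OF X this] obtain g where g: "g \<in> L"
    and lim: "(\<lambda>n. nm (\<lambda>z. X n z - g z)) \<longlonglongrightarrow> 0" by blast
  have "(\<lambda>n. F (X n) - F g) \<longlonglongrightarrow> 0"
  proof (rule Lim_null_comparison)
    show "(\<lambda>n. C * nm (\<lambda>z. X n z - g z)) \<longlonglongrightarrow> 0" using tendsto_mult_right_zero[OF lim] .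
    show "\<forall>\<^sub>F n in sequentially. norm (F (X n) - F g) \<le> C * nm (\<lambda>z. X n z - g z)"
      using F_bound[of "\<lambda>z. X _ z - g z"] X g by (auto intro!: always_eventually simp: F_diff)
  qed
  then have Flim: "(\<lambda>n. F (X n)) \<longlonglongrightarrow> F g" by (simp add: LIM_zero_iff)
  have "(\<lambda>n. J (X n)) \<longlonglongrightarrow> J g"
    unfolding J_def by (intro tendsto_intros tendsto_nm[OF X g lim] Flim)
  moreover have "(\<lambda>n. d + 1 / real (Suc n)) \<longlonglongrightarrow> d + 0"
    by (intro tendsto_intros LIMSEQ_Suc lim_1_over_n)
  ultimately have "J g \<le> d + 0" using JX by (intro LIMSEQ_le) (auto intro: less_imp_le)
  then have min: "J g \<le> J h" if "h \<in> L" for h using d_le[OF that] by linarith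
  have "F k = ip k g" if k: "k \<in> L" for k
  proof (rule ccontr)
    assume "F k \<noteq> ip k g"
    define \<delta> where "\<delta> = ip k g - F k"
    have \<delta>: "\<delta> \<noteq> 0" using \<open>F k \<noteq> ip k g\<close> by (simp add: \<delta>_def)
    \<comment> \<open>The step length of a descent from the minimizer \<open>g\<close> along
      \<open>k\<close>. Moving by \<open>a\<close> changes the functional by a linear term of size 2
      s times the square of the modulus of \<delta>, with negative sign, and by a quadratic term
      that is smaller by the factor \<open>s * (nm k)\<^sup>2 / 2\<close>, which is below
      1/2.\<close>
    define s where "s = 1 / (1 + (nm k)\<^sup>2)"
    have k0: "0 < 1 + (nm k)\<^sup>2" by (simp add: add_pos_nonneg)
    then have s: "s > 0" by (simp add: s_def)
    have sk: "s * (nm k)\<^sup>2 < 1" unfolding s_def using k0 by (simp add: divide_less_eq)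
    define a where "a = - complex_of_real s * cnj \<delta>"
    have ak: "(\<lambda>z. a * k z) \<in> L" using k by simp
    have "J (\<lambda>z. g z + a * k z) = J g + (cmod a)\<^sup>2 * (nm k)\<^sup>2 + 2 * Re (a * \<delta>)"
      unfolding J_def nm_add_sq[OF g ak] F_add[OF g ak] F_scale[OF k] nm_scale ip_cnj[of g] ip_scale_left \<delta>_def
      by (simp add: power_mult_distrib algebra_simps)
    moreover have "a * \<delta> = complex_of_real (- s * (cmod \<delta>)\<^sup>2)"
      unfolding a_def using complex_norm_square[of \<delta>] by (simp add: mult.commute mult.left_commute)
    moreover have "(cmod a)\<^sup>2 = s\<^sup>2 * (cmod \<delta>)\<^sup>2"
      unfolding a_def using s by (simp add: norm_mult power_mult_distrib)
    ultimately have "J (\<lambda>z. g z + a * k z) = J g + s\<^sup>2 * (cmod \<delta>)\<^sup>2 * (nm k)\<^sup>2 + 2 * (- s * (cmod \<delta>)\<^sup>2)"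
      by (simp only: Re_complex_of_real)
    then have "J (\<lambda>z. g z + a * k z) = J g + s * (cmod \<delta>)\<^sup>2 * (s * (nm k)\<^sup>2 - 2)"
      by (simp add: algebra_simps power2_eq_square)
    moreover have "s * (cmod \<delta>)\<^sup>2 * (s * (nm k)\<^sup>2 - 2) < 0"
      using s sk \<delta> by (intro mult_pos_neg mult_pos_pos) auto
    ultimately show False using min[OF L_add[OF g ak]] by linarith
  qed
  then show ?thesis using g by blast
qed

end

section \<open>Bounded operators and their adjoints\<close>

context l2_space
begin

lemma bop_mem: "bop A \<Longrightarrow> h \<in> L \<Longrightarrow> A h \<in> L"
  by (simp add: bounded_operator_def)

lemma bop_add: "bop A \<Longrightarrow> h \<in> L \<Longrightarrow> k \<in> L \<Longrightarrow> A (\<lambda>z. h z + k z) = (\<lambda>z. A h z + A k z)"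
  by (simp add: bounded_operator_def)

lemma bop_scale: "bop A \<Longrightarrow> h \<in> L \<Longrightarrow> A (\<lambda>z. a * h z) = (\<lambda>z. a * A h z)"
  by (simp add: bounded_operator_def)

lemma bop_zero: "bop A \<Longrightarrow> A (\<lambda>z. 0) = (\<lambda>z. 0)"
  using bop_scale[of A "\<lambda>z. 0" 0] by simp

lemma bop_diff:
  assumes "bop A" "h \<in> L" "k \<in> L"
  shows "A (\<lambda>z. h z - k z) = (\<lambda>z. A h z - A k z)"
  using bop_add[of A h "\<lambda>z. (-1) * k z"] bop_scale[of A k "-1"] L_scale[of k "-1"] assms by simp

lemma bop_sum:
  assumes A: "bop A" and "finite S" and "\<And>j. j \<in> S \<Longrightarrow> f j \<in> L"
  shows "A (\<lambda>z. \<Sum>j\<in>S. c j * f j z) = (\<lambda>z. \<Sum>j\<in>S. c j * A (f j) z)"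
  using assms(2,3)
proof (induction S rule: finite_induct)
  case (insert x F)
  have "A (\<lambda>z. c x * f x z + (\<Sum>j\<in>F. c j * f j z)) = (\<lambda>z. c x * A (f x) z + (\<Sum>j\<in>F. c j * A (f j) z))"
    using bop_add[OF A, of "\<lambda>z. c x * f x z" "\<lambda>z. \<Sum>j\<in>F. c j * f j z"] bop_scale[OF A, of "f x" "c x"] insert
      L_sum[of F "\<lambda>j z. c j * f j z"] by simp
  then show ?case using insert by simp
qed (simp add: bop_zero[OF A])

text \<open>The constant in \<open>bounded_operator\<close> may have any sign, for instance when
  \<open>L\<close> contains only zero. Replacing it by \<open>max C 1\<close> gives a bound that can
  be used as a factor in estimates and as a positive scale in
  \<open>schatten_dominated\<close>.\<close>

lemma bop_bound:
  assumes "bop A"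
  obtains C where "C > 0" "\<And>h. h \<in> L \<Longrightarrow> nm (A h) \<le> C * nm h"
proof -
  obtain C where C: "\<And>h. h \<in> L \<Longrightarrow> nm (A h) \<le> C * nm h"
    using assms unfolding bounded_operator_def by blast
  have "nm (A h) \<le> max C 1 * nm h" if "h \<in> L" for h
    using C[OF that] mult_right_mono[of C "max C 1" "nm h"] by simp
  then show ?thesis using that[of "max C 1"] by simp
qed

lemma bopI:
  assumes "\<And>h. h \<in> L \<Longrightarrow> A h \<in> L"
    and "\<And>h k. h \<in> L \<Longrightarrow> k \<in> L \<Longrightarrow> A (\<lambda>z. h z + k z) = (\<lambda>z. A h z + A k z)"
    and "\<And>h a. h \<in> L \<Longrightarrow> A (\<lambda>z. a * h z) = (\<lambda>z. a * A h z)"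
    and "\<And>h. h \<in> L \<Longrightarrow> nm (A h) \<le> C * nm h"
  shows "bop A"
  unfolding bounded_operator_def using assms by blast

lemma bop_cong:
  assumes A: "bop A" and eq: "\<And>h. h \<in> L \<Longrightarrow> A h = B h"
  shows "bop B"
proof -
  obtain C where C: "\<And>h. h \<in> L \<Longrightarrow> nm (A h) \<le> C * nm h" using bop_bound[OF A] by blast
  show ?thesis
    by (rule bopI[where C = C])
      (simp_all add: C eq[symmetric] bop_mem[OF A] bop_add[OF A] bop_scale[OF A])
qed

lemma bop_plus:
  assumes A: "bop A" and B: "bop B"
  shows "bop (\<lambda>h z. A h z + B h z)"
proof -
  obtain C where C: "\<And>h. h \<in> L \<Longrightarrow> nm (A h) \<le> C * nm h" using bop_bound[OF A] by blast
  obtain D where D: "\<And>h. h \<in> L \<Longrightarrow> nm (B h) \<le> D * nm h" using bop_bound[OF B] by blast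
  show ?thesis
  proof (rule bopI[where C = "C + D"])
    fix h assume h: "h \<in> L"
    show "nm (\<lambda>z. A h z + B h z) \<le> (C + D) * nm h"
      using nm_triangle[OF bop_mem[OF A h] bop_mem[OF B h]] C[OF h] D[OF h] by (simp add: distrib_right)
  qed (simp_all add: bop_mem[OF A] bop_mem[OF B] bop_add[OF A] bop_add[OF B] bop_scale[OF A] bop_scale[OF B]
      algebra_simps)
qed

lemma bop_comp:
  assumes A: "bop A" and B: "bop B"
  shows "bop (\<lambda>h. A (B h))"
proof -
  obtain C where C0: "C > 0" and C: "\<And>h. h \<in> L \<Longrightarrow> nm (A h) \<le> C * nm h" using bop_bound[OF A] by blast
  obtain D where D: "\<And>h. h \<in> L \<Longrightarrow> nm (B h) \<le> D * nm h" using bop_bound[OF B] by blast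
  show ?thesis
  proof (rule bopI[where C = "C * D"])
    fix h assume h: "h \<in> L"
    show "nm (A (B h)) \<le> C * D * nm h"
      using order_trans[OF C[OF bop_mem[OF B h]] mult_left_mono[OF D[OF h], of C]] C0 by (simp add: mult.assoc)
  qed (simp_all add: bop_mem[OF A] bop_mem[OF B] bop_add[OF A] bop_add[OF B] bop_scale[OF A] bop_scale[OF B])
qed

lemma bop_mult: "bop (\<lambda>h z. a * h z)"
  by (rule bopI[where C = "cmod a"]) (simp_all add: nm_scale algebra_simps)

lemma bop_minus:
  assumes A: "bop A" and B: "bop B"
  shows "bop (\<lambda>h z. A h z - B h z)"
  using bop_plus[OF A bop_comp[OF bop_mult[of "-1"] B]] by simp

lemma adj_unique:
  assumes "h \<in> L" "g \<in> L" "g' \<in> L" "\<And>k. k \<in> L \<Longrightarrow> ip (A k) h = ip k g"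
    "\<And>k. k \<in> L \<Longrightarrow> ip (A k) h = ip k g'"
  shows "g = g'"
  using assms by (intro ip_eqI) auto

lemma adj_eqI:
  assumes "h \<in> L" "g \<in> L" "\<And>k. k \<in> L \<Longrightarrow> ip (A k) h = ip k g"
  shows "adj A h = g"
  unfolding op_adjoint_def by (rule the_equality) (use assms in \<open>auto intro!: adj_unique[of h _ _ A]\<close>)

lemma adj_exists:
  assumes A: "bop A" and h: "h \<in> L"
  shows "\<exists>g\<in>L. \<forall>k\<in>L. ip (A k) h = ip k g"
proof -
  obtain C where C: "\<And>h. h \<in> L \<Longrightarrow> nm (A h) \<le> C * nm h" using bop_bound[OF A] by blast
  show ?thesis
  proof (rule riesz_representation[where C = "C * nm h"])
    fix f assume f: "f \<in> L"
    have "cmod (ip (A f) h) \<le> nm (A f) * nm h" by (rule cauchy_schwarz[OF bop_mem[OF A f] h])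
    also have "\<dots> \<le> C * nm f * nm h" by (rule mult_right_mono[OF C[OF f]]) simp
    finally show "cmod (ip (A f) h) \<le> C * nm h * nm f" by (simp add: mult_ac)
  qed (use h in \<open>simp_all add: bop_add[OF A] bop_scale[OF A] bop_mem[OF A] ip_simps\<close>)
qed

lemma
  assumes A: "bop A" and h: "h \<in> L"
  shows adj_mem: "adj A h \<in> L" and adj_ip: "k \<in> L \<Longrightarrow> ip (A k) h = ip k (adj A h)"
  using adj_exists[OF A h] adj_eqI[OF h] by metis+

lemma adj_ip': "bop A \<Longrightarrow> h \<in> L \<Longrightarrow> k \<in> L \<Longrightarrow> ip (adj A h) k = ip h (A k)"
  using adj_ip[of A h k] ip_cnj[of "adj A h" k] ip_cnj[of "h" "A k"] by simp

text \<open>The square of the norm of \<open>adj A h\<close> is the inner product of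
  \<open>A (adj A h)\<close> and \<open>h\<close>, so Cauchy-Schwarz bounds it by
  \<open>C * nm (adj A h) * nm h\<close>. Cancelling one factor shows that the bound of
  \<open>A\<close> serves for the adjoint as well.\<close>

lemma bop_adj:
  assumes A: "bop A"
  shows "bop (adj A)"
proof -
  obtain C where C: "\<And>h. h \<in> L \<Longrightarrow> nm (A h) \<le> C * nm h" using bop_bound[OF A] by blast
  show ?thesis
  proof (rule bopI[where C = C])
    fix h assume h: "h \<in> L"
    have g: "adj A h \<in> L" by (rule adj_mem[OF A h])
    have "(nm (adj A h))\<^sup>2 = Re (ip (A (adj A h)) h)" using adj_ip[OF A h g] Re_ip_self[of "adj A h"] by simp
    also have "\<dots> \<le> nm (A (adj A h)) * nm h"
      using cauchy_schwarz[OF bop_mem[OF A g] h] complex_Re_le_cmod[of "ip (A (adj A h)) h"] by linarith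
    also have "\<dots> \<le> C * nm (adj A h) * nm h" by (rule mult_right_mono[OF C[OF g]]) simp
    finally have "nm (adj A h) * nm (adj A h) \<le> nm (adj A h) * (C * nm h)" by (simp add: power2_eq_square mult_ac)
    then show "nm (adj A h) \<le> C * nm h"
    proof (cases "nm (adj A h) = 0")
      case True
      have "0 \<le> C * nm h" using order_trans[OF nm_nonneg C[OF h]] .
      then show ?thesis using True by simp
    next
      case False
      then have "0 < nm (adj A h)" using nm_nonneg[of "adj A h"] by linarith
      then show ?thesis using \<open>nm (adj A h) * nm (adj A h) \<le> _\<close> by (simp add: mult_le_cancel_left_pos)
    qed
  next
    fix h k assume "h \<in> L" "k \<in> L"
    then show "adj A (\<lambda>z. h z + k z) = (\<lambda>z. adj A h z + adj A k z)"
      by (intro adj_eqI) (simp_all add: adj_mem[OF A] ip_simps bop_mem[OF A] adj_ip[OF A])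
  next
    fix h a assume "h \<in> L"
    then show "adj A (\<lambda>z. a * h z) = (\<lambda>z. a * adj A h z)"
      by (intro adj_eqI) (simp_all add: adj_mem[OF A] ip_simps bop_mem[OF A] adj_ip[OF A])
  qed (rule adj_mem[OF A])
qed

lemma adj_plus:
  assumes "bop A" "bop B" "h \<in> L"
  shows "adj (\<lambda>h z. A h z + B h z) h = (\<lambda>z. adj A h z + adj B h z)"
  using assms by (intro adj_eqI) (simp_all add: adj_mem ip_simps bop_mem adj_ip)

lemma adj_comp:
  assumes "bop A" "bop B" "h \<in> L"
  shows "adj (\<lambda>h. A (B h)) h = adj B (adj A h)"
  using assms by (intro adj_eqI) (simp_all add: adj_mem bop_mem adj_ip)

lemma adj_mult: "h \<in> L \<Longrightarrow> adj (\<lambda>h z. a * h z) h = (\<lambda>z. cnj a * h z)"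
  by (intro adj_eqI) (simp_all add: ip_simps)

lemma adj_cong: "bop A \<Longrightarrow> (\<And>h. h \<in> L \<Longrightarrow> A h = B h) \<Longrightarrow> h \<in> L \<Longrightarrow> adj B h = adj A h"
  by (rule adj_eqI) (auto simp: adj_mem adj_ip[symmetric])


section \<open>Compact operators\<close>

abbreviation cop where "cop \<equiv> compact_operator \<mu> L"

lemma cop_bop: "cop A \<Longrightarrow> bop A"
  by (simp add: compact_operator_def)

lemma copI:
  assumes "bop A"
    and "\<And>h :: nat \<Rightarrow> 'a \<Rightarrow> complex. (\<And>k. h k \<in> L) \<Longrightarrow> (\<And>k. nm (h k) \<le> 1) \<Longrightarrow>
      \<exists>r g. strict_mono r \<and> g \<in> L \<and> (\<lambda>k. nm (\<lambda>z. A (h (r k)) z - g z)) \<longlonglongrightarrow> 0"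
  shows "cop A"
  using assms by (simp add: compact_operator_def)

text \<open>Compactness is defined by sequences in the unit ball. Dividing by \<open>D\<close>
  brings a bounded sequence there, and the limit is multiplied back. The value
  \<open>\<bar>C\<bar> + 1\<close> keeps the divisor positive for every \<open>C\<close>.\<close>

lemma cop_subsequence:
  fixes h :: "nat \<Rightarrow> 'a \<Rightarrow> complex"
  assumes A: "cop A" and h: "\<And>k. h k \<in> L" and C: "\<And>k. nm (h k) \<le> C"
  obtains r g where "strict_mono r" "g \<in> L" "(\<lambda>k::nat. nm (\<lambda>z. A (h (r k)) z - g z)) \<longlonglongrightarrow> 0"
proof -
  define D where "D = \<bar>C\<bar> + 1"
  have D: "D > 0" and CD: "C \<le> D" by (auto simp: D_def)
  define h' where "h' k = (\<lambda>z. complex_of_real (1/D) * h k z)" for k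
  have "h' k \<in> L" "nm (h' k) \<le> 1" for k
  proof -
    show "h' k \<in> L" unfolding h'_def by (rule L_scale[OF h])
    have "nm (h k) \<le> D" using C[of k] CD by linarith
    then show "nm (h' k) \<le> 1" unfolding h'_def nm_scale using D by (simp add: norm_divide divide_le_eq)
  qed
  then have "\<forall>k. h' k \<in> L \<and> nm (h' k) \<le> 1" by simp
  then have "\<exists>r g. strict_mono r \<and> g \<in> L \<and> (\<lambda>k. nm (\<lambda>z. A (h' (r k)) z - g z)) \<longlonglongrightarrow> 0"
    using A[unfolded compact_operator_def, THEN conjunct2, THEN spec[of _ h']] by simp
  then obtain r g where r: "strict_mono r" and g: "g \<in> L"
    and lim: "(\<lambda>k::nat. nm (\<lambda>z. A (h' (r k)) z - g z)) \<longlonglongrightarrow> 0" by blast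
  have eq: "nm (\<lambda>z. A (h k) z - complex_of_real D * g z) = D * nm (\<lambda>z. A (h' k) z - g z)" for k
  proof -
    have "A (h' k) = (\<lambda>z. complex_of_real (1/D) * A (h k) z)"
      unfolding h'_def by (rule bop_scale[OF cop_bop[OF A] h])
    then have "(\<lambda>z. A (h k) z - complex_of_real D * g z) = (\<lambda>z. complex_of_real D * (A (h' k) z - g z))"
      using D by (simp add: right_diff_distrib)
    then show ?thesis using nm_scale[of "complex_of_real D"] D by simp
  qed
  show ?thesis
  proof (rule that[OF r L_scale[OF g, of "complex_of_real D"]])
    show "(\<lambda>k. nm (\<lambda>z. A (h (r k)) z - complex_of_real D * g z)) \<longlonglongrightarrow> 0"
      unfolding eq using tendsto_mult_right_zero[OF lim] .
  qed
qed

lemma cop_cong: "cop A \<Longrightarrow> (\<And>h. h \<in> L \<Longrightarrow> A h = B h) \<Longrightarrow> cop B"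
  using bop_cong[of A B] by (simp add: compact_operator_def)

lemma cop_comp_right:
  assumes A: "cop A" and B: "bop B"
  shows "cop (\<lambda>h. A (B h))"
proof (rule copI[OF bop_comp[OF cop_bop[OF A] B]])
  fix h :: "nat \<Rightarrow> 'a \<Rightarrow> complex" assume h: "\<And>k. h k \<in> L" "\<And>k. nm (h k) \<le> 1"
  obtain C where C0: "C > 0" and C: "\<And>h. h \<in> L \<Longrightarrow> nm (B h) \<le> C * nm h" using bop_bound[OF B] by blast
  have "nm (B (h k)) \<le> C" for k
    using order_trans[OF C[OF h(1)[of k]] mult_left_mono[OF h(2)[of k], of C]] C0 by simp
  then obtain r g where "strict_mono r" "g \<in> L" "(\<lambda>k. nm (\<lambda>z. A (B (h (r k))) z - g z)) \<longlonglongrightarrow> 0"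
    by (rule cop_subsequence[OF A bop_mem[OF B h(1)]])
  then show "\<exists>r g. strict_mono r \<and> g \<in> L \<and> (\<lambda>k. nm (\<lambda>z. A (B (h (r k))) z - g z)) \<longlonglongrightarrow> 0" by blast
qed

lemma cop_comp_left:
  assumes A: "cop A" and B: "bop B"
  shows "cop (\<lambda>h. B (A h))"
proof (rule copI[OF bop_comp[OF B cop_bop[OF A]]])
  fix h :: "nat \<Rightarrow> 'a \<Rightarrow> complex" assume h: "\<And>k. h k \<in> L" "\<And>k. nm (h k) \<le> 1"
  obtain C where C: "\<And>h. h \<in> L \<Longrightarrow> nm (B h) \<le> C * nm h" using bop_bound[OF B] by blast
  obtain r g where r: "strict_mono r" and g: "g \<in> L"
    and lim: "(\<lambda>k. nm (\<lambda>z. A (h (r k)) z - g z)) \<longlonglongrightarrow> 0"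
    by (rule cop_subsequence[OF A h])
  have "(\<lambda>k. nm (\<lambda>z. B (A (h (r k))) z - B g z)) \<longlonglongrightarrow> 0"
  proof (rule Lim_null_comparison)
    show "(\<lambda>k. C * nm (\<lambda>z. A (h (r k)) z - g z)) \<longlonglongrightarrow> 0" using tendsto_mult_right_zero[OF lim] .
    show "\<forall>\<^sub>F k in sequentially. norm (nm (\<lambda>z. B (A (h (r k))) z - B g z)) \<le> C * nm (\<lambda>z. A (h (r k)) z - g z)"
    proof (rule always_eventually, rule allI)
      fix k
      have "A (h (r k)) \<in> L" by (rule bop_mem[OF cop_bop[OF A] h(1)])
      then show "norm (nm (\<lambda>z. B (A (h (r k))) z - B g z)) \<le> C * nm (\<lambda>z. A (h (r k)) z - g z)"
        using C[of "\<lambda>z. A (h (r k)) z - g z"] bop_diff[OF B, of "A (h (r k))" g] g by simp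
    qed
  qed
  then show "\<exists>r g. strict_mono r \<and> g \<in> L \<and> (\<lambda>k. nm (\<lambda>z. B (A (h (r k))) z - g z)) \<longlonglongrightarrow> 0"
    using r bop_mem[OF B g] by blast
qed

lemma cop_plus:
  assumes A: "cop A" and B: "cop B"
  shows "cop (\<lambda>h z. A h z + B h z)"
proof (rule copI[OF bop_plus[OF cop_bop[OF A] cop_bop[OF B]]])
  fix h :: "nat \<Rightarrow> 'a \<Rightarrow> complex" assume h: "\<And>k. h k \<in> L" "\<And>k. nm (h k) \<le> 1"
  obtain r f where r: "strict_mono r" and f: "f \<in> L"
    and limA: "(\<lambda>k. nm (\<lambda>z. A (h (r k)) z - f z)) \<longlonglongrightarrow> 0"
    by (rule cop_subsequence[OF A h])
  obtain r' g where r': "strict_mono r'" and g: "g \<in> L"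
    and limB: "(\<lambda>k. nm (\<lambda>z. B (h (r (r' k))) z - g z)) \<longlonglongrightarrow> 0"
    by (rule cop_subsequence[OF B, of "\<lambda>k. h (r k)" 1, OF h])
  have limA': "(\<lambda>k. nm (\<lambda>z. A (h (r (r' k))) z - f z)) \<longlonglongrightarrow> 0"
    using LIMSEQ_subseq_LIMSEQ[OF limA r'] by (simp add: o_def)
  have "(\<lambda>k. nm (\<lambda>z. A (h (r (r' k))) z + B (h (r (r' k))) z - (f z + g z))) \<longlonglongrightarrow> 0"
  proof (rule Lim_null_comparison)
    show "(\<lambda>k. nm (\<lambda>z. A (h (r (r' k))) z - f z) + nm (\<lambda>z. B (h (r (r' k))) z - g z)) \<longlonglongrightarrow> 0"
      using tendsto_add[OF limA' limB] by simp
    have "nm (\<lambda>z. A (h k) z + B (h k) z - (f z + g z)) \<le> nm (\<lambda>z. A (h k) z - f z) + nm (\<lambda>z. B (h k) z - g z)" for k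
    proof -
      have "(\<lambda>z. A (h k) z + B (h k) z - (f z + g z)) = (\<lambda>z. (A (h k) z - f z) + (B (h k) z - g z))"
        by (simp add: algebra_simps)
      moreover have "A (h k) \<in> L" "B (h k) \<in> L" using bop_mem[OF cop_bop[OF A] h(1)] bop_mem[OF cop_bop[OF B] h(1)] by auto
      ultimately show ?thesis
        using nm_triangle[of "\<lambda>z. A (h k) z - f z" "\<lambda>z. B (h k) z - g z"] f g by simp
    qed
    then show "\<forall>\<^sub>F k in sequentially. norm (nm (\<lambda>z. A (h (r (r' k))) z + B (h (r (r' k))) z - (f z + g z)))
        \<le> nm (\<lambda>z. A (h (r (r' k))) z - f z) + nm (\<lambda>z. B (h (r (r' k))) z - g z)"
      by (intro always_eventually allI) simp
  qed
  moreover have "strict_mono (\<lambda>k. r (r' k))" using strict_mono_o[OF r r'] by (simp add: o_def)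
  ultimately show "\<exists>r g. strict_mono r \<and> g \<in> L \<and> (\<lambda>k. nm (\<lambda>z. (A (h (r k)) z + B (h (r k)) z) - g z)) \<longlonglongrightarrow> 0"
    using L_add[OF f g] by blast
qed

text \<open>Maximizes the norm of \<open>A x\<close> over the unit ball of the complement of
  \<open>E\<close>. This complement is invariant under the composition of \<open>adj A\<close> with
  \<open>A\<close>, as the elements of \<open>E\<close> are eigenvectors, and a maximizer is an
  eigenvector whose eigenvalue is the square of the maximum. The test vector \<open>x0\<close> only
  certifies that the maximum exceeds \<open>t\<close>. With \<open>t = 0\<close> the lemma extends a
  system of singular vectors; with positive \<open>t\<close> it bounds \<open>A\<close> off the
  large ones.\<close>

lemma top_eigenvector:
  assumes A: "cop A" and E: "E \<subseteq> L" and inv: "\<And>e. e \<in> E \<Longrightarrow> \<exists>c. adj A (A e) = (\<lambda>z. c * e z)"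
    and x0: "x0 \<in> L" "\<And>e. e \<in> E \<Longrightarrow> ip x0 e = 0" and t: "0 \<le> t" "t * nm x0 < nm (A x0)"
  shows "\<exists>f\<in>L. (\<forall>e\<in>E. ip f e = 0) \<and> nm f = 1 \<and> t < nm (A f) \<and>
    adj A (A f) = (\<lambda>z. complex_of_real ((nm (A f))\<^sup>2) * f z)"
proof -
  have bA: "bop A" by (rule cop_bop[OF A])
  have bA': "bop (adj A)" by (rule bop_adj[OF bA])
  define M where "M = {x \<in> L. \<forall>e\<in>E. ip x e = 0}"
  have inL: "x \<in> L" if "x \<in> M" for x using that by (simp add: M_def)
  have Mscale: "(\<lambda>z. a * x z) \<in> M" if "x \<in> M" for x a using that by (simp add: M_def ip_scale_left)
  obtain C where C0: "C > 0" and C: "\<And>h. h \<in> L \<Longrightarrow> nm (A h) \<le> C * nm h" using bop_bound[OF bA] by blast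
  define S where "S = (\<lambda>x. nm (A x)) ` {x \<in> M. nm x \<le> 1}"
  have bdd: "bdd_above S"
  proof (rule bdd_aboveI)
    fix y assume "y \<in> S"
    then obtain x where x: "x \<in> M" "nm x \<le> 1" "y = nm (A x)" by (auto simp: S_def)
    show "y \<le> C" using order_trans[OF C[OF inL[OF x(1)]] mult_left_mono[OF x(2), of C]] C0 x(3) by simp
  qed
  have ne: "S \<noteq> {}"
  proof -
    have "(\<lambda>z. 0) \<in> M" by (simp add: M_def)
    then show ?thesis unfolding S_def using nm_zero by fastforce
  qed
  define s where "s = Sup S"
  have s_bound: "nm (A x) \<le> s * nm x" if x: "x \<in> M" for x
  proof (cases "nm x = 0")
    case True
    then have "x = (\<lambda>z. 0)" using nm_eq_0 inL[OF x] by blast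
    then show ?thesis using True bop_zero[OF bA] by simp
  next
    case False
    then have p: "nm x > 0" using nm_nonneg[of x] by linarith
    define y where "y = (\<lambda>z. complex_of_real (1 / nm x) * x z)"
    have "y \<in> M" unfolding y_def by (rule Mscale[OF x])
    moreover have "nm y = 1" unfolding y_def nm_scale using p by (simp add: norm_divide)
    ultimately have "nm (A y) \<in> S" by (auto simp: S_def)
    then have "nm (A y) \<le> s" unfolding s_def by (rule cSup_upper[OF _ bdd])
    moreover have "nm (A y) = nm (A x) / nm x"
      unfolding y_def bop_scale[OF bA inL[OF x]] nm_scale using p by (simp add: norm_divide)
    ultimately show ?thesis using p by (simp add: divide_le_eq)
  qed
  have x0M: "x0 \<in> M" using x0 by (simp add: M_def)
  have "t * nm x0 < s * nm x0" using t(2) s_bound[OF x0M] by linarith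
  then have ts: "t < s" using nm_nonneg[of x0] by (simp add: mult_less_cancel_right)
  then have s0: "s > 0" using t by linarith
  have "\<exists>x\<in>M. nm x \<le> 1 \<and> s - 1 / real (Suc n) < nm (A x)" for n
  proof -
    have "s - 1 / real (Suc n) < Sup S" by (simp add: s_def)
    then show ?thesis using less_cSupD[OF ne] by (fastforce simp: S_def)
  qed
  then obtain X where XM: "\<And>n. X n \<in> M" and X1: "\<And>n. nm (X n) \<le> 1"
    and Xs: "\<And>n. s - 1 / real (Suc n) < nm (A (X n))" by metis
  have XL: "X n \<in> L" for n using inL[OF XM] .
  obtain r y where r: "strict_mono r" and y: "y \<in> L"
    and limy: "(\<lambda>k. nm (\<lambda>z. A (X (r k)) z - y z)) \<longlonglongrightarrow> 0"
    by (rule cop_subsequence[OF A XL X1])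
  define Y where "Y = X \<circ> r"
  have YM: "Y n \<in> M" and YL: "Y n \<in> L" and Y1: "nm (Y n) \<le> 1" for n
    using XM XL X1 by (auto simp: Y_def)
  have AX: "(\<lambda>n. nm (A (X n))) \<longlonglongrightarrow> s"
  proof (rule tendsto_sandwich[OF always_eventually always_eventually])
    show "\<forall>n. s - 1 / real (Suc n) \<le> nm (A (X n))" using Xs by (auto intro: less_imp_le)
    show "\<forall>n. nm (A (X n)) \<le> s"
      using order_trans[OF s_bound[OF XM] mult_left_mono[OF X1, of s]] s0 by simp
    have "(\<lambda>n. s - 1 / real (Suc n)) \<longlonglongrightarrow> s - 0" by (intro tendsto_intros LIMSEQ_Suc lim_1_over_n)
    then show "(\<lambda>n. s - 1 / real (Suc n)) \<longlonglongrightarrow> s" by simp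
  qed simp
  have AY: "(\<lambda>n. nm (A (Y n))) \<longlonglongrightarrow> s"
    using LIMSEQ_subseq_LIMSEQ[OF AX r] by (simp add: Y_def o_def)
  \<comment> \<open>Moving the self-adjoint composition to the other side of the inner product
    replaces \<open>e\<close> by a multiple of itself.\<close>
  have TM: "adj A (A x) \<in> M" if x: "x \<in> M" for x
  proof -
    have xL: "x \<in> L" by (rule inL[OF x])
    have "ip (adj A (A x)) e = 0" if e: "e \<in> E" for e
    proof -
      have eL: "e \<in> L" using e E by blast
      obtain c where c: "adj A (A e) = (\<lambda>z. c * e z)" using inv[OF e] by blast
      have "ip (adj A (A x)) e = ip (A x) (A e)" by (rule adj_ip'[OF bA bop_mem[OF bA xL] eL])
      also have "\<dots> = ip x (adj A (A e))" by (rule adj_ip[OF bA bop_mem[OF bA eL] xL])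
      also have "\<dots> = 0" unfolding c ip_scale_right using x e by (simp add: M_def)
      finally show ?thesis .
    qed
    then show ?thesis using bop_mem[OF bA' bop_mem[OF bA xL]] by (simp add: M_def)
  qed
  have T_bound: "nm (adj A (A x)) \<le> s * nm (A x)" if x: "x \<in> M" for x
  proof (cases "nm (adj A (A x)) = 0")
    case False
    let ?u = "adj A (A x)"
    have xL: "x \<in> L" and uL: "?u \<in> L" using inL[OF x] inL[OF TM[OF x]] by auto
    have "(nm ?u)\<^sup>2 = Re (ip (A ?u) (A x))"
      using adj_ip[OF bA bop_mem[OF bA xL] uL] Re_ip_self[of ?u] by simp
    also have "\<dots> \<le> nm (A ?u) * nm (A x)"
      using cauchy_schwarz[OF bop_mem[OF bA uL] bop_mem[OF bA xL]] complex_Re_le_cmod[of "ip (A ?u) (A x)"] by linarith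
    also have "\<dots> \<le> s * nm ?u * nm (A x)" by (rule mult_right_mono[OF s_bound[OF TM[OF x]]]) simp
    finally have "nm ?u * nm ?u \<le> nm ?u * (s * nm (A x))" by (simp add: power2_eq_square mult_ac)
    moreover have "0 < nm ?u" using False nm_nonneg[of ?u] by linarith
    ultimately show ?thesis by (simp add: mult_le_cancel_left_pos)
  qed (use s0 in simp)
  define u where "u = adj A y"
  have uL: "u \<in> L" unfolding u_def by (rule bop_mem[OF bA' y])
  have limu: "(\<lambda>n. nm (\<lambda>z. adj A (A (Y n)) z - u z)) \<longlonglongrightarrow> 0"
  proof -
    obtain D where D: "\<And>h. h \<in> L \<Longrightarrow> nm (adj A h) \<le> D * nm h" using bop_bound[OF bA'] by blast
    show ?thesis
    proof (rule Lim_null_comparison)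
      show "(\<lambda>n. D * nm (\<lambda>z. A (Y n) z - y z)) \<longlonglongrightarrow> 0"
        using tendsto_mult_right_zero[OF limy] by (simp add: Y_def)
      have "nm (\<lambda>z. adj A (A (Y n)) z - u z) \<le> D * nm (\<lambda>z. A (Y n) z - y z)" for n
        using D[of "\<lambda>z. A (Y n) z - y z"] bop_diff[OF bA' bop_mem[OF bA YL] y] y bop_mem[OF bA YL] by (simp add: u_def)
      then show "\<forall>\<^sub>F n in sequentially. norm (nm (\<lambda>z. adj A (A (Y n)) z - u z)) \<le> D * nm (\<lambda>z. A (Y n) z - y z)"
        by (intro always_eventually allI) simp
    qed
  qed
  define s2 where "s2 = complex_of_real (s\<^sup>2)"
  \<comment> \<open>Expanding the square, the three terms are at most
    \<open>s\<^sup>2 * (nm (A (Y n)))\<^sup>2\<close>, \<open>s ^ 4\<close> and minus twice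
    \<open>s\<^sup>2 * (nm (A (Y n)))\<^sup>2\<close>. What remains is s^2 times the gap between s^2
    and the square of the norm of \<open>A (Y n)\<close>, and the sequence was chosen to close this
    gap.\<close>
  have lims: "(\<lambda>n. nm (\<lambda>z. adj A (A (Y n)) z - s2 * Y n z)) \<longlonglongrightarrow> 0"
  proof -
    have b: "(nm (\<lambda>z. adj A (A (Y n)) z - s2 * Y n z))\<^sup>2 \<le> s\<^sup>2 * (s\<^sup>2 - (nm (A (Y n)))\<^sup>2)" for n
    proof -
      have TL: "adj A (A (Y n)) \<in> L" by (rule inL[OF TM[OF YM]])
      have "ip (adj A (A (Y n))) (\<lambda>z. s2 * Y n z) = s2 * ip (A (Y n)) (A (Y n))"
        unfolding ip_scale_right using adj_ip'[OF bA bop_mem[OF bA YL[of n]] YL[of n]] by (simp add: s2_def)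
      then have "Re (ip (adj A (A (Y n))) (\<lambda>z. s2 * Y n z)) = s\<^sup>2 * (nm (A (Y n)))\<^sup>2"
        by (simp add: ip_self s2_def flip: of_real_mult del: of_real_power)
      then have "(nm (\<lambda>z. adj A (A (Y n)) z - s2 * Y n z))\<^sup>2
          = (nm (adj A (A (Y n))))\<^sup>2 + (s\<^sup>2 * nm (Y n))\<^sup>2 - 2 * (s\<^sup>2 * (nm (A (Y n)))\<^sup>2)"
        using nm_diff_sq[OF TL L_scale[OF YL[of n], of s2]] nm_scale[of s2 "Y n"] by (simp add: s2_def norm_power)
      also have "(nm (adj A (A (Y n))))\<^sup>2 \<le> (s * nm (A (Y n)))\<^sup>2"
        by (rule power_mono[OF T_bound[OF YM]]) simp
      also have "(s\<^sup>2 * nm (Y n))\<^sup>2 \<le> (s\<^sup>2 * 1)\<^sup>2"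
        by (rule power_mono[OF mult_left_mono[OF Y1]]) auto
      finally show ?thesis by (simp add: power_mult_distrib right_diff_distrib power2_eq_square)
    qed
    have "(\<lambda>n. s\<^sup>2 * (s\<^sup>2 - (nm (A (Y n)))\<^sup>2)) \<longlonglongrightarrow> s\<^sup>2 * (s\<^sup>2 - s\<^sup>2)"
      by (rule tendsto_mult[OF tendsto_const tendsto_diff[OF tendsto_const tendsto_power[OF AY]]])
    then have "(\<lambda>n. s\<^sup>2 * (s\<^sup>2 - (nm (A (Y n)))\<^sup>2)) \<longlonglongrightarrow> 0" by simp
    then have "(\<lambda>n. (nm (\<lambda>z. adj A (A (Y n)) z - s2 * Y n z))\<^sup>2) \<longlonglongrightarrow> 0"
      by (rule Lim_null_comparison[rotated]) (use b in \<open>simp_all add: always_eventually\<close>)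
    then have "(\<lambda>n. sqrt ((nm (\<lambda>z. adj A (A (Y n)) z - s2 * Y n z))\<^sup>2)) \<longlonglongrightarrow> sqrt 0"
      by (rule tendsto_real_sqrt)
    then show ?thesis by simp
  qed
  \<comment> \<open>Compactness makes only the images \<open>A (Y n)\<close> converge. The vectors
    themselves converge because \<open>s2\<close> times them is asymptotic to the convergent
    sequence \<open>adj A (A (Y n))\<close>.\<close>
  define f where "f = (\<lambda>z. (1 / s2) * u z)"
  have fL: "f \<in> L" unfolding f_def by (rule L_scale[OF uL])
  have s20: "s2 \<noteq> 0" using s0 by (simp add: s2_def)
  have Yf: "(\<lambda>n. nm (\<lambda>z. Y n z - f z)) \<longlonglongrightarrow> 0"
  proof (rule Lim_null_comparison)
    show "(\<lambda>n. (1 / s\<^sup>2) * (nm (\<lambda>z. adj A (A (Y n)) z - s2 * Y n z) + nm (\<lambda>z. adj A (A (Y n)) z - u z))) \<longlonglongrightarrow> 0"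
      using tendsto_mult_right_zero[OF tendsto_add[OF lims limu, simplified]] .
    have "nm (\<lambda>z. Y n z - f z) \<le> (1 / s\<^sup>2) * (nm (\<lambda>z. adj A (A (Y n)) z - s2 * Y n z) + nm (\<lambda>z. adj A (A (Y n)) z - u z))" for n
    proof -
      have "nm (\<lambda>z. Y n z - f z) = nm (\<lambda>z. (1 / s2) * (s2 * Y n z - u z))"
        using s20 by (simp add: f_def right_diff_distrib)
      also have "\<dots> = (1 / s\<^sup>2) * nm (\<lambda>z. s2 * Y n z - u z)"
        using nm_scale[of "1 / s2" "\<lambda>z. s2 * Y n z - u z"] by (simp add: s2_def norm_divide norm_power)
      also have "\<dots> \<le> (1 / s\<^sup>2) * (nm (\<lambda>z. adj A (A (Y n)) z - s2 * Y n z) + nm (\<lambda>z. adj A (A (Y n)) z - u z))"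
        using nm_triangle_diff[of "\<lambda>z. s2 * Y n z" "adj A (A (Y n))" u] YL uL inL[OF TM[OF YM]]
          nm_diff_commute[of "\<lambda>z. s2 * Y n z" "adj A (A (Y n))"] by (intro mult_left_mono) auto
      finally show ?thesis .
    qed
    then show "\<forall>\<^sub>F n in sequentially. norm (nm (\<lambda>z. Y n z - f z)) \<le>
        (1 / s\<^sup>2) * (nm (\<lambda>z. adj A (A (Y n)) z - s2 * Y n z) + nm (\<lambda>z. adj A (A (Y n)) z - u z))"
      by (intro always_eventually allI) simp
  qed
  have fM: "ip f e = 0" if e: "e \<in> E" for e
  proof -
    have "(\<lambda>n. ip (Y n) e) \<longlonglongrightarrow> ip f e" using tendsto_ip[OF YL fL Yf] e E by blast
    moreover have "ip (Y n) e = 0" for n using YM e by (simp add: M_def)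
    ultimately show ?thesis by (simp add: LIMSEQ_const_iff)
  qed
  have nAf: "nm (A f) = s"
  proof -
    have "(\<lambda>n. nm (\<lambda>z. A (Y n) z - A f z)) \<longlonglongrightarrow> 0"
    proof (rule Lim_null_comparison)
      show "(\<lambda>n. C * nm (\<lambda>z. Y n z - f z)) \<longlonglongrightarrow> 0" using tendsto_mult_right_zero[OF Yf] .
      show "\<forall>\<^sub>F n in sequentially. norm (nm (\<lambda>z. A (Y n) z - A f z)) \<le> C * nm (\<lambda>z. Y n z - f z)"
        using C[of "\<lambda>z. Y _ z - f z"] bop_diff[OF bA YL fL] YL fL by (auto intro!: always_eventually)
    qed
    from tendsto_nm[OF bop_mem[OF bA YL] bop_mem[OF bA fL] this] AY show ?thesis by (rule LIMSEQ_unique)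
  qed
  have n1: "nm f \<le> 1"
    using tendsto_nm[OF YL fL Yf] Y1 by (intro LIMSEQ_le_const2) auto
  \<comment> \<open>The maximum \<open>s\<close> is attained at \<open>f\<close>, and
    \<open>s \<le> s * nm f\<close> excludes a norm below one.\<close>
  have n1': "nm f = 1"
    using s_bound[of f] fL fM s0 n1 unfolding nAf M_def by (simp add: mult_le_cancel_left1)
  have "adj A (A f) = (\<lambda>z. s2 * f z)"
  proof -
    have "nm (\<lambda>z. adj A (A f) z - s2 * f z) = 0"
    proof -
      have fM': "f \<in> M" using fL fM by (simp add: M_def)
      have TL: "adj A (A f) \<in> L" by (rule inL[OF TM[OF fM']])
      have "Re (ip (adj A (A f)) (\<lambda>z. s2 * f z)) = s\<^sup>2 * (nm (A f))\<^sup>2"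
        unfolding ip_scale_right using adj_ip'[OF bA bop_mem[OF bA fL] fL]
        by (simp add: s2_def ip_self flip: of_real_mult del: of_real_power)
      then have "(nm (\<lambda>z. adj A (A f) z - s2 * f z))\<^sup>2 = (nm (adj A (A f)))\<^sup>2 + (s\<^sup>2 * 1)\<^sup>2 - 2 * (s\<^sup>2 * s\<^sup>2)"
        using nm_diff_sq[OF TL L_scale[OF fL, of s2]] nm_scale[of s2 f] n1' nAf by (simp add: s2_def norm_power)
      also have "(nm (adj A (A f)))\<^sup>2 \<le> (s * s)\<^sup>2"
        using T_bound[OF fM'] nAf by (intro power_mono) auto
      finally have "(nm (\<lambda>z. adj A (A f) z - s2 * f z))\<^sup>2 \<le> 0" by (simp add: power2_eq_square)
      then show ?thesis by simp
    qed
    then have "(\<lambda>z. adj A (A f) z - s2 * f z) = (\<lambda>z. 0)"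
      using nm_eq_0 L_diff[OF bop_mem[OF bA' bop_mem[OF bA fL]] L_scale[OF fL]] by blast
    then show ?thesis by (simp add: fun_eq_iff)
  qed
  then show ?thesis using fL fM n1' nAf ts by (intro bexI[of _ f]) (auto simp: s2_def)
qed

end

section \<open>Singular values and Schatten classes\<close>

text \<open>Induction on the number of equations. If the last one involves an unknown
  \<open>p\<close>, it is used to eliminate \<open>p\<close> from the others, which leaves one
  equation and one unknown less.\<close>

lemma nontrivial_solution:
  fixes a :: "'i \<Rightarrow> nat \<Rightarrow> complex"
  assumes "finite I" "n < card I"
  shows "\<exists>c. (\<exists>i\<in>I. c i \<noteq> 0) \<and> (\<forall>k<n. (\<Sum>i\<in>I. c i * a i k) = 0)"
  using assms
proof (induction n arbitrary: I a)
  case 0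
  then obtain i where "i \<in> I" by fastforce
  then show ?case by (intro exI[of _ "\<lambda>_. 1"]) auto
next
  case (Suc n)
  show ?case
  proof (cases "\<forall>i\<in>I. a i n = 0")
    case True
    obtain c where "\<exists>i\<in>I. c i \<noteq> 0" "\<forall>k<n. (\<Sum>i\<in>I. c i * a i k) = 0"
      using Suc.IH[of I a] Suc.prems by auto
    then show ?thesis using True by (intro exI[of _ c]) (auto simp: less_Suc_eq)
  next
    case False
    then obtain p where p: "p \<in> I" "a p n \<noteq> 0" by blast
    \<comment> \<open>The coefficients after subtracting from equation \<open>k\<close> the multiple
      of equation \<open>n\<close> that cancels the unknown \<open>p\<close>.\<close>
    define b where "b i k = a i k - a i n / a p n * a p k" for i k
    obtain c where c: "\<exists>i\<in>I - {p}. c i \<noteq> 0" "\<And>k. k < n \<Longrightarrow> (\<Sum>i\<in>I - {p}. c i * b i k) = 0"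
    proof -
      have "n < card (I - {p})" using Suc.prems p by simp
      then show ?thesis using Suc.IH[of "I - {p}" b] Suc.prems that by blast
    qed
    define d where "d i = (if i = p then - (\<Sum>i\<in>I - {p}. c i * a i n) / a p n else c i)" for i
    have sum: "(\<Sum>i\<in>I. d i * a i k) = d p * a p k + (\<Sum>i\<in>I - {p}. c i * a i k)" for k
      using Suc.prems p by (simp add: sum.remove[of I p] d_def)
    have "(\<Sum>i\<in>I. d i * a i k) = 0" if "k < Suc n" for k
    proof (cases "k = n")
      case True
      then show ?thesis unfolding sum using p by (simp add: d_def)
    next
      case False
      then have "(\<Sum>i\<in>I - {p}. c i * b i k) = 0" using c(2)[of k] that by simp
      moreover have "(\<Sum>i\<in>I - {p}. c i * b i k)
          = (\<Sum>i\<in>I - {p}. c i * a i k) - (\<Sum>i\<in>I - {p}. c i * a i n) / a p n * a p k"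
        unfolding b_def by (simp add: right_diff_distrib sum_subtractf sum_distrib_left sum_distrib_right sum_divide_distrib mult_ac)
      ultimately show ?thesis unfolding sum by (simp add: d_def)
    qed
    moreover have "\<exists>i\<in>I. d i \<noteq> 0" using c(1) by (auto simp: d_def)
    ultimately show ?thesis by blast
  qed
qed

text \<open>Converts a comparison of counting functions into a matching, and thereby into a
  comparison of sums. The smallest element \<open>p\<close> is matched last: at its level all of
  \<open>F\<close> is counted, so there are at least \<open>card F\<close> candidates, and one of
  them has not been taken by the other elements.\<close>

lemma dominating_injection:
  fixes s :: "'i \<Rightarrow> real" and a :: "'j \<Rightarrow> real"
  assumes "finite F" "\<And>j. j \<in> F \<Longrightarrow> finite {g \<in> G. s j \<le> a g} \<and> card {i \<in> F. s j \<le> s i} \<le> card {g \<in> G. s j \<le> a g}"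
  shows "\<exists>f. inj_on f F \<and> f ` F \<subseteq> G \<and> (\<forall>j\<in>F. s j \<le> a (f j))"
  using assms
proof (induction "card F" arbitrary: F)
  case 0
  then show ?case by simp
next
  case (Suc n)
  then have "F \<noteq> {}" by auto
  define p where "p = arg_min_on s F"
  have p: "p \<in> F" and min: "\<And>i. i \<in> F \<Longrightarrow> s p \<le> s i"
    unfolding p_def using arg_min_if_finite[OF Suc.prems(1) \<open>F \<noteq> {}\<close>, of s] by (auto simp: not_less)
  have "\<exists>f. inj_on f (F - {p}) \<and> f ` (F - {p}) \<subseteq> G \<and> (\<forall>j\<in>F - {p}. s j \<le> a (f j))"
  proof (rule Suc.hyps(1))
    show "n = card (F - {p})" using Suc.hyps(2) p Suc.prems(1) by simp
    fix j assume j: "j \<in> F - {p}"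
    have "card {i \<in> F - {p}. s j \<le> s i} \<le> card {i \<in> F. s j \<le> s i}"
      using Suc.prems(1) by (intro card_mono) auto
    then show "finite {g \<in> G. s j \<le> a g} \<and> card {i \<in> F - {p}. s j \<le> s i} \<le> card {g \<in> G. s j \<le> a g}"
      using Suc.prems(2)[of j] j by auto
  qed (use Suc.prems in simp)
  then obtain f where f: "inj_on f (F - {p})" "f ` (F - {p}) \<subseteq> G" "\<And>j. j \<in> F - {p} \<Longrightarrow> s j \<le> a (f j)" by blast
  have "{i \<in> F. s p \<le> s i} = F" using min by auto
  then have "card F \<le> card {g \<in> G. s p \<le> a g}" "finite {g \<in> G. s p \<le> a g}" using Suc.prems(2)[OF p] by auto
  moreover have "card (f ` (F - {p})) < card F"
    using card_image_le[of "F - {p}" f] Suc.prems(1) card_Diff1_less[OF Suc.prems(1) p] by simp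
  ultimately have "\<not> {g \<in> G. s p \<le> a g} \<subseteq> f ` (F - {p})"
    using card_mono[of "f ` (F - {p})" "{g \<in> G. s p \<le> a g}"] Suc.prems(1) by auto
  then obtain g where g: "g \<in> G" "s p \<le> a g" "g \<notin> f ` (F - {p})" by blast
  have "inj_on (f(p := g)) F"
    using f(1) g(3) p by (auto simp: inj_on_def)
  moreover have "(f(p := g)) ` F \<subseteq> G" using f(2) g(1) by auto
  moreover have "\<forall>j\<in>F. s j \<le> a ((f(p := g)) j)" using f(3) g(2) by auto
  ultimately show ?case by blast
qed

text \<open>Each finite set of indices is matched into the disjoint union of \<open>J1\<close> and
  \<open>J2\<close> so that every \<open>s j\<close> is at most \<open>2 * C\<close> times the value
  of its partner. The finite sums are then bounded by a constant times the two given sums,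
  independently of the set.\<close>

lemma summable_on_dominated_counts:
  fixes s s1 s2 :: "nat \<Rightarrow> real"
  assumes C: "C > 0" and q: "q \<ge> 0" and pos: "\<And>j. j \<in> J \<Longrightarrow> s j > 0"
    and fin: "\<And>t. t > 0 \<Longrightarrow> finite {j \<in> J. s j > t}" "\<And>t. t > 0 \<Longrightarrow> finite {j \<in> J1. s1 j > t}"
      "\<And>t. t > 0 \<Longrightarrow> finite {j \<in> J2. s2 j > t}"
    and count: "\<And>t. t > 0 \<Longrightarrow> card {j \<in> J. s j > C * t} \<le> card {j \<in> J1. s1 j > t} + card {j \<in> J2. s2 j > t}"
    and s1: "(\<lambda>k. s1 k powr q) summable_on J1" and s2: "(\<lambda>k. s2 k powr q) summable_on J2"
  shows "(\<lambda>k. s k powr q) summable_on J"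
proof (rule nonneg_bdd_above_summable_on)
  define G where "G = Inl ` J1 \<union> Inr ` J2"
  define a where "a = (\<lambda>g :: nat + nat. 2 * C * case_sum s1 s2 g)"
  have G_split: "{g \<in> G. P g} = Inl ` {j \<in> J1. P (Inl j)} \<union> Inr ` {j \<in> J2. P (Inr j)}" for P
    unfolding G_def by auto
  have cardG: "card {g \<in> G. P g} = card {j \<in> J1. P (Inl j)} + card {j \<in> J2. P (Inr j)}"
    if "finite {j \<in> J1. P (Inl j)}" "finite {j \<in> J2. P (Inr j)}" for P
    unfolding G_split using that
    by (subst card_Un_disjoint) (auto simp: card_image)
  show "bdd_above (sum (\<lambda>k. s k powr q) ` {F. F \<subseteq> J \<and> finite F})"
  proof (rule bdd_aboveI2)
    fix F assume "F \<in> {F. F \<subseteq> J \<and> finite F}"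
    then have F: "F \<subseteq> J" "finite F" by auto
    have "\<exists>f. inj_on f F \<and> f ` F \<subseteq> G \<and> (\<forall>j\<in>F. s j \<le> a (f j))"
    proof (rule dominating_injection[OF F(2)])
      fix j assume j: "j \<in> F"
      \<comment> \<open>The counts are compared at level \<open>2 * t\<close>. Since
        \<open>C * (2 * t)\<close> is half of \<open>s j\<close>, the set of indices with
        \<open>s j \<le> s i\<close> is covered by a strict level set; the factor 2 in
        \<open>a\<close> pays for this. The lower level \<open>t\<close> serves to infer finiteness
        of sets with a weak inequality.\<close>
      define t where "t = s j / (4 * C)"
      have sj: "s j > 0" using pos j F by auto
      have t: "t > 0" using sj C by (simp add: t_def)
      have Ct: "C * t < s j" using sj C by (simp add: t_def)
      have iff: "s j \<le> 2 * C * x \<longleftrightarrow> 2 * t \<le> x" for x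
        using C by (simp add: t_def divide_le_eq mult_ac)
      have sub: "{i \<in> J1. s1 i > 2 * t} \<subseteq> {i \<in> J1. 2 * t \<le> s1 i}" "{i \<in> J1. 2 * t \<le> s1 i} \<subseteq> {i \<in> J1. s1 i > t}"
        "{i \<in> J2. 2 * t \<le> s2 i} \<subseteq> {i \<in> J2. s2 i > t}" "{i \<in> J2. s2 i > 2 * t} \<subseteq> {i \<in> J2. 2 * t \<le> s2 i}"
        using t by auto
      have f1: "finite {i \<in> J1. 2 * t \<le> s1 i}" and f2: "finite {i \<in> J2. 2 * t \<le> s2 i}"
        using finite_subset[OF sub(2) fin(2)[OF t]] finite_subset[OF sub(3) fin(3)[OF t]] by auto
      have eq1: "{i \<in> J1. s j \<le> a (Inl i)} = {i \<in> J1. 2 * t \<le> s1 i}"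
        and eq2: "{i \<in> J2. s j \<le> a (Inr i)} = {i \<in> J2. 2 * t \<le> s2 i}"
        unfolding a_def by (auto simp: iff)
      have "finite {g \<in> G. s j \<le> a g}" unfolding G_split eq1 eq2 using f1 f2 by simp
      moreover have "card {i \<in> F. s j \<le> s i} \<le> card {i \<in> J. s i > C * (2 * t)}"
        using F sj C fin(1)[of "C * (2 * t)"] t by (intro card_mono) (auto simp: t_def)
      then have "card {i \<in> F. s j \<le> s i} \<le> card {i \<in> J1. s1 i > 2 * t} + card {i \<in> J2. s2 i > 2 * t}"
        using count[of "2 * t"] t by linarith
      then have "card {i \<in> F. s j \<le> s i} \<le> card {g \<in> G. s j \<le> a g}"
        using cardG[of "\<lambda>g. s j \<le> a g"] f1 f2 card_mono[OF f1 sub(1)] card_mono[OF f2 sub(4)] unfolding eq1 eq2 by linarith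
      ultimately show "finite {g \<in> G. s j \<le> a g} \<and> card {i \<in> F. s j \<le> s i} \<le> card {g \<in> G. s j \<le> a g}" by blast
    qed
    then obtain f where f: "inj_on f F" "f ` F \<subseteq> G" "\<And>j. j \<in> F \<Longrightarrow> s j \<le> a (f j)" by blast
    define F1 where "F1 = {i \<in> J1. Inl i \<in> f ` F}"
    define F2 where "F2 = {i \<in> J2. Inr i \<in> f ` F}"
    have "f ` F = f ` F \<inter> G" using f(2) by blast
    also have "\<dots> = Inl ` F1 \<union> Inr ` F2" unfolding G_def F1_def F2_def
      by (rule set_eqI, rename_tac x, case_tac x) auto
    finally have fF: "f ` F = Inl ` F1 \<union> Inr ` F2" .
    have "finite (f ` F)" using F by simp
    then have fin12: "finite F1" "finite F2" unfolding fF by (auto dest: finite_imageD simp: inj_on_def)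
    define u where "u = (\<lambda>g :: nat + nat. (2 * C) powr q * (case_sum s1 s2 g) powr q)"
    have "(\<Sum>j\<in>F. s j powr q) \<le> (\<Sum>j\<in>F. u (f j))"
    proof (rule sum_mono)
      fix j assume j: "j \<in> F"
      have sj: "0 < s j" using pos j F by auto
      have cs: "0 \<le> case_sum s1 s2 (f j)"
      proof -
        have "0 < a (f j)" using f(3)[OF j] sj by linarith
        then show ?thesis using C by (simp add: a_def zero_less_mult_iff)
      qed
      have "s j powr q \<le> a (f j) powr q" using f(3)[OF j] sj q by (intro powr_mono2) auto
      also have "\<dots> = u (f j)" unfolding a_def u_def using C cs by (simp add: powr_mult)
      finally show "s j powr q \<le> u (f j)" .
    qed
    also have "\<dots> = (\<Sum>g\<in>f ` F. u g)" using f(1) by (simp add: sum.reindex)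
    also have "\<dots> = (\<Sum>i\<in>F1. u (Inl i)) + (\<Sum>i\<in>F2. u (Inr i))"
      unfolding fF using fin12 by (subst sum.union_disjoint) (auto simp: sum.reindex)
    also have "\<dots> = (2 * C) powr q * ((\<Sum>i\<in>F1. s1 i powr q) + (\<Sum>i\<in>F2. s2 i powr q))"
      by (simp add: u_def sum_distrib_left distrib_left)
    also have "\<dots> \<le> (2 * C) powr q * (infsum (\<lambda>k. s1 k powr q) J1 + infsum (\<lambda>k. s2 k powr q) J2)"
      using fin12 by (intro mult_left_mono add_mono finite_sum_le_infsum s1 s2) (auto simp: F1_def F2_def)
    finally show "(\<Sum>j\<in>F. s j powr q) \<le> (2 * C) powr q * (infsum (\<lambda>k. s1 k powr q) J1 + infsum (\<lambda>k. s2 k powr q) J2)" .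
  qed
qed simp

section \<open>Singular vectors of a compact operator\<close>

context l2_space
begin

text \<open>The conditions of \<open>singular_values\<close> other than the one on the kernel, with
  the vectors exposed and an arbitrary index type. The latter lets a set of vectors index itself
  while Zorn's lemma is applied; numbering by natural numbers comes afterwards.\<close>

definition singular_system :: "(('a \<Rightarrow> complex) \<Rightarrow> ('a \<Rightarrow> complex)) \<Rightarrow> 'i set \<Rightarrow> ('i \<Rightarrow> real) \<Rightarrow> ('i \<Rightarrow> 'a \<Rightarrow> complex) \<Rightarrow> bool"
  where "singular_system A J s e \<longleftrightarrow> (\<forall>j\<in>J. e j \<in> L) \<and> (\<forall>j\<in>J. \<forall>k\<in>J. ip (e j) (e k) = of_bool (j = k)) \<and>
    (\<forall>j\<in>J. s j > 0 \<and> adj A (A (e j)) = (\<lambda>z. complex_of_real ((s j)\<^sup>2) * e j z))"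

lemma singular_values_iff:
  "singular_values \<mu> L A J s \<longleftrightarrow> (\<exists>e. singular_system A J s e \<and>
     (\<forall>h\<in>L. (\<forall>j\<in>J. ip h (e j) = 0) \<longrightarrow> A h = (\<lambda>z. 0)))"
  unfolding singular_values_def singular_system_def by blast

lemma
  assumes A: "bop A" and S: "singular_system A J s e"
  shows sing_mem: "j \<in> J \<Longrightarrow> e j \<in> L"
    and sing_pos: "j \<in> J \<Longrightarrow> 0 < s j"
    and sing_orth: "j \<in> J \<Longrightarrow> k \<in> J \<Longrightarrow> ip (e j) (e k) = of_bool (j = k)"
    and sing_image: "j \<in> J \<Longrightarrow> k \<in> J \<Longrightarrow> ip (A (e j)) (A (e k)) = of_bool (j = k) * complex_of_real ((s k)\<^sup>2)"
    and sing_eig: "j \<in> J \<Longrightarrow> adj A (A (e j)) = (\<lambda>z. complex_of_real ((s j)\<^sup>2) * e j z)"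
proof -
  show mem: "e j \<in> L" if "j \<in> J" for j using S that by (simp add: singular_system_def)
  show orth: "ip (e j) (e k) = of_bool (j = k)" if "j \<in> J" "k \<in> J" for j k
    using S that by (simp add: singular_system_def)
  show eig: "adj A (A (e j)) = (\<lambda>z. complex_of_real ((s j)\<^sup>2) * e j z)" if "j \<in> J" for j
    using S that by (simp add: singular_system_def)
  show "ip (A (e j)) (A (e k)) = of_bool (j = k) * complex_of_real ((s k)\<^sup>2)" if "j \<in> J" "k \<in> J"
    using adj_ip[OF A bop_mem[OF A mem[OF that(2)]] mem[OF that(1)]] eig[OF that(2)] orth[OF that]
    by (simp add: ip_scale_right)
  show "j \<in> J \<Longrightarrow> 0 < s j" using S by (simp add: singular_system_def)
qed

text \<open>The images of the singular vectors are pairwise orthogonal and have the singular values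
  as norms. Infinitely many of them above \<open>t\<close> would be more than \<open>t\<close> apart
  from each other, which excludes a convergent subsequence.\<close>

lemma singular_system_finite:
  assumes A: "cop A" and S: "singular_system A J s e" and t: "t > 0"
  shows "finite {j \<in> J. s j > t}"
proof (rule ccontr)
  assume "infinite {j \<in> J. s j > t}"
  then obtain f :: "nat \<Rightarrow> 'b" where f: "inj f" "range f \<subseteq> {j \<in> J. s j > t}"
    by (meson infinite_countable_subset)
  have bA: "bop A" by (rule cop_bop[OF A])
  have fJ: "f k \<in> J" and ft: "s (f k) > t" for k using f(2) by auto
  have eL: "e (f k) \<in> L" for k by (rule sing_mem[OF bA S fJ])
  have "nm (e (f k)) \<le> 1" for k
  proof -
    have "complex_of_real ((nm (e (f k)))\<^sup>2) = 1"
      using sing_orth[OF bA S fJ fJ, of k k] by (simp add: ip_self)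
    then have "(nm (e (f k)))\<^sup>2 = 1" using of_real_eq_1_iff by blast
    then show ?thesis by (simp add: power2_eq_1_iff) (use nm_nonneg[of "e (f k)"] in linarith)
  qed
  then obtain r g where r: "strict_mono r" and g: "g \<in> L"
    and lim: "(\<lambda>k. nm (\<lambda>z. A (e (f (r k))) z - g z)) \<longlonglongrightarrow> 0"
    by (rule cop_subsequence[OF A eL])
  obtain N where N: "\<And>k. k \<ge> N \<Longrightarrow> nm (\<lambda>z. A (e (f (r k))) z - g z) < t / 2"
    using LIMSEQ_D[OF lim, of "t / 2"] t by auto
  let ?u = "A (e (f (r N)))" and ?v = "A (e (f (r (Suc N))))"
  have uv: "?u \<in> L" "?v \<in> L" using bop_mem[OF bA eL] by auto
  have "nm (\<lambda>z. ?u z - ?v z) < t"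
    using nm_triangle_diff[OF uv(1) g uv(2)] N[of N] N[of "Suc N"] nm_diff_commute[of ?v g] by simp
  then have "(nm (\<lambda>z. ?u z - ?v z))\<^sup>2 < t\<^sup>2" by (intro power_strict_mono) auto
  moreover have "r N \<noteq> r (Suc N)" using strict_monoD[OF r, of N "Suc N"] by simp
  then have "ip ?u ?v = 0" using sing_image[OF bA S fJ fJ, of "r N" "r (Suc N)"] f(1) by (simp add: inj_eq)
  then have "(nm (\<lambda>z. ?u z - ?v z))\<^sup>2 = (nm ?u)\<^sup>2 + (nm ?v)\<^sup>2" using nm_diff_sq[OF uv] by simp
  moreover have "(nm ?u)\<^sup>2 = (s (f (r N)))\<^sup>2"
    unfolding Re_ip_self[symmetric] sing_image[OF bA S fJ fJ] by simp
  moreover have "t\<^sup>2 < (s (f (r N)))\<^sup>2" using ft t by (intro power_strict_mono) auto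
  moreover have "0 \<le> (nm ?v)\<^sup>2" by simp
  ultimately show False by linarith
qed

text \<open>A maximal system, ordered by inclusion, must exhaust the complement of the kernel: on a
  vector orthogonal to it with nonzero image, \<open>top_eigenvector\<close> with
  \<open>t = 0\<close> would produce one more member. The system is the union of its finite parts
  above 1/(n+1), hence countable, and can be numbered.\<close>

lemma singular_values_exist:
  assumes A: "cop A"
  shows "\<exists>J s. singular_values \<mu> L A J s"
proof -
  have bA: "bop A" by (rule cop_bop[OF A])
  define \<E> where "\<E> = {E. singular_system A E (\<lambda>e. nm (A e)) (\<lambda>e. e)}"
  have "\<exists>E\<in>\<E>. \<forall>X\<in>\<E>. E \<subseteq> X \<longrightarrow> X = E"
  proof (rule subset_Zorn')
    fix C assume C: "subset.chain \<E> C"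
    then have C\<E>: "\<And>E. E \<in> C \<Longrightarrow> singular_system A E (\<lambda>e. nm (A e)) (\<lambda>e. e)"
      and lin: "\<And>E F. E \<in> C \<Longrightarrow> F \<in> C \<Longrightarrow> E \<subseteq> F \<or> F \<subseteq> E"
      by (auto simp: subset_chain_def \<E>_def)
    have "ip j k = of_bool (j = k)" if jk: "j \<in> \<Union>C" "k \<in> \<Union>C" for j k
    proof -
      obtain E F where EF: "E \<in> C" "j \<in> E" "F \<in> C" "k \<in> F" using jk by blast
      then have "(j \<in> F \<and> k \<in> F) \<or> (j \<in> E \<and> k \<in> E)" using lin by blast
      then show ?thesis using C\<E>[OF EF(1)] C\<E>[OF EF(3)] unfolding singular_system_def by blast
    qed
    moreover have "j \<in> L \<and> 0 < nm (A j) \<and> adj A (A j) = (\<lambda>z. complex_of_real ((nm (A j))\<^sup>2) * j z)"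
      if j: "j \<in> \<Union>C" for j
    proof -
      obtain F where F: "F \<in> C" "j \<in> F" using j by blast
      show ?thesis
        using sing_mem[OF bA C\<E>[OF F(1)] F(2)] sing_pos[OF bA C\<E>[OF F(1)] F(2)] sing_eig[OF bA C\<E>[OF F(1)] F(2)] by simp
    qed
    ultimately show "\<Union>C \<in> \<E>" unfolding \<E>_def singular_system_def by simp
  qed
  then obtain E where E: "singular_system A E (\<lambda>e. nm (A e)) (\<lambda>e. e)"
    and max: "\<And>X. X \<in> \<E> \<Longrightarrow> E \<subseteq> X \<Longrightarrow> X = E" by (auto simp: \<E>_def)
  have EL: "E \<subseteq> L" using sing_mem[OF bA E] by auto
  have ker: "A h = (\<lambda>z. 0)" if h: "h \<in> L" "\<And>e. e \<in> E \<Longrightarrow> ip h e = 0" for h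
  proof (rule ccontr)
    assume ne: "A h \<noteq> (\<lambda>z. 0)"
    then have "nm (A h) \<noteq> 0" using nm_eq_0[OF bop_mem[OF bA h(1)]] by blast
    then have "0 * nm h < nm (A h)" using nm_nonneg[of "A h"] by (simp add: order.strict_iff_order)
    then obtain f where f: "f \<in> L" "\<And>e. e \<in> E \<Longrightarrow> ip f e = 0" "nm f = 1" "0 < nm (A f)"
      "adj A (A f) = (\<lambda>z. complex_of_real ((nm (A f))\<^sup>2) * f z)"
      using top_eigenvector[OF A EL _ h, of 0] sing_eig[OF bA E] by blast
    have "insert f E \<in> \<E>"
    proof -
      have "ip f f = 1" using f(3) by (simp add: ip_self)
      moreover have "f \<notin> E" using f(2)[of f] calculation by auto
      moreover have "ip e f = 0" if "e \<in> E" for e using ip_cnj[of e f] f(2)[OF that] by simp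
      ultimately have "\<forall>j\<in>insert f E. \<forall>k\<in>insert f E. ip j k = of_bool (j = k)"
        using f(2) sing_orth[OF bA E] by auto
      then show ?thesis using E f by (simp add: \<E>_def singular_system_def)
    qed
    then have "f \<in> E" using max by blast
    then have "complex_of_real ((nm f)\<^sup>2) = 0" using f(2) unfolding ip_self[symmetric] by blast
    then show False using f(3) by simp
  qed
  have "E = (\<Union>n. {e \<in> E. nm (A e) > 1 / real (Suc n)})"
  proof -
    have "\<exists>n. nm (A e) > 1 / real (Suc n)" if "e \<in> E" for e
      using reals_Archimedean[OF sing_pos[OF bA E that]] by (simp add: inverse_eq_divide)
    then show ?thesis by blast
  qed
  moreover have "finite {e \<in> E. nm (A e) > 1 / real (Suc n)}" for n
    by (rule singular_system_finite[OF A E]) simp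
  then have "countable (\<Union>n. {e \<in> E. nm (A e) > 1 / real (Suc n)})"
    by (intro countable_UN[OF countableI_type] countable_finite)
  ultimately have "countable E" by simp
  then obtain i :: "('a \<Rightarrow> complex) \<Rightarrow> nat" where i: "inj_on i E" using countableE by blast
  let ?e = "the_inv_into E i"
  have ei: "?e (i e) = e" if "e \<in> E" for e using the_inv_into_f_f[OF i that] .
  have "singular_system A (i ` E) (\<lambda>j. nm (A (?e j))) ?e"
    using E inj_on_eq_iff[OF i] unfolding singular_system_def by (simp add: ei)
  moreover have "\<forall>h\<in>L. (\<forall>j\<in>i ` E. ip h (?e j) = 0) \<longrightarrow> A h = (\<lambda>z. 0)"
    using ker by (simp add: ei)
  ultimately show ?thesis unfolding singular_values_iff by blast
qed

section \<open>Singular numbers and the ideal property of Schatten classes\<close>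

text \<open>Bounds the \<open>(n+1)\<close>-st singular number of \<open>A\<close>, counted with multiplicity, by \<open>t\<close>.\<close>
definition small_off :: "(('a \<Rightarrow> complex) \<Rightarrow> ('a \<Rightarrow> complex)) \<Rightarrow> nat \<Rightarrow> real \<Rightarrow> bool" where
  "small_off A n t \<longleftrightarrow> (\<exists>G. finite G \<and> G \<subseteq> L \<and> card G \<le> n \<and>
     (\<forall>x\<in>L. (\<forall>g\<in>G. ip x g = 0) \<longrightarrow> nm (A x) \<le> t * nm x))"

text \<open>The exceptional set consists of the singular vectors above \<open>t\<close>. If the
  bound failed off this set, there would be an eigenvector \<open>f\<close> orthogonal to it whose
  eigenvalue exceeds \<open>t\<^sup>2\<close>. The remaining singular vectors have eigenvalues at
  most \<open>t\<^sup>2\<close>, so \<open>f\<close> is orthogonal to them too, and the kernel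
  condition gives \<open>A f = 0\<close>.\<close>

lemma singular_values_small_off:
  assumes A: "cop A" and sv: "singular_values \<mu> L A J s" and t: "t > 0"
  shows "small_off A (card {j \<in> J. s j > t}) t"
proof -
  have bA: "bop A" by (rule cop_bop[OF A])
  obtain e where S: "singular_system A J s e"
    and ker: "\<And>h. h \<in> L \<Longrightarrow> (\<And>j. j \<in> J \<Longrightarrow> ip h (e j) = 0) \<Longrightarrow> A h = (\<lambda>z. 0)"
    using sv unfolding singular_values_iff by blast
  define G where "G = e ` {j \<in> J. s j > t}"
  have fin: "finite {j \<in> J. s j > t}" by (rule singular_system_finite[OF A S t])
  have GL: "G \<subseteq> L" using sing_mem[OF bA S] by (auto simp: G_def)
  have "nm (A x) \<le> t * nm x" if x: "x \<in> L" "\<And>g. g \<in> G \<Longrightarrow> ip x g = 0" for x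
  proof (rule ccontr)
    assume "\<not> nm (A x) \<le> t * nm x"
    then have "t * nm x < nm (A x)" by simp
    moreover have "\<exists>c. adj A (A g) = (\<lambda>z. c * g z)" if "g \<in> G" for g
      using that sing_eig[OF bA S] unfolding G_def by blast
    ultimately obtain f where f: "f \<in> L" "\<And>g. g \<in> G \<Longrightarrow> ip f g = 0" "nm f = 1" "t < nm (A f)"
      "adj A (A f) = (\<lambda>z. complex_of_real ((nm (A f))\<^sup>2) * f z)"
      using top_eigenvector[OF A GL _ x, of t] t by (metis less_imp_le)
    have "ip f (e j) = 0" if j: "j \<in> J" for j
    proof (cases "s j > t")
      case True
      then show ?thesis using f(2) j by (auto simp: G_def)
    next
      case False
      have ejL: "e j \<in> L" by (rule sing_mem[OF bA S j])
      have "complex_of_real ((nm (A f))\<^sup>2) * ip f (e j) = ip (adj A (A f)) (e j)"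
        unfolding f(5) ip_scale_left ..
      also have "\<dots> = ip f (adj A (A (e j)))"
        using adj_ip'[OF bA bop_mem[OF bA f(1)] ejL] adj_ip[OF bA bop_mem[OF bA ejL] f(1)] by simp
      also have "\<dots> = complex_of_real ((s j)\<^sup>2) * ip f (e j)"
        unfolding sing_eig[OF bA S j] ip_scale_right by simp
      finally have "complex_of_real ((nm (A f))\<^sup>2 - (s j)\<^sup>2) * ip f (e j) = 0"
        by (simp add: left_diff_distrib)
      moreover have "(s j)\<^sup>2 < (nm (A f))\<^sup>2"
        using False f(4) sing_pos[OF bA S j] by (intro power_strict_mono) auto
      ultimately show ?thesis by (simp add: mult_eq_0_iff flip: of_real_power of_real_diff)
    qed
    then have "A f = (\<lambda>z. 0)" by (rule ker[OF f(1)])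
    then show False using f(4) t by simp
  qed
  then show ?thesis
    unfolding small_off_def using fin GL card_image_le[OF fin, of e] by (intro exI[of _ G]) (auto simp: G_def)
qed

text \<open>The other half of the min-max principle. More than \<open>n\<close> singular vectors
  admit a nontrivial combination \<open>x\<close> orthogonal to all exceptional vectors; by
  orthogonality of the singular vectors and of their images, \<open>nm (A x)\<close> exceeds
  \<open>t * nm x\<close>. The finite set \<open>F\<close> keeps the lemma free of infinite
  cardinalities.\<close>

lemma small_off_card:
  assumes A: "bop A" and S: "singular_system A J s e" and W: "small_off A n t" and t: "t \<ge> 0"
    and fin: "finite F" and F: "F \<subseteq> {j \<in> J. s j > t}"
  shows "card F \<le> n"
proof (rule ccontr)
  assume "\<not> card F \<le> n"
  obtain G where G: "finite G" "G \<subseteq> L" "card G \<le> n" and W: "\<And>x. x \<in> L \<Longrightarrow> (\<And>g. g \<in> G \<Longrightarrow> ip x g = 0) \<Longrightarrow> nm (A x) \<le> t * nm x"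
    using W unfolding small_off_def by (elim exE conjE) simp
  obtain g where g: "bij_betw g {..<card G} G" using ex_bij_betw_nat_finite[OF G(1)] by (auto simp: atLeast0LessThan)
  have "card G < card F" using G(3) \<open>\<not> card F \<le> n\<close> by linarith
  then obtain c where c: "\<exists>i\<in>F. c i \<noteq> 0" "\<And>k. k < card G \<Longrightarrow> (\<Sum>i\<in>F. c i * ip (e i) (g k)) = 0"
    using nontrivial_solution[OF fin, of "card G" "\<lambda>i k. ip (e i) (g k)"] by blast
  have FJ: "i \<in> J" "s i > t" if "i \<in> F" for i using F that by auto
  have eL: "e i \<in> L" if "i \<in> F" for i using sing_mem[OF A S FJ(1)[OF that]] .
  define x where "x = (\<lambda>z. \<Sum>i\<in>F. c i * e i z)"
  have xL: "x \<in> L" unfolding x_def using eL by (intro L_sum[OF fin] L_scale)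
  have ipx: "ip x h = (\<Sum>i\<in>F. c i * ip (e i) h)" if "h \<in> L" for h
    unfolding x_def using ip_sum_left[OF fin, of "\<lambda>i z. c i * e i z" h] eL that by (simp add: ip_scale_left)
  have Ax: "A x = (\<lambda>z. \<Sum>i\<in>F. c i * A (e i) z)" unfolding x_def by (rule bop_sum[OF A fin eL])
  have AeL: "A (e i) \<in> L" if "i \<in> F" for i using bop_mem[OF A eL[OF that]] .
  have ipAx: "ip (A x) h = (\<Sum>i\<in>F. c i * ip (A (e i)) h)" if "h \<in> L" for h
    unfolding Ax using ip_sum_left[OF fin, of "\<lambda>i z. c i * A (e i) z" h] AeL that by (simp add: ip_scale_left)
  have "ip x y = 0" if y: "y \<in> G" for y
  proof -
    obtain k where "k < card G" "y = g k" using g y by (auto simp: bij_betw_def)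
    then show ?thesis using ipx[of y] c(2)[of k] G(2) y by auto
  qed
  then have le: "nm (A x) \<le> t * nm x" by (rule W[OF xL])
  have xe: "ip x (e j) = c j" if "j \<in> F" for j
  proof -
    have "ip x (e j) = (\<Sum>i\<in>F. if i = j then c i else 0)"
      unfolding ipx[OF eL[OF that]] using sing_orth[OF A S FJ(1) FJ(1)] that by (intro sum.cong) auto
    then show ?thesis using that fin by simp
  qed
  have nx: "(nm x)\<^sup>2 = (\<Sum>i\<in>F. (cmod (c i))\<^sup>2)"
  proof -
    have "ip x x = (\<Sum>i\<in>F. c i * cnj (c i))"
      unfolding ipx[OF xL] using xe by (intro sum.cong) (auto simp: ip_cnj[of "e _" x])
    also have "\<dots> = complex_of_real (\<Sum>i\<in>F. (cmod (c i))\<^sup>2)" by (simp add: complex_norm_square del: of_real_power)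
    finally show ?thesis unfolding Re_ip_self[symmetric] by simp
  qed
  have Axe: "ip (A x) (A (e j)) = c j * complex_of_real ((s j)\<^sup>2)" if "j \<in> F" for j
  proof -
    have "ip (A x) (A (e j)) = (\<Sum>i\<in>F. if i = j then c i * complex_of_real ((s j)\<^sup>2) else 0)"
      unfolding ipAx[OF AeL[OF that]] using sing_image[OF A S FJ(1) FJ(1)] that by (intro sum.cong) auto
    then show ?thesis using that fin by simp
  qed
  have nAx: "(nm (A x))\<^sup>2 = (\<Sum>i\<in>F. (s i)\<^sup>2 * (cmod (c i))\<^sup>2)"
  proof -
    have "ip (A x) (A x) = (\<Sum>i\<in>F. c i * cnj (c i * complex_of_real ((s i)\<^sup>2)))"
      unfolding ipAx[OF bop_mem[OF A xL]] using Axe by (intro sum.cong) (auto simp: ip_cnj[of "A (e _)" "A x"])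
    also have "\<dots> = (\<Sum>i\<in>F. complex_of_real ((s i)\<^sup>2 * (cmod (c i))\<^sup>2))"
      by (intro sum.cong) (simp_all add: complex_norm_square mult_ac del: of_real_power)
    also have "\<dots> = complex_of_real (\<Sum>i\<in>F. (s i)\<^sup>2 * (cmod (c i))\<^sup>2)" by simp
    finally show ?thesis unfolding Re_ip_self[symmetric] by (simp only: Re_complex_of_real)
  qed
  have "t\<^sup>2 * (\<Sum>i\<in>F. (cmod (c i))\<^sup>2) < (\<Sum>i\<in>F. (s i)\<^sup>2 * (cmod (c i))\<^sup>2)"
    unfolding sum_distrib_left
  proof (rule sum_strict_mono_ex1[OF fin])
    have st: "t\<^sup>2 < (s i)\<^sup>2" if "i \<in> F" for i using FJ(2)[OF that] t by (intro power_strict_mono) auto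
    then show "\<forall>i\<in>F. t\<^sup>2 * (cmod (c i))\<^sup>2 \<le> (s i)\<^sup>2 * (cmod (c i))\<^sup>2"
      by (intro ballI mult_right_mono) (auto intro: less_imp_le)
    show "\<exists>i\<in>F. t\<^sup>2 * (cmod (c i))\<^sup>2 < (s i)\<^sup>2 * (cmod (c i))\<^sup>2"
    proof -
      obtain i where i: "i \<in> F" "c i \<noteq> 0" using c(1) by blast
      have "t\<^sup>2 * (cmod (c i))\<^sup>2 < (s i)\<^sup>2 * (cmod (c i))\<^sup>2"
        by (rule mult_strict_right_mono[OF st[OF i(1)]]) (use i in simp)
      then show ?thesis using i(1) by blast
    qed
  qed
  then have "(t * nm x)\<^sup>2 < (nm (A x))\<^sup>2" by (simp add: nx nAx power_mult_distrib)
  moreover have "(nm (A x))\<^sup>2 \<le> (t * nm x)\<^sup>2" using le by (intro power_mono) auto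
  ultimately show False by linarith
qed

text \<open>Reduces every closure property of the class to a statement about
  \<open>small_off\<close>, in which vectors are estimated rather than singular values. The two
  operators \<open>A\<close> and \<open>B\<close> accommodate sums; for properties of one operator
  they are taken equal, and then the count \<open>n + m\<close> is merely generous.\<close>

lemma schatten_dominated:
  assumes A: "A \<in> schatten_class p \<mu> L" and B: "B \<in> schatten_class p \<mu> L" and X: "cop X" and C: "C > 0"
    and W: "\<And>n m t. t > 0 \<Longrightarrow> small_off A n t \<Longrightarrow> small_off B m t \<Longrightarrow> small_off X (n + m) (C * t)"
  shows "X \<in> schatten_class p \<mu> L"
proof (cases "p = \<infinity>")
  case False
  have cA: "cop A" and cB: "cop B" using A B by (auto simp: schatten_class_def)
  obtain J1 s1 where 1: "singular_values \<mu> L A J1 s1" "(\<lambda>k. s1 k powr enn2real p) summable_on J1"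
    using A False by (auto simp: schatten_class_def)
  obtain J2 s2 where 2: "singular_values \<mu> L B J2 s2" "(\<lambda>k. s2 k powr enn2real p) summable_on J2"
    using B False by (auto simp: schatten_class_def)
  obtain J s where sv: "singular_values \<mu> L X J s" using singular_values_exist[OF X] by blast
  obtain e where S: "singular_system X J s e" using sv unfolding singular_values_iff by blast
  obtain e1 where S1: "singular_system A J1 s1 e1" using 1(1) unfolding singular_values_iff by blast
  obtain e2 where S2: "singular_system B J2 s2 e2" using 2(1) unfolding singular_values_iff by blast
  have "(\<lambda>k. s k powr enn2real p) summable_on J"
  proof (rule summable_on_dominated_counts[OF C _ _ _ _ _ _ 1(2) 2(2)])
    fix t :: real assume t: "t > 0"
    show "card {j \<in> J. s j > C * t} \<le> card {j \<in> J1. s1 j > t} + card {j \<in> J2. s2 j > t}"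
      using W[OF t singular_values_small_off[OF cA 1(1) t] singular_values_small_off[OF cB 2(1) t]] t C
      by (intro small_off_card[OF cop_bop[OF X] S] singular_system_finite[OF X S]) auto
  qed (use singular_system_finite[OF X S] singular_system_finite[OF cA S1] singular_system_finite[OF cB S2]
      sing_pos[OF cop_bop[OF X] S] in auto)
  then show ?thesis using X sv by (auto simp: schatten_class_def)
qed (use X in \<open>simp add: schatten_class_def\<close>)

lemma schatten_cop: "A \<in> schatten_class p \<mu> L \<Longrightarrow> cop A"
  by (simp add: schatten_class_def)

lemma schatten_bop: "A \<in> schatten_class p \<mu> L \<Longrightarrow> bop A"
  by (intro cop_bop schatten_cop)

lemma small_off_mono: "small_off A n t \<Longrightarrow> n \<le> m \<Longrightarrow> small_off A m t"
  unfolding small_off_def by (meson order_trans)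

text \<open>The value of an operator outside of \<open>L\<close> is arbitrary, and the operator
  identities below hold on \<open>L\<close> only. Passing through \<open>small_off\<close> replaces
  a comparison of the adjoints that occur in \<open>singular_values\<close>.\<close>

lemma schatten_cong:
  assumes A: "A \<in> schatten_class p \<mu> L" and eq: "\<And>h. h \<in> L \<Longrightarrow> A h = B h"
  shows "B \<in> schatten_class p \<mu> L"
proof (rule schatten_dominated[OF A A cop_cong[OF schatten_cop[OF A] eq] zero_less_one])
  fix n m :: nat and t :: real assume "small_off A n t"
  then have "small_off B n t" unfolding small_off_def using eq by auto
  then show "small_off B (n + m) (1 * t)" using small_off_mono by simp
qed

text \<open>Off the union of the two exceptional sets both summands are bounded by \<open>t\<close>,
  hence the sum by \<open>2 * t\<close>.\<close>

lemma schatten_plus: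
  assumes A: "A \<in> schatten_class p \<mu> L" and B: "B \<in> schatten_class p \<mu> L"
  shows "(\<lambda>h z. A h z + B h z) \<in> schatten_class p \<mu> L"
proof (rule schatten_dominated[OF A B cop_plus[OF schatten_cop[OF A] schatten_cop[OF B]], of 2])
  fix n m :: nat and t :: real assume "small_off A n t" "small_off B m t"
  then obtain G H where G: "finite G" "G \<subseteq> L" "card G \<le> n" "\<And>x. x \<in> L \<Longrightarrow> (\<And>g. g \<in> G \<Longrightarrow> ip x g = 0) \<Longrightarrow> nm (A x) \<le> t * nm x"
    and H: "finite H" "H \<subseteq> L" "card H \<le> m" "\<And>x. x \<in> L \<Longrightarrow> (\<And>g. g \<in> H \<Longrightarrow> ip x g = 0) \<Longrightarrow> nm (B x) \<le> t * nm x"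
    unfolding small_off_def by metis
  have "nm (\<lambda>z. A x z + B x z) \<le> (2 * t) * nm x" if x: "x \<in> L" "\<forall>g\<in>G \<union> H. ip x g = 0" for x
    using nm_triangle[OF bop_mem[OF schatten_bop[OF A] x(1)] bop_mem[OF schatten_bop[OF B] x(1)]]
      G(4)[OF x(1)] H(4)[OF x(1)] x(2) by auto
  then show "small_off (\<lambda>h z. A h z + B h z) (n + m) (2 * t)"
    unfolding small_off_def using G H card_Un_le[of G H] by (intro exI[of _ "G \<union> H"]) auto
qed simp

lemma schatten_left:
  assumes A: "A \<in> schatten_class p \<mu> L" and Y: "bop Y"
  shows "(\<lambda>h. Y (A h)) \<in> schatten_class p \<mu> L"
proof -
  obtain C where C0: "C > 0" and C: "\<And>h. h \<in> L \<Longrightarrow> nm (Y h) \<le> C * nm h" using bop_bound[OF Y] by blast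
  show ?thesis
  proof (rule schatten_dominated[OF A A cop_comp_left[OF schatten_cop[OF A] Y] C0])
    fix n m :: nat and t :: real assume "small_off A n t"
    then obtain G where G: "finite G" "G \<subseteq> L" "card G \<le> n" "\<And>x. x \<in> L \<Longrightarrow> (\<And>g. g \<in> G \<Longrightarrow> ip x g = 0) \<Longrightarrow> nm (A x) \<le> t * nm x"
      unfolding small_off_def by metis
    have "nm (Y (A x)) \<le> C * t * nm x" if x: "x \<in> L" "\<forall>g\<in>G. ip x g = 0" for x
      using order_trans[OF C[OF bop_mem[OF schatten_bop[OF A] x(1)]] mult_left_mono[OF G(4)[OF x(1)], of C]] x C0
      by (simp add: mult.assoc)
    then show "small_off (\<lambda>h. Y (A h)) (n + m) (C * t)"
      unfolding small_off_def using G by (intro exI[of _ G]) auto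
  qed
qed

text \<open>Here the exceptional set has to change: \<open>Y x\<close> is orthogonal to
  \<open>g\<close> exactly if \<open>x\<close> is orthogonal to \<open>adj Y g\<close>, so
  \<open>G\<close> is replaced by its image under the adjoint.\<close>

lemma schatten_right:
  assumes A: "A \<in> schatten_class p \<mu> L" and Y: "bop Y"
  shows "(\<lambda>h. A (Y h)) \<in> schatten_class p \<mu> L"
proof -
  obtain C where C0: "C > 0" and C: "\<And>h. h \<in> L \<Longrightarrow> nm (Y h) \<le> C * nm h" using bop_bound[OF Y] by blast
  show ?thesis
  proof (rule schatten_dominated[OF A A cop_comp_right[OF schatten_cop[OF A] Y] C0])
    fix n m :: nat and t :: real assume t: "t > 0" and "small_off A n t"
    then obtain G where G: "finite G" "G \<subseteq> L" "card G \<le> n" "\<And>x. x \<in> L \<Longrightarrow> (\<And>g. g \<in> G \<Longrightarrow> ip x g = 0) \<Longrightarrow> nm (A x) \<le> t * nm x"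
      unfolding small_off_def by metis
    have "nm (A (Y x)) \<le> C * t * nm x" if x: "x \<in> L" "\<forall>g\<in>adj Y ` G. ip x g = 0" for x
    proof -
      have "ip (Y x) g = 0" if "g \<in> G" for g using adj_ip[OF Y, of g x] x G(2) that by auto
      then have "nm (A (Y x)) \<le> t * nm (Y x)" by (rule G(4)[OF bop_mem[OF Y x(1)]])
      also have "\<dots> \<le> t * (C * nm x)" using C[OF x(1)] t by (intro mult_left_mono) auto
      finally show ?thesis by (simp add: mult_ac)
    qed
    then show "small_off (\<lambda>h. A (Y h)) (n + m) (C * t)"
      unfolding small_off_def using G card_image_le[OF G(1), of "adj Y"] adj_mem[OF Y]
      by (intro exI[of _ "adj Y ` G"]) auto
  qed
qed

lemma schatten_scale: "A \<in> schatten_class p \<mu> L \<Longrightarrow> (\<lambda>h z. a * A h z) \<in> schatten_class p \<mu> L"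
  using schatten_left[OF _ bop_mult[of a]] by simp

end

section \<open>Holomorphic functions of several variables\<close>

lemma norm_vec_scale: "norm (c *s x) = cmod c * norm (x :: complex^'n)"
  unfolding norm_vec_def vector_smult_component by (simp add: norm_mult L2_set_right_distrib)

lemma vec_scaleR: "r *\<^sub>R (x :: complex^'n) = complex_of_real r *s x"
  by (simp add: vec_eq_iff) (simp add: scaleR_conv_of_real)

lemma bounded_linear_vec_scale: "bounded_linear (\<lambda>c. c *s (v :: complex^'n))"
  by (rule bounded_linear_intro[of _ "norm v"])
    (simp_all add: norm_vec_scale vec_eq_iff algebra_simps)

abbreviation clinear_fun :: "(complex^'n \<Rightarrow> complex) \<Rightarrow> bool" where
  "clinear_fun \<equiv> Vector_Spaces.linear (*s) (*)"

lemma clinear_fun_iff: "clinear_fun D \<longleftrightarrow> (\<forall>x y. D (x + y) = D x + D y) \<and> (\<forall>c x. D (c *s x) = c * D x)"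
proof -
  have "module ((*s) :: complex \<Rightarrow> complex^'n \<Rightarrow> _)" by (simp add: module_def vec_eq_iff algebra_simps)
  moreover have "module ((*) :: complex \<Rightarrow> complex \<Rightarrow> _)" by (simp add: module_def algebra_simps)
  ultimately show ?thesis
    by (auto simp: Vector_Spaces.linear_def module_hom_def module_hom_axioms_def vector_space_def module_def)
qed

lemma clinear_fun_add: "clinear_fun D \<Longrightarrow> D (x + y) = D x + D y"
  and clinear_fun_scale: "clinear_fun D \<Longrightarrow> D (c *s x) = c * D x"
  by (simp_all add: clinear_fun_iff)

lemma holo_funI: "(\<And>z. z \<in> U \<Longrightarrow> \<exists>D. (f has_derivative D) (at z) \<and> clinear_fun D) \<Longrightarrow> holo_fun f U"
  by (simp add: holo_fun_def)

lemma holo_funE: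
  assumes "holo_fun f U" "z \<in> U"
  obtains D where "(f has_derivative D) (at z)" "clinear_fun D"
  using assms unfolding holo_fun_def by blast

lemma holo_fun_derivative:
  assumes "holo_fun f U" "z \<in> U"
  shows "(f has_derivative frechet_derivative f (at z)) (at z)" "clinear_fun (frechet_derivative f (at z))"
proof -
  obtain D where D: "(f has_derivative D) (at z)" "clinear_fun D" using holo_funE[OF assms] .
  then have "frechet_derivative f (at z) = D" using frechet_derivative_at by metis
  then show "(f has_derivative frechet_derivative f (at z)) (at z)" "clinear_fun (frechet_derivative f (at z))"
    using D by simp_all
qed

lemma holo_fun_subset: "holo_fun f U \<Longrightarrow> V \<subseteq> U \<Longrightarrow> holo_fun f V"
  by (auto simp: holo_fun_def)

lemma holo_fun_cong:
  assumes U: "open U" and f: "holo_fun f U" and eq: "\<And>z. z \<in> U \<Longrightarrow> f z = g z"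
  shows "holo_fun g U"
proof (rule holo_funI)
  fix z assume z: "z \<in> U"
  obtain D where D: "(f has_derivative D) (at z)" "clinear_fun D" using holo_funE[OF f z] .
  have "(g has_derivative D) (at z)"
    by (rule has_derivative_transform_within_open[OF D(1) U z eq])
  then show "\<exists>D. (g has_derivative D) (at z) \<and> clinear_fun D" using D(2) by blast
qed

lemma holo_fun_isCont: "holo_fun f U \<Longrightarrow> z \<in> U \<Longrightarrow> isCont f z"
  by (metis holo_funE has_derivative_continuous)

lemma holo_fun_continuous_on: "holo_fun f U \<Longrightarrow> continuous_on U f"
  by (meson continuous_at_imp_continuous_on holo_fun_isCont)

lemma holo_fun_const: "holo_fun (\<lambda>z. c) U"
  by (rule holo_funI) (auto intro!: exI[of _ "\<lambda>_. 0"] simp: clinear_fun_iff)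

lemma holo_fun_coord: "holo_fun (\<lambda>z. z $ i) U"
  by (rule holo_funI)
    (auto intro!: exI[of _ "\<lambda>x. x $ i"] bounded_linear_imp_has_derivative bounded_linear_vec_nth simp: clinear_fun_iff)

lemma holo_fun_add:
  assumes f: "holo_fun f U" and g: "holo_fun g U"
  shows "holo_fun (\<lambda>z. f z + g z) U"
proof (rule holo_funI)
  fix z assume z: "z \<in> U"
  obtain D where D: "(f has_derivative D) (at z)" "clinear_fun D" using holo_funE[OF f z] .
  obtain E where E: "(g has_derivative E) (at z)" "clinear_fun E" using holo_funE[OF g z] .
  show "\<exists>D. ((\<lambda>z. f z + g z) has_derivative D) (at z) \<and> clinear_fun D"
    using has_derivative_add[OF D(1) E(1)] D(2) E(2)
    by (intro exI[of _ "\<lambda>x. D x + E x"]) (auto simp: clinear_fun_iff algebra_simps)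
qed

lemma holo_fun_mult:
  assumes f: "holo_fun f U" and g: "holo_fun g U"
  shows "holo_fun (\<lambda>z. f z * g z) U"
proof (rule holo_funI)
  fix z assume z: "z \<in> U"
  obtain D where D: "(f has_derivative D) (at z)" "clinear_fun D" using holo_funE[OF f z] .
  obtain E where E: "(g has_derivative E) (at z)" "clinear_fun E" using holo_funE[OF g z] .
  show "\<exists>D. ((\<lambda>z. f z * g z) has_derivative D) (at z) \<and> clinear_fun D"
    using has_derivative_mult[OF D(1) E(1)] D(2) E(2)
    by (intro exI[of _ "\<lambda>h. f z * E h + D h * g z"]) (auto simp: clinear_fun_iff algebra_simps)
qed

lemma holo_fun_inverse:
  assumes f: "holo_fun f U" and nz: "\<And>z. z \<in> U \<Longrightarrow> f z \<noteq> 0"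
  shows "holo_fun (\<lambda>z. inverse (f z)) U"
proof (rule holo_funI)
  fix z assume z: "z \<in> U"
  obtain D where D: "(f has_derivative D) (at z)" "clinear_fun D" using holo_funE[OF f z] .
  show "\<exists>D. ((\<lambda>z. inverse (f z)) has_derivative D) (at z) \<and> clinear_fun D"
    using Deriv.has_derivative_inverse[OF nz[OF z] D(1)] D(2)
    by (intro exI[of _ "\<lambda>h. - (inverse (f z) * D h * inverse (f z))"]) (auto simp: clinear_fun_iff algebra_simps)
qed

lemma holo_fun_diff: "holo_fun f U \<Longrightarrow> holo_fun g U \<Longrightarrow> holo_fun (\<lambda>z. f z - g z) U"
  using holo_fun_add[of f U "\<lambda>z. (-1) * g z"] holo_fun_mult[OF holo_fun_const[of "-1" U], of g] by simp

lemma holo_fun_divide: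
  "holo_fun f U \<Longrightarrow> holo_fun g U \<Longrightarrow> (\<And>z. z \<in> U \<Longrightarrow> g z \<noteq> 0) \<Longrightarrow> holo_fun (\<lambda>z. f z / g z) U"
  using holo_fun_mult[of f U "\<lambda>z. inverse (g z)"] holo_fun_inverse[of g U] by (simp add: divide_inverse)

lemma holo_fun_sum: "(\<And>i. i \<in> I \<Longrightarrow> holo_fun (f i) U) \<Longrightarrow> holo_fun (\<lambda>z. \<Sum>i\<in>I. f i z) U"
  by (induction I rule: infinite_finite_induct) (auto intro: holo_fun_const holo_fun_add)

lemma holo_fun_prod: "(\<And>i. i \<in> I \<Longrightarrow> holo_fun (f i) U) \<Longrightarrow> holo_fun (\<lambda>z. \<Prod>i\<in>I. f i z) U"
  by (induction I rule: infinite_finite_induct) (auto intro: holo_fun_const holo_fun_mult)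

lemma holo_fun_power: "holo_fun f U \<Longrightarrow> holo_fun (\<lambda>z. f z ^ n) U"
  by (induction n) (auto intro: holo_fun_const holo_fun_mult)

lemma holo_map_coord: "holo_map \<phi> U \<Longrightarrow> holo_fun (\<lambda>z. \<phi> z $ i) U"
  by (simp add: holo_map_def)

lemma holo_map_cong:
  assumes "open U" "holo_map f U" "\<And>z. z \<in> U \<Longrightarrow> f z = g z"
  shows "holo_map g U"
  using assms holo_fun_cong[of U "\<lambda>z. f z $ _" "\<lambda>z. g z $ _"] by (simp add: holo_map_def)

lemma has_derivative_vec_componentwise:
  fixes f :: "'a::real_normed_vector \<Rightarrow> complex^'n"
  assumes "\<And>i. ((\<lambda>x. f x $ i) has_derivative (\<lambda>x. f' x $ i)) (at a within S)"
  shows "(f has_derivative f') (at a within S)"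
proof -
  have "((\<lambda>x. f x \<bullet> b) has_derivative (\<lambda>x. f' x \<bullet> b)) (at a within S)" if "b \<in> Basis" for b
  proof -
    obtain i u where b: "b = axis i u" using \<open>b \<in> Basis\<close> by (auto simp: Basis_vec_def)
    show ?thesis unfolding b inner_axis
      by (rule has_derivative_inner_left[OF assms])
  qed
  then show ?thesis by (simp add: has_derivative_componentwise_within[of f])
qed

definition jacobian :: "(complex^'n \<Rightarrow> complex^'m) \<Rightarrow> complex^'n \<Rightarrow> complex^'n^'m" where
  "jacobian \<phi> z = (\<chi> i j. frechet_derivative (\<lambda>z. \<phi> z $ i) (at z) (axis j 1))"

lemma vec_axis_expansion: "(h :: complex^'n) = (\<Sum>j\<in>UNIV. h $ j *s axis j 1)"
  by (simp add: vec_eq_iff axis_def if_distrib cong: if_cong)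

lemma clinear_fun_expansion:
  assumes D: "clinear_fun D"
  shows "D h = (\<Sum>j\<in>UNIV. D (axis j 1) * h $ j)"
proof -
  have "D (\<Sum>j\<in>S. h $ j *s axis j 1) = (\<Sum>j\<in>S. D (axis j 1) * h $ j)" if "finite S" for S
    using that
  proof (induction S rule: finite_induct)
    case empty
    then show ?case using clinear_fun_scale[OF D, of 0 0] by simp
  next
    case (insert x F)
    then show ?case by (simp add: clinear_fun_add[OF D] clinear_fun_scale[OF D] mult.commute)
  qed
  then show ?thesis using vec_axis_expansion[of h] by (metis finite)
qed

lemma has_derivative_jacobian:
  assumes \<phi>: "holo_map \<phi> U" and z: "z \<in> U"
  shows "(\<phi> has_derivative (\<lambda>h. jacobian \<phi> z *v h)) (at z)"
proof (rule has_derivative_vec_componentwise)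
  fix i
  have "(jacobian \<phi> z *v h) $ i = frechet_derivative (\<lambda>z. \<phi> z $ i) (at z) h" for h
    using clinear_fun_expansion[OF holo_fun_derivative(2)[OF holo_map_coord[OF \<phi>] z], of i h]
    by (simp add: matrix_vector_mult_def jacobian_def)
  then show "((\<lambda>x. \<phi> x $ i) has_derivative (\<lambda>h. (jacobian \<phi> z *v h) $ i)) (at z)"
    using holo_fun_derivative(1)[OF holo_map_coord[OF \<phi>] z, of i] by presburger
qed

lemma jacobian_unique:
  assumes \<phi>: "holo_map \<phi> U" and z: "z \<in> U" and A: "(\<phi> has_derivative (\<lambda>h. A *v h)) (at z)"
  shows "jacobian \<phi> z = A"
  using has_derivative_unique[OF has_derivative_jacobian[OF \<phi> z] A] by (metis matrix_eq)

lemma holo_map_isCont: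
  assumes "holo_map \<phi> U" "z \<in> U" shows "isCont \<phi> z"
  using has_derivative_continuous[OF has_derivative_jacobian[OF assms]] .

lemma holo_map_continuous_on: "holo_map \<phi> U \<Longrightarrow> continuous_on U \<phi>"
  by (meson continuous_at_imp_continuous_on holo_map_isCont)

lemma matrix_vector_mult_scale: "(A :: complex^'n^'m) *v (c *s x) = c *s (A *v x)"
  by (simp add: matrix_vector_mult_def vec_eq_iff sum_distrib_left mult_ac)

lemma holo_fun_compose:
  assumes f: "holo_fun f W" and \<phi>: "holo_map \<phi> U" and sub: "\<phi> ` U \<subseteq> W"
  shows "holo_fun (\<lambda>z. f (\<phi> z)) U"
proof (rule holo_funI)
  fix z assume z: "z \<in> U"
  obtain D where D: "(f has_derivative D) (at (\<phi> z))" "clinear_fun D" using holo_funE[OF f] z sub by blast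
  show "\<exists>D. ((\<lambda>z. f (\<phi> z)) has_derivative D) (at z) \<and> clinear_fun D"
    using has_derivative_compose[OF has_derivative_jacobian[OF \<phi> z] D(1)] D(2)
    by (intro exI[of _ "\<lambda>h. D (jacobian \<phi> z *v h)"])
      (simp add: clinear_fun_iff matrix_vector_right_distrib matrix_vector_mult_scale)
qed

lemma holo_map_compose:
  "holo_map f W \<Longrightarrow> holo_map \<phi> U \<Longrightarrow> \<phi> ` U \<subseteq> W \<Longrightarrow> holo_map (\<lambda>z. f (\<phi> z)) U"
  unfolding holo_map_def[of f] holo_map_def[of "\<lambda>z. f (\<phi> z)"] using holo_fun_compose by blast

lemma jacobian_compose:
  assumes f: "holo_map f W" and \<phi>: "holo_map \<phi> U" and sub: "\<phi> ` U \<subseteq> W" and z: "z \<in> U"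
  shows "jacobian (\<lambda>z. f (\<phi> z)) z = jacobian f (\<phi> z) ** jacobian \<phi> z"
proof (rule jacobian_unique[OF holo_map_compose[OF f \<phi> sub] z])
  have "\<phi> z \<in> W" using z sub by blast
  from has_derivative_compose[OF has_derivative_jacobian[OF \<phi> z] has_derivative_jacobian[OF f this]]
  show "((\<lambda>z. f (\<phi> z)) has_derivative (\<lambda>h. (jacobian f (\<phi> z) ** jacobian \<phi> z) *v h)) (at z)"
    by (simp add: matrix_vector_mul_assoc)
qed

section \<open>Restriction to complex lines, Cauchy estimates and limits\<close>

lemma line_has_field_derivative:
  assumes f: "holo_fun f U" and z: "z + \<zeta> *s v \<in> U"
  shows "((\<lambda>\<zeta>. f (z + \<zeta> *s v)) has_field_derivative frechet_derivative f (at (z + \<zeta> *s v)) v) (at \<zeta>)"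
proof -
  note D = holo_fun_derivative[OF f z]
  have "((\<lambda>\<zeta>. z + \<zeta> *s v) has_derivative (\<lambda>c. c *s v)) (at \<zeta>)"
    using has_derivative_add[OF has_derivative_const bounded_linear_imp_has_derivative[OF bounded_linear_vec_scale]]
    by simp
  from has_derivative_compose[OF this D(1)]
  have "((\<lambda>\<zeta>. f (z + \<zeta> *s v)) has_derivative (\<lambda>c. c * frechet_derivative f (at (z + \<zeta> *s v)) v)) (at \<zeta>)"
    by (simp add: clinear_fun_scale[OF D(2)])
  then show ?thesis unfolding has_field_derivative_def
    by (rule has_derivative_eq_rhs) (simp add: fun_eq_iff)
qed

lemma line_holomorphic:
  assumes f: "holo_fun f U" and S: "\<And>\<zeta>. \<zeta> \<in> S \<Longrightarrow> z + \<zeta> *s v \<in> U"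
  shows "(\<lambda>\<zeta>. f (z + \<zeta> *s v)) holomorphic_on S"
  unfolding holomorphic_on_def field_differentiable_def
  using line_has_field_derivative[OF f S] has_field_derivative_at_within by blast

text \<open>On the line through \<open>z\<close> in direction \<open>v\<close> the disc of radius
  \<open>r / norm v\<close> stays in the ball, and the one-variable inequality applies there. The
  case \<open>v = 0\<close> is separate because this radius would be meaningless.\<close>

lemma cauchy_estimate:
  assumes f: "holo_fun f U" and r: "r > 0" and sub: "cball z r \<subseteq> U"
    and B: "\<And>w. w \<in> cball z r \<Longrightarrow> cmod (f w) \<le> B"
  shows "cmod (frechet_derivative f (at z) v) \<le> B / r * norm v"
proof (cases "v = 0")
  case True
  have "z \<in> U" using sub r by auto
  then have "frechet_derivative f (at z) v = 0"
    using clinear_fun_scale[OF holo_fun_derivative(2)[OF f], of z 0 0] True by simp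
  then show ?thesis using True by simp
next
  case False
  define \<rho> where "\<rho> = r / norm v"
  have \<rho>: "\<rho> > 0" using r False by (simp add: \<rho>_def)
  have in_ball: "z + \<zeta> *s v \<in> cball z r" if "cmod \<zeta> \<le> \<rho>" for \<zeta>
    using that False by (simp add: dist_norm norm_vec_scale \<rho>_def pos_le_divide_eq)
  have hol: "(\<lambda>\<zeta>. f (z + \<zeta> *s v)) holomorphic_on cball 0 \<rho>"
    by (rule line_holomorphic[OF f]) (use in_ball sub in auto)
  have "norm ((deriv ^^ 1) (\<lambda>\<zeta>. f (z + \<zeta> *s v)) 0) \<le> fact 1 * B / \<rho> ^ 1"
    by (rule Cauchy_inequality[OF holomorphic_on_subset[OF hol ball_subset_cball] holomorphic_on_imp_continuous_on[OF hol] \<rho>])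
      (use B in_ball in auto)
  moreover have "z \<in> U" using sub r by auto
  then have "deriv (\<lambda>\<zeta>. f (z + \<zeta> *s v)) 0 = frechet_derivative f (at z) v"
    using line_has_field_derivative[OF f, of z 0 v] by (intro DERIV_imp_deriv) simp
  ultimately show ?thesis by (simp add: \<rho>_def)
qed

text \<open>Cauchy estimates for the differences \<open>F m - F n\<close> make the derivatives
  uniformly Cauchy on a smaller ball, so the limit is differentiable with the limit of the
  derivatives as its derivative. Complex linearity passes to that limit pointwise.\<close>

theorem holo_fun_uniform_limit:
  fixes F :: "nat \<Rightarrow> complex^'n \<Rightarrow> complex"
  assumes F: "\<And>n. holo_fun (F n) U"
    and lim: "\<And>a. a \<in> U \<Longrightarrow> \<exists>r>0. cball a r \<subseteq> U \<and> uniform_limit (cball a r) F f sequentially"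
  shows "holo_fun f U"
proof (rule holo_funI)
  fix a assume a: "a \<in> U"
  obtain r where r: "r > 0" "cball a r \<subseteq> U" "uniform_limit (cball a r) F f sequentially" using lim[OF a] by blast
  define DF where "DF n x = frechet_derivative (F n) (at x)" for n x
  \<comment> \<open>Balls of radius r/2 about points of \<open>S\<close> stay in the ball of uniform
    convergence. In the next step functions within e r/4 of the limit differ by at most e r/2, and
    the estimate on radius r/2 turns this into \<open>e\<close>.\<close>
  define S where "S = ball a (r/2)"
  have S_sub: "cball x (r/2) \<subseteq> cball a r" if "x \<in> S" for x
  proof
    fix w assume "w \<in> cball x (r/2)"
    then show "w \<in> cball a r" using that dist_triangle[of a w x] by (simp add: S_def)
  qed
  have SU: "x \<in> U" if "x \<in> S" for x using S_sub[OF that] r by (auto dest: subsetD[of _ _ x])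
  have key: "\<exists>N. \<forall>m\<ge>N. \<forall>n\<ge>N. \<forall>x\<in>S. \<forall>h. cmod (DF m x h - DF n x h) \<le> e * norm h" if e: "e > 0" for e
  proof -
    have "\<forall>\<^sub>F n in sequentially. \<forall>x\<in>cball a r. dist (F n x) (f x) < e * r / 4"
      using uniform_limitD[OF r(3), of "e * r / 4"] e r(1) by simp
    then obtain N where N: "\<And>n x. n \<ge> N \<Longrightarrow> x \<in> cball a r \<Longrightarrow> dist (F n x) (f x) < e * r / 4"
      unfolding eventually_sequentially by blast
    have "cmod (DF m x h - DF n x h) \<le> e * norm h" if mn: "m \<ge> N" "n \<ge> N" and x: "x \<in> S" for m n x h
    proof -
      have "cmod (F m w - F n w) \<le> e * r / 2" if w: "w \<in> cball x (r/2)" for w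
      proof -
        have "w \<in> cball a r" using w S_sub[OF x] by blast
        then have "dist (F m w) (F n w) < e * r / 4 + e * r / 4"
          using N[OF mn(1)] N[OF mn(2)] dist_triangle_less_add[of "F m w" "f w" "e * r / 4" "F n w" "e * r / 4"]
          by (simp add: dist_commute)
        then show ?thesis by (simp add: dist_norm)
      qed
      then have "cmod (frechet_derivative (\<lambda>z. F m z - F n z) (at x) h) \<le> (e * r / 2) / (r / 2) * norm h"
        using S_sub[OF x] r by (intro cauchy_estimate[OF holo_fun_diff[OF F F]]) auto
      moreover have "frechet_derivative (\<lambda>z. F m z - F n z) (at x) = (\<lambda>h. DF m x h - DF n x h)"
        unfolding DF_def
        by (rule frechet_derivative_at[symmetric])
          (rule has_derivative_diff[OF holo_fun_derivative(1)[OF F SU[OF x]] holo_fun_derivative(1)[OF F SU[OF x]]])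
      ultimately show ?thesis using r(1) by simp
    qed
    then show ?thesis by blast
  qed
  define g' where "g' x h = lim (\<lambda>n. DF n x h)" for x h
  have conv: "(\<lambda>n. DF n x h) \<longlonglongrightarrow> g' x h" if x: "x \<in> S" for x h
  proof -
    have "Cauchy (\<lambda>n. DF n x h)"
    proof (rule metric_CauchyI)
      fix e :: real assume e: "e > 0"
      have "e / (norm h + 1) > 0" using e by (simp add: add_nonneg_pos)
      from key[OF this] obtain N where N: "\<And>m n. m \<ge> N \<Longrightarrow> n \<ge> N \<Longrightarrow> cmod (DF m x h - DF n x h) \<le> e / (norm h + 1) * norm h"
        using x by blast
      have "e / (norm h + 1) * norm h < e"
        using e by (simp add: divide_less_eq add_nonneg_pos)
      then show "\<exists>M. \<forall>m\<ge>M. \<forall>n\<ge>M. dist (DF m x h) (DF n x h) < e"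
        using N unfolding dist_norm by (meson le_less_trans)
    qed
    then show ?thesis unfolding g'_def by (simp add: Cauchy_convergent_iff convergent_LIMSEQ_iff)
  qed
  have aS: "a \<in> S" using r by (simp add: S_def)
  have "\<exists>g. \<forall>x\<in>S. (\<lambda>n. F n x) \<longlonglongrightarrow> g x \<and> (g has_derivative g' x) (at x within S)"
  proof (rule has_derivative_sequence[where f' = DF and ?x0.0 = a and l = "f a"])
    show "convex S" by (simp add: S_def)
    show "(F n has_derivative DF n x) (at x within S)" if "x \<in> S" for n x
      unfolding DF_def by (rule has_derivative_at_withinI[OF holo_fun_derivative(1)[OF F SU[OF that]]])
    show "\<forall>\<^sub>F n in sequentially. \<forall>x\<in>S. \<forall>h. norm (DF n x h - g' x h) \<le> e * norm h" if e: "e > 0" for e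
    proof -
      obtain N where N: "\<And>m n x h. m \<ge> N \<Longrightarrow> n \<ge> N \<Longrightarrow> x \<in> S \<Longrightarrow> cmod (DF m x h - DF n x h) \<le> e * norm h"
        using key[OF e] by blast
      have "cmod (DF n x h - g' x h) \<le> e * norm h" if n: "n \<ge> N" and x: "x \<in> S" for n x h
      proof (rule LIMSEQ_le_const2)
        show "(\<lambda>m. cmod (DF n x h - DF m x h)) \<longlonglongrightarrow> cmod (DF n x h - g' x h)"
          by (intro tendsto_norm tendsto_diff tendsto_const conv[OF x])
        show "\<exists>M. \<forall>m\<ge>M. cmod (DF n x h - DF m x h) \<le> e * norm h" using N[OF n _ x] by blast
      qed
      then show ?thesis unfolding eventually_sequentially by blast
    qed
    show "a \<in> S" by (rule aS)
    show "(\<lambda>n. F n a) \<longlonglongrightarrow> f a" using tendsto_uniform_limitI[OF r(3)] r(1) by simp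
  qed
  then obtain g where g: "\<And>x. x \<in> S \<Longrightarrow> (\<lambda>n. F n x) \<longlonglongrightarrow> g x" "\<And>x. x \<in> S \<Longrightarrow> (g has_derivative g' x) (at x within S)" by blast
  have gf: "g x = f x" if "x \<in> S" for x
  proof -
    have "x \<in> cball a r" using that r by (simp add: S_def)
    then show ?thesis using tendsto_uniform_limitI[OF r(3)] g(1)[OF that] LIMSEQ_unique by blast
  qed
  have oS: "open S" by (simp add: S_def)
  have "(g has_derivative g' a) (at a)" using g(2)[OF aS] at_within_open[OF aS oS] by simp
  then have "(f has_derivative g' a) (at a)" by (rule has_derivative_transform_within_open[OF _ oS aS gf])
  moreover have "clinear_fun (g' a)"
    unfolding clinear_fun_iff
  proof (intro conjI allI)
    have lin: "clinear_fun (DF n a)" for n unfolding DF_def by (rule holo_fun_derivative(2)[OF F a])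
    show "g' a (x + y) = g' a x + g' a y" for x y
      using conv[OF aS, of "x + y"] tendsto_add[OF conv[OF aS, of x] conv[OF aS, of y]]
      by (intro LIMSEQ_unique[of "\<lambda>n. DF n a (x + y)"]) (simp_all add: clinear_fun_add[OF lin])
    show "g' a (c *s x) = c * g' a x" for c x
      using conv[OF aS, of "c *s x"] tendsto_mult_left[OF conv[OF aS, of x], of c]
      by (intro LIMSEQ_unique[of "\<lambda>n. DF n a (c *s x)"]) (simp_all add: clinear_fun_scale[OF lin])
  qed
  ultimately show "\<exists>D. (f has_derivative D) (at a) \<and> clinear_fun D" by blast
qed

text \<open>The directional derivative is the locally uniform limit of difference quotients.\<close>
lemma holo_fun_directional_derivative:
  assumes U: "open U" and f: "holo_fun f U"
  shows "holo_fun (\<lambda>z. frechet_derivative f (at z) v) U"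
proof -
  have local: "\<exists>r>0. ball a r \<subseteq> U \<and> holo_fun (\<lambda>z. frechet_derivative f (at z) v) (ball a r)" if a: "a \<in> U" for a
  proof -
    obtain R where R: "R > 0" "cball a R \<subseteq> U" using U a open_contains_cball by blast
    have "compact (f ` cball a R)"
      using holo_fun_continuous_on[OF holo_fun_subset[OF f R(2)]] by (intro compact_continuous_image) auto
    then obtain B where B: "\<And>z. z \<in> cball a R \<Longrightarrow> cmod (f z) \<le> B" and B0: "B > 0"
      using compact_imp_bounded bounded_pos by (metis image_eqI)
    \<comment> \<open>Half of \<open>R\<close> is left for the base point and half for the
      displacement: for \<open>cmod \<zeta> \<le> \<rho>\<close> the vector
      \<open>\<zeta> *s v\<close> has norm at most \<open>r\<close>. The summand 1 in the definition
      of \<rho> covers \<open>v = 0\<close>.\<close>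
    define r where "r = R / 2"
    define \<rho> where "\<rho> = r / (norm v + 1)"
    have v1: "norm v + 1 > 0" by (simp add: add_nonneg_pos)
    have r: "r > 0" and \<rho>: "\<rho> > 0" using R v1 by (auto simp: r_def \<rho>_def)
    have inR: "z + \<zeta> *s v \<in> cball a R" if z: "z \<in> cball a r" and \<zeta>: "cmod \<zeta> \<le> \<rho>" for z \<zeta>
    proof -
      have "cmod \<zeta> * norm v \<le> \<rho> * (norm v + 1)" using \<zeta> \<rho> by (intro mult_mono) auto
      also have "\<dots> = r" using v1 by (simp add: \<rho>_def)
      finally have "norm (\<zeta> *s v) \<le> r" by (simp add: norm_vec_scale)
      moreover have "norm (a - (z + \<zeta> *s v)) \<le> norm (a - z) + norm (\<zeta> *s v)"
        using norm_triangle_ineq4[of "a - z" "\<zeta> *s v"] by (simp add: diff_diff_eq)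
      ultimately show ?thesis using z by (simp add: dist_norm r_def)
    qed
    obtain N :: nat where N: "1 / real (Suc N) < \<rho> / 2" using reals_Archimedean[of "\<rho>/2"] \<rho> by (auto simp: inverse_eq_divide)
    define t where "t n = 1 / real (Suc (n + N))" for n
    have t0: "t n > 0" and t1: "t n < \<rho> / 2" for n
    proof -
      show "t n > 0" by (simp add: t_def)
      have "t n \<le> 1 / real (Suc N)" unfolding t_def by (intro divide_left_mono) auto
      then show "t n < \<rho> / 2" using N by linarith
    qed
    define F where "F n z = (f (z + complex_of_real (t n) *s v) - f z) / complex_of_real (t n)" for n z
    have Fh: "holo_fun (F n) (ball a r)" for n
      unfolding F_def
    proof (intro holo_fun_divide holo_fun_diff holo_fun_const)
      show "holo_fun f (ball a r)" using R r by (intro holo_fun_subset[OF f]) (auto simp: r_def)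
      show "holo_fun (\<lambda>z. f (z + complex_of_real (t n) *s v)) (ball a r)"
      proof (rule holo_fun_compose[OF f])
        show "holo_map (\<lambda>z. z + complex_of_real (t n) *s v) (ball a r)"
          unfolding holo_map_def by (auto intro!: holo_fun_add holo_fun_coord holo_fun_const)
        have "cmod (complex_of_real (t n)) \<le> \<rho>" using t0[of n] t1[of n] \<rho> by simp
        then show "(\<lambda>z. z + complex_of_real (t n) *s v) ` ball a r \<subseteq> U"
          using inR R(2) by (fastforce simp: less_imp_le)
      qed
      show "complex_of_real (t n) \<noteq> 0" for n using t0[of n] by simp
    qed
    \<comment> \<open>Cauchy's bound for the second derivative on discs of radius \<rho>/2 about
      points of the disc of radius \<rho>/2. All step lengths \<open>t n\<close> lie below \<rho>/2,
      so that the Taylor expansion stays in that disc.\<close>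
    define C where "C = 2 * B / (\<rho> / 2) ^ 2"
    have bound: "cmod (F n z - frechet_derivative f (at z) v) \<le> C * t n" if z: "z \<in> cball a r" for n z
    proof -
      define g where "g \<zeta> = f (z + \<zeta> *s v)" for \<zeta>
      have hol: "g holomorphic_on cball 0 \<rho>"
        unfolding g_def by (rule line_holomorphic[OF f]) (use inR[OF z] R in auto)
      have holb: "g holomorphic_on ball 0 \<rho>" by (rule holomorphic_on_subset[OF hol]) auto
      let ?S = "ball 0 (\<rho>/2) :: complex set"
      have "cmod ((deriv ^^ 0) g (t n) - (\<Sum>i\<le>1. (deriv ^^ i) g 0 * (complex_of_real (t n) - 0) ^ i / fact i))
          \<le> C * cmod (complex_of_real (t n) - 0) ^ Suc 1 / fact 1"
      proof (rule complex_Taylor[where S = ?S])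
        show "convex ?S" by simp
        show "((deriv ^^ i) g has_field_derivative (deriv ^^ Suc i) g x) (at x within ?S)" if "x \<in> ?S" for i x
        proof -
          have "(deriv ^^ i) g holomorphic_on ball 0 \<rho>" by (rule holomorphic_higher_deriv[OF holb]) simp
          then have "((deriv ^^ i) g has_field_derivative deriv ((deriv ^^ i) g) x) (at x)"
            using that \<rho> by (intro holomorphic_derivI[of _ "ball 0 \<rho>"]) auto
          then show ?thesis by (simp add: has_field_derivative_at_within)
        qed
        show "cmod ((deriv ^^ Suc 1) g x) \<le> C" if x: "x \<in> ?S" for x
        proof -
          have sub: "cball x (\<rho>/2) \<subseteq> cball 0 \<rho>"
          proof
            fix w assume "w \<in> cball x (\<rho>/2)"
            then show "w \<in> cball 0 \<rho>" using x norm_triangle_ineq2[of w x] by (simp add: dist_norm norm_minus_commute)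
          qed
          have "norm ((deriv ^^ 2) g x) \<le> fact 2 * B / (\<rho>/2) ^ 2"
          proof (rule Cauchy_inequality)
            show "g holomorphic_on ball x (\<rho>/2)" using sub by (intro holomorphic_on_subset[OF hol]) auto
            show "continuous_on (cball x (\<rho>/2)) g" using sub by (intro holomorphic_on_imp_continuous_on holomorphic_on_subset[OF hol])
            show "norm (g w) \<le> B" if "norm (x - w) = \<rho>/2" for w
            proof -
              have "w \<in> cball 0 \<rho>" using sub that by (auto simp: dist_norm)
              then show ?thesis unfolding g_def using B inR[OF z] by simp
            qed
          qed (use \<rho> in simp)
          then show ?thesis by (simp add: C_def numeral_2_eq_2)
        qed
      qed (use t0[of n] t1[of n] \<rho> in auto)
      moreover have "deriv g 0 = frechet_derivative f (at z) v"
      proof -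
        have "z \<in> U" using z R r by (auto simp: r_def)
        then show ?thesis
          unfolding g_def using line_has_field_derivative[OF f, of z 0 v] by (intro DERIV_imp_deriv) auto
      qed
      ultimately have "cmod (f (z + complex_of_real (t n) *s v) - f z - frechet_derivative f (at z) v * complex_of_real (t n)) \<le> C * (t n)\<^sup>2"
        using t0[of n] by (simp add: g_def diff_diff_eq power2_eq_square)
      moreover have "F n z - frechet_derivative f (at z) v
          = (f (z + complex_of_real (t n) *s v) - f z - frechet_derivative f (at z) v * complex_of_real (t n)) / complex_of_real (t n)"
        using t0[of n] by (simp add: F_def diff_divide_distrib)
      ultimately show ?thesis using t0[of n] by (simp add: norm_divide divide_le_eq power2_eq_square mult_ac)
    qed
    have tlim: "t \<longlonglongrightarrow> 0"
      unfolding t_def using LIMSEQ_ignore_initial_segment[OF lim_1_over_n[THEN LIMSEQ_Suc], of N] by simp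
    have ul: "uniform_limit (cball a r) F (\<lambda>z. frechet_derivative f (at z) v) sequentially"
    proof (rule uniform_limitI)
      fix e :: real assume e: "e > 0"
      have "(\<lambda>n. C * t n) \<longlonglongrightarrow> 0" using tendsto_mult_right_zero[OF tlim] .
      then have "\<forall>\<^sub>F n in sequentially. C * t n < e" using e by (rule order_tendstoD)
      then show "\<forall>\<^sub>F n in sequentially. \<forall>z\<in>cball a r. dist (F n z) (frechet_derivative f (at z) v) < e"
        by (rule eventually_mono) (use le_less_trans[OF bound] in \<open>auto simp: dist_norm\<close>)
    qed
    have "holo_fun (\<lambda>z. frechet_derivative f (at z) v) (ball a r)"
    proof (rule holo_fun_uniform_limit[OF Fh])
      fix b assume b: "b \<in> ball a r"
      then obtain s where s: "s > 0" "cball b s \<subseteq> ball a r" using open_contains_cball open_ball by blast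
      have "uniform_limit (cball b s) F (\<lambda>z. frechet_derivative f (at z) v) sequentially"
        by (rule uniform_limit_on_subset[OF ul]) (use s in auto)
      then show "\<exists>s>0. cball b s \<subseteq> ball a r \<and> uniform_limit (cball b s) F (\<lambda>z. frechet_derivative f (at z) v) sequentially"
        using s by blast
    qed
    moreover have "ball a r \<subseteq> U" using R r by (auto simp: r_def)
    ultimately show ?thesis using r by blast
  qed
  show ?thesis
  proof (rule holo_funI)
    fix z assume "z \<in> U"
    from local[OF this] obtain r where "r > 0" "holo_fun (\<lambda>z. frechet_derivative f (at z) v) (ball z r)" by blast
    then show "\<exists>D. ((\<lambda>z. frechet_derivative f (at z) v) has_derivative D) (at z) \<and> clinear_fun D"
      using holo_funE by (metis centre_in_ball)
  qed
qed

lemma holo_fun_det_jacobian: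
  fixes \<phi> :: "complex^'n \<Rightarrow> complex^'n"
  assumes "open U" "holo_map \<phi> U"
  shows "holo_fun (\<lambda>z. det (jacobian \<phi> z)) U"
  unfolding det_def jacobian_def
  by (intro holo_fun_sum holo_fun_mult holo_fun_prod holo_fun_const)
    (auto intro!: holo_fun_directional_derivative assms holo_map_coord)

section \<open>The real determinant of a complex linear map\<close>

definition diag_mat :: "('n \<Rightarrow> complex) \<Rightarrow> complex^'n^'n" where
  "diag_mat d = (\<chi> k l. if k = l then d k else 0)"

text \<open>As a left factor it adds multiples of row \<open>i\<close> to the other rows; as a right
  factor it adds a combination of the other columns to column \<open>i\<close>. Both uses occur, and
  \<open>row_shear\<close> is its transposed counterpart.\<close>

definition col_shear :: "'n \<Rightarrow> ('n \<Rightarrow> complex) \<Rightarrow> complex^'n^'n" where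
  "col_shear i c = (\<chi> k l. (if k = l then 1 else 0) + (if l = i \<and> k \<noteq> i then c k else 0))"

definition row_shear :: "'n \<Rightarrow> ('n \<Rightarrow> complex) \<Rightarrow> complex^'n^'n" where
  "row_shear i d = (\<chi> k l. (if k = l then 1 else 0) + (if k = i \<and> l \<noteq> i then d l else 0))"

lemma diag_mat_mult_left: "(diag_mat d ** A) $ k $ l = d k * A $ k $ l"
  by (simp add: matrix_matrix_mult_def diag_mat_def if_distrib[of "\<lambda>x. x * _"] cong: if_cong)

lemma diag_mat_mult_right: "(A ** diag_mat d) $ k $ l = A $ k $ l * d l"
  by (simp add: matrix_matrix_mult_def diag_mat_def if_distrib[of "\<lambda>x. _ * x"] cong: if_cong)

lemma col_shear_mult: "(col_shear i c ** A) $ k $ l = A $ k $ l + (if k \<noteq> i then c k * A $ i $ l else 0)"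
proof -
  have "(col_shear i c ** A) $ k $ l
      = (\<Sum>m\<in>UNIV. (if k = m then A $ m $ l else 0) + (if m = i then (if k \<noteq> i then c k * A $ m $ l else 0) else 0))"
    unfolding matrix_matrix_mult_def col_shear_def by (auto intro!: sum.cong simp: distrib_right)
  then show ?thesis by (simp add: sum.distrib)
qed

lemma row_shear_mult: "(A ** row_shear i d) $ k $ l = A $ k $ l + (if l \<noteq> i then A $ k $ i * d l else 0)"
proof -
  have "(A ** row_shear i d) $ k $ l
      = (\<Sum>m\<in>UNIV. (if m = l then A $ k $ m else 0) + (if m = i then (if l \<noteq> i then A $ k $ m * d l else 0) else 0))"
    unfolding matrix_matrix_mult_def row_shear_def by (auto intro!: sum.cong simp: distrib_left)
  then show ?thesis by (simp add: sum.distrib)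
qed

lemma mult_col_shear: "(A ** col_shear i c) $ k $ l = A $ k $ l + (if l = i then (\<Sum>m\<in>UNIV - {i}. A $ k $ m * c m) else 0)"
proof -
  have "(A ** col_shear i c) $ k $ l
      = (\<Sum>m\<in>UNIV. (if m = l then A $ k $ m else 0) + (if m \<noteq> i then (if l = i then A $ k $ m * c m else 0) else 0))"
    unfolding matrix_matrix_mult_def col_shear_def by (auto intro!: sum.cong simp: distrib_left)
  also have "\<dots> = A $ k $ l + (\<Sum>m\<in>UNIV. if m \<noteq> i then (if l = i then A $ k $ m * c m else 0) else 0)"
    by (simp add: sum.distrib)
  also have "(\<Sum>m\<in>UNIV. if m \<noteq> i then (if l = i then A $ k $ m * c m else 0) else 0)
     = (\<Sum>m\<in>UNIV - {i}. if l = i then A $ k $ m * c m else 0)"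
    by (intro sum.mono_neutral_cong_right) auto
  finally show ?thesis by simp
qed

lemma mult_row_shear: "(row_shear i d ** A) $ k $ l = A $ k $ l + (if k = i then (\<Sum>m\<in>UNIV - {i}. d m * A $ m $ l) else 0)"
proof -
  have "(row_shear i d ** A) $ k $ l
      = (\<Sum>m\<in>UNIV. (if k = m then A $ m $ l else 0) + (if m \<noteq> i then (if k = i then d m * A $ m $ l else 0) else 0))"
    unfolding matrix_matrix_mult_def row_shear_def by (auto intro!: sum.cong simp: distrib_right)
  also have "\<dots> = A $ k $ l + (\<Sum>m\<in>UNIV. if m \<noteq> i then (if k = i then d m * A $ m $ l else 0) else 0)"
    by (simp add: sum.distrib)
  also have "(\<Sum>m\<in>UNIV. if m \<noteq> i then (if k = i then d m * A $ m $ l else 0) else 0)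
     = (\<Sum>m\<in>UNIV - {i}. if k = i then d m * A $ m $ l else 0)"
    by (intro sum.mono_neutral_cong_right) auto
  finally show ?thesis by simp
qed

text \<open>Satisfied both by the squared modulus of the determinant and by the absolute value of
  the determinant of the underlying real map. Uniqueness identifies the two and so avoids a
  determinant with two-by-two blocks.\<close>

locale multiplicative_modulus =
  fixes r :: "complex^'n^'n \<Rightarrow> real"
  assumes r_mult: "r (A ** B) = r A * r B" and r_nonneg: "0 \<le> r A"
    and r_scalar: "r (diag_mat (\<lambda>_. a)) = cmod a ^ (2 * CARD('n))"
begin

definition coord_scaling :: "'n \<Rightarrow> complex \<Rightarrow> complex^'n^'n" where
  "coord_scaling i a = diag_mat (\<lambda>k. if k = i then a else 1)"

lemma r_one: "r (diag_mat (\<lambda>_. 1)) = 1"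
  using r_scalar[of 1] by simp

text \<open>The two scalings are conjugate by the permutation matrix that exchanges \<open>i\<close>
  and \<open>j\<close>. It is its own inverse, so the square of its modulus is one and
  cancels.\<close>

lemma r_coord_scaling_eq: "r (coord_scaling i a) = r (coord_scaling j a)"
proof -
  define \<tau> where "\<tau> k = (if k = i then j else if k = j then i else k)" for k
  have \<tau>: "\<tau> k = l \<longleftrightarrow> k = \<tau> l" for k l by (auto simp: \<tau>_def)
  define P :: "complex^'n^'n" where "P = (\<chi> k l. if \<tau> k = l then 1 else 0)"
  have 1: "(P ** A) $ k $ l = A $ (\<tau> k) $ l" for A :: "complex^'n^'n" and k l
    by (simp add: P_def matrix_matrix_mult_def if_distrib[of "\<lambda>x. x * _"] cong: if_cong)
  have 2: "(A ** P) $ k $ l = A $ k $ (\<tau> l)" for A :: "complex^'n^'n" and k l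
  proof -
    have "(\<Sum>m\<in>UNIV. A $ k $ m * (if \<tau> m = l then 1 else 0)) = (\<Sum>m\<in>UNIV. if m = \<tau> l then A $ k $ m else 0)"
      by (rule sum.cong) (auto simp: \<tau>[of _ l])
    then show ?thesis by (simp add: P_def matrix_matrix_mult_def)
  qed
  have "P ** coord_scaling i a ** P = coord_scaling j a"
    by (simp add: vec_eq_iff 1 2) (auto simp: coord_scaling_def diag_mat_def \<tau>_def)
  moreover have "P ** P = diag_mat (\<lambda>_. 1)"
    by (simp add: vec_eq_iff 1) (auto simp: P_def diag_mat_def \<tau>_def)
  then have "r P * r P = 1" using r_mult[of P P] r_one by simp
  ultimately show ?thesis using r_mult[of "P ** coord_scaling i a" P] r_mult[of P "coord_scaling i a"] by (simp add: mult_ac)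
qed

lemma r_diag_prod:
  "finite F \<Longrightarrow> r (diag_mat (\<lambda>k. if k \<in> F then d k else 1)) = (\<Prod>k\<in>F. r (coord_scaling k (d k)))"
proof (induction F rule: finite_induct)
  case (insert x F)
  have "diag_mat (\<lambda>k. if k \<in> insert x F then d k else 1)
      = coord_scaling x (d x) ** diag_mat (\<lambda>k. if k \<in> F then d k else 1)"
    using insert unfolding coord_scaling_def
    by (simp add: vec_eq_iff diag_mat_mult_left) (auto simp: diag_mat_def)
  then show ?case using insert r_mult by simp
qed (simp add: r_one)

text \<open>A scalar matrix is the product of the scalings of all coordinates, and these have the
  same modulus. Hence the modulus of one scaling is determined as a nonnegative root of the value on
  scalar matrices.\<close>

lemma r_coord_scaling: "r (coord_scaling i a) = (cmod a)\<^sup>2"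
proof -
  have "r (coord_scaling i a) ^ CARD('n) = (\<Prod>k\<in>UNIV. r (coord_scaling k a))"
    unfolding prod_constant[symmetric] by (intro prod.cong refl r_coord_scaling_eq)
  also have "\<dots> = r (diag_mat (\<lambda>_. a))" using r_diag_prod[of UNIV "\<lambda>_. a"] by simp
  also have "\<dots> = ((cmod a)\<^sup>2) ^ CARD('n)" by (simp add: r_scalar power_mult)
  finally show ?thesis by (rule power_eq_imp_eq_base) (simp_all add: r_nonneg)
qed

lemma r_diag: "r (diag_mat d) = (\<Prod>k\<in>UNIV. (cmod (d k))\<^sup>2)"
  using r_diag_prod[of UNIV d] by (simp add: r_coord_scaling)

text \<open>A shear is conjugate to its own square by a coordinate scaling.\<close>
lemma r_col_shear: "r (col_shear i c) = 1"
proof -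
  let ?E = "\<lambda>a. diag_mat (\<lambda>k. if k = i then a else 1)"
  have sq: "col_shear i c ** col_shear i c = col_shear i (\<lambda>k. 2 * c k)"
    by (simp add: vec_eq_iff col_shear_mult) (auto simp: col_shear_def)
  have conj: "?E (1/2) ** col_shear i c ** ?E 2 = col_shear i (\<lambda>k. 2 * c k)"
    by (simp add: vec_eq_iff diag_mat_mult_left diag_mat_mult_right) (auto simp: col_shear_def)
  have "r (?E (1/2)) * r (?E 2) = 1"
    using r_coord_scaling[of i] unfolding coord_scaling_def by (simp add: norm_divide power2_eq_square)
  then have "r (col_shear i c) * r (col_shear i c) = r (col_shear i c)"
    using sq conj r_mult[of "col_shear i c" "col_shear i c"] r_mult[of "?E (1/2) ** col_shear i c" "?E 2"]
      r_mult[of "?E (1/2)" "col_shear i c"] by (simp add: mult_ac)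
  moreover have "col_shear i c ** col_shear i (\<lambda>k. - c k) = diag_mat (\<lambda>_. 1)"
    by (simp add: vec_eq_iff col_shear_mult) (auto simp: col_shear_def diag_mat_def)
  then have "r (col_shear i c) \<noteq> 0" using r_mult[of "col_shear i c" "col_shear i (\<lambda>k. - c k)"] r_one by auto
  ultimately show ?thesis by simp
qed

lemma r_row_shear: "r (row_shear i c) = 1"
proof -
  let ?E = "\<lambda>a. diag_mat (\<lambda>k. if k = i then a else 1)"
  have sq: "row_shear i c ** row_shear i c = row_shear i (\<lambda>k. 2 * c k)"
    by (simp add: vec_eq_iff row_shear_mult) (auto simp: row_shear_def)
  have conj: "?E 2 ** row_shear i c ** ?E (1/2) = row_shear i (\<lambda>k. 2 * c k)"
    by (simp add: vec_eq_iff diag_mat_mult_left diag_mat_mult_right) (auto simp: row_shear_def)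
  have "r (?E (1/2)) * r (?E 2) = 1"
    using r_coord_scaling[of i] unfolding coord_scaling_def by (simp add: norm_divide power2_eq_square)
  then have "r (row_shear i c) * r (row_shear i c) = r (row_shear i c)"
    using sq conj r_mult[of "row_shear i c" "row_shear i c"] r_mult[of "?E 2 ** row_shear i c" "?E (1/2)"]
      r_mult[of "?E 2" "row_shear i c"] by (simp add: mult_ac)
  moreover have "row_shear i c ** row_shear i (\<lambda>k. - c k) = diag_mat (\<lambda>_. 1)"
    by (simp add: vec_eq_iff row_shear_mult) (auto simp: row_shear_def diag_mat_def)
  then have "r (row_shear i c) \<noteq> 0" using r_mult[of "row_shear i c" "row_shear i (\<lambda>k. - c k)"] r_one by auto
  ultimately show ?thesis by simp
qed

end

text \<open>Gaussian elimination; \<open>S\<close> contains the indices of the rows and columns that are not yet cleared.\<close>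
lemma multiplicative_modulus_unique_aux:
  fixes r q :: "complex^'n^'n \<Rightarrow> real"
  assumes r: "multiplicative_modulus r" and q: "multiplicative_modulus q"
    and S: "\<And>k l. k \<noteq> l \<Longrightarrow> k \<notin> S \<or> l \<notin> S \<Longrightarrow> A $ k $ l = 0"
  shows "r A = q A"
  using S
proof (induction "card S" arbitrary: S A)
  case 0
  then have "A = diag_mat (\<lambda>k. A $ k $ k)" by (auto simp: vec_eq_iff diag_mat_def)
  then show ?case using multiplicative_modulus.r_diag[OF r] multiplicative_modulus.r_diag[OF q] by metis
next
  case (Suc n)
  note rm = multiplicative_modulus.r_mult[OF r] multiplicative_modulus.r_mult[OF q]
    multiplicative_modulus.r_col_shear[OF r] multiplicative_modulus.r_col_shear[OF q]
    multiplicative_modulus.r_row_shear[OF r] multiplicative_modulus.r_row_shear[OF q]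
  obtain i where i: "i \<in> S" using Suc.hyps(2) by fastforce
  have IH: "r B = q B" if "\<And>k l. k \<noteq> l \<Longrightarrow> k \<notin> S - {i} \<or> l \<notin> S - {i} \<Longrightarrow> B $ k $ l = 0" for B
    by (rule Suc.hyps(1)[of "S - {i}"]) (use Suc.hyps(2) i that in auto)
  have pivot: "r B = q B" if B: "\<And>k l. k \<noteq> l \<Longrightarrow> k \<notin> S \<or> l \<notin> S \<Longrightarrow> B $ k $ l = 0" and nz: "B $ i $ i \<noteq> 0" for B
  proof -
    define C where "C = col_shear i (\<lambda>k. - B $ k $ i / B $ i $ i)"
    define D where "D = row_shear i (\<lambda>l. - B $ i $ l / B $ i $ i)"
    have "r (C ** B ** D) = q (C ** B ** D)"
    proof (rule IH)
      fix k l assume "k \<noteq> l" "k \<notin> S - {i} \<or> l \<notin> S - {i}"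
      then consider "k = i" "l \<noteq> i" | "l = i" "k \<noteq> i" | "k \<noteq> i" "l \<noteq> i" "k \<notin> S" | "k \<noteq> i" "l \<noteq> i" "l \<notin> S" by blast
      then show "(C ** B ** D) $ k $ l = 0"
        using nz \<open>k \<noteq> l\<close> B[of k l] B[of k i] B[of i l] unfolding C_def D_def
        by cases (simp_all add: col_shear_mult row_shear_mult)
    qed
    then show ?thesis by (simp add: rm C_def D_def)
  qed
  \<comment> \<open>If the diagonal entry vanishes, a nonzero entry in column \<open>i\<close> or
    row \<open>i\<close> is brought to the diagonal by adding row \<open>k\<close> to row
    \<open>i\<close> or column \<open>k\<close> to column \<open>i\<close>; both operations are
    shears. If there is no such entry, index \<open>i\<close> is already cleared.\<close>
  consider "A $ i $ i \<noteq> 0" | k where "A $ i $ i = 0" "k \<noteq> i" "A $ k $ i \<noteq> 0"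
    | k where "A $ i $ i = 0" "k \<noteq> i" "A $ i $ k \<noteq> 0"
    | "A $ i $ i = 0" "\<forall>k. k \<noteq> i \<longrightarrow> A $ k $ i = 0 \<and> A $ i $ k = 0" by blast
  then show ?case
  proof cases
    case 1
    then show ?thesis using pivot[OF Suc.prems] by blast
  next
    case (2 k)
    have kS: "k \<in> S" using Suc.prems[of k i] 2 by blast
    have sh: "(row_shear i (\<lambda>m. if m = k then 1 else 0) ** A) $ p $ l = A $ p $ l + (if p = i then A $ k $ l else 0)" for p l
      unfolding mult_row_shear using 2(2) by (simp add: if_distrib[of "\<lambda>x. x * _"] cong: if_cong)
    have "r (row_shear i (\<lambda>m. if m = k then 1 else 0) ** A) = q (row_shear i (\<lambda>m. if m = k then 1 else 0) ** A)"
    proof (rule pivot)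
      fix p l assume pl: "p \<noteq> l" "p \<notin> S \<or> l \<notin> S"
      have "p = i \<Longrightarrow> A $ k $ l = 0" using Suc.prems[of k l] pl i kS by blast
      then show "(row_shear i (\<lambda>m. if m = k then 1 else 0) ** A) $ p $ l = 0" using Suc.prems[OF pl] by (simp add: sh)
    qed (use 2 in \<open>simp add: sh\<close>)
    then show ?thesis by (simp add: rm)
  next
    case (3 k)
    have kS: "k \<in> S" using Suc.prems[of i k] 3 by blast
    have sh: "(A ** col_shear i (\<lambda>m. if m = k then 1 else 0)) $ p $ l = A $ p $ l + (if l = i then A $ p $ k else 0)" for p l
      unfolding mult_col_shear using 3(2) by (simp add: if_distrib[of "\<lambda>x. _ * x"] cong: if_cong)
    have "r (A ** col_shear i (\<lambda>m. if m = k then 1 else 0)) = q (A ** col_shear i (\<lambda>m. if m = k then 1 else 0))"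
    proof (rule pivot)
      fix p l assume pl: "p \<noteq> l" "p \<notin> S \<or> l \<notin> S"
      have "l = i \<Longrightarrow> A $ p $ k = 0" using Suc.prems[of p k] pl i kS by blast
      then show "(A ** col_shear i (\<lambda>m. if m = k then 1 else 0)) $ p $ l = 0" using Suc.prems[OF pl] by (simp add: sh)
    qed (use 3 in \<open>simp add: sh\<close>)
    then show ?thesis by (simp add: rm)
  next
    case 4
    show ?thesis by (rule IH) (use Suc.prems 4 in \<open>auto\<close>)
  qed
qed

lemma det_diag_mat: "det (diag_mat d) = (\<Prod>k\<in>UNIV. d k)"
  unfolding diag_mat_def by (subst det_diagonal) auto

lemma multiplicative_modulus_det: "multiplicative_modulus (\<lambda>A :: complex^'n^'n. (cmod (det A))\<^sup>2)"
  by unfold_locales (simp_all add: det_mul norm_mult power_mult_distrib det_diag_mat norm_power power_mult[symmetric] mult.commute)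

theorem multiplicative_modulus_unique:
  "multiplicative_modulus r \<Longrightarrow> r A = (cmod (det A))\<^sup>2"
  using multiplicative_modulus_unique_aux[OF _ multiplicative_modulus_det, of r UNIV A] by simp

section \<open>Real coordinates and the underlying real matrix\<close>

text \<open>The index type \<open>'n bit0\<close> has twice as many elements as \<open>'n\<close> and is well-ordered, as
  required by the change of variables theorem.\<close>
definition cart_basis :: "'n bit0 \<Rightarrow> complex^('n::finite)" where
  "cart_basis = (SOME \<beta>. bij_betw \<beta> UNIV Basis)"

lemma bij_cart_basis: "bij_betw (cart_basis :: 'n bit0 \<Rightarrow> complex^('n::finite)) UNIV Basis"
proof -
  have "card (UNIV :: 'n bit0 set) = card (Basis :: (complex^'n) set)" by simp
  then have "\<exists>\<beta>. bij_betw \<beta> (UNIV :: 'n bit0 set) (Basis :: (complex^'n) set)"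
    by (intro finite_same_card_bij) auto
  then show ?thesis unfolding cart_basis_def by (rule someI_ex)
qed

definition cart :: "complex^'n \<Rightarrow> real^('n::finite bit0)" where
  "cart x = (\<chi> k. x \<bullet> cart_basis k)"

definition uncart :: "real^('n::finite bit0) \<Rightarrow> complex^'n" where
  "uncart y = (\<Sum>k\<in>UNIV. y $ k *\<^sub>R cart_basis k)"

lemma cart_basis_in: "cart_basis k \<in> Basis"
  using bij_cart_basis by (auto simp: bij_betw_def)

lemma cart_basis_inner: "cart_basis k \<bullet> cart_basis l = (if k = l then 1 else 0)"
  using bij_cart_basis by (auto simp: bij_betw_def inj_def inner_Basis[OF cart_basis_in cart_basis_in])

lemma cart_uncart [simp]: "cart (uncart y) = y"
  by (simp add: vec_eq_iff cart_def uncart_def inner_sum_left cart_basis_inner if_distrib[of "\<lambda>x. _ * x"] cong: if_cong)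

lemma uncart_cart [simp]: "uncart (cart x) = x"
proof -
  have "uncart (cart x) = (\<Sum>k\<in>UNIV. (x \<bullet> cart_basis k) *\<^sub>R cart_basis k)" by (simp add: uncart_def cart_def)
  also have "\<dots> = (\<Sum>b\<in>Basis. (x \<bullet> b) *\<^sub>R b)" by (rule sum.reindex_bij_betw[OF bij_cart_basis])
  finally show ?thesis by (simp add: euclidean_representation)
qed

lemma linear_cart: "linear cart"
  by (rule linearI) (simp_all add: cart_def vec_eq_iff inner_add_left)

lemma linear_uncart: "linear uncart"
  by (rule linearI) (simp_all add: uncart_def scaleR_add_left sum.distrib scaleR_sum_right)

lemma norm_cart: "norm (cart x) = norm x"
proof -
  have "(norm (cart x))\<^sup>2 = (\<Sum>k\<in>UNIV. (cart x $ k)\<^sup>2)"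
    unfolding power2_norm_eq_inner inner_vec_def by (simp add: power2_eq_square)
  also have "\<dots> = (\<Sum>k\<in>UNIV. (x \<bullet> cart_basis k)\<^sup>2)" by (simp add: cart_def)
  also have "\<dots> = (\<Sum>b\<in>Basis. (x \<bullet> b)\<^sup>2)" by (rule sum.reindex_bij_betw[OF bij_cart_basis])
  also have "\<dots> = (norm x)\<^sup>2" unfolding power2_norm_eq_inner by (subst euclidean_inner) (simp add: power2_eq_square)
  finally show ?thesis by simp
qed

lemma cart_image: "cart ` C = uncart -` C"
  by (auto intro: rev_image_eqI)

lemma norm_uncart: "norm (uncart y) = norm y"
  using norm_cart[of "uncart y"] by simp

lemma cart_continuous: "continuous_on S cart" "continuous_on S' uncart"
  using linear_cart linear_uncart by (auto intro: linear_continuous_on simp: linear_conv_bounded_linear)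

lemma cart_measurable [measurable]: "cart \<in> borel_measurable borel" "uncart \<in> borel_measurable borel"
  using cart_continuous by (auto intro: borel_measurable_continuous_onI)

text \<open>In these coordinates \<open>cart\<close> merely renumbers the real basis, so boxes
  correspond to boxes with the same side lengths, and boxes determine Lebesgue measure.\<close>

lemma distr_lborel_cart: "distr lborel borel (cart :: complex^'n \<Rightarrow> _) = lborel"
proof (rule lborel_eqI[symmetric])
  fix l u :: "real^('n bit0)" assume le: "\<And>b. b \<in> Basis \<Longrightarrow> l \<bullet> b \<le> u \<bullet> b"
  have lu: "l $ k \<le> u $ k" for k using le[of "axis k 1"] by (auto simp: inner_axis Basis_vec_def)
  have unc: "uncart y \<bullet> cart_basis k = y $ k" for y :: "real^('n bit0)" and k
    using arg_cong[OF cart_uncart[of y], of "\<lambda>v. v $ k"] by (simp add: cart_def)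
  have all: "(\<forall>b\<in>Basis. P b) \<longleftrightarrow> (\<forall>k. P (cart_basis k))" for P :: "complex^'n \<Rightarrow> bool"
    unfolding bij_betw_imp_surj_on[OF bij_cart_basis, symmetric] by simp
  have "cart -` box l u = (box (uncart l) (uncart u) :: (complex^'n) set)"
  proof -
    have "x \<in> box (uncart l) (uncart u) \<longleftrightarrow> (\<forall>k. l $ k < x \<bullet> cart_basis k \<and> x \<bullet> cart_basis k < u $ k)" for x :: "complex^'n"
      unfolding box_def mem_Collect_eq all unc ..
    moreover have "cart x \<in> box l u \<longleftrightarrow> (\<forall>k. l $ k < x \<bullet> cart_basis k \<and> x \<bullet> cart_basis k < u $ k)" for x :: "complex^'n"
      unfolding mem_box_cart by (simp add: cart_def)
    ultimately show ?thesis by (simp add: set_eq_iff)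
  qed
  then have "emeasure (distr lborel borel (cart :: complex^'n \<Rightarrow> _)) (box l u) = emeasure lborel (box (uncart l) (uncart u) :: (complex^'n) set)"
    by (subst emeasure_distr) simp_all
  also have "\<dots> = (\<Prod>b\<in>Basis. (uncart u - uncart l) \<bullet> b)"
  proof (rule emeasure_lborel_box)
    have "\<forall>b\<in>Basis. uncart l \<bullet> b \<le> uncart u \<bullet> (b :: complex^'n)" unfolding all unc using lu by simp
    then show "uncart l \<bullet> b \<le> uncart u \<bullet> b" if "b \<in> Basis" for b :: "complex^'n" using that by blast
  qed
  also have "(\<Prod>b\<in>Basis. (uncart u - uncart l) \<bullet> b) = (\<Prod>k\<in>UNIV. (uncart u - uncart l) \<bullet> cart_basis k)"
    by (rule prod.reindex_bij_betw[OF bij_cart_basis, symmetric])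
  also have "\<dots> = (\<Prod>k\<in>UNIV. (u - l) \<bullet> axis k 1)" by (simp add: inner_diff_left unc inner_axis)
  also have "\<dots> = (\<Prod>b\<in>Basis. (u - l) \<bullet> b)"
  proof (rule prod.reindex_bij_betw)
    show "bij_betw (\<lambda>k. axis k 1) UNIV (Basis :: (real^('n bit0)) set)"
      by (auto simp: bij_betw_def inj_def axis_eq_axis Basis_vec_def)
  qed
  finally show "emeasure (distr lborel borel (cart :: complex^'n \<Rightarrow> _)) (box l u) = (\<Prod>b\<in>Basis. (u - l) \<bullet> b)" .
qed simp

definition real_matrix :: "complex^'n^'n \<Rightarrow> real^('n::finite bit0)^('n bit0)" where
  "real_matrix A = matrix (cart \<circ> (\<lambda>x. A *v x) \<circ> uncart)"

lemma linear_complex_matrix: "linear (\<lambda>x :: complex^'n. (A :: complex^'n^'m) *v x)"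
  by (rule linearI) (simp_all add: matrix_vector_right_distrib vec_scaleR matrix_vector_mult_scale)

lemma linear_cart_conj: "linear (cart \<circ> (\<lambda>x. A *v x) \<circ> uncart)"
  by (intro linear_compose linear_cart linear_uncart linear_complex_matrix)

lemma cart_diag_mat: "(\<lambda>x. diag_mat (\<lambda>_. a) *v x) = (\<lambda>x. a *s x)"
  by (auto simp: diag_mat_def matrix_vector_mult_def vec_eq_iff if_distrib[of "\<lambda>x. x * _"] fun_eq_iff cong: if_cong)

text \<open>Multiplication by \<open>a\<close> is a rotation by the phase \<open>u\<close>, which is
  a real orthogonal map, followed by dilation with \<open>cmod a\<close> in twice as many real
  dimensions as there are complex ones. For \<open>a = 0\<close> the phase is set to 1.\<close>

lemma abs_det_real_matrix_scalar:
  "\<bar>det (real_matrix (diag_mat (\<lambda>_. a) :: complex^'n^'n))\<bar> = cmod a ^ (2 * CARD('n::finite))"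
proof -
  define u where "u = (if a = 0 then 1 else a / complex_of_real (cmod a))"
  have u: "cmod u = 1" "a = complex_of_real (cmod a) * u" by (auto simp: u_def norm_divide)
  define g :: "real^('n bit0) \<Rightarrow> real^('n bit0)" where "g = cart \<circ> (\<lambda>x. diag_mat (\<lambda>_. u) *v x) \<circ> uncart"
  have lg: "linear g" unfolding g_def by (rule linear_cart_conj)
  have "norm (g y) = norm y" for y by (simp add: g_def cart_diag_mat norm_cart norm_vec_scale u norm_uncart)
  then have "orthogonal_transformation g" using lg by (simp add: orthogonal_transformation)
  then have dg: "\<bar>det (matrix g)\<bar> = 1" using det_orthogonal_matrix[of "matrix g"] orthogonal_transformation_matrix[of g] by auto
  have "cart \<circ> (\<lambda>x. diag_mat (\<lambda>_. a) *v x) \<circ> uncart = ((*\<^sub>R) (cmod a)) \<circ> g"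
  proof
    fix y :: "real^('n bit0)"
    have "a *s uncart y = cmod a *\<^sub>R (u *s uncart y)"
      unfolding vec_scaleR vector_smult_assoc using u(2) by simp
    then show "(cart \<circ> (\<lambda>x. diag_mat (\<lambda>_. a) *v x) \<circ> uncart) y = (((*\<^sub>R) (cmod a)) \<circ> g) y"
      using linear_scale[OF linear_cart, of "cmod a" "u *s uncart y"] by (simp add: g_def cart_diag_mat)
  qed
  then have "real_matrix (diag_mat (\<lambda>_. a)) = matrix ((*\<^sub>R) (cmod a)) ** matrix g"
    unfolding real_matrix_def using matrix_compose[OF lg, of "(*\<^sub>R) (cmod a)"] linear_scaleR by simp
  then show ?thesis using dg by (simp add: det_mul abs_mult)
qed

theorem abs_det_real_matrix: "\<bar>det (real_matrix A)\<bar> = (cmod (det A))\<^sup>2"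
proof (rule multiplicative_modulus_unique, unfold_locales)
  fix A B :: "complex^'n^'n"
  have "cart \<circ> (\<lambda>x. (A ** B) *v x) \<circ> uncart = (cart \<circ> (\<lambda>x. A *v x) \<circ> uncart) \<circ> (cart \<circ> (\<lambda>x. B *v x) \<circ> uncart)"
    by (simp add: fun_eq_iff matrix_vector_mul_assoc)
  then have "real_matrix (A ** B) = real_matrix A ** real_matrix B"
    unfolding real_matrix_def by (simp add: matrix_compose[OF linear_cart_conj linear_cart_conj])
  then show "\<bar>det (real_matrix (A ** B))\<bar> = \<bar>det (real_matrix A)\<bar> * \<bar>det (real_matrix B)\<bar>"
    by (simp add: det_mul abs_mult)
qed (simp_all add: abs_det_real_matrix_scalar)

section \<open>Change of variables\<close>

text \<open>The real change of variables theorem, conjugated by \<open>cart\<close>. Boundedness of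
  the image makes its measure finite, as that theorem works with real-valued integrals;
  measurability of the Jacobian on \<open>B\<close> is what carries the integral back through
  \<open>uncart\<close>.\<close>

lemma emeasure_holo_image:
  fixes \<phi> :: "complex^'n \<Rightarrow> complex^'n"
  assumes \<phi>: "holo_map \<phi> U" and inj: "inj_on \<phi> U" and B: "B \<in> sets borel" "B \<subseteq> U"
    and im: "\<phi> ` B \<in> sets borel" "bounded (\<phi> ` B)"
    and J: "(\<lambda>z. (cmod (det (jacobian \<phi> z)))\<^sup>2 * indicator B z) \<in> borel_measurable borel"
  shows "emeasure lborel (\<phi> ` B) = (\<integral>\<^sup>+z. ennreal ((cmod (det (jacobian \<phi> z)))\<^sup>2) * indicator B z \<partial>lborel)"
proof -
  define g where "g = cart \<circ> \<phi> \<circ> uncart"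
  define S where "S = cart ` B"
  have S_eq: "S = uncart -` B" unfolding S_def by (rule cart_image)
  have Sb: "S \<in> sets borel" unfolding S_eq using measurable_sets[OF cart_measurable(2) B(1)] by simp
  have gS: "g ` S = cart ` \<phi> ` B" by (auto simp: g_def S_def image_image)
  have gS_eq: "g ` S = uncart -` (\<phi> ` B)" unfolding gS by (rule cart_image)
  have gSb: "g ` S \<in> sets borel" unfolding gS_eq using measurable_sets[OF cart_measurable(2) im(1)] by simp
  have bl: "bounded_linear (cart :: complex^'n \<Rightarrow> _)" "bounded_linear (uncart :: _ \<Rightarrow> complex^'n)"
    using linear_cart linear_uncart linear_conv_bounded_linear by blast+
  have "bounded (g ` S)" unfolding gS by (rule bounded_linear_image[OF im(2) bl(1)])
  then have gSm: "g ` S \<in> lmeasurable" using gSb by (intro bounded_set_imp_lmeasurable) auto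
  define g' where "g' x = cart \<circ> (\<lambda>h. jacobian \<phi> (uncart x) *v h) \<circ> uncart" for x
  have der: "(g has_derivative g' x) (at x within S)" if x: "x \<in> S" for x
  proof -
    have "uncart x \<in> U" using x B by (auto simp: S_eq)
    note d = has_derivative_jacobian[OF \<phi> this]
    have d1: "(uncart has_derivative uncart) (at x)" by (rule bounded_linear_imp_has_derivative[OF bl(2)])
    have d2: "(cart has_derivative cart) (at (\<phi> (uncart x)))" by (rule bounded_linear_imp_has_derivative[OF bl(1)])
    from has_derivative_compose[OF has_derivative_compose[OF d1 d] d2]
    show ?thesis unfolding g_def g'_def o_def by (rule has_derivative_at_withinI)
  qed
  have injg: "inj_on g S"
    using inj B(2) by (auto simp: inj_on_def g_def S_def) (metis subsetD uncart_cart)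
  have det: "\<bar>det (matrix (g' x))\<bar> = (cmod (det (jacobian \<phi> (uncart x))))\<^sup>2" for x
    unfolding g'_def using abs_det_real_matrix[of "jacobian \<phi> (uncart x)"] by (simp add: real_matrix_def)
  have "((\<lambda>x. \<bar>det (matrix (g' x))\<bar>) has_integral measure lebesgue (g ` S)) S"
    using has_measure_differentiable_image[OF _ der injg, of "measure lebesgue (g ` S)"] Sb gSm by auto
  from nn_integral_has_integral_lebesgue'[OF _ this]
  have "(\<integral>\<^sup>+x. ennreal ((cmod (det (jacobian \<phi> (uncart x))))\<^sup>2) * indicator S x \<partial>lborel) = ennreal (measure lebesgue (g ` S))"
    unfolding det by simp
  also have "\<dots> = emeasure lebesgue (g ` S)" using gSm by (simp add: emeasure_eq_measure2 fmeasurableD)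
  also have "\<dots> = emeasure lborel (g ` S)" using gSb by simp
  also have "\<dots> = emeasure lborel (\<phi> ` B)"
  proof -
    have "emeasure lborel (g ` S) = emeasure (distr lborel borel (cart :: complex^'n \<Rightarrow> _)) (g ` S)"
      unfolding distr_lborel_cart ..
    also have "\<dots> = emeasure lborel (cart -` g ` S :: (complex^'n) set)" using gSb by (simp add: emeasure_distr)
    also have "cart -` g ` S = \<phi> ` B" unfolding gS_eq by auto
    finally show ?thesis .
  qed
  finally have 1: "emeasure lborel (\<phi> ` B) = (\<integral>\<^sup>+x. ennreal ((cmod (det (jacobian \<phi> (uncart x))))\<^sup>2) * indicator S x \<partial>lborel)" by simp
  define G where "G z = ennreal ((cmod (det (jacobian \<phi> z)))\<^sup>2 * indicator B z)" for z
  have G [measurable]: "G \<in> borel_measurable borel" unfolding G_def using J by measurable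
  have "(\<integral>\<^sup>+x. ennreal ((cmod (det (jacobian \<phi> (uncart x))))\<^sup>2) * indicator S x \<partial>lborel) = (\<integral>\<^sup>+x. G (uncart x) \<partial>lborel)"
    by (intro nn_integral_cong) (simp add: G_def S_eq indicator_def)
  also have "\<dots> = (\<integral>\<^sup>+x. G (uncart x) \<partial>(distr lborel borel cart))" unfolding distr_lborel_cart ..
  also have "\<dots> = (\<integral>\<^sup>+z. G z \<partial>lborel)" by (subst nn_integral_distr) simp_all
  also have "\<dots> = (\<integral>\<^sup>+z. ennreal ((cmod (det (jacobian \<phi> z)))\<^sup>2) * indicator B z \<partial>lborel)"
    by (intro nn_integral_cong) (simp add: G_def indicator_def)
  finally show ?thesis using 1 by simp
qed

section \<open>Point evaluations on Bergman spaces\<close>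

lemma jacobian_affine:
  "jacobian (\<lambda>h. z + u *s h) x = diag_mat (\<lambda>_. u)"
  and holo_map_affine: "holo_map (\<lambda>h :: complex^'n. z + u *s h) U"
proof -
  show hol: "holo_map (\<lambda>h :: complex^'n. z + u *s h) U" for U
    unfolding holo_map_def by (auto intro!: holo_fun_add holo_fun_mult holo_fun_const holo_fun_coord)
  have "linear (\<lambda>h :: complex^'n. u *s h)"
    by (rule linearI) (simp_all add: vector_add_ldistrib vec_scaleR vector_smult_assoc mult.commute)
  then have "bounded_linear (\<lambda>h :: complex^'n. u *s h)" by (simp add: linear_conv_bounded_linear)
  then have "((\<lambda>h :: complex^'n. z + u *s h) has_derivative (\<lambda>h. diag_mat (\<lambda>_. u) *v h)) (at x)"
    unfolding cart_diag_mat
    using has_derivative_add[OF has_derivative_const bounded_linear_imp_has_derivative] by simp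
  then show "jacobian (\<lambda>h. z + u *s h) x = diag_mat (\<lambda>_. u)"
    by (rule jacobian_unique[OF hol[of UNIV] UNIV_I])
qed

lemma distr_lborel_unimodular:
  fixes z :: "complex^'n"
  assumes u: "cmod u = 1"
  shows "distr lborel borel (\<lambda>h. z + u *s h) = lborel"
proof (rule lborel_eqI[symmetric])
  fix l r :: "complex^'n" assume le: "\<And>b. b \<in> Basis \<Longrightarrow> l \<bullet> b \<le> r \<bullet> b"
  \<comment> \<open>The inverse of the map: the preimage of a box is its image under this \<phi>, to
    which the change of variables applies.\<close>
  define \<phi> where "\<phi> x = (- (cnj u *s z)) + cnj u *s x" for x
  have cu: "cnj u * u = 1" "u * cnj u = 1" using u complex_norm_square[of u] by (auto simp: mult.commute)
  have cont: "continuous_on S (\<lambda>h :: complex^'n. z + v *s h)" for S z v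
    by (rule holo_map_continuous_on[OF holo_map_affine])
  then have meas: "(\<lambda>h. z + u *s h) \<in> borel_measurable borel" by (rule borel_measurable_continuous_onI)
  have inv: "z + u *s \<phi> x = x" "\<phi> (z + u *s x) = x" for x
    by (simp_all add: \<phi>_def vec_eq_iff algebra_simps cu flip: mult.assoc)
  have vim: "(\<lambda>h. z + u *s h) -` box l r = \<phi> ` box l r"
    using inv by (auto intro: rev_image_eqI)
  have sm: "(\<lambda>h. z + u *s h) -` box l r \<in> sets borel" using measurable_sets[OF meas, of "box l r"] by simp
  have "emeasure lborel (\<phi> ` box l r)
      = (\<integral>\<^sup>+x. ennreal ((cmod (det (jacobian \<phi> x)))\<^sup>2) * indicator (box l r) x \<partial>lborel)"
  proof (rule emeasure_holo_image[of _ UNIV])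
    show "holo_map \<phi> UNIV" unfolding \<phi>_def by (rule holo_map_affine)
    show "inj_on \<phi> UNIV" by (rule inj_on_inverseI[of _ "\<lambda>h. z + u *s h"]) (rule inv)
    show "\<phi> ` box l r \<in> sets borel" using sm vim by simp
    have "bounded (\<phi> ` cbox l r)"
      unfolding \<phi>_def by (intro compact_imp_bounded compact_continuous_image cont compact_cbox)
    then show "bounded (\<phi> ` box l r)" by (rule bounded_subset) (use box_subset_cbox in blast)
    show "(\<lambda>x. (cmod (det (jacobian \<phi> x)))\<^sup>2 * indicator (box l r) x) \<in> borel_measurable borel"
      unfolding \<phi>_def jacobian_affine by measurable
  qed auto
  also have "\<dots> = (\<integral>\<^sup>+x. indicator (box l r) x \<partial>lborel)"
    unfolding \<phi>_def jacobian_affine det_diag_mat using u by (simp add: norm_power)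
  also have "\<dots> = emeasure lborel (box l r)" by simp
  finally show "emeasure (distr lborel borel (\<lambda>h. z + u *s h)) (box l r) = (\<Prod>b\<in>Basis. (r - l) \<bullet> b)"
    using le meas vim by (simp add: emeasure_distr emeasure_lborel_box)
qed simp

lemma bounded_bilinear_vec_scale: "bounded_bilinear (\<lambda>c (x :: complex^'n). c *s x)"
  by (rule bounded_bilinear.intro) (auto simp: vec_eq_iff algebra_simps norm_vec_scale intro!: exI[of _ 1])

text \<open>Cauchy's formula at the centre of the unit disc; parametrized by the exponential, the
  form du/u becomes 2 pi i dt. The interval of length one needs no normalizing factor.\<close>

lemma circle_mean:
  assumes g: "g holomorphic_on cball 0 1"
  shows "((\<lambda>t. g (exp (2 * of_real pi * \<i> * of_real t))) has_integral g 0) {0..1}"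
proof -
  define K :: complex where "K = 2 * of_real pi * \<i>"
  have K: "K \<noteq> 0" by (simp add: K_def)
  have "((\<lambda>u. g u / (u - 0)) has_contour_integral (2 * of_real pi * \<i> * g 0)) (circlepath 0 1)"
    by (rule Cauchy_integral_circlepath)
      (use g holomorphic_on_subset[OF g ball_subset_cball] in \<open>auto intro: holomorphic_on_imp_continuous_on\<close>)
  then have "((\<lambda>t. K * g (exp (2 * of_real pi * \<i> * of_real t))) has_integral K * g 0) {0..1}"
    unfolding has_contour_integral_def K_def
  proof (rule has_integral_eq[rotated])
    fix t :: real assume "t \<in> {0..1}"
    then show "g (circlepath 0 1 t) / (circlepath 0 1 t - 0) * vector_derivative (circlepath 0 1) (at t within {0..1})
        = (2 * of_real pi * \<i>) * g (exp (2 * of_real pi * \<i> * of_real t))"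
      by (simp add: vector_derivative_circlepath01) (simp add: circlepath)
  qed
  from has_integral_mult_right[OF this, of "inverse K"]
  show ?thesis using K by (simp flip: mult.assoc)
qed

text \<open>For every \<open>h\<close> in the ball the mean value property holds for the square of
  \<open>f\<close> along the circle of radius one in the line through \<open>z\<close> and
  \<open>z + h\<close>; squaring keeps holomorphy and makes the modulus equal to the integrand.
  Integrating over \<open>h\<close> and exchanging the integrals, each rotation contributes the same
  integral over the ball about \<open>z\<close>, because rotations preserve Lebesgue
  measure.\<close>

lemma sub_mean_value:
  fixes f :: "complex^'n \<Rightarrow> complex"
  assumes f: "holo_fun f U" and r: "r > 0" and sub: "cball z r \<subseteq> U"
  shows "ennreal ((cmod (f z))\<^sup>2) * emeasure lborel (ball (0 :: complex^'n) r)
     \<le> (\<integral>\<^sup>+x. ennreal ((cmod (f x))\<^sup>2) * indicator (ball z r) x \<partial>lborel)"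
proof -
  define F where "F x = ennreal ((cmod (f x))\<^sup>2 * indicator (ball z r) x)" for x
  have "continuous_on (ball z r) (\<lambda>x. (cmod (f x))\<^sup>2)"
    by (intro continuous_intros continuous_on_subset[OF holo_fun_continuous_on[OF f]] order_trans[OF ball_subset_cball sub])
  then have "(\<lambda>x. indicator (ball z r) x *\<^sub>R (cmod (f x))\<^sup>2) \<in> borel_measurable borel"
    by (intro borel_measurable_continuous_on_indicator) auto
  then have F [measurable]: "F \<in> borel_measurable borel" unfolding F_def by (simp add: mult.commute)
  define e where "e t = exp (2 * of_real pi * \<i> * of_real t)" for t :: real
  have e1: "cmod (e t) = 1" for t by (simp add: e_def)
  have conte: "continuous_on UNIV e" unfolding e_def by (intro continuous_intros)
  have cont: "continuous_on UNIV (\<lambda>(t, h :: complex^'n). z + e t *s h)"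
    unfolding case_prod_unfold
    by (intro continuous_on_add continuous_on_const bounded_bilinear.continuous_on[OF bounded_bilinear_vec_scale]
        continuous_on_compose2[OF conte] continuous_on_fst continuous_on_snd continuous_on_id) auto
  have meas: "(\<lambda>(t, h). z + e t *s h) \<in> borel_measurable (borel \<Otimes>\<^sub>M borel)"
    using borel_measurable_continuous_onI[OF cont] by (simp add: borel_prod)
  have *: "(\<lambda>(t, h). F (z + e t *s h) * indicator {0..1} t) \<in> borel_measurable (lborel \<Otimes>\<^sub>M lborel)"
  proof -
    have "(\<lambda>p. F ((\<lambda>(t, h). z + e t *s h) p) * indicator {0..1} (fst p)) \<in> borel_measurable (borel \<Otimes>\<^sub>M borel)"
      by (intro borel_measurable_times_ennreal measurable_compose[OF meas F] measurable_compose[OF measurable_fst]) simp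
    then show ?thesis by (simp add: case_prod_unfold cong: measurable_cong_sets)
  qed
  have inner: "ennreal ((cmod (f z))\<^sup>2) * indicator (ball 0 r) h \<le> (\<integral>\<^sup>+t. F (z + e t *s h) * indicator {0..1} t \<partial>lborel)" for h
  proof (cases "h \<in> ball 0 r")
    case True
    define g where "g \<zeta> = (f (z + \<zeta> *s h))\<^sup>2" for \<zeta>
    have in_ball: "z + \<zeta> *s h \<in> ball z r" if "cmod \<zeta> \<le> 1" for \<zeta>
    proof -
      have "cmod \<zeta> * norm h \<le> 1 * norm h" using that by (intro mult_right_mono) auto
      then show ?thesis using True by (simp add: dist_norm norm_vec_scale)
    qed
    have hol: "g holomorphic_on cball 0 1"
      unfolding g_def by (intro holomorphic_intros line_holomorphic[OF f])
        (use in_ball sub ball_subset_cball in fastforce)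
    note m = circle_mean[OF hol, folded e_def]
    have e_in: "e t \<in> cball 0 1" for t by (simp add: e1)
    have cont: "continuous_on {0..1} (\<lambda>t. cmod (g (e t)))"
      by (intro continuous_on_norm continuous_on_compose2[OF holomorphic_on_imp_continuous_on[OF hol] continuous_on_subset[OF conte]])
        (use e_in in auto)
    then have int: "(\<lambda>t. cmod (g (e t))) integrable_on {0..1}" by (rule integrable_continuous_real)
    have "cmod (g 0) \<le> integral {0..1} (\<lambda>t. cmod (g (e t)))"
      using integral_norm_bound_integral[OF has_integral_integrable[OF m] int] integral_unique[OF m] by simp
    then have "ennreal (cmod (g 0)) \<le> ennreal (integral {0..1} (\<lambda>t. cmod (g (e t))))" by (rule ennreal_leI)
    also have "\<dots> = (\<integral>\<^sup>+t. ennreal (cmod (g (e t))) * indicator {0..1} t \<partial>lborel)"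
      by (rule nn_integral_has_integral_lebesgue'[symmetric]) (use int in \<open>auto intro: integrable_integral\<close>)
    also have "\<dots> = (\<integral>\<^sup>+t. F (z + e t *s h) * indicator {0..1} t \<partial>lborel)"
      using in_ball e1 by (intro nn_integral_cong) (simp add: F_def g_def norm_power)
    finally show ?thesis using True by (simp add: g_def norm_power)
  qed simp
  have "ennreal ((cmod (f z))\<^sup>2) * emeasure lborel (ball (0 :: complex^'n) r)
      = (\<integral>\<^sup>+h. ennreal ((cmod (f z))\<^sup>2) * indicator (ball (0 :: complex^'n) r) h \<partial>lborel)"
    by (subst nn_integral_cmult_indicator) simp_all
  also have "\<dots> \<le> (\<integral>\<^sup>+h. (\<integral>\<^sup>+t. F (z + e t *s h) * indicator {0..1} t \<partial>lborel) \<partial>lborel)"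
    by (intro nn_integral_mono inner)
  also have "\<dots> = (\<integral>\<^sup>+t. (\<integral>\<^sup>+h. F (z + e t *s h) * indicator {0..1} t \<partial>lborel) \<partial>lborel)"
    by (rule lborel_pair.Fubini'[OF *])
  also have "\<dots> = (\<integral>\<^sup>+t. (\<integral>\<^sup>+x. F x \<partial>lborel) * indicator {0..1::real} t \<partial>lborel)"
  proof (intro nn_integral_cong)
    fix t :: real
    have mt: "(\<lambda>h. z + e t *s h) \<in> lborel \<rightarrow>\<^sub>M borel"
      using borel_measurable_continuous_onI[OF holo_map_continuous_on[OF holo_map_affine]] by simp
    have "(\<integral>\<^sup>+h. F (z + e t *s h) * indicator {0..1} t \<partial>lborel) = (\<integral>\<^sup>+h. F (z + e t *s h) \<partial>lborel) * indicator {0..1} t"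
      by (intro nn_integral_multc measurable_compose[OF mt F])
    also have "(\<integral>\<^sup>+h. F (z + e t *s h) \<partial>lborel) = (\<integral>\<^sup>+x. F x \<partial>distr lborel borel (\<lambda>h. z + e t *s h))"
      by (rule nn_integral_distr[OF mt, symmetric]) simp
    finally show "(\<integral>\<^sup>+h. F (z + e t *s h) * indicator {0..1} t \<partial>lborel) = (\<integral>\<^sup>+x. F x \<partial>lborel) * indicator {0..1} t"
      by (simp add: distr_lborel_unimodular[OF e1])
  qed
  also have "\<dots> = (\<integral>\<^sup>+x. F x \<partial>lborel)" by (subst nn_integral_cmult) simp_all
  also have "\<dots> = (\<integral>\<^sup>+x. ennreal ((cmod (f x))\<^sup>2) * indicator (ball z r) x \<partial>lborel)"
    by (intro nn_integral_cong) (simp add: F_def indicator_def)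
  finally show ?thesis .
qed

text \<open>Covers the normalized Lebesgue measure, on which the kernel lives, and the weighted
  measure \<mu>, on which the operators act. Continuity and positivity make the weight bounded below
  on compact balls, and finiteness puts the bounded functions into the space.\<close>

locale weighted_domain =
  fixes \<Omega> :: "(complex^'n) set" and \<mu> :: "(complex^'n) measure" and w :: "complex^'n \<Rightarrow> real"
  assumes open_\<Omega>: "open \<Omega>" and w_cont: "continuous_on \<Omega> w" and w_pos: "z \<in> \<Omega> \<Longrightarrow> w z > 0"
    and \<mu>_eq: "\<mu> = density (restrict_space lborel \<Omega>) (\<lambda>z. ennreal (w z))"
    and \<mu>_finite: "emeasure \<mu> \<Omega> < \<infinity>"
begin

abbreviation A2 where "A2 \<equiv> bergman_space \<Omega> \<mu>"

lemma space_\<mu>: "space \<mu> = \<Omega>"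
  by (simp add: \<mu>_eq space_restrict_space)

lemma sets_\<mu>: "sets \<mu> = sets (restrict_space borel \<Omega>)"
  by (simp add: \<mu>_eq sets_restrict_space)

lemma continuous_measurable: "continuous_on \<Omega> f \<Longrightarrow> f \<in> borel_measurable \<mu>"
  using borel_measurable_continuous_on_restrict[of \<Omega> f] measurable_cong_sets[OF sets_\<mu> refl] by blast

lemma holo_measurable: "holo_fun f \<Omega> \<Longrightarrow> f \<in> borel_measurable \<mu>"
  by (intro continuous_measurable holo_fun_continuous_on)

lemma A2_holo: "f \<in> A2 \<Longrightarrow> holo_fun f \<Omega>"
  and A2_integrable: "f \<in> A2 \<Longrightarrow> integrable \<mu> (\<lambda>z. (cmod (f z))\<^sup>2)"
  and A2_outside: "f \<in> A2 \<Longrightarrow> z \<notin> \<Omega> \<Longrightarrow> f z = 0"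
  by (simp_all add: bergman_space_def)

lemma A2_nn_integral: "f \<in> A2 \<Longrightarrow> (\<integral>\<^sup>+z. ennreal ((cmod (f z))\<^sup>2) \<partial>\<mu>) = ennreal ((l2_norm \<mu> f)\<^sup>2)"
  by (subst nn_integral_eq_integral) (auto simp: A2_integrable l2_norm_def)

lemma nn_integral_\<mu>:
  assumes f: "f \<in> borel_measurable \<mu>"
  shows "(\<integral>\<^sup>+z. f z \<partial>\<mu>) = (\<integral>\<^sup>+z. ennreal (w z) * f z * indicator \<Omega> z \<partial>lborel)"
proof -
  have wm: "(\<lambda>z. ennreal (w z)) \<in> borel_measurable (restrict_space lborel \<Omega>)"
    using continuous_measurable[OF w_cont] by (simp add: \<mu>_eq)
  have fm: "f \<in> borel_measurable (restrict_space lborel \<Omega>)" using f by (simp add: \<mu>_eq)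
  show ?thesis
    unfolding \<mu>_eq using nn_integral_density[OF wm fm] open_\<Omega> nn_integral_restrict_space[of \<Omega> lborel] by simp
qed

text \<open>On a small ball the weight is at least \<open>m\<close>, so the unweighted sub-mean
  value inequality costs only the factor 1/m. Uniformity of the constant in \<open>z\<close> is what
  turns convergence in norm into locally uniform convergence.\<close>

lemma point_estimate:
  assumes a: "a \<in> \<Omega>"
  shows "\<exists>r C. r > 0 \<and> cball a r \<subseteq> \<Omega> \<and> C > 0 \<and> (\<forall>f\<in>A2. \<forall>z\<in>cball a r. cmod (f z) \<le> C * l2_norm \<mu> f)"
proof -
  obtain R where R: "R > 0" "cball a R \<subseteq> \<Omega>" using open_\<Omega> a open_contains_cball by blast
  define r where "r = R / 2"
  have r: "r > 0" using R by (simp add: r_def)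
  have sub: "cball z r \<subseteq> cball a R" if z: "z \<in> cball a r" for z
  proof
    fix x assume "x \<in> cball z r"
    then show "x \<in> cball a R" using dist_triangle[of a x z] z by (simp add: r_def)
  qed
  have "continuous_on (cball a R) w" by (rule continuous_on_subset[OF w_cont R(2)])
  then obtain x0 where x0: "x0 \<in> cball a R" "\<And>x. x \<in> cball a R \<Longrightarrow> w x0 \<le> w x"
    using continuous_attains_inf[OF compact_cball, of a R w] R(1) by auto
  define m where "m = w x0"
  have m: "m > 0" using w_pos x0(1) R(2) by (auto simp: m_def)
  define V where "V = measure lborel (ball (0 :: complex^'n) r)"
  have V: "V > 0" unfolding V_def using content_ball_pos[OF r] by simp
  have eV: "emeasure lborel (ball (0 :: complex^'n) r) = ennreal V"
    unfolding V_def by (intro emeasure_eq_ennreal_measure) (use emeasure_bounded_finite[of "ball (0 :: complex^'n) r"] in auto)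
  have main: "cmod (f z) \<le> (1 / sqrt (m * V)) * l2_norm \<mu> f" if f: "f \<in> A2" and z: "z \<in> cball a r" for f z
  proof -
    have "ennreal m * (ennreal ((cmod (f z))\<^sup>2) * ennreal V)
        \<le> ennreal m * (\<integral>\<^sup>+x. ennreal ((cmod (f x))\<^sup>2) * indicator (ball z r) x \<partial>lborel)"
      using sub_mean_value[OF A2_holo[OF f] r order_trans[OF sub[OF z] R(2)]] eV by (intro mult_left_mono) auto
    also have "\<dots> = ennreal m * (\<integral>\<^sup>+x. ennreal ((cmod (f x))\<^sup>2 * indicator (ball z r) x) \<partial>lborel)"
      by (intro arg_cong[where f = "\<lambda>x. ennreal m * x"] nn_integral_cong) (simp add: indicator_def)
    also have "\<dots> = (\<integral>\<^sup>+x. ennreal m * ennreal ((cmod (f x))\<^sup>2 * indicator (ball z r) x) \<partial>lborel)"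
    proof (rule nn_integral_cmult[symmetric])
      have "continuous_on (ball z r) (\<lambda>x. (cmod (f x))\<^sup>2)"
        using order_trans[OF ball_subset_cball order_trans[OF sub[OF z] R(2)]]
        by (intro continuous_intros continuous_on_subset[OF holo_fun_continuous_on[OF A2_holo[OF f]]])
      then have "(\<lambda>x. indicator (ball z r) x *\<^sub>R (cmod (f x))\<^sup>2) \<in> borel_measurable borel"
        by (intro borel_measurable_continuous_on_indicator) auto
      then show "(\<lambda>x. ennreal ((cmod (f x))\<^sup>2 * indicator (ball z r) x)) \<in> borel_measurable lborel"
        by (simp add: mult.commute)
    qed
    also have "\<dots> \<le> (\<integral>\<^sup>+x. ennreal (w x) * ennreal ((cmod (f x))\<^sup>2) * indicator \<Omega> x \<partial>lborel)"
    proof (rule nn_integral_mono)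
      fix x
      show "ennreal m * ennreal ((cmod (f x))\<^sup>2 * indicator (ball z r) x) \<le> ennreal (w x) * ennreal ((cmod (f x))\<^sup>2) * indicator \<Omega> x"
      proof (cases "x \<in> ball z r")
        case True
        then have "x \<in> cball a R" using sub[OF z] ball_subset_cball by blast
        then have "x \<in> \<Omega>" "m \<le> w x" using R(2) x0(2) by (auto simp: m_def)
        then show ?thesis using True by (auto intro!: mult_right_mono ennreal_leI)
      qed simp
    qed
    also have "\<dots> = (\<integral>\<^sup>+z. ennreal ((cmod (f z))\<^sup>2) \<partial>\<mu>)"
      by (rule nn_integral_\<mu>[symmetric]) (use holo_measurable[OF A2_holo[OF f]] in measurable)
    also have "\<dots> = ennreal ((l2_norm \<mu> f)\<^sup>2)" by (rule A2_nn_integral[OF f])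
    finally have "m * ((cmod (f z))\<^sup>2 * V) \<le> (l2_norm \<mu> f)\<^sup>2"
      using m V by (simp add: ennreal_mult[symmetric])
    then have "(cmod (f z))\<^sup>2 \<le> (l2_norm \<mu> f)\<^sup>2 / (m * V)" using m V by (simp add: pos_le_divide_eq mult_ac)
    then have "sqrt ((cmod (f z))\<^sup>2) \<le> sqrt ((l2_norm \<mu> f)\<^sup>2 / (m * V))" by (rule real_sqrt_le_mono)
    then show ?thesis by (simp add: real_sqrt_divide l2_norm_def)
  qed
  moreover have "cball a r \<subseteq> \<Omega>" using R by (auto simp: r_def)
  moreover have "0 < 1 / sqrt (m * V)" using m V by simp
  ultimately show ?thesis using r by blast
qed

lemma A2_add: "f \<in> A2 \<Longrightarrow> g \<in> A2 \<Longrightarrow> (\<lambda>z. f z + g z) \<in> A2"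
proof -
  assume f: "f \<in> A2" and g: "g \<in> A2"
  have hol: "holo_fun (\<lambda>z. f z + g z) \<Omega>" by (intro holo_fun_add A2_holo f g)
  have "integrable \<mu> (\<lambda>z. (cmod (f z + g z))\<^sup>2)"
  proof (rule Bochner_Integration.integrable_bound)
    show "integrable \<mu> (\<lambda>z. 2 * (cmod (f z))\<^sup>2 + 2 * (cmod (g z))\<^sup>2)" using A2_integrable[OF f] A2_integrable[OF g] by simp
    show "(\<lambda>z. (cmod (f z + g z))\<^sup>2) \<in> borel_measurable \<mu>" using holo_measurable[OF hol] by measurable
    have "(cmod (f z + g z))\<^sup>2 \<le> 2 * (cmod (f z))\<^sup>2 + 2 * (cmod (g z))\<^sup>2" for z
    proof -
      have "(cmod (f z + g z))\<^sup>2 \<le> (cmod (f z) + cmod (g z))\<^sup>2" by (intro power_mono norm_triangle_ineq) simp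
      moreover have "0 \<le> (cmod (f z) - cmod (g z))\<^sup>2" by simp
      ultimately show ?thesis unfolding power2_sum power2_diff by linarith
    qed
    then show "AE z in \<mu>. norm ((cmod (f z + g z))\<^sup>2) \<le> norm (2 * (cmod (f z))\<^sup>2 + 2 * (cmod (g z))\<^sup>2)" by simp
  qed
  then show ?thesis using hol A2_outside[OF f] A2_outside[OF g] by (simp add: bergman_space_def)
qed

lemma A2_mult:
  assumes f: "f \<in> A2" and g: "holo_fun g \<Omega>" and B: "\<And>z. z \<in> \<Omega> \<Longrightarrow> cmod (g z) \<le> B"
  shows "(\<lambda>z. g z * f z) \<in> A2" and "l2_norm \<mu> (\<lambda>z. g z * f z) \<le> \<bar>B\<bar> * l2_norm \<mu> f"
proof -
  have hol: "holo_fun (\<lambda>z. g z * f z) \<Omega>" by (intro holo_fun_mult g A2_holo f)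
  have le: "(cmod (g z * f z))\<^sup>2 \<le> B\<^sup>2 * (cmod (f z))\<^sup>2" if "z \<in> \<Omega>" for z
    unfolding norm_mult power_mult_distrib using B[OF that] by (intro mult_right_mono power_mono) auto
  have int2: "integrable \<mu> (\<lambda>z. B\<^sup>2 * (cmod (f z))\<^sup>2)" using A2_integrable[OF f] by simp
  have int: "integrable \<mu> (\<lambda>z. (cmod (g z * f z))\<^sup>2)"
  proof (rule Bochner_Integration.integrable_bound[OF int2])
    show "(\<lambda>z. (cmod (g z * f z))\<^sup>2) \<in> borel_measurable \<mu>" using holo_measurable[OF hol] by measurable
    show "AE z in \<mu>. norm ((cmod (g z * f z))\<^sup>2) \<le> norm (B\<^sup>2 * (cmod (f z))\<^sup>2)" using le by (intro AE_I2) (simp add: space_\<mu>)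
  qed
  then show "(\<lambda>z. g z * f z) \<in> A2" using hol A2_outside[OF f] by (simp add: bergman_space_def)
  have "(LINT z|\<mu>. (cmod (g z * f z))\<^sup>2) \<le> (LINT z|\<mu>. B\<^sup>2 * (cmod (f z))\<^sup>2)"
    by (rule integral_mono[OF int int2]) (use le in \<open>simp add: space_\<mu>\<close>)
  then have "(LINT z|\<mu>. (cmod (g z * f z))\<^sup>2) \<le> B\<^sup>2 * (LINT z|\<mu>. (cmod (f z))\<^sup>2)" by simp
  then have "sqrt (LINT z|\<mu>. (cmod (g z * f z))\<^sup>2) \<le> sqrt (B\<^sup>2 * (LINT z|\<mu>. (cmod (f z))\<^sup>2))" by (rule real_sqrt_le_mono)
  then show "l2_norm \<mu> (\<lambda>z. g z * f z) \<le> \<bar>B\<bar> * l2_norm \<mu> f" by (simp add: l2_norm_def real_sqrt_mult)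
qed

lemma A2_scale: "f \<in> A2 \<Longrightarrow> (\<lambda>z. a * f z) \<in> A2"
  by (rule A2_mult(1)[OF _ holo_fun_const]) auto

lemma A2_diff: "f \<in> A2 \<Longrightarrow> g \<in> A2 \<Longrightarrow> (\<lambda>z. f z - g z) \<in> A2"
  using A2_add[of f "\<lambda>z. (-1) * g z"] A2_scale[of g "-1"] by simp

lemma A2_one: "(\<lambda>z. if z \<in> \<Omega> then 1 else 0) \<in> A2"
proof -
  have "integrable \<mu> (\<lambda>z. (cmod (if z \<in> \<Omega> then 1 else 0))\<^sup>2)"
  proof (rule Bochner_Integration.integrable_cong[THEN iffD2, OF refl])
    show "integrable \<mu> (\<lambda>z. 1 :: real)"
      using \<mu>_finite by (intro finite_measure.integrable_const finite_measureI) (simp add: space_\<mu>)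
  qed (simp add: space_\<mu>)
  then show ?thesis
    using holo_fun_cong[OF open_\<Omega> holo_fun_const[of 1], of "\<lambda>z. if z \<in> \<Omega> then 1 else 0"] by (simp add: bergman_space_def)
qed

lemma A2_bounded:
  assumes g: "holo_fun g \<Omega>" and B: "\<And>z. z \<in> \<Omega> \<Longrightarrow> cmod (g z) \<le> B"
  shows "(\<lambda>z. if z \<in> \<Omega> then g z else 0) \<in> A2"
proof -
  have "(\<lambda>z. g z * (if z \<in> \<Omega> then 1 else 0)) = (\<lambda>z. if z \<in> \<Omega> then g z else 0)" by auto
  then show ?thesis using A2_mult(1)[OF A2_one g B] by simp
qed

lemma A2_definite:
  assumes f: "f \<in> A2" and 0: "(LINT z|\<mu>. (cmod (f z))\<^sup>2) = 0"
  shows "f = (\<lambda>z. 0)"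
proof
  fix z
  show "f z = 0"
  proof (cases "z \<in> \<Omega>")
    case True
    obtain r C where "r > 0" "cball z r \<subseteq> \<Omega>" "C > 0"
      and C: "\<And>f x. f \<in> A2 \<Longrightarrow> x \<in> cball z r \<Longrightarrow> cmod (f x) \<le> C * l2_norm \<mu> f"
      using point_estimate[OF True] by blast
    have "l2_norm \<mu> f = 0" using 0 by (simp add: l2_norm_def)
    then show ?thesis using C[OF f, of z] \<open>r > 0\<close> by simp
  qed (use A2_outside[OF f] in simp)
qed

text \<open>By \<open>point_estimate\<close> the sequence is locally uniformly Cauchy, so it has a
  holomorphic limit \<open>g\<close>. Fatou's lemma then controls the distance of \<open>X n\<close>
  to \<open>g\<close> in norm.\<close>

lemma A2_complete:
  assumes X: "\<And>n. X n \<in> A2"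
    and C: "\<And>e. e > 0 \<Longrightarrow> \<exists>N. \<forall>m\<ge>N. \<forall>n\<ge>N. l2_norm \<mu> (\<lambda>z. X m z - X n z) < e"
  shows "\<exists>g\<in>A2. (\<lambda>n::nat. l2_norm \<mu> (\<lambda>z. X n z - g z)) \<longlonglongrightarrow> 0"
proof -
  have loc: "\<exists>r>0. cball a r \<subseteq> \<Omega> \<and> uniformly_Cauchy_on (cball a r) X" if a: "a \<in> \<Omega>" for a
  proof -
    obtain r D where r: "r > 0" "cball a r \<subseteq> \<Omega>" and D: "D > 0" "\<And>f z. f \<in> A2 \<Longrightarrow> z \<in> cball a r \<Longrightarrow> cmod (f z) \<le> D * l2_norm \<mu> f"
      using point_estimate[OF a] by blast
    have "uniformly_Cauchy_on (cball a r) X"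
    proof (rule uniformly_Cauchy_onI)
      fix e :: real assume e: "e > 0"
      have "e / D > 0" using e D by simp
      from C[OF this] obtain N where N: "\<forall>m\<ge>N. \<forall>n\<ge>N. l2_norm \<mu> (\<lambda>z. X m z - X n z) < e / D" ..
      have "dist (X m z) (X n z) < e" if "z \<in> cball a r" "m \<ge> N" "n \<ge> N" for z m n
      proof -
        have "cmod (X m z - X n z) \<le> D * l2_norm \<mu> (\<lambda>z. X m z - X n z)"
          using D(2)[OF A2_diff[OF X X] that(1), of m n] .
        also have "\<dots> < e" using N[rule_format, OF that(2,3)] D(1) by (simp add: pos_less_divide_eq mult.commute)
        finally show ?thesis by (simp add: dist_norm)
      qed
      then show "\<exists>M. \<forall>x\<in>cball a r. \<forall>m\<ge>M. \<forall>n\<ge>M. dist (X m x) (X n x) < e" by blast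
    qed
    then show ?thesis using r by blast
  qed
  define g where "g z = (if z \<in> \<Omega> then lim (\<lambda>n. X n z) else 0)" for z
  have loc': "\<exists>r>0. cball a r \<subseteq> \<Omega> \<and> uniform_limit (cball a r) X g sequentially" if a: "a \<in> \<Omega>" for a
  proof -
    obtain r where r: "r > 0" "cball a r \<subseteq> \<Omega>" "uniformly_Cauchy_on (cball a r) X" using loc[OF a] by blast
    obtain l where l: "uniform_limit (cball a r) X l sequentially"
      using uniformly_convergent_eq_Cauchy[of "cball a r" X] r(3) Cauchy_uniformly_convergent uniformly_convergent_on_def by metis
    have "uniform_limit (cball a r) X g sequentially"
    proof (rule uniform_limit_cong[THEN iffD1, OF _ _ l])
      fix z assume z: "z \<in> cball a r"
      have "lim (\<lambda>n. X n z) = l z" using tendsto_uniform_limitI[OF l z] by (rule limI)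
      then show "l z = g z" using z r(2) by (auto simp: g_def)
    qed auto
    then show ?thesis using r by blast
  qed
  have gh: "holo_fun g \<Omega>" by (rule holo_fun_uniform_limit[OF A2_holo[OF X] loc'])
  have ptw: "(\<lambda>n. X n z) \<longlonglongrightarrow> g z" if "z \<in> \<Omega>" for z
  proof -
    from loc'[OF that] obtain r where "r > 0" "uniform_limit (cball z r) X g sequentially" by blast
    then show ?thesis by (intro tendsto_uniform_limitI) auto
  qed
  have Xm: "X n \<in> borel_measurable \<mu>" for n by (rule holo_measurable[OF A2_holo[OF X]])
  have gm: "g \<in> borel_measurable \<mu>" by (rule holo_measurable[OF gh])
  have fatou: "(\<integral>\<^sup>+z. ennreal ((cmod (X n z - g z))\<^sup>2) \<partial>\<mu>) \<le> ennreal (e\<^sup>2)"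
    if e: "e > 0" and N: "\<And>m. m \<ge> N \<Longrightarrow> l2_norm \<mu> (\<lambda>z. X n z - X m z) < e" for e n N
  proof -
    have "(\<integral>\<^sup>+z. ennreal ((cmod (X n z - g z))\<^sup>2) \<partial>\<mu>) = (\<integral>\<^sup>+z. liminf (\<lambda>m. ennreal ((cmod (X n z - X m z))\<^sup>2)) \<partial>\<mu>)"
    proof (rule nn_integral_cong)
      fix z assume "z \<in> space \<mu>"
      then have "(\<lambda>m. ennreal ((cmod (X n z - X m z))\<^sup>2)) \<longlonglongrightarrow> ennreal ((cmod (X n z - g z))\<^sup>2)"
        using ptw by (intro tendsto_ennrealI tendsto_power tendsto_norm tendsto_diff tendsto_const) (simp add: space_\<mu>)
      then show "ennreal ((cmod (X n z - g z))\<^sup>2) = liminf (\<lambda>m. ennreal ((cmod (X n z - X m z))\<^sup>2))"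
        using lim_imp_Liminf[OF sequentially_bot] by metis
    qed
    also have "\<dots> \<le> liminf (\<lambda>m. \<integral>\<^sup>+z. ennreal ((cmod (X n z - X m z))\<^sup>2) \<partial>\<mu>)"
      by (rule nn_integral_liminf) (use Xm in measurable)
    also have "\<dots> \<le> ennreal (e\<^sup>2)"
    proof (rule Liminf_le)
      have "(\<integral>\<^sup>+z. ennreal ((cmod (X n z - X m z))\<^sup>2) \<partial>\<mu>) \<le> ennreal (e\<^sup>2)" if "m \<ge> N" for m
        unfolding A2_nn_integral[OF A2_diff[OF X X]] using N[OF that] by (intro ennreal_leI power_mono) (auto simp: l2_norm_def)
      then show "\<forall>\<^sub>F m in sequentially. (\<integral>\<^sup>+z. ennreal ((cmod (X n z - X m z))\<^sup>2) \<partial>\<mu>) \<le> ennreal (e\<^sup>2)"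
        unfolding eventually_sequentially by blast
    qed simp
    finally show ?thesis .
  qed
  \<comment> \<open>At this point nothing is known about integrability of \<open>g\<close>.
    Membership is obtained for the difference from \<open>X n\<close>, and \<open>g\<close> itself
    then results by subtraction.\<close>
  have diffA2: "(\<lambda>z. X n z - g z) \<in> A2 \<and> l2_norm \<mu> (\<lambda>z. X n z - g z) \<le> e"
    if e: "e > 0" and N: "\<And>m. m \<ge> N \<Longrightarrow> l2_norm \<mu> (\<lambda>z. X n z - X m z) < e" for e n N
  proof
    have "(\<lambda>z. (cmod (X n z - g z))\<^sup>2) \<in> borel_measurable \<mu>" using Xm gm by measurable
    moreover have fat: "(\<integral>\<^sup>+z. ennreal ((cmod (X n z - g z))\<^sup>2) \<partial>\<mu>) \<le> ennreal (e\<^sup>2)"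
      by (rule fatou[OF e]) (rule N)
    then have "(\<integral>\<^sup>+z. ennreal ((cmod (X n z - g z))\<^sup>2) \<partial>\<mu>) < \<infinity>" by (auto intro: le_less_trans)
    ultimately have "integrable \<mu> (\<lambda>z. (cmod (X n z - g z))\<^sup>2)" by (intro integrableI_bounded) simp_all
    then show A: "(\<lambda>z. X n z - g z) \<in> A2"
      using holo_fun_diff[OF A2_holo[OF X] gh] A2_outside[OF X] by (simp add: bergman_space_def g_def)
    have "ennreal ((l2_norm \<mu> (\<lambda>z. X n z - g z))\<^sup>2) \<le> ennreal (e\<^sup>2)"
      using fat unfolding A2_nn_integral[OF A] .
    then have "(l2_norm \<mu> (\<lambda>z. X n z - g z))\<^sup>2 \<le> e\<^sup>2" by simp
    then show "l2_norm \<mu> (\<lambda>z. X n z - g z) \<le> e" by (rule power2_le_imp_le) (use e in simp)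
  qed
  obtain N where N: "\<And>m n. m \<ge> N \<Longrightarrow> n \<ge> N \<Longrightarrow> l2_norm \<mu> (\<lambda>z. X m z - X n z) < 1" using C[of 1] by auto
  have "(\<lambda>z. X N z - g z) \<in> A2" using diffA2[of 1 N N] N by auto
  from A2_diff[OF X[of N] this] have "g \<in> A2" by simp
  moreover have "(\<lambda>n. l2_norm \<mu> (\<lambda>z. X n z - g z)) \<longlonglongrightarrow> 0"
  proof (rule LIMSEQ_I)
    fix e :: real assume e: "e > 0"
    obtain N where N: "\<And>m n. m \<ge> N \<Longrightarrow> n \<ge> N \<Longrightarrow> l2_norm \<mu> (\<lambda>z. X m z - X n z) < e / 2" using C[of "e/2"] e by auto
    have "l2_norm \<mu> (\<lambda>z. X n z - g z) < e" if "n \<ge> N" for n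
      using diffA2[of "e/2" N n] N[OF that] e by fastforce
    moreover have "0 \<le> l2_norm \<mu> f" for f :: "complex^'n \<Rightarrow> complex" by (simp add: l2_norm_def)
    ultimately show "\<exists>no. \<forall>n\<ge>no. norm (l2_norm \<mu> (\<lambda>z. X n z - g z) - 0) < e" by auto
  qed
  ultimately show ?thesis by blast
qed

sublocale A2: l2_space \<mu> A2
proof
  show "(\<lambda>z. 0) \<in> A2" using A2_scale[OF A2_one, of 0] by simp
qed (auto intro: A2_complete A2_definite A2_add A2_scale A2_integrable holo_measurable A2_holo)

end

section \<open>Transformation of the Bergman kernel\<close>

lemma biholoD:
  assumes "biholo U W \<phi>"
  shows "bij_betw \<phi> U W" "holo_map \<phi> U" "holo_map (the_inv_into U \<phi>) W" "inj_on \<phi> U"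
    "\<And>z. z \<in> U \<Longrightarrow> \<phi> z \<in> W" "\<And>z. z \<in> W \<Longrightarrow> the_inv_into U \<phi> z \<in> U"
    "\<And>z. z \<in> U \<Longrightarrow> the_inv_into U \<phi> (\<phi> z) = z" "\<And>z. z \<in> W \<Longrightarrow> \<phi> (the_inv_into U \<phi> z) = z"
proof -
  show b: "bij_betw \<phi> U W" and "holo_map \<phi> U" "holo_map (the_inv_into U \<phi>) W" using assms by (auto simp: biholo_def)
  show inj: "inj_on \<phi> U" using b by (simp add: bij_betw_def)
  show "\<And>z. z \<in> U \<Longrightarrow> \<phi> z \<in> W" using b by (auto simp: bij_betw_def)
  show "\<And>z. z \<in> W \<Longrightarrow> the_inv_into U \<phi> z \<in> U" using bij_betw_the_inv_into[OF b] by (auto simp: bij_betw_def)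
  show "\<And>z. z \<in> U \<Longrightarrow> the_inv_into U \<phi> (\<phi> z) = z" by (rule the_inv_into_f_f[OF inj])
  show "\<And>z. z \<in> W \<Longrightarrow> \<phi> (the_inv_into U \<phi> z) = z" using b f_the_inv_into_f[OF inj] by (simp add: bij_betw_def)
qed

lemma the_inv_into_the_inv_into:
  assumes b: "biholo U W \<phi>" and z: "z \<in> U"
  shows "the_inv_into W (the_inv_into U \<phi>) z = \<phi> z"
  by (rule the_inv_into_f_eq) (use bij_betw_the_inv_into[OF biholoD(1)[OF b]] biholoD[OF b] z in \<open>auto simp: bij_betw_def\<close>)

text \<open>The inverse of the inverse agrees with \<phi> only on \<open>U\<close>; off that set it
  is an unspecified value. Openness of \<open>U\<close> allows holomorphy to be carried
  over.\<close>

lemma biholo_inverse: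
  assumes U: "open U" and b: "biholo U W \<phi>"
  shows "biholo W U (the_inv_into U \<phi>)"
  unfolding biholo_def
  using bij_betw_the_inv_into[OF biholoD(1)[OF b]] biholoD(3)[OF b]
    holo_map_cong[OF U biholoD(2)[OF b]] the_inv_into_the_inv_into[OF b] by metis

lemma biholo_det_jacobian:
  assumes U: "open U" and b: "biholo U W \<phi>" and z: "z \<in> U"
  shows "det (jacobian (the_inv_into U \<phi>) (\<phi> z)) * det (jacobian \<phi> z) = 1"
proof -
  let ?\<psi> = "the_inv_into U \<phi>"
  have sub: "\<phi> ` U \<subseteq> W" using biholoD(5)[OF b] by auto
  have "jacobian (\<lambda>z. ?\<psi> (\<phi> z)) z = mat 1"
  proof (rule jacobian_unique[OF holo_map_compose[OF biholoD(3)[OF b] biholoD(2)[OF b] sub] z])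
    have "((\<lambda>z. z) has_derivative (\<lambda>h. mat 1 *v h)) (at z)" by (simp add: has_derivative_ident)
    then show "((\<lambda>z. ?\<psi> (\<phi> z)) has_derivative (\<lambda>h. mat 1 *v h)) (at z)"
      by (rule has_derivative_transform_within_open[OF _ U z]) (simp add: biholoD(7)[OF b])
  qed
  then have "jacobian ?\<psi> (\<phi> z) ** jacobian \<phi> z = mat 1"
    using jacobian_compose[OF biholoD(3)[OF b] biholoD(2)[OF b] sub z] by simp
  then show ?thesis by (metis det_mul det_I)
qed

section \<open>The unweighted Bergman space of a bounded open set\<close>

locale bounded_open =
  fixes \<Omega> :: "(complex^'n) set"
  assumes open_\<Omega>': "open \<Omega>" and bounded_\<Omega>: "bounded \<Omega>" and nonempty_\<Omega>: "\<Omega> \<noteq> {}"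
begin

abbreviation v where "v \<equiv> normalized_lebesgue \<Omega>"

definition vol :: real where "vol = measure lborel \<Omega>"

lemma emeasure_\<Omega>: "emeasure lborel \<Omega> = ennreal vol" and vol_pos: "vol > 0"
proof -
  have fin: "emeasure lborel \<Omega> < \<infinity>" by (rule emeasure_bounded_finite[OF bounded_\<Omega>])
  then show *: "emeasure lborel \<Omega> = ennreal vol"
    unfolding vol_def by (intro emeasure_eq_ennreal_measure) auto
  obtain a where a: "a \<in> \<Omega>" using nonempty_\<Omega> by blast
  obtain r where r: "r > 0" "ball a r \<subseteq> \<Omega>" using open_\<Omega>' a open_contains_ball by blast
  have "0 < measure lborel (ball a r)" using content_ball_pos[OF r(1)] by simp
  also have "\<dots> \<le> vol" unfolding vol_def
    using r(2) fin open_\<Omega>' by (intro measure_mono_fmeasurable) (auto simp: fmeasurable_def)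
  finally show "vol > 0" .
qed

lemma normalized_lebesgue_eq: "v = density (restrict_space lborel \<Omega>) (\<lambda>_. ennreal (1 / vol))"
proof -
  have "emeasure (restrict_space lborel \<Omega>) \<Omega> = ennreal vol"
    using emeasure_restrict_space[of \<Omega> lborel \<Omega>] open_\<Omega>' by (simp add: emeasure_\<Omega>)
  moreover have "\<Omega> \<in> sets (restrict_space lborel \<Omega>)" using open_\<Omega>' by (auto simp: sets_restrict_space)
  then have "indicator \<Omega> \<in> borel_measurable (restrict_space lborel \<Omega>)" by (rule borel_measurable_indicator)
  ultimately show ?thesis
    unfolding normalized_lebesgue_def uniform_measure_def
    using vol_pos by (intro density_cong borel_measurable_divide_ennreal AE_I2)
      (simp_all add: space_restrict_space divide_ennreal[symmetric])
qed

sublocale N: weighted_domain \<Omega> v "\<lambda>_. 1 / vol"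
proof
  show "emeasure v \<Omega> < \<infinity>"
  proof -
    have "emeasure v \<Omega> = (\<integral>\<^sup>+x. ennreal (1 / vol) * indicator \<Omega> x \<partial>restrict_space lborel \<Omega>)"
      unfolding normalized_lebesgue_eq using open_\<Omega>' by (subst emeasure_density) (auto simp: sets_restrict_space)
    also have "\<dots> = ennreal (1 / vol) * emeasure (restrict_space lborel \<Omega>) \<Omega>"
      using open_\<Omega>' by (intro nn_integral_cmult_indicator) (auto simp: sets_restrict_space)
    also have "\<dots> = ennreal (1 / vol) * ennreal vol"
      using emeasure_restrict_space[of \<Omega> lborel \<Omega>] open_\<Omega>' by (simp add: emeasure_\<Omega>)
    finally show ?thesis by (simp add: ennreal_mult_less_top)
  qed
qed (use open_\<Omega>' vol_pos normalized_lebesgue_eq in auto)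

abbreviation A2v where "A2v \<equiv> bergman_space \<Omega> v"

lemma automorphism_measurable: "automorphism \<Omega> \<phi> \<Longrightarrow> \<phi> \<in> v \<rightarrow>\<^sub>M v"
  unfolding measurable_cong_sets[OF refl N.sets_\<mu>]
  by (rule measurable_restrict_space2)
    (use biholoD(5)[of \<Omega> \<Omega> \<phi>] N.continuous_measurable[OF holo_map_continuous_on[OF biholoD(2)]] in \<open>auto simp: N.space_\<mu>\<close>)

text \<open>Change of variables stated as an equality of an image measure with the original one. The
  general rules for image measures and densities then give the formulas for integrals and for
  integrability with no further approximation.\<close>

lemma measure_transform:
  assumes b: "automorphism \<Omega> \<phi>"
  shows "distr (density v (\<lambda>z. ennreal ((cmod (det (jacobian \<phi> z)))\<^sup>2))) v \<phi> = v"
proof (rule measure_eqI)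
  let ?J2 = "\<lambda>z. (cmod (det (jacobian \<phi> z)))\<^sup>2"
  have J: "holo_fun (\<lambda>z. det (jacobian \<phi> z)) \<Omega>" by (rule holo_fun_det_jacobian[OF open_\<Omega>' biholoD(2)[OF b]])
  have Jm: "(\<lambda>z. ennreal (?J2 z)) \<in> borel_measurable v" using N.holo_measurable[OF J] by measurable
  note \<phi>m = automorphism_measurable[OF b]
  show "sets (distr (density v (\<lambda>z. ennreal (?J2 z))) v \<phi>) = sets v" by simp
  fix A assume "A \<in> sets (distr (density v (\<lambda>z. ennreal (?J2 z))) v \<phi>)"
  then have A: "A \<in> sets v" by simp
  then obtain A' where A': "A' \<in> sets borel" "A = A' \<inter> \<Omega>" by (auto simp: N.sets_\<mu> sets_restrict_space)
  then have Ab: "A \<in> sets borel" "A \<subseteq> \<Omega>" using open_\<Omega>' by auto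
  define B where "B = \<phi> -` A \<inter> \<Omega>"
  have Bv: "B \<in> sets v" unfolding B_def using measurable_sets[OF \<phi>m A] by (simp add: N.space_\<mu>)
  then have Bb: "B \<in> sets borel" "B \<subseteq> \<Omega>" using open_\<Omega>' by (auto simp: N.sets_\<mu> sets_restrict_space B_def)
  have "\<phi> ` \<Omega> = \<Omega>" using biholoD(1)[OF b] by (simp add: bij_betw_def)
  moreover have "\<phi> ` (\<phi> -` A \<inter> \<Omega>) = A \<inter> \<phi> ` \<Omega>" by blast
  ultimately have im: "\<phi> ` B = A" using Ab(2) unfolding B_def by auto
  have em: "emeasure v C = ennreal (1 / vol) * emeasure lborel C" if C: "C \<in> sets borel" "C \<subseteq> \<Omega>" for C
  proof -
    have Cr: "C \<in> sets (restrict_space lborel \<Omega>)" using C by (auto simp: sets_restrict_space)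
    have "emeasure v C = ennreal (1 / vol) * emeasure (restrict_space lborel \<Omega>) C"
      unfolding normalized_lebesgue_eq using Cr by (subst emeasure_density) (auto intro: nn_integral_cmult_indicator)
    also have "emeasure (restrict_space lborel \<Omega>) C = emeasure lborel C"
      by (rule emeasure_restrict_space) (use C open_\<Omega>' in auto)
    finally show ?thesis .
  qed
  \<comment> \<open>Off \<Omega> the Jacobian consists of unspecified values, so Borel measurability
    on the whole space is shown after multiplication with the indicator of \<Omega>.\<close>
  have "continuous_on \<Omega> ?J2" by (intro continuous_intros holo_fun_continuous_on[OF J])
  then have "(\<lambda>z. indicator \<Omega> z *\<^sub>R ?J2 z) \<in> borel_measurable borel"
    using open_\<Omega>' by (intro borel_measurable_continuous_on_indicator) auto
  then have "(\<lambda>z. (indicator \<Omega> z *\<^sub>R ?J2 z) * indicator B z) \<in> borel_measurable borel" using Bb by measurable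
  moreover have "(\<lambda>z. (indicator \<Omega> z *\<^sub>R ?J2 z) * indicator B z) = (\<lambda>z. ?J2 z * indicator B z)"
    using Bb(2) by (auto simp: indicator_def fun_eq_iff)
  ultimately have m: "(\<lambda>z. ?J2 z * indicator B z) \<in> borel_measurable borel" by simp
  have "emeasure (distr (density v (\<lambda>z. ennreal (?J2 z))) v \<phi>) A = emeasure (density v (\<lambda>z. ennreal (?J2 z))) B"
    using A \<phi>m by (subst emeasure_distr) (auto simp: B_def N.space_\<mu>)
  also have "\<dots> = (\<integral>\<^sup>+z. ennreal (?J2 z) * indicator B z \<partial>v)" by (rule emeasure_density[OF Jm Bv])
  also have "\<dots> = (\<integral>\<^sup>+z. ennreal (1 / vol) * (ennreal (?J2 z) * indicator B z) * indicator \<Omega> z \<partial>lborel)"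
    by (rule N.nn_integral_\<mu>) (use Jm Bv in measurable)
  also have "\<dots> = (\<integral>\<^sup>+z. ennreal (1 / vol) * ennreal (?J2 z * indicator B z) \<partial>lborel)"
    using Bb(2) by (intro nn_integral_cong) (auto simp: indicator_def)
  also have "\<dots> = ennreal (1 / vol) * (\<integral>\<^sup>+z. ennreal (?J2 z * indicator B z) \<partial>lborel)"
    by (rule nn_integral_cmult) (use m in simp)
  also have "(\<integral>\<^sup>+z. ennreal (?J2 z * indicator B z) \<partial>lborel) = (\<integral>\<^sup>+z. ennreal (?J2 z) * indicator B z \<partial>lborel)"
    by (intro nn_integral_cong) (auto simp: indicator_def)
  also have "\<dots> = emeasure lborel A"
    unfolding im[symmetric]
    by (rule emeasure_holo_image[OF biholoD(2)[OF b] biholoD(4)[OF b] Bb, symmetric])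
      (use Ab bounded_subset[OF bounded_\<Omega>] m im in auto)
  finally show "emeasure (distr (density v (\<lambda>z. ennreal (?J2 z))) v \<phi>) A = emeasure v A"
    using em[OF Ab] by simp
qed

lemma
  fixes f :: "complex^'n \<Rightarrow> 'b::{banach, second_countable_topology}"
  assumes b: "automorphism \<Omega> \<phi>" and f: "f \<in> borel_measurable v"
  shows integral_transform: "(LINT z|v. f z) = (LINT z|v. (cmod (det (jacobian \<phi> z)))\<^sup>2 *\<^sub>R f (\<phi> z))"
    and integrable_transform: "integrable v f \<longleftrightarrow> integrable v (\<lambda>z. (cmod (det (jacobian \<phi> z)))\<^sup>2 *\<^sub>R f (\<phi> z))"
proof -
  let ?J2 = "\<lambda>z. (cmod (det (jacobian \<phi> z)))\<^sup>2"
  note \<phi>m = automorphism_measurable[OF b]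
  have J: "holo_fun (\<lambda>z. det (jacobian \<phi> z)) \<Omega>" by (rule holo_fun_det_jacobian[OF open_\<Omega>' biholoD(2)[OF b]])
  have Jm: "?J2 \<in> borel_measurable v" using N.holo_measurable[OF J] by measurable
  have fm: "(\<lambda>z. f (\<phi> z)) \<in> borel_measurable v" by (rule measurable_compose[OF \<phi>m f])
  have \<phi>m': "\<phi> \<in> density v (\<lambda>z. ennreal (?J2 z)) \<rightarrow>\<^sub>M v" using \<phi>m by simp
  have "(LINT z|v. f z) = (LINT z|distr (density v (\<lambda>z. ennreal (?J2 z))) v \<phi>. f z)" unfolding measure_transform[OF b] ..
  also have "\<dots> = (LINT z|density v (\<lambda>z. ennreal (?J2 z)). f (\<phi> z))" by (rule integral_distr[OF \<phi>m' f])
  also have "\<dots> = (LINT z|v. ?J2 z *\<^sub>R f (\<phi> z))" by (rule integral_density[OF fm Jm]) simp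
  finally show "(LINT z|v. f z) = (LINT z|v. ?J2 z *\<^sub>R f (\<phi> z))" .
  have "integrable v f \<longleftrightarrow> integrable (distr (density v (\<lambda>z. ennreal (?J2 z))) v \<phi>) f" unfolding measure_transform[OF b] ..
  also have "\<dots> \<longleftrightarrow> integrable (density v (\<lambda>z. ennreal (?J2 z))) (\<lambda>z. f (\<phi> z))" by (rule integrable_distr_eq[OF \<phi>m' f])
  also have "\<dots> \<longleftrightarrow> integrable v (\<lambda>z. ?J2 z *\<^sub>R f (\<phi> z))" by (rule integrable_density[OF fm Jm]) simp
  finally show "integrable v f \<longleftrightarrow> integrable v (\<lambda>z. ?J2 z *\<^sub>R f (\<phi> z))" .
qed

text \<open>The unitary action of an automorphism on the unweighted Bergman space; by change of
  variables the Jacobian factor preserves the inner product.\<close>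

definition transform :: "(complex^'n \<Rightarrow> complex^'n) \<Rightarrow> (complex^'n \<Rightarrow> complex) \<Rightarrow> complex^'n \<Rightarrow> complex" where
  "transform \<phi> f z = (if z \<in> \<Omega> then det (jacobian \<phi> z) * f (\<phi> z) else 0)"

lemma transform_A2:
  assumes b: "automorphism \<Omega> \<phi>" and f: "f \<in> A2v"
  shows "transform \<phi> f \<in> A2v"
proof -
  have J: "holo_fun (\<lambda>z. det (jacobian \<phi> z)) \<Omega>" by (rule holo_fun_det_jacobian[OF open_\<Omega>' biholoD(2)[OF b]])
  have "holo_fun (\<lambda>z. det (jacobian \<phi> z) * f (\<phi> z)) \<Omega>"
    by (intro holo_fun_mult J holo_fun_compose[OF N.A2_holo[OF f] biholoD(2)[OF b]]) (use biholoD(5)[OF b] in auto)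
  then have hol: "holo_fun (transform \<phi> f) \<Omega>"
    by (rule holo_fun_cong[OF open_\<Omega>']) (simp add: transform_def)
  have "(\<lambda>z. (cmod (f z))\<^sup>2) \<in> borel_measurable v" using N.holo_measurable[OF N.A2_holo[OF f]] by measurable
  from integrable_transform[OF b this] N.A2_integrable[OF f]
  have "integrable v (\<lambda>z. (cmod (det (jacobian \<phi> z)))\<^sup>2 *\<^sub>R (cmod (f (\<phi> z)))\<^sup>2)" by simp
  then have "integrable v (\<lambda>z. (cmod (transform \<phi> f z))\<^sup>2)"
    by (rule Bochner_Integration.integrable_cong[THEN iffD1, rotated 2]) (simp_all add: transform_def N.space_\<mu> norm_mult power_mult_distrib)
  then show ?thesis using hol by (simp add: bergman_space_def transform_def)
qed

lemma transform_inner: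
  assumes b: "automorphism \<Omega> \<phi>" and f: "f \<in> A2v" and g: "g \<in> A2v"
  shows "l2_inner v (transform \<phi> f) (transform \<phi> g) = l2_inner v f g"
proof -
  have "(\<lambda>z. f z * cnj (g z)) \<in> borel_measurable v"
    by (rule borel_measurable_integrable[OF N.A2.integrable_ip[OF f g]])
  from integral_transform[OF b this]
  have "l2_inner v f g = (LINT z|v. (cmod (det (jacobian \<phi> z)))\<^sup>2 *\<^sub>R (f (\<phi> z) * cnj (g (\<phi> z))))" by (simp add: l2_inner_def)
  also have "\<dots> = l2_inner v (transform \<phi> f) (transform \<phi> g)"
    unfolding l2_inner_def
  proof (rule Bochner_Integration.integral_cong[OF refl])
    fix z assume "z \<in> space v"
    then show "(cmod (det (jacobian \<phi> z)))\<^sup>2 *\<^sub>R (f (\<phi> z) * cnj (g (\<phi> z))) = transform \<phi> f z * cnj (transform \<phi> g z)"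
      by (simp add: transform_def N.space_\<mu> scaleR_conv_of_real complex_norm_square del: of_real_power)
  qed
  finally show ?thesis by simp
qed

lemma transform_inverse:
  assumes b: "automorphism \<Omega> \<phi>" and g: "g \<in> A2v"
  shows "transform \<phi> (transform (the_inv_into \<Omega> \<phi>) g) = g"
proof
  fix z
  show "transform \<phi> (transform (the_inv_into \<Omega> \<phi>) g) z = g z"
  proof (cases "z \<in> \<Omega>")
    case True
    have "transform \<phi> (transform (the_inv_into \<Omega> \<phi>) g) z
        = det (jacobian (the_inv_into \<Omega> \<phi>) (\<phi> z)) * det (jacobian \<phi> z) * g z"
      using True biholoD(5)[OF b True] biholoD(7)[OF b True] by (simp add: transform_def)
    then show ?thesis using biholo_det_jacobian[OF open_\<Omega>' b True] by simp
  qed (simp add: transform_def N.A2_outside[OF g])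
qed

section \<open>The Bergman kernel under automorphisms\<close>

context
  fixes K assumes K: "is_bergman_kernel \<Omega> v K"
begin

definition kernel_at :: "complex^'n \<Rightarrow> complex^'n \<Rightarrow> complex" where
  "kernel_at w = (\<lambda>z. if z \<in> \<Omega> then K z w else 0)"

lemma kernel_at_A2: "w \<in> \<Omega> \<Longrightarrow> kernel_at w \<in> A2v"
  using K by (simp add: is_bergman_kernel_def kernel_at_def)

lemma kernel_at_apply: "z \<in> \<Omega> \<Longrightarrow> kernel_at w z = K z w"
  by (simp add: kernel_at_def)

lemma kernel_reproduces: "w \<in> \<Omega> \<Longrightarrow> f \<in> A2v \<Longrightarrow> l2_inner v f (kernel_at w) = f w"
proof -
  assume w: "w \<in> \<Omega>" and f: "f \<in> A2v"
  have "l2_inner v f (kernel_at w) = l2_inner v f (\<lambda>z. K z w)"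
    unfolding l2_inner_def by (rule Bochner_Integration.integral_cong) (simp_all add: kernel_at_def N.space_\<mu>)
  then show ?thesis using K w f by (simp add: is_bergman_kernel_def)
qed

lemma kernel_hermitian:
  assumes "z \<in> \<Omega>" "w \<in> \<Omega>"
  shows "K w z = cnj (K z w)"
proof -
  have "K w z = l2_inner v (kernel_at z) (kernel_at w)"
    using kernel_reproduces[OF assms(2) kernel_at_A2[OF assms(1)]] kernel_at_apply[OF assms(2)] by simp
  moreover have "K z w = l2_inner v (kernel_at w) (kernel_at z)"
    using kernel_reproduces[OF assms(1) kernel_at_A2[OF assms(2)]] kernel_at_apply[OF assms(1)] by simp
  ultimately show ?thesis using N.A2.ip_cnj[of "kernel_at z" "kernel_at w"] by simp
qed

lemma kernel_diagonal: "z \<in> \<Omega> \<Longrightarrow> K z z = complex_of_real ((l2_norm v (kernel_at z))\<^sup>2)"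
  using kernel_reproduces[OF _ kernel_at_A2, of z z] kernel_at_apply[of z z] N.A2.ip_self[of "kernel_at z"] by simp

text \<open>The function \<open>k\<close> formed from the kernel at \<open>\<phi> w\<close>
  reproduces values at \<open>w\<close>: every \<open>g\<close> is the transform of some
  \<open>f\<close>, and the unitary turns the pairing of \<open>g\<close> with \<open>k\<close> into
  the evaluation of \<open>f\<close> at \<open>\<phi> w\<close>. The reproducing element of a point
  is unique.\<close>

lemma kernel_transformation:
  assumes b: "automorphism \<Omega> \<phi>" and z: "z \<in> \<Omega>" and w: "w \<in> \<Omega>"
  shows "K z w = det (jacobian \<phi> z) * K (\<phi> z) (\<phi> w) * cnj (det (jacobian \<phi> w))"
proof -
  let ?J = "\<lambda>z. det (jacobian \<phi> z)"
  have \<phi>w: "\<phi> w \<in> \<Omega>" and \<phi>z: "\<phi> z \<in> \<Omega>" using biholoD(5)[OF b] z w by auto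
  define k where "k = (\<lambda>z. cnj (?J w) * transform \<phi> (kernel_at (\<phi> w)) z)"
  have kA: "k \<in> A2v" unfolding k_def by (intro N.A2_scale transform_A2 b kernel_at_A2 \<phi>w)
  have "kernel_at w = k"
  proof (rule N.A2.ip_eqI[OF kernel_at_A2[OF w] kA])
    fix g assume g: "g \<in> A2v"
    define f where "f = transform (the_inv_into \<Omega> \<phi>) g"
    have f: "f \<in> A2v" unfolding f_def by (rule transform_A2[OF biholo_inverse[OF open_\<Omega>' b] g])
    have fg: "transform \<phi> f = g" unfolding f_def by (rule transform_inverse[OF b g])
    have "l2_inner v g k = ?J w * l2_inner v (transform \<phi> f) (transform \<phi> (kernel_at (\<phi> w)))"
      unfolding k_def N.A2.ip_scale_right fg by simp
    also have "\<dots> = ?J w * f (\<phi> w)"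
      using transform_inner[OF b f kernel_at_A2[OF \<phi>w]] kernel_reproduces[OF \<phi>w f] by simp
    also have "\<dots> = g w" using w unfolding fg[symmetric] by (simp add: transform_def)
    finally show "l2_inner v g (kernel_at w) = l2_inner v g k" using kernel_reproduces[OF w g] by simp
  qed
  then have "kernel_at w z = k z" by simp
  then show ?thesis using z \<phi>z by (simp add: k_def kernel_at_apply transform_def mult_ac)
qed

end

end

section \<open>Polynomials in \<open>z\<close> and the conjugate of \<open>w\<close>\<close>

definition monomial :: "('n::finite \<Rightarrow> nat) \<Rightarrow> complex^'n \<Rightarrow> complex" where
  "monomial a z = (\<Prod>i\<in>UNIV. (z $ i) ^ a i)"

definition deg :: "('n::finite \<Rightarrow> nat) \<Rightarrow> nat" where
  "deg a = (\<Sum>i\<in>UNIV. a i)"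

lemma monomial_scale: "monomial a (s *s z) = s ^ deg a * monomial a z"
  by (simp add: monomial_def deg_def power_mult_distrib prod.distrib power_sum)

lemma monomial_holo: "holo_fun (monomial a) U"
  unfolding monomial_def by (intro holo_fun_prod holo_fun_power holo_fun_coord)

lemma monomial_deg_1:
  assumes "deg a = 1"
  obtains i where "\<And>z. monomial a z = z $ i"
proof -
  obtain i where i: "a i \<noteq> 0" using assms unfolding deg_def by (metis One_nat_def sum.neutral zero_neq_one)
  have "a i + (\<Sum>j\<in>UNIV - {i}. a j) = 1" using assms unfolding deg_def by (simp add: sum.remove[of UNIV i])
  then have "a i = 1" "(\<Sum>j\<in>UNIV - {i}. a j) = 0" using i by linarith+
  then have "a i = 1" "\<And>j. j \<noteq> i \<Longrightarrow> a j = 0" by simp_all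
  then have "monomial a z = z $ i" for z
    unfolding monomial_def by (simp add: prod.remove[of UNIV i])
  then show ?thesis by (rule that)
qed

lemma cnj_monomial: "cnj (monomial a z) = (\<Prod>i\<in>UNIV. cnj (z $ i) ^ a i)"
  by (simp add: monomial_def)

locale sesqui_polynomial =
  fixes \<Delta> :: "complex^'n \<Rightarrow> complex^'n \<Rightarrow> complex" and A and c :: "('n \<Rightarrow> nat) \<times> ('n \<Rightarrow> nat) \<Rightarrow> complex"
  assumes fin_A: "finite A" and \<Delta>_eq: "\<Delta> z w = (\<Sum>p\<in>A. c p * monomial (fst p) z * cnj (monomial (snd p) w))"
begin

text \<open>The component that is homogeneous of degree \<open>k\<close> in the holomorphic
  variable; the antiholomorphic variable keeps all degrees.\<close>

definition part :: "nat \<Rightarrow> complex^'n \<Rightarrow> complex^'n \<Rightarrow> complex" where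
  "part k z w = (\<Sum>p\<in>{p\<in>A. deg (fst p) = k}. c p * monomial (fst p) z * cnj (monomial (snd p) w))"

text \<open>Only an upper bound for the degrees is wanted. The sum provides one and makes sense for
  empty \<open>A\<close>.\<close>

definition top_deg :: nat where
  "top_deg = (\<Sum>p\<in>A. deg (fst p))"

lemma deg_le_top: "p \<in> A \<Longrightarrow> deg (fst p) \<le> top_deg"
  unfolding top_deg_def by (rule member_le_sum) (auto simp: fin_A)

lemma expansion: "\<Delta> (s *s z) w = (\<Sum>k\<le>top_deg. s ^ k * part k z w)"
proof -
  have "(\<Sum>k\<le>top_deg. s ^ k * part k z w)
      = (\<Sum>k\<le>top_deg. \<Sum>p\<in>{p\<in>A. deg (fst p) = k}. s ^ deg (fst p) * (c p * monomial (fst p) z * cnj (monomial (snd p) w)))"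
    unfolding part_def sum_distrib_left by (intro sum.cong) auto
  also have "\<dots> = (\<Sum>p\<in>A. s ^ deg (fst p) * (c p * monomial (fst p) z * cnj (monomial (snd p) w)))"
    by (rule sum.group) (use fin_A deg_le_top in auto)
  also have "\<dots> = \<Delta> (s *s z) w" unfolding \<Delta>_eq monomial_scale by (intro sum.cong) (auto simp: mult_ac)
  finally show ?thesis by simp
qed

lemma holo_left: "holo_fun (\<lambda>z. \<Delta> z w) U"
  unfolding \<Delta>_eq by (intro holo_fun_sum holo_fun_mult holo_fun_const monomial_holo)

lemma continuous_monomial: "continuous_on S g \<Longrightarrow> continuous_on S (\<lambda>x. monomial a (g x))"
  unfolding monomial_def by (intro continuous_intros bounded_linear.continuous_on[OF bounded_linear_vec_nth])

lemma continuous_\<Delta>: "continuous_on S f \<Longrightarrow> continuous_on S g \<Longrightarrow> continuous_on S (\<lambda>x. \<Delta> (f x) (g x))"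
  unfolding \<Delta>_eq by (intro continuous_intros continuous_monomial)

lemma continuous_part: "continuous_on S g \<Longrightarrow> continuous_on S (\<lambda>x. part k z (g x))"
  unfolding part_def by (intro continuous_intros continuous_monomial)

lemma part_1_linear: "clinear_fun (\<lambda>z. part 1 z w)"
proof -
  have *: "monomial (fst p) (x + y) = monomial (fst p) x + monomial (fst p) y" "monomial (fst p) (s *s x) = s * monomial (fst p) x"
    if "deg (fst p) = 1" for p :: "('n \<Rightarrow> nat) \<times> ('n \<Rightarrow> nat)" and x y s
    using monomial_deg_1[OF that] by (metis vector_add_component, metis vector_smult_component)
  show ?thesis
    unfolding clinear_fun_iff part_def sum_distrib_left sum.distrib[symmetric]
    by (auto intro!: sum.cong simp: * algebra_simps)
qed

text \<open>Averaging against the roots of unity of an order larger than the degree extracts the linear part.\<close>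
lemma part_1_average:
  obtains m :: nat and \<omega> where "m > 0" "cmod \<omega> = 1"
    "\<And>z w. of_nat m * part 1 z w = (\<Sum>k<m. \<omega> ^ (k * (m - 1)) * \<Delta> (\<omega> ^ k *s z) w)"
proof -
  \<comment> \<open>The factor with exponent \<open>k * (m - 1)\<close> is the inverse of
    \<open>\<omega> ^ k\<close>, so degree \<open>j\<close> survives iff \<open>m\<close> divides
    \<open>m - 1 + j\<close>. For \<open>j \<le> top_deg\<close> this leaves \<open>j = 1\<close>;
    the summand 2 gives \<open>m \<ge> 2\<close> also if all degrees are zero.\<close>
  define m where "m = top_deg + 2"
  define \<omega> where "\<omega> = exp (2 * of_real pi * \<i> * of_nat 1 / of_nat m)"
  have m: "m \<ge> 2" by (simp add: m_def)
  have \<omega>j: "\<omega> ^ j = exp (2 * of_real pi * \<i> * of_nat j / of_nat m)" for j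
    unfolding \<omega>_def exp_of_nat_mult[symmetric] by (simp add: mult_ac)
  have \<omega>1: "\<omega> ^ j = 1 \<longleftrightarrow> m dvd j" for j
    unfolding \<omega>j using complex_root_unity_eq_1[of m j] m by simp
  have geo: "(\<Sum>k<m. \<omega> ^ (k * (m - 1)) * (\<omega> ^ k) ^ j) = (if j = 1 then of_nat m else 0)" if j: "j \<le> top_deg" for j
  proof -
    define x where "x = \<omega> ^ (m - 1 + j)"
    have "(\<Sum>k<m. \<omega> ^ (k * (m - 1)) * (\<omega> ^ k) ^ j) = (\<Sum>k<m. x ^ k)"
      unfolding x_def by (intro sum.cong) (auto simp: power_mult[symmetric] power_add[symmetric] algebra_simps)
    moreover have "x = 1 \<longleftrightarrow> j = 1"
    proof -
      have "m dvd m - 1 + j \<longleftrightarrow> j = 1"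
      proof
        assume d: "m dvd m - 1 + j"
        show "j = 1"
        proof (rule ccontr)
          assume "j \<noteq> 1"
          then consider "j = 0" | "j \<ge> 2" by linarith
          then show False
          proof cases
            case 1
            then show False using d m nat_dvd_not_less[of "m - 1" m] by simp
          next
            case 2
            then have "m - 1 + j = m + (j - 1)" using m by simp
            then have "m dvd j - 1" using d by simp
            moreover have "0 < j - 1" "j - 1 < m" using 2 j by (auto simp: m_def)
            ultimately show False using nat_dvd_not_less by blast
          qed
        qed
      qed (use m in simp)
      then show ?thesis unfolding x_def using \<omega>1 by simp
    qed
    moreover have "x ^ m = 1"
      unfolding x_def power_mult[symmetric] \<omega>1 by simp
    ultimately show ?thesis using geometric_sum[of x m] by auto
  qed
  have "(\<Sum>k<m. \<omega> ^ (k * (m - 1)) * \<Delta> (\<omega> ^ k *s z) w) = of_nat m * part 1 z w" for z w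
  proof -
    have "(\<Sum>k<m. \<omega> ^ (k * (m - 1)) * \<Delta> (\<omega> ^ k *s z) w)
        = (\<Sum>k<m. \<Sum>j\<le>top_deg. \<omega> ^ (k * (m - 1)) * (\<omega> ^ k) ^ j * part j z w)"
      unfolding expansion sum_distrib_left by (simp add: mult_ac)
    also have "\<dots> = (\<Sum>j\<le>top_deg. (\<Sum>k<m. \<omega> ^ (k * (m - 1)) * (\<omega> ^ k) ^ j) * part j z w)"
      unfolding sum_distrib_right by (rule sum.swap)
    also have "\<dots> = (\<Sum>j\<le>top_deg. if j = 1 then of_nat m * part 1 z w else 0)"
    proof (rule sum.cong[OF refl])
      fix j assume "j \<in> {..top_deg}"
      then have "j \<le> top_deg" by simp
      from geo[OF this] show "(\<Sum>k<m. \<omega> ^ (k * (m - 1)) * (\<omega> ^ k) ^ j) * part j z w = (if j = 1 then of_nat m * part 1 z w else 0)"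
        by (cases "j = 1") simp_all
    qed
    also have "\<dots> = of_nat m * part 1 z w"
    proof (cases "1 \<le> top_deg")
      case False
      then have "{p \<in> A. deg (fst p) = 1} = {}" using deg_le_top by fastforce
      then have "part 1 z w = 0" unfolding part_def by (simp only: sum.empty)
      then show ?thesis by simp
    qed simp
    finally show ?thesis .
  qed
  moreover have "cmod \<omega> = 1"
  proof -
    have "\<omega> = exp (\<i> * complex_of_real (2 * pi / real m))" by (simp add: \<omega>_def mult_ac)
    then show ?thesis by (simp only: norm_exp_i_times)
  qed
  ultimately show ?thesis using m by (intro that[of m \<omega>]) auto
qed

lemma bounded_left:
  assumes "bounded S"
  obtains B where "B > 0" "\<And>z. z \<in> S \<Longrightarrow> cmod (\<Delta> z w) \<le> B"
proof -
  have "compact ((\<lambda>z. \<Delta> z w) ` closure S)"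
    using assms by (intro compact_continuous_image continuous_\<Delta> continuous_on_id continuous_on_const) (simp add: compact_closure)
  then have "bounded ((\<lambda>z. \<Delta> z w) ` closure S)" by (rule compact_imp_bounded)
  then obtain B where "B > 0" "\<And>x. x \<in> (\<lambda>z. \<Delta> z w) ` closure S \<Longrightarrow> norm x \<le> B" unfolding bounded_pos by blast
  then show ?thesis using that[of B] closure_subset by blast
qed

end

text \<open>A continuous function with finite range is constant on a connected set. The lemma
  removes the exponent \<open>N\<close> from identities between powers.\<close>

lemma root_of_unity_constant:
  fixes q :: "'a::topological_space \<Rightarrow> complex"
  assumes S: "connected S" and q: "continuous_on S q" and N: "N > 0" and root: "\<And>x. x \<in> S \<Longrightarrow> q x ^ N = 1"
    and x0: "x0 \<in> S" "q x0 = 1" and x: "x \<in> S"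
  shows "q x = 1"
proof -
  have "finite {z :: complex. z ^ N = 1}" using N by (intro finite_roots_unity) simp
  then have "finite (q ` S)" by (rule finite_subset[rotated]) (use root in auto)
  then have "q constant_on S" using continuous_finite_range_constant[OF S q] by blast
  then show ?thesis using x0 x unfolding constant_on_def by metis
qed

text \<open>A real vector orthogonal to the subspace controls only the real part of the complex
  pairing. As the subspace is closed under multiplication by the imaginary unit, the imaginary part
  vanishes as well. Conjugating the entries makes the pairing bilinear.\<close>

lemma annihilator_exists:
  fixes X :: "(complex^'n) set"
  assumes sub: "vec.subspace X" and ne: "X \<noteq> UNIV"
  shows "\<exists>v. v \<noteq> 0 \<and> (\<forall>x\<in>X. (\<Sum>i\<in>UNIV. v $ i * x $ i) = 0)"
proof -
  have rs: "subspace X"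
    using vec.subspace_0[OF sub] vec.subspace_add[OF sub] vec.subspace_scale[OF sub]
    by (auto simp: subspace_def vec_scaleR)
  then have "span X \<noteq> UNIV" using ne span_eq_iff by metis
  then have "dim X < DIM(complex^'n)" using dim_eq_full[of X] dim_subset_UNIV[of X] by linarith
  then obtain y where y: "y \<noteq> 0" "\<And>x. x \<in> span X \<Longrightarrow> orthogonal y x"
    using orthogonal_to_subspace_exists[of X] by blast
  have Re: "Re (\<Sum>i\<in>UNIV. cnj (y $ i) * x $ i) = y \<bullet> x" for x
    by (simp add: inner_vec_def inner_complex_def)
  have "(\<Sum>i\<in>UNIV. cnj (y $ i) * x $ i) = 0" if x: "x \<in> X" for x
  proof (rule complex_eqI)
    show "Re (\<Sum>i\<in>UNIV. cnj (y $ i) * x $ i) = Re 0"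
      unfolding Re using y(2)[OF span_base[OF x]] by (simp add: orthogonal_def)
    have "\<i> *s x \<in> X" by (rule vec.subspace_scale[OF sub x])
    then have "Re (\<Sum>i\<in>UNIV. cnj (y $ i) * (\<i> *s x) $ i) = 0"
      unfolding Re using y(2)[OF span_base] unfolding orthogonal_def by blast
    moreover have "(\<Sum>i\<in>UNIV. cnj (y $ i) * (\<i> *s x) $ i) = \<i> * (\<Sum>i\<in>UNIV. cnj (y $ i) * x $ i)"
      by (simp add: sum_distrib_left mult_ac)
    ultimately have "Re (\<i> * (\<Sum>i\<in>UNIV. cnj (y $ i) * x $ i)) = 0" by (simp only:)
    then show "Im (\<Sum>i\<in>UNIV. cnj (y $ i) * x $ i) = Im 0"
      unfolding Re_i_times neg_equal_0_iff_equal by (simp only: zero_complex.sel)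
  qed
  moreover have "(\<chi> i. cnj (y $ i)) \<noteq> 0" using y(1) by (auto simp: vec_eq_iff)
  ultimately show ?thesis by (intro exI[of _ "\<chi> i. cnj (y $ i)"]) auto
qed

section \<open>The Jordan triple determinant under automorphisms\<close>

text \<open>The domain side of the argument: a connected circular domain containing the origin, with
  a Bergman kernel that is a power of the inverse of a polynomial. The spectral unit ball enters the
  transformation rule through these properties.\<close>

locale circular_kernel = bounded_open \<Omega> + sesqui_polynomial \<Delta> A c
  for \<Omega> :: "(complex^'n) set" and \<Delta> :: "complex^'n \<Rightarrow> complex^'n \<Rightarrow> complex"
    and A :: "(('n \<Rightarrow> nat) \<times> ('n \<Rightarrow> nat)) set" and c :: "('n \<Rightarrow> nat) \<times> ('n \<Rightarrow> nat) \<Rightarrow> complex" +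
  fixes N :: nat
  assumes connected_\<Omega>: "connected \<Omega>" and zero_in: "0 \<in> \<Omega>"
    and circular: "z \<in> \<Omega> \<Longrightarrow> cmod u = 1 \<Longrightarrow> u *s z \<in> \<Omega>"
    and N_pos: "N > 0" and \<Delta>_00: "\<Delta> 0 0 = 1" and \<Delta>_nz: "z \<in> \<Omega> \<Longrightarrow> w \<in> \<Omega> \<Longrightarrow> \<Delta> z w \<noteq> 0"
    and kernel: "is_bergman_kernel \<Omega> v (\<lambda>z w. 1 / \<Delta> z w ^ N)"
begin

lemma rotation_automorphism:
  assumes u: "cmod u = 1"
  shows "automorphism \<Omega> (\<lambda>z. u *s z)"
proof -
  have cu: "cnj u * u = 1" "u * cnj u = 1" "cmod (cnj u) = 1" using u complex_norm_square[of u] by (auto simp: mult.commute)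
  have bij: "bij_betw (\<lambda>z. u *s z) \<Omega> \<Omega>"
    by (rule bij_betw_byWitness[of _ "\<lambda>z. cnj u *s z"]) (use circular u cu in \<open>auto simp: vector_smult_assoc\<close>)
  have hol: "holo_map (\<lambda>z. u *s z) \<Omega>" for u :: complex using holo_map_affine[of 0 u \<Omega>] by simp
  have "holo_map (the_inv_into \<Omega> (\<lambda>z. u *s z)) \<Omega>"
  proof (rule holo_map_cong[OF open_\<Omega>' hol[of "cnj u"]])
    fix z assume z: "z \<in> \<Omega>"
    show "cnj u *s z = the_inv_into \<Omega> (\<lambda>z. u *s z) z"
      by (rule the_inv_into_f_eq[symmetric])
        (use bij circular[OF z cu(3)] cu in \<open>auto simp: bij_betw_def vector_smult_assoc\<close>)
  qed
  then show ?thesis using bij hol by (simp add: biholo_def)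
qed

lemma \<Delta>_rotation_power:
  assumes u: "cmod u = 1" and z: "z \<in> \<Omega>" and w: "w \<in> \<Omega>"
  shows "\<Delta> (u *s z) (u *s w) ^ N = \<Delta> z w ^ N"
proof -
  have J: "det (jacobian (\<lambda>z. u *s z) x) = u ^ CARD('n)" for x :: "complex^'n"
    using jacobian_affine[of 0 u x] by (simp add: det_diag_mat)
  have "u ^ CARD('n) * cnj (u ^ CARD('n)) = 1"
    using u complex_norm_square[of "u ^ CARD('n)"] by (simp add: norm_power)
  then have "1 / \<Delta> z w ^ N = 1 / \<Delta> (u *s z) (u *s w) ^ N"
    using kernel_transformation[OF kernel rotation_automorphism[OF u] z w] unfolding J
    by (simp add: mult.commute mult.left_commute divide_inverse)
  then show ?thesis using \<Delta>_nz[OF z w] \<Delta>_nz[OF circular[OF z u] circular[OF w u]] by (simp add: field_simps)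
qed

text \<open>By invariance under rotations, the polynomial in \<zeta> obtained from
  \<open>\<zeta> *s z\<close> is constant on the unit circle, and its mean there is the value 1 at
  the centre. The kernel identity is applied on the circle only; inside the disc, holomorphy of the
  polynomial on the whole space suffices.\<close>

lemma \<Delta>_z0_power:
  assumes z: "z \<in> \<Omega>"
  shows "\<Delta> z 0 ^ N = 1"
proof -
  define p where "p \<zeta> = \<Delta> (0 + \<zeta> *s z) 0 ^ N" for \<zeta>
  have "p holomorphic_on cball 0 1"
    unfolding p_def by (rule line_holomorphic[OF holo_fun_power[OF holo_left[of _ UNIV]]]) simp
  from circle_mean[OF this]
  have m: "((\<lambda>t. p (exp (2 * of_real pi * \<i> * of_real t))) has_integral p 0) {0..1}" .
  have "p (exp (2 * of_real pi * \<i> * of_real t)) = \<Delta> z 0 ^ N" for t :: real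
    using \<Delta>_rotation_power[of "exp (2 * of_real pi * \<i> * of_real t)" z 0] z zero_in by (simp add: p_def)
  then have "((\<lambda>t::real. \<Delta> z 0 ^ N) has_integral p 0) {0..1}" using m by simp
  moreover have "((\<lambda>t::real. \<Delta> z 0 ^ N) has_integral \<Delta> z 0 ^ N) {0..1}"
    using has_integral_const_real[of "\<Delta> z 0 ^ N" 0 1] by simp
  ultimately have "p 0 = \<Delta> z 0 ^ N" by (rule has_integral_unique)
  then show ?thesis by (simp add: p_def \<Delta>_00)
qed

text \<open>The quotient of the two functions is a continuous root of unity on the connected set
  \<open>\<Omega> \<times> \<Omega>\<close>, so agreement at a single diagonal point
  decides.\<close>

lemma \<Delta>_eqI:
  assumes "continuous_on (\<Omega> \<times> \<Omega>) (\<lambda>x. f (fst x) (snd x))" "continuous_on (\<Omega> \<times> \<Omega>) (\<lambda>x. g (fst x) (snd x))"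
    and nz: "\<And>z w. z \<in> \<Omega> \<Longrightarrow> w \<in> \<Omega> \<Longrightarrow> g z w \<noteq> (0 :: complex)"
    and pow: "\<And>z w. z \<in> \<Omega> \<Longrightarrow> w \<in> \<Omega> \<Longrightarrow> f z w ^ N = g z w ^ N"
    and b: "b \<in> \<Omega>" "f b b = g b b" and zw: "z \<in> \<Omega>" "w \<in> \<Omega>"
  shows "f z w = g z w"
proof -
  define q where "q x = f (fst x) (snd x) / g (fst x) (snd x)" for x
  have "q (z, w) = 1"
  proof (rule root_of_unity_constant[where S = "\<Omega> \<times> \<Omega>" and q = q and ?x0.0 = "(b, b)", OF _ _ N_pos])
    show "connected (\<Omega> \<times> \<Omega>)" by (intro connected_Times connected_\<Omega>)
    show "continuous_on (\<Omega> \<times> \<Omega>) q"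
      unfolding q_def using assms(1,2) nz by (intro continuous_on_divide) auto
    show "q x ^ N = 1" if "x \<in> \<Omega> \<times> \<Omega>" for x
      using that pow[of "fst x" "snd x"] nz[of "fst x" "snd x"] by (auto simp: q_def power_divide)
    show "q (b, b) = 1" using b nz[of b b] by (simp add: q_def)
  qed (use b zw in auto)
  then show ?thesis using nz[OF zw] by (simp add: q_def)
qed

lemma \<Delta>_z0: "z \<in> \<Omega> \<Longrightarrow> \<Delta> z 0 = 1"
  by (rule \<Delta>_eqI[of "\<lambda>z w. \<Delta> z 0" "\<lambda>z w. 1" 0 z 0])
    (use zero_in \<Delta>_z0_power \<Delta>_00 in \<open>auto intro!: continuous_\<Delta> continuous_on_fst continuous_on_id continuous_on_const\<close>)

lemma \<Delta>_hermitian: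
  assumes "z \<in> \<Omega>" "w \<in> \<Omega>"
  shows "\<Delta> z w = cnj (\<Delta> w z)"
proof (rule \<Delta>_eqI[of \<Delta> "\<lambda>z w. cnj (\<Delta> w z)" 0 z w])
  show "\<Delta> z w ^ N = cnj (\<Delta> w z) ^ N" if "z \<in> \<Omega>" "w \<in> \<Omega>" for z w
    using kernel_hermitian[OF kernel that(2,1)] \<Delta>_nz[OF that] \<Delta>_nz[OF that(2,1)] by (simp add: field_simps)
qed (use zero_in \<Delta>_00 \<Delta>_nz assms in \<open>auto intro!: continuous_\<Delta> continuous_on_fst continuous_on_snd continuous_on_id continuous_on_cnj\<close>)

lemma \<Delta>_rotation:
  assumes u: "cmod u = 1" and "z \<in> \<Omega>" "w \<in> \<Omega>"
  shows "\<Delta> (u *s z) (u *s w) = \<Delta> z w"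
proof (rule \<Delta>_eqI[of "\<lambda>z w. \<Delta> (u *s z) (u *s w)" \<Delta> 0 z w])
  have cont: "continuous_on S (\<lambda>x. u *s f x)" if "continuous_on S f" for S and f :: "(complex^'n) \<times> (complex^'n) \<Rightarrow> complex^'n"
    by (intro bounded_bilinear.continuous_on[OF bounded_bilinear_vec_scale] continuous_on_const that)
  show "continuous_on (\<Omega> \<times> \<Omega>) (\<lambda>x. \<Delta> (u *s fst x) (u *s snd x))"
    by (intro continuous_\<Delta> cont continuous_on_fst continuous_on_snd continuous_on_id)
qed (use assms zero_in \<Delta>_nz \<Delta>_rotation_power in \<open>auto intro!: continuous_\<Delta> continuous_on_fst continuous_on_snd continuous_on_id\<close>)

text \<open>The kernel is a squared norm on the diagonal, so the phase of
  \<open>\<Delta> x x\<close> is a root of unity. It is continuous and equals 1 at the origin. This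
  makes the weight of \<mu> positive and continuous.\<close>

lemma \<Delta>_diagonal_pos:
  assumes z: "z \<in> \<Omega>"
  shows "Im (\<Delta> z z) = 0" "Re (\<Delta> z z) > 0"
proof -
  define q where "q x = \<Delta> x x / complex_of_real (cmod (\<Delta> x x))" for x
  have "q z = 1"
  proof (rule root_of_unity_constant[OF connected_\<Omega> _ N_pos _ zero_in])
    show "continuous_on \<Omega> q"
      unfolding q_def using \<Delta>_nz by (intro continuous_on_divide continuous_\<Delta> continuous_on_of_real continuous_on_norm continuous_on_id) auto
    fix x assume x: "x \<in> \<Omega>"
    define r where "r = (l2_norm v (kernel_at (\<lambda>z w. 1 / \<Delta> z w ^ N) x))\<^sup>2"
    have r: "1 / \<Delta> x x ^ N = complex_of_real r" unfolding r_def by (rule kernel_diagonal[OF kernel x])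
    have nz: "\<Delta> x x \<noteq> 0" by (rule \<Delta>_nz[OF x x])
    have "r \<ge> 0" by (simp add: r_def)
    have "cmod (1 / \<Delta> x x ^ N) = r" unfolding r using \<open>r \<ge> 0\<close> by simp
    then have r': "r = 1 / cmod (\<Delta> x x) ^ N" by (simp add: norm_divide norm_power)
    have "1 / \<Delta> x x ^ N = 1 / complex_of_real (cmod (\<Delta> x x)) ^ N" using r unfolding r' by simp
    then show "q x ^ N = 1" using nz by (simp add: q_def power_divide)
  qed (use z in \<open>simp_all add: q_def \<Delta>_00\<close>)
  then have "\<Delta> z z = complex_of_real (cmod (\<Delta> z z))" using \<Delta>_nz[OF z z] by (simp add: q_def)
  then show "Im (\<Delta> z z) = 0" "Re (\<Delta> z z) > 0" using \<Delta>_nz[OF z z] by (metis Im_complex_of_real, metis Re_complex_of_real zero_less_norm_iff)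
qed

theorem determinant_transformation:
  assumes b: "automorphism \<Omega> \<phi>" and z: "z \<in> \<Omega>" and w: "w \<in> \<Omega>"
  defines "a \<equiv> the_inv_into \<Omega> \<phi> 0"
  shows "\<Delta> (\<phi> z) (\<phi> w) * \<Delta> z a * \<Delta> a w = \<Delta> z w * \<Delta> a a"
proof -
  have a: "a \<in> \<Omega>" "\<phi> a = 0" unfolding a_def using biholoD[OF b] zero_in by auto
  have \<phi>: "\<phi> x \<in> \<Omega>" if "x \<in> \<Omega>" for x using biholoD(5)[OF b that] .
  define J where "J x = det (jacobian \<phi> x)" for x
  have tr: "1 / \<Delta> x y ^ N = J x * (1 / \<Delta> (\<phi> x) (\<phi> y) ^ N) * cnj (J y)" if "x \<in> \<Omega>" "y \<in> \<Omega>" for x y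
    unfolding J_def by (rule kernel_transformation[OF kernel b that])
  have Ka: "1 / \<Delta> x a ^ N = J x * cnj (J a)" if x: "x \<in> \<Omega>" for x
    using tr[OF x a(1)] \<Delta>_z0_power[OF \<phi>[OF x]] by (simp add: a)
  have pow: "(\<Delta> (\<phi> x) (\<phi> y) * \<Delta> x a * \<Delta> a y) ^ N = (\<Delta> x y * \<Delta> a a) ^ N" if x: "x \<in> \<Omega>" and y: "y \<in> \<Omega>" for x y
  proof -
    have "1 / \<Delta> a y ^ N = J a * cnj (J y)"
      using Ka[OF y] \<Delta>_hermitian[OF a(1) y] by (metis complex_cnj_cnj complex_cnj_divide complex_cnj_mult complex_cnj_one complex_cnj_power mult.commute)
    then have "(1 / \<Delta> (\<phi> x) (\<phi> y) ^ N) * (1 / \<Delta> x a ^ N) * (1 / \<Delta> a y ^ N) = (1 / \<Delta> x y ^ N) * (1 / \<Delta> a a ^ N)"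
      unfolding tr[OF x y] Ka[OF x] Ka[OF a(1)] by (simp add: mult_ac)
    then show ?thesis
      using \<Delta>_nz[OF \<phi>[OF x] \<phi>[OF y]] \<Delta>_nz[OF x a(1)] \<Delta>_nz[OF a(1) y] \<Delta>_nz[OF x y] \<Delta>_nz[OF a(1) a(1)]
      by (simp add: power_mult_distrib field_simps)
  qed
  note \<phi>c = holo_map_continuous_on[OF biholoD(2)[OF b]]
  \<comment> \<open>The base point is \<open>a\<close>: since \<open>\<phi> a = 0\<close> and
    \<open>\<Delta> 0 0 = 1\<close>, both sides equal \<open>\<Delta> a a * \<Delta> a a\<close>
    there.\<close>
  show ?thesis
  proof (rule \<Delta>_eqI[of "\<lambda>z w. \<Delta> (\<phi> z) (\<phi> w) * \<Delta> z a * \<Delta> a w" "\<lambda>z w. \<Delta> z w * \<Delta> a a" a])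
    show "continuous_on (\<Omega> \<times> \<Omega>) (\<lambda>x. \<Delta> (\<phi> (fst x)) (\<phi> (snd x)) * \<Delta> (fst x) a * \<Delta> a (snd x))"
      by (intro continuous_on_mult continuous_\<Delta> continuous_on_compose2[OF \<phi>c] continuous_on_fst continuous_on_snd continuous_on_id continuous_on_const) auto
    show "continuous_on (\<Omega> \<times> \<Omega>) (\<lambda>x. \<Delta> (fst x) (snd x) * \<Delta> a a)"
      by (intro continuous_on_mult continuous_\<Delta> continuous_on_fst continuous_on_snd continuous_on_id continuous_on_const)
  qed (use pow a z w \<Delta>_nz \<Delta>_00 in auto)
qed

text \<open>With \<open>w = 0\<close> the transformation rule reads
  \<open>\<Delta> (\<phi> z) (\<phi> 0) * \<Delta> z a = \<Delta> a a\<close>. The first factor is a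
  polynomial on a bounded set, so the second cannot come close to zero.\<close>

lemma denominator_bounded_below:
  assumes b: "automorphism \<Omega> \<phi>"
  obtains \<delta> where "\<delta> > 0" "\<And>z. z \<in> \<Omega> \<Longrightarrow> \<delta> \<le> cmod (\<Delta> z (the_inv_into \<Omega> \<phi> 0))"
proof -
  define a where "a = the_inv_into \<Omega> \<phi> 0"
  have a: "a \<in> \<Omega>" unfolding a_def using biholoD(6)[OF b zero_in] .
  obtain B where B: "B > 0" "\<And>z. z \<in> \<Omega> \<Longrightarrow> cmod (\<Delta> z (\<phi> 0)) \<le> B" using bounded_left[OF bounded_\<Omega>] by blast
  have "cmod (\<Delta> a a) / B \<le> cmod (\<Delta> z a)" if z: "z \<in> \<Omega>" for z
  proof -
    have "\<Delta> (\<phi> z) (\<phi> 0) * \<Delta> z a = \<Delta> a a"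
      using determinant_transformation[OF b z zero_in] \<Delta>_z0[OF z] \<Delta>_z0[OF a] by (simp add: a_def)
    then have "cmod (\<Delta> a a) = cmod (\<Delta> (\<phi> z) (\<phi> 0)) * cmod (\<Delta> z a)" by (metis norm_mult)
    also have "\<dots> \<le> B * cmod (\<Delta> z a)" using B(2)[OF biholoD(5)[OF b z]] by (intro mult_right_mono) auto
    finally show ?thesis using B(1) by (simp add: divide_le_eq mult.commute)
  qed
  then show ?thesis using that[of "cmod (\<Delta> a a) / B"] \<Delta>_nz[OF a a] B(1) by (simp add: a_def)
qed

text \<open>Let k(w) be the kernel function at w and move w = t x away from the origin. If the
  linear part vanishes, then \<open>\<Delta> w w\<close> is 1 + o(t^2), and so the squared norm of
  k(w) - k(0) is o(t^2). Pairing this difference with the i-th coordinate function gives t times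
  \<open>x $ i\<close>, and Cauchy-Schwarz bounds its square by o(t^2). Hence every coordinate of
  \<open>x\<close> is zero.\<close>

lemma linear_part_nondegenerate:
  assumes L: "\<And>w. w \<in> \<Omega> \<Longrightarrow> part 1 x w = 0"
  shows "x = 0"
proof -
  let ?K = "\<lambda>z w. 1 / \<Delta> z w ^ N"
  obtain r where r: "r > 0" "ball 0 r \<subseteq> \<Omega>" using open_\<Omega>' zero_in open_contains_ball by blast
  define T where "T = r / (norm x + 1)"
  have x1: "norm x + 1 > 0" by (simp add: add_nonneg_pos)
  have T: "T > 0" using r x1 by (simp add: T_def)
  have in\<Omega>: "complex_of_real t *s x \<in> \<Omega>" if "0 < t" "t < T" for t
  proof -
    have "t * norm x \<le> t * (norm x + 1)" using that by (intro mult_left_mono) auto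
    also have "\<dots> < T * (norm x + 1)" using that x1 by (intro mult_strict_right_mono) auto
    also have "\<dots> = r" using x1 by (simp add: T_def)
    finally show ?thesis using r that by (auto simp: norm_vec_scale)
  qed
  \<comment> \<open>Subtracting the value at second argument 0 is legitimate, as
    \<open>\<Delta> z 0 = 1\<close>, and it makes \<open>R 0 = 0\<close>. This gains the decisive
    o(t^2) over a mere O(t^2).\<close>
  define R where "R t = (\<Sum>k\<in>{2..top_deg}. complex_of_real t ^ (k - 2) * (part k x (complex_of_real t *s x) - part k x 0))" for t
  define D where "D t = \<Delta> (complex_of_real t *s x) (complex_of_real t *s x)" for t
  have D_eq: "D t = 1 + complex_of_real (t\<^sup>2) * R t" if t: "0 < t" "t < T" for t
  proof -
    let ?w = "complex_of_real t *s x" and ?s = "complex_of_real t"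
    have w: "?w \<in> \<Omega>" by (rule in\<Omega>[OF t])
    have p0: "part 0 x w = \<Delta> 0 w" for w
    proof -
      have "\<Delta> (0 *s x) w = part 0 x w"
        unfolding expansion by (simp add: power_0_left if_distrib[of "\<lambda>a. a * _"] cong: if_cong)
      then show ?thesis by simp
    qed
    have "\<Delta> 0 ?w = 1" using \<Delta>_hermitian[OF zero_in w] \<Delta>_z0[OF w] by simp
    then have p0': "part 0 x ?w - part 0 x 0 = 0" by (simp add: p0 \<Delta>_00)
    have p1': "part 1 x ?w - part 1 x 0 = 0" using L[OF w] L[OF zero_in] by simp
    have "D t - 1 = \<Delta> (?s *s x) ?w - \<Delta> (?s *s x) 0" using \<Delta>_z0[OF w] by (simp add: D_def)
    also have "\<dots> = (\<Sum>k\<le>top_deg. ?s ^ k * (part k x ?w - part k x 0))"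
      unfolding expansion by (simp add: sum_subtractf right_diff_distrib)
    also have "\<dots> = (\<Sum>k\<in>{2..top_deg}. ?s ^ k * (part k x ?w - part k x 0))"
    proof (rule sum.mono_neutral_right)
      show "\<forall>k\<in>{..top_deg} - {2..top_deg}. ?s ^ k * (part k x ?w - part k x 0) = 0"
      proof
        fix k assume "k \<in> {..top_deg} - {2..top_deg}"
        then have "k = 0 \<or> k = 1" by auto
        then show "?s ^ k * (part k x ?w - part k x 0) = 0" using p0' p1' by auto
      qed
    qed auto
    also have "\<dots> = (\<Sum>k\<in>{2..top_deg}. ?s\<^sup>2 * (?s ^ (k - 2) * (part k x ?w - part k x 0)))"
    proof (rule sum.cong[OF refl])
      fix k assume "k \<in> {2..top_deg}"
      then have "?s ^ k = ?s\<^sup>2 * ?s ^ (k - 2)" by (metis atLeastAtMost_iff le_add_diff_inverse power_add)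
      then show "?s ^ k * (part k x ?w - part k x 0) = ?s\<^sup>2 * (?s ^ (k - 2) * (part k x ?w - part k x 0))"
        by (simp add: mult.assoc)
    qed
    also have "\<dots> = ?s\<^sup>2 * R t" by (simp add: R_def sum_distrib_left)
    finally show ?thesis by (simp add: algebra_simps)
  qed
  have cw: "continuous_on UNIV (\<lambda>t. complex_of_real t *s x)"
    by (intro bounded_bilinear.continuous_on[OF bounded_bilinear_vec_scale] continuous_intros)
  have contR: "isCont R 0"
  proof -
    have "continuous_on UNIV R" unfolding R_def
      by (intro continuous_intros continuous_part cw)
    then show ?thesis by (simp add: continuous_on_eq_continuous_at)
  qed
  have contD: "isCont D 0"
  proof -
    have "continuous_on UNIV D" unfolding D_def by (intro continuous_\<Delta> cw)
    then show ?thesis by (simp add: continuous_on_eq_continuous_at)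
  qed
  have R0: "R 0 = 0"
  proof -
    have "complex_of_real 0 *s x = 0" by (simp add: vec_eq_iff)
    then show ?thesis by (simp add: R_def)
  qed
  have D0: "D 0 = 1"
  proof -
    have "complex_of_real 0 *s x = 0" by (simp add: vec_eq_iff)
    then show ?thesis by (simp add: D_def \<Delta>_00)
  qed
  have "x $ i = 0" for i
  proof -
    define f where "f = (\<lambda>z. if z \<in> \<Omega> then z $ i else 0)"
    obtain B where B: "\<And>z. z \<in> \<Omega> \<Longrightarrow> norm z \<le> B" using bounded_\<Omega> bounded_iff by metis
    have f: "f \<in> A2v"
      unfolding f_def by (rule N.A2_bounded[OF holo_fun_coord]) (use order_trans[OF Finite_Cartesian_Product.norm_nth_le B] in blast)
    \<comment> \<open>The quotient of \<open>1 / D t ^ N - 1\<close> by \<open>t\<^sup>2\<close>,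
      written through the geometric sum so that continuity at 0 and \<open>E 0 = 0\<close> are
      visible.\<close>
    define E where "E t = - R t * (\<Sum>j<N. D t ^ j) / D t ^ N" for t
    have est: "(cmod (x $ i))\<^sup>2 \<le> (l2_norm v f)\<^sup>2 * Re (E t)" if t: "0 < t" "t < T" for t
    proof -
      let ?w = "complex_of_real t *s x"
      have w: "?w \<in> \<Omega>" by (rule in\<Omega>[OF t])
      define k where "k = kernel_at ?K"
      have kw: "k ?w \<in> A2v" and k0: "k 0 \<in> A2v" unfolding k_def using kernel_at_A2[OF kernel] w zero_in by auto
      have ipw: "l2_inner v g (k ?w) = g ?w" and ip0: "l2_inner v g (k 0) = g 0" if "g \<in> A2v" for g
        unfolding k_def using kernel_reproduces[OF kernel _ that] w zero_in by auto
      have "\<Delta> 0 ?w = 1" using \<Delta>_hermitian[OF zero_in w] \<Delta>_z0[OF w] by simp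
      then have vals: "k ?w ?w = 1 / D t ^ N" "k 0 ?w = 1" "k ?w 0 = 1" "k 0 0 = 1"
        using w zero_in \<Delta>_z0[OF w] \<Delta>_00 by (simp_all add: k_def kernel_at_apply[OF kernel] D_def)
      have "complex_of_real t * x $ i = l2_inner v f (\<lambda>z. k ?w z - k 0 z)"
        using N.A2.ip_diff_right[OF kw k0 f] ipw[OF f] ip0[OF f] w zero_in by (simp add: f_def)
      then have "cmod (complex_of_real t * x $ i) \<le> l2_norm v f * l2_norm v (\<lambda>z. k ?w z - k 0 z)"
        using N.A2.cauchy_schwarz[OF f N.A2_diff[OF kw k0]] by simp
      then have "(cmod (complex_of_real t * x $ i))\<^sup>2 \<le> (l2_norm v f * l2_norm v (\<lambda>z. k ?w z - k 0 z))\<^sup>2"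
        by (intro power_mono) auto
      then have "t\<^sup>2 * (cmod (x $ i))\<^sup>2 \<le> (l2_norm v f)\<^sup>2 * (l2_norm v (\<lambda>z. k ?w z - k 0 z))\<^sup>2"
        by (simp add: norm_mult power_mult_distrib)
      also have "(l2_norm v (\<lambda>z. k ?w z - k 0 z))\<^sup>2 = Re (1 / D t ^ N - 1)"
        using N.A2.nm_diff_sq[OF kw k0] ipw[OF kw] ip0[OF k0] ip0[OF kw] vals
        unfolding N.A2.Re_ip_self[symmetric] by simp
      also have "1 / D t ^ N - 1 = complex_of_real (t\<^sup>2) * E t"
      proof -
        have nz: "D t \<noteq> 0" unfolding D_def by (rule \<Delta>_nz[OF w w])
        have "1 / D t ^ N - 1 = (1 - D t ^ N) / D t ^ N" using nz by (simp add: diff_divide_distrib)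
        also have "1 - D t ^ N = (1 - D t) * (\<Sum>j<N. D t ^ j)" by (rule one_diff_power_eq)
        also have "1 - D t = - complex_of_real (t\<^sup>2) * R t" unfolding D_eq[OF t] by simp
        finally show ?thesis by (simp add: E_def)
      qed
      also have "Re (complex_of_real (t\<^sup>2) * E t) = t\<^sup>2 * Re (E t)" by (simp del: of_real_power)
      finally have "t\<^sup>2 * (cmod (x $ i))\<^sup>2 \<le> t\<^sup>2 * ((l2_norm v f)\<^sup>2 * Re (E t))" by (simp add: mult_ac)
      then show ?thesis using t by (simp add: mult_le_cancel_left_pos)
    qed
    have "isCont E 0"
      unfolding E_def using contR contD D0 by (intro continuous_intros) auto
    then have "(\<lambda>t. (l2_norm v f)\<^sup>2 * Re (E t)) \<midarrow>0\<rightarrow> (l2_norm v f)\<^sup>2 * Re (E 0)"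
      by (intro tendsto_mult tendsto_const tendsto_Re) (simp add: isCont_def)
    then have "((\<lambda>t. (l2_norm v f)\<^sup>2 * Re (E t)) \<longlongrightarrow> (l2_norm v f)\<^sup>2 * Re (E 0)) (at_right 0)"
      by (rule filterlim_mono) (auto simp: at_within_le_at)
    moreover have "E 0 = 0" by (simp add: E_def R0)
    ultimately have lim: "((\<lambda>t. (l2_norm v f)\<^sup>2 * Re (E t)) \<longlongrightarrow> 0) (at_right 0)" by simp
    have "\<forall>\<^sub>F t in at_right 0. (cmod (x $ i))\<^sup>2 \<le> (l2_norm v f)\<^sup>2 * Re (E t)"
      unfolding eventually_at_right_field using est T by blast
    then have "(cmod (x $ i))\<^sup>2 \<le> 0"
      by (rule tendsto_lowerbound[OF lim]) simp
    then show ?thesis by simp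
  qed
  then show ?thesis by (simp add: vec_eq_iff)
qed

text \<open>The coordinate functions are, on \<open>\<Omega>\<close>, linear combinations of the functions \<open>\<lambda>z. \<Delta> z u\<close>.\<close>
lemma coordinate_in_span:
  assumes add: "\<And>f h. P f \<Longrightarrow> P h \<Longrightarrow> P (\<lambda>z. f z + h z)"
    and scale: "\<And>a f. P f \<Longrightarrow> P (\<lambda>z. a * f z)"
    and cong: "\<And>f h. P f \<Longrightarrow> (\<And>z. z \<in> \<Omega> \<Longrightarrow> f z = h z) \<Longrightarrow> P h"
    and \<Delta>: "\<And>u. u \<in> \<Omega> \<Longrightarrow> P (\<lambda>z. \<Delta> (g z) u)" and g: "\<And>z. z \<in> \<Omega> \<Longrightarrow> g z \<in> \<Omega>"
  shows "P (\<lambda>z. g z $ i)"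
proof -
  have P0: "P (\<lambda>z. 0)" using scale[OF \<Delta>[OF zero_in], of 0] by simp
  have Psum: "P (\<lambda>z. \<Sum>k\<in>F. f k z)" if "finite F" "\<And>k. k \<in> F \<Longrightarrow> P (f k)" for F :: "nat set" and f
    using that by (induction F rule: finite_induct) (auto intro: P0 add)
  \<comment> \<open>The coefficient vectors of linear forms that satisfy \<open>P\<close> after
    composition with \<open>g\<close>. The aim is to show that this subspace is everything: a vector
    annihilating it has vanishing linear part, which is excluded by nondegeneracy.\<close>
  define X where "X = {x. P (\<lambda>z. \<Sum>j\<in>UNIV. g z $ j * x $ j)}"
  have sub: "vec.subspace X"
    unfolding X_def
  proof (rule vec.subspaceI; unfold mem_Collect_eq)
    show "P (\<lambda>z. \<Sum>j\<in>UNIV. g z $ j * 0 $ j)" using P0 by simp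
    fix x y :: "complex^'n" assume "P (\<lambda>z. \<Sum>j\<in>UNIV. g z $ j * x $ j)" "P (\<lambda>z. \<Sum>j\<in>UNIV. g z $ j * y $ j)"
    from add[OF this] show "P (\<lambda>z. \<Sum>j\<in>UNIV. g z $ j * (x + y) $ j)"
      by (simp add: distrib_left sum.distrib)
  next
    fix s and x :: "complex^'n" assume "P (\<lambda>z. \<Sum>j\<in>UNIV. g z $ j * x $ j)"
    from scale[OF this, of s] show "P (\<lambda>z. \<Sum>j\<in>UNIV. g z $ j * (s *s x) $ j)"
      by (simp add: sum_distrib_left mult_ac)
  qed
  obtain m \<omega> where m: "m > 0" "cmod \<omega> = 1"
    and avg: "\<And>z w. of_nat m * part 1 z w = (\<Sum>k<m. \<omega> ^ (k * (m - 1)) * \<Delta> (\<omega> ^ k *s z) w)"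
    using part_1_average by blast
  have xw: "(\<chi> j. part 1 (axis j 1) w) \<in> X" if w: "w \<in> \<Omega>" for w
  proof -
    have "P (\<lambda>z. inverse (of_nat m) * (\<Sum>k<m. \<omega> ^ (k * (m - 1)) * \<Delta> (g z) (cnj (\<omega> ^ k) *s w)))"
      by (intro scale Psum \<Delta> circular w) (use m in \<open>auto simp: norm_power\<close>)
    then have "P (\<lambda>z. \<Sum>j\<in>UNIV. g z $ j * (\<chi> j. part 1 (axis j 1) w) $ j)"
    proof (rule cong)
      fix z assume z: "z \<in> \<Omega>"
      \<comment> \<open>Invariance under rotations moves the root of unity to the second argument,
        so the average becomes a combination of functions to which the hypothesis on
        \<open>\<Delta> (g z) u\<close> applies.\<close>
      have "\<Delta> (\<omega> ^ k *s g z) w = \<Delta> (g z) (cnj (\<omega> ^ k) *s w)" for k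
      proof -
        have 1: "cmod (\<omega> ^ k) = 1" "cmod (cnj (\<omega> ^ k)) = 1" using m(2) by (simp_all add: norm_power)
        have "\<omega> ^ k *s (cnj (\<omega> ^ k) *s w) = w"
          using complex_norm_square[of "\<omega> ^ k"] 1 by (simp add: vector_smult_assoc)
        then show ?thesis using \<Delta>_rotation[OF 1(1) g[OF z] circular[OF w 1(2)]] by simp
      qed
      then have "inverse (of_nat m) * (\<Sum>k<m. \<omega> ^ (k * (m - 1)) * \<Delta> (g z) (cnj (\<omega> ^ k) *s w)) = part 1 (g z) w"
        using avg[of "g z" w, symmetric] m(1) by simp
      also have "\<dots> = (\<Sum>j\<in>UNIV. g z $ j * (\<chi> j. part 1 (axis j 1) w) $ j)"
        using clinear_fun_expansion[OF part_1_linear, of "g z" w] by (simp add: mult.commute)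
      finally show "inverse (of_nat m) * (\<Sum>k<m. \<omega> ^ (k * (m - 1)) * \<Delta> (g z) (cnj (\<omega> ^ k) *s w))
        = (\<Sum>j\<in>UNIV. g z $ j * (\<chi> j. part 1 (axis j 1) w) $ j)" .
    qed
    then show ?thesis by (simp add: X_def)
  qed
  have "X = UNIV"
  proof (rule ccontr)
    assume "X \<noteq> UNIV"
    then obtain y where y: "y \<noteq> 0" "\<And>x. x \<in> X \<Longrightarrow> (\<Sum>i\<in>UNIV. y $ i * x $ i) = 0"
      using annihilator_exists[OF sub] by blast
    have "part 1 y w = 0" if "w \<in> \<Omega>" for w
      using y(2)[OF xw[OF that]] clinear_fun_expansion[OF part_1_linear, of y w] by (simp add: mult.commute)
    then show False using linear_part_nondegenerate y(1) by blast
  qed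
  then have "axis i 1 \<in> X" by simp
  then show ?thesis by (simp add: X_def axis_def if_distrib[of "\<lambda>a. _ * a"] cong: if_cong)
qed

end

section \<open>Commutators in Schatten classes\<close>

context l2_space
begin

lemma schatten_zero: "(\<lambda>h z. 0) \<in> schatten_class p \<mu> L"
proof -
  have b: "bop (\<lambda>h z. 0)" by (rule bopI[where C = 0]) simp_all
  have "cop (\<lambda>h z. 0)"
    by (rule copI[OF b], rule exI[of _ "id :: nat \<Rightarrow> nat"], rule exI[of _ "\<lambda>z. 0"]) (simp add: strict_mono_id)
  moreover have "singular_values \<mu> L (\<lambda>h z. 0) {} (\<lambda>_. 0)" by (simp add: singular_values_def)
  ultimately show ?thesis unfolding schatten_class_def by (auto intro!: exI[of _ "{} :: nat set"])
qed

definition comm_in :: "ennreal \<Rightarrow> (('a \<Rightarrow> complex) \<Rightarrow> ('a \<Rightarrow> complex)) \<Rightarrow> (('a \<Rightarrow> complex) \<Rightarrow> ('a \<Rightarrow> complex)) \<Rightarrow> bool" where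
  "comm_in p A B \<longleftrightarrow> op_commutator A B \<in> schatten_class p \<mu> L"

lemma comm_in_cong:
  assumes "comm_in p A B" and A: "\<And>h. h \<in> L \<Longrightarrow> A h = A' h" and B: "\<And>h. h \<in> L \<Longrightarrow> B h = B' h"
    and "bop A" "bop B"
  shows "comm_in p A' B'"
  unfolding comm_in_def
proof (rule schatten_cong[OF assms(1)[unfolded comm_in_def]])
  fix h assume h: "h \<in> L"
  show "op_commutator A B h = op_commutator A' B' h"
    using A[OF h] B[OF h] A[OF bop_mem[OF assms(5) h]] B[OF bop_mem[OF assms(4) h]] by (simp add: op_commutator_def)
qed

lemma comm_in_swap:
  assumes "comm_in p A B" shows "comm_in p B A"
  using schatten_scale[OF assms[unfolded comm_in_def], of "-1"] unfolding comm_in_def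
  by (rule schatten_cong) (simp add: op_commutator_def)

lemma comm_in_plus:
  assumes "comm_in p A1 B" "comm_in p A2 B" "bop A1" "bop A2" "bop B"
  shows "comm_in p (\<lambda>h z. A1 h z + A2 h z) B"
  using schatten_plus[OF assms(1,2)[unfolded comm_in_def]] unfolding comm_in_def
  by (rule schatten_cong) (simp add: op_commutator_def bop_mem[OF assms(3)] bop_mem[OF assms(4)] bop_add[OF assms(5)] algebra_simps)

text \<open>The derivation rule [A1 A2, B] = A1 [A2, B] + [A1, B] A2, together with the two-sided
  ideal property.\<close>

lemma comm_in_comp:
  assumes c: "comm_in p A1 B" "comm_in p A2 B" and A1: "bop A1" and A2: "bop A2" and B: "bop B"
  shows "comm_in p (\<lambda>h. A1 (A2 h)) B"
  using schatten_plus[OF schatten_left[OF c(2)[unfolded comm_in_def] A1] schatten_right[OF c(1)[unfolded comm_in_def] A2]]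
  unfolding comm_in_def
  by (rule schatten_cong) (simp add: op_commutator_def bop_mem[OF A2] bop_mem[OF B] bop_diff[OF A1])

lemma comm_in_mult: "bop B \<Longrightarrow> comm_in p (\<lambda>h z. a * h z) B"
  unfolding comm_in_def
  by (rule schatten_cong[OF schatten_zero]) (simp add: op_commutator_def bop_scale)

text \<open>\<open>[A\<inverse>, B] = - A\<inverse> [A, B] A\<inverse>\<close>\<close>
lemma comm_in_inverse:
  assumes c: "comm_in p A B" and A: "bop A" and A': "bop A'" and B: "bop B"
    and inv: "\<And>h. h \<in> L \<Longrightarrow> A (A' h) = h" "\<And>h. h \<in> L \<Longrightarrow> A' (A h) = h"
  shows "comm_in p A' B"
  using schatten_scale[OF schatten_left[OF schatten_right[OF c[unfolded comm_in_def] A'] A'], of "-1"]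
  unfolding comm_in_def
  by (rule schatten_cong)
    (simp add: op_commutator_def bop_mem[OF A] bop_mem[OF A'] bop_mem[OF B] bop_diff[OF A'] inv)

lemma p_essentially_normal_iff:
  assumes "\<And>i. bop (A i)" "\<And>i j h. h \<in> L \<Longrightarrow> A i (A j h) = A j (A i h)"
  shows "p_essentially_normal p \<mu> L A \<longleftrightarrow> (\<forall>i j. comm_in p (A i) (adj (A j)))"
  using assms unfolding p_essentially_normal_def comm_in_def by blast

end

definition bounded_holo :: "(complex^'n) set \<Rightarrow> (complex^'n \<Rightarrow> complex) set" where
  "bounded_holo \<Omega> = {f. holo_fun f \<Omega> \<and> (\<exists>B. \<forall>z\<in>\<Omega>. cmod (f z) \<le> B)}"

text \<open>\<open>gen \<Omega> F\<close> is the algebra of functions on \<open>\<Omega>\<close> generated by \<open>F\<close> and closed under inverses that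
  are bounded holomorphic functions.\<close>
inductive_set gen :: "(complex^'n) set \<Rightarrow> (complex^'n \<Rightarrow> complex) set \<Rightarrow> (complex^'n \<Rightarrow> complex) set"
  for \<Omega> F where
  gen_base: "f \<in> F \<Longrightarrow> f \<in> gen \<Omega> F"
| gen_const: "(\<lambda>z. a) \<in> gen \<Omega> F"
| gen_add: "f \<in> gen \<Omega> F \<Longrightarrow> g \<in> gen \<Omega> F \<Longrightarrow> (\<lambda>z. f z + g z) \<in> gen \<Omega> F"
| gen_mult: "f \<in> gen \<Omega> F \<Longrightarrow> g \<in> gen \<Omega> F \<Longrightarrow> (\<lambda>z. f z * g z) \<in> gen \<Omega> F"
| gen_inverse: "f \<in> gen \<Omega> F \<Longrightarrow> g \<in> bounded_holo \<Omega> \<Longrightarrow> (\<And>z. z \<in> \<Omega> \<Longrightarrow> f z * g z = 1) \<Longrightarrow> g \<in> gen \<Omega> F"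
| gen_cong: "f \<in> gen \<Omega> F \<Longrightarrow> (\<And>z. z \<in> \<Omega> \<Longrightarrow> f z = g z) \<Longrightarrow> g \<in> gen \<Omega> F"

lemma gen_bounded_holo:
  assumes \<Omega>: "open \<Omega>" and F: "F \<subseteq> bounded_holo \<Omega>" and f: "f \<in> gen \<Omega> F"
  shows "f \<in> bounded_holo \<Omega>"
  using f
proof (induction rule: gen.induct)
  case (gen_const a)
  then show ?case by (auto simp: bounded_holo_def holo_fun_const)
next
  case (gen_add f g)
  then obtain B C where "\<And>z. z \<in> \<Omega> \<Longrightarrow> cmod (f z) \<le> B" "\<And>z. z \<in> \<Omega> \<Longrightarrow> cmod (g z) \<le> C"
    by (auto simp: bounded_holo_def)
  then have "\<forall>z\<in>\<Omega>. cmod (f z + g z) \<le> B + C" by (meson add_mono norm_triangle_le)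
  then show ?case using gen_add by (auto simp: bounded_holo_def holo_fun_add)
next
  case (gen_mult f g)
  then obtain B C where "\<And>z. z \<in> \<Omega> \<Longrightarrow> cmod (f z) \<le> B" "\<And>z. z \<in> \<Omega> \<Longrightarrow> cmod (g z) \<le> C"
    by (auto simp: bounded_holo_def)
  then have "\<forall>z\<in>\<Omega>. cmod (f z * g z) \<le> B * C"
    unfolding norm_mult by (meson mult_mono' norm_ge_zero)
  then show ?case using gen_mult by (auto simp: bounded_holo_def holo_fun_mult)
next
  case (gen_cong f g)
  then have "holo_fun f \<Omega>" and "\<exists>B. \<forall>z\<in>\<Omega>. cmod (f z) \<le> B" by (auto simp: bounded_holo_def)
  then show ?case using holo_fun_cong[OF \<Omega> \<open>holo_fun f \<Omega>\<close> gen_cong.hyps(2)] gen_cong.hyps(2)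
    by (simp add: bounded_holo_def)
qed (use F in auto)

text \<open>The representation \<open>R\<close> is left abstract because it is used twice: for the
  Toeplitz operators and for their adjoints. The latter are conjugate linear in the symbol, which is
  why constants act through \<kappa>.\<close>

lemma (in l2_space) gen_comm_in:
  assumes \<Omega>: "open \<Omega>" and F: "F \<subseteq> bounded_holo \<Omega>" and B: "bop B"
    and R_bop: "\<And>f. f \<in> bounded_holo \<Omega> \<Longrightarrow> bop (R f)"
    and R_const: "\<And>a h. h \<in> L \<Longrightarrow> R (\<lambda>z. a) h = (\<lambda>z. \<kappa> a * h z)" and \<kappa>1: "\<kappa> 1 = 1"
    and R_add: "\<And>f g h. f \<in> bounded_holo \<Omega> \<Longrightarrow> g \<in> bounded_holo \<Omega> \<Longrightarrow> h \<in> L \<Longrightarrow>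
      R (\<lambda>z. f z + g z) h = (\<lambda>z. R f h z + R g h z)"
    and R_mult: "\<And>f g h. f \<in> bounded_holo \<Omega> \<Longrightarrow> g \<in> bounded_holo \<Omega> \<Longrightarrow> h \<in> L \<Longrightarrow> R (\<lambda>z. f z * g z) h = R f (R g h)"
    and R_cong: "\<And>f g h. f \<in> bounded_holo \<Omega> \<Longrightarrow> h \<in> L \<Longrightarrow> (\<And>z. z \<in> \<Omega> \<Longrightarrow> f z = g z) \<Longrightarrow> R f h = R g h"
    and base: "\<And>f. f \<in> F \<Longrightarrow> comm_in p (R f) B" and f: "f \<in> gen \<Omega> F"
  shows "comm_in p (R f) B"
  using f
proof (induction rule: gen.induct)
  case (gen_const a)
  show ?case
    by (rule comm_in_cong[OF comm_in_mult[OF B, of p "\<kappa> a"] _ refl bop_mult B]) (simp add: R_const)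
next
  case (gen_add f g)
  have fg: "f \<in> bounded_holo \<Omega>" "g \<in> bounded_holo \<Omega>" using gen_add gen_bounded_holo[OF \<Omega> F] by auto
  show ?case
    by (rule comm_in_cong[OF comm_in_plus[OF gen_add.IH R_bop[OF fg(1)] R_bop[OF fg(2)] B] _ refl bop_plus[OF R_bop[OF fg(1)] R_bop[OF fg(2)]] B])
      (simp add: R_add[OF fg])
next
  case (gen_mult f g)
  have fg: "f \<in> bounded_holo \<Omega>" "g \<in> bounded_holo \<Omega>" using gen_mult gen_bounded_holo[OF \<Omega> F] by auto
  show ?case
    by (rule comm_in_cong[OF comm_in_comp[OF gen_mult.IH R_bop[OF fg(1)] R_bop[OF fg(2)] B] _ refl bop_comp[OF R_bop[OF fg(1)] R_bop[OF fg(2)]] B])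
      (simp add: R_mult[OF fg])
next
  case (gen_inverse f g)
  have fb: "f \<in> bounded_holo \<Omega>" using gen_inverse gen_bounded_holo[OF \<Omega> F] by auto
  have one: "(\<lambda>z. 1) \<in> bounded_holo \<Omega>" by (auto simp: bounded_holo_def holo_fun_const)
  have "R (\<lambda>z. f z * g z) h = h" "R (\<lambda>z. g z * f z) h = h" if h: "h \<in> L" for h
    using R_cong[OF one h, of "\<lambda>z. f z * g z"] R_cong[OF one h, of "\<lambda>z. g z * f z"] R_const[OF h, of 1] \<kappa>1 gen_inverse.hyps(3)
    by (simp_all add: mult.commute)
  then show ?case
    using R_mult[OF fb gen_inverse.hyps(2)] R_mult[OF gen_inverse.hyps(2) fb]
    by (intro comm_in_inverse[OF gen_inverse.IH R_bop[OF fb] R_bop[OF gen_inverse.hyps(2)] B]) auto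
next
  case (gen_cong f g)
  have fb: "f \<in> bounded_holo \<Omega>" using gen_cong gen_bounded_holo[OF \<Omega> F] by auto
  show ?case
    by (rule comm_in_cong[OF gen_cong.IH R_cong[OF fb _ gen_cong.hyps(2)] refl R_bop[OF fb] B])
qed (rule base)

section \<open>Transport by a unitary\<close>

locale l2_unitary = A: l2_space \<mu> L + B: l2_space \<nu> L'
  for \<mu> :: "'a measure" and L and \<nu> :: "'b measure" and L' +
  fixes U :: "('a \<Rightarrow> complex) \<Rightarrow> 'b \<Rightarrow> complex"
  assumes U_image: "L' = U ` L"
    and U_add: "f \<in> L \<Longrightarrow> g \<in> L \<Longrightarrow> U (\<lambda>z. f z + g z) = (\<lambda>z. U f z + U g z)"
    and U_scale: "f \<in> L \<Longrightarrow> U (\<lambda>z. a * f z) = (\<lambda>z. a * U f z)"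
    and U_ip: "f \<in> L \<Longrightarrow> g \<in> L \<Longrightarrow> l2_inner \<nu> (U f) (U g) = l2_inner \<mu> f g"
begin

lemma U_mem: "f \<in> L \<Longrightarrow> U f \<in> L'"
  using U_image by blast

lemma U_diff: "f \<in> L \<Longrightarrow> g \<in> L \<Longrightarrow> U (\<lambda>z. f z - g z) = (\<lambda>z. U f z - U g z)"
  using U_add[of f "\<lambda>z. (-1) * g z"] U_scale[of g "-1"] A.L_scale[of g "-1"] by simp

lemma U_zero: "U (\<lambda>z. 0) = (\<lambda>z. 0)"
  using U_scale[of "\<lambda>z. 0" 0] by simp

lemma U_nm: "f \<in> L \<Longrightarrow> l2_norm \<nu> (U f) = l2_norm \<mu> f"
proof -
  assume f: "f \<in> L"
  have "(l2_norm \<nu> (U f))\<^sup>2 = (l2_norm \<mu> f)\<^sup>2"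
    unfolding A.Re_ip_self[symmetric] B.Re_ip_self[symmetric] U_ip[OF f f] ..
  then show ?thesis by simp
qed

lemma U_inj: "inj_on U L"
proof (rule inj_onI)
  fix f g assume f: "f \<in> L" and g: "g \<in> L" and eq: "U f = U g"
  have "l2_norm \<mu> (\<lambda>z. f z - g z) = l2_norm \<nu> (\<lambda>z. U f z - U g z)"
    using U_nm[of "\<lambda>z. f z - g z"] U_diff[OF f g] f g by simp
  then have "l2_norm \<mu> (\<lambda>z. f z - g z) = 0" using eq by simp
  then have "(\<lambda>z. f z - g z) = (\<lambda>z. 0)" using A.nm_eq_0 A.L_diff[OF f g] by blast
  then show "f = g" by (simp add: fun_eq_iff)
qed

text \<open>Makes the two spaces interchangeable, so that a transfer needs to be proved in one
  direction only.\<close>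

lemma inverse_unitary: "l2_unitary \<nu> L' \<mu> L (the_inv_into L U)"
proof -
  let ?V = "the_inv_into L U"
  have VU: "?V (U f) = f" if "f \<in> L" for f by (rule the_inv_into_f_f[OF U_inj that])
  show ?thesis
  proof unfold_locales
    show "L = ?V ` L'" unfolding U_image image_image using VU by simp
    fix f g assume "f \<in> L'" "g \<in> L'"
    then obtain f' g' where fg: "f' \<in> L" "f = U f'" "g' \<in> L" "g = U g'" using U_image by blast
    show "?V (\<lambda>z. f z + g z) = (\<lambda>z. ?V f z + ?V g z)"
      using fg VU[of "\<lambda>z. f' z + g' z"] U_add[OF fg(1,3)] by (simp add: VU)
    show "l2_inner \<mu> (?V f) (?V g) = l2_inner \<nu> f g" using fg U_ip[OF fg(1,3)] by (simp add: VU)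
  next
    fix f a assume "f \<in> L'"
    then obtain f' where f: "f' \<in> L" "f = U f'" using U_image by blast
    show "?V (\<lambda>z. a * f z) = (\<lambda>z. a * ?V f z)"
      using f VU[of "\<lambda>z. a * f' z"] U_scale[OF f(1)] by (simp add: VU)
  qed
qed

definition intertwines where
  "intertwines A A' \<longleftrightarrow> (\<forall>h\<in>L. A' (U h) = U (A h))"

lemma intertwines_bop:
  assumes A: "bounded_operator \<mu> L A" and i: "intertwines A A'"
  shows "bounded_operator \<nu> L' A'"
proof -
  have iA: "A' (U h) = U (A h)" if "h \<in> L" for h using i that by (simp add: intertwines_def)
  obtain C where C: "\<And>h. h \<in> L \<Longrightarrow> l2_norm \<mu> (A h) \<le> C * l2_norm \<mu> h" using A.bop_bound[OF A] by blast
  show ?thesis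
  proof (rule B.bopI[where C = C])
    fix h' assume "h' \<in> L'"
    then obtain h where h: "h \<in> L" "h' = U h" using U_image by blast
    note Ah = A.bop_mem[OF A h(1)]
    show "A' h' \<in> L'" using h iA U_mem[OF Ah] by simp
    show "l2_norm \<nu> (A' h') \<le> C * l2_norm \<nu> h'" using h iA U_nm[OF Ah] U_nm[OF h(1)] C by simp
    show "A' (\<lambda>z. a * h' z) = (\<lambda>z. a * A' h' z)" for a
      using iA[of "\<lambda>z. a * h z"] h iA[OF h(1)] U_scale[OF h(1)] U_scale[OF Ah] A.bop_scale[OF A h(1)] by simp
    fix k' assume "k' \<in> L'"
    then obtain k where k: "k \<in> L" "k' = U k" using U_image by blast
    note Ak = A.bop_mem[OF A k(1)]
    show "A' (\<lambda>z. h' z + k' z) = (\<lambda>z. A' h' z + A' k' z)"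
      using iA[of "\<lambda>z. h z + k z"] h k iA[OF h(1)] iA[OF k(1)] U_add[OF h(1) k(1)] U_add[OF Ah Ak] A.bop_add[OF A h(1) k(1)] by simp
  qed
qed

lemma intertwines_adj:
  assumes A: "bounded_operator \<mu> L A" and i: "intertwines A A'"
  shows "intertwines (op_adjoint \<mu> L A) (op_adjoint \<nu> L' A')"
  unfolding intertwines_def
proof
  fix h assume h: "h \<in> L"
  show "op_adjoint \<nu> L' A' (U h) = U (op_adjoint \<mu> L A h)"
  proof (rule B.adj_eqI[OF U_mem[OF h] U_mem[OF A.adj_mem[OF A h]]])
    fix k' assume "k' \<in> L'"
    then obtain k where k: "k \<in> L" "k' = U k" using U_image by blast
    show "l2_inner \<nu> (A' k') (U h) = l2_inner \<nu> k' (U (op_adjoint \<mu> L A h))"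
      using i k U_ip[OF A.bop_mem[OF A k(1)] h] U_ip[OF k(1) A.adj_mem[OF A h]] A.adj_ip[OF A h k(1)]
      by (simp add: intertwines_def)
  qed
qed

lemma intertwines_commutator:
  assumes A: "bounded_operator \<mu> L A" "intertwines A A'" and C: "bounded_operator \<mu> L C" "intertwines C C'"
  shows "intertwines (op_commutator A C) (op_commutator A' C')"
  unfolding intertwines_def
proof
  fix h assume h: "h \<in> L"
  have "op_commutator A' C' (U h) = (\<lambda>z. U (A (C h)) z - U (C (A h)) z)"
    using A(2) C(2) h A.bop_mem[OF A(1) h] A.bop_mem[OF C(1) h] by (simp add: op_commutator_def intertwines_def)
  also have "\<dots> = U (op_commutator A C h)"
    unfolding op_commutator_def
    by (rule U_diff[symmetric]) (use A.bop_mem[OF A(1)] A.bop_mem[OF C(1)] h in auto)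
  finally show "op_commutator A' C' (U h) = U (op_commutator A C h)" .
qed

text \<open>The singular values and their index set stay the same; the singular vectors are moved by
  \<open>U\<close>, and the adjoint is intertwined along with the operator.\<close>

lemma intertwines_schatten:
  assumes S: "A \<in> schatten_class p \<mu> L" and i: "intertwines A A'"
  shows "A' \<in> schatten_class p \<nu> L'"
proof -
  have A: "bounded_operator \<mu> L A" by (rule A.schatten_bop[OF S])
  have iA: "A' (U h) = U (A h)" if "h \<in> L" for h using i that by (simp add: intertwines_def)
  have cop: "compact_operator \<nu> L' A'"
  proof (rule B.copI[OF intertwines_bop[OF A i]])
    fix h' :: "nat \<Rightarrow> 'b \<Rightarrow> complex" assume h': "\<And>k. h' k \<in> L'" "\<And>k. l2_norm \<nu> (h' k) \<le> 1"
    have "\<forall>k. \<exists>h. h \<in> L \<and> h' k = U h" using h'(1) U_image by blast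
    then obtain h where h: "\<And>k. h k \<in> L" "\<And>k. h' k = U (h k)" by metis
    have "l2_norm \<mu> (h k) \<le> 1" for k using h'(2)[of k] U_nm[OF h(1)] h(2) by simp
    then obtain r g where r: "strict_mono r" and g: "g \<in> L" and lim: "(\<lambda>k. l2_norm \<mu> (\<lambda>z. A (h (r k)) z - g z)) \<longlonglongrightarrow> 0"
      by (rule A.cop_subsequence[OF A.schatten_cop[OF S] h(1)])
    have "l2_norm \<nu> (\<lambda>z. A' (h' k) z - U g z) = l2_norm \<mu> (\<lambda>z. A (h k) z - g z)" for k
      using U_nm[OF A.L_diff[OF A.bop_mem[OF A h(1)] g], of k] U_diff[OF A.bop_mem[OF A h(1)] g, of k] iA[OF h(1)] h(2) by simp
    then show "\<exists>r g. strict_mono r \<and> g \<in> L' \<and> (\<lambda>k. l2_norm \<nu> (\<lambda>z. A' (h' (r k)) z - g z)) \<longlonglongrightarrow> 0"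
      using r lim U_mem[OF g] by (intro exI[of _ r] exI[of _ "U g"]) simp
  qed
  show ?thesis
  proof (cases "p = \<infinity>")
    case False
    then obtain J s where sv: "singular_values \<mu> L A J s" and sum: "(\<lambda>k. s k powr enn2real p) summable_on J"
      using S by (auto simp: schatten_class_def)
    obtain e where e: "A.singular_system A J s e" and ker: "\<And>h. h \<in> L \<Longrightarrow> (\<And>j. j \<in> J \<Longrightarrow> l2_inner \<mu> h (e j) = 0) \<Longrightarrow> A h = (\<lambda>z. 0)"
      using sv unfolding A.singular_values_iff by blast
    note em = A.sing_mem[OF A e]
    have "op_adjoint \<nu> L' A' (A' (U (e j))) = (\<lambda>z. complex_of_real ((s j)\<^sup>2) * U (e j) z)" if j: "j \<in> J" for j
      using intertwines_adj[OF A i] A.bop_mem[OF A em[OF j]] iA[OF em[OF j]] A.sing_eig[OF A e j] U_scale[OF em[OF j]]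
      by (simp add: intertwines_def)
    then have "B.singular_system A' J s (\<lambda>j. U (e j))"
      unfolding B.singular_system_def
      using U_mem[OF em] U_ip[OF em em] A.sing_orth[OF A e] A.sing_pos[OF A e] by auto
    moreover have "A' h' = (\<lambda>z. 0)" if h': "h' \<in> L'" "\<forall>j\<in>J. l2_inner \<nu> h' (U (e j)) = 0" for h'
    proof -
      obtain h where h: "h \<in> L" "h' = U h" using h'(1) U_image by blast
      have "A h = (\<lambda>z. 0)" by (rule ker[OF h(1)]) (use h'(2) h U_ip[OF h(1) em] in auto)
      then show ?thesis using iA[OF h(1)] h(2) U_zero by simp
    qed
    ultimately have "singular_values \<nu> L' A' J s" unfolding B.singular_values_iff by blast
    then show ?thesis using cop sum by (auto simp: schatten_class_def)
  qed (use cop in \<open>simp add: schatten_class_def\<close>)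
qed

lemma intertwines_schatten_iff:
  assumes A: "bounded_operator \<mu> L A" and i: "intertwines A A'"
  shows "A' \<in> schatten_class p \<nu> L' \<longleftrightarrow> A \<in> schatten_class p \<mu> L"
proof
  interpret I: l2_unitary \<nu> L' \<mu> L "the_inv_into L U" by (rule inverse_unitary)
  assume "A' \<in> schatten_class p \<nu> L'"
  moreover have "I.intertwines A' A"
    unfolding I.intertwines_def
  proof
    fix h' assume "h' \<in> L'"
    then obtain h where h: "h \<in> L" "h' = U h" using U_image by blast
    then show "A (the_inv_into L U h') = the_inv_into L U (A' h')"
      using i A.bop_mem[OF A h(1)] by (simp add: intertwines_def the_inv_into_f_f[OF U_inj])
  qed
  ultimately show "A \<in> schatten_class p \<mu> L" by (rule I.intertwines_schatten)
qed (rule intertwines_schatten[OF _ i])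

end

section \<open>Truncated Toeplitz operators\<close>

locale variety_quotient = weighted_domain \<Omega> \<mu> w for \<Omega> :: "(complex^'n) set" and \<mu> w +
  fixes V :: "(complex^'n) set" and L :: "(complex^'n \<Rightarrow> complex) set"
  assumes V_sub: "V \<subseteq> \<Omega>" and L_eq: "L = bergman_perp \<Omega> \<mu> (variety_submodule \<Omega> \<mu> V)"
begin

abbreviation M where "M \<equiv> variety_submodule \<Omega> \<mu> V"

lemma L_sub: "h \<in> L \<Longrightarrow> h \<in> A2"
  by (simp add: L_eq bergman_perp_def)

lemma M_sub: "f \<in> M \<Longrightarrow> f \<in> A2"
  by (simp add: variety_submodule_def)

lemma L_M_orth: "h \<in> L \<Longrightarrow> f \<in> M \<Longrightarrow> l2_inner \<mu> h f = 0"
  by (simp add: L_eq bergman_perp_def)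

lemma L_I: "h \<in> A2 \<Longrightarrow> (\<And>f. f \<in> M \<Longrightarrow> l2_inner \<mu> h f = 0) \<Longrightarrow> h \<in> L"
  by (simp add: L_eq bergman_perp_def)

sublocale P: l2_space \<mu> L
proof
  fix X :: "nat \<Rightarrow> complex^'n \<Rightarrow> complex"
  assume X: "\<And>n. X n \<in> L" and C: "\<And>e. e > 0 \<Longrightarrow> \<exists>N. \<forall>m\<ge>N. \<forall>n\<ge>N. l2_norm \<mu> (\<lambda>z. X m z - X n z) < e"
  obtain g where g: "g \<in> A2" and lim: "(\<lambda>n. l2_norm \<mu> (\<lambda>z. X n z - g z)) \<longlonglongrightarrow> 0"
    using A2.L_complete[OF L_sub[OF X] C] by blast
  have "l2_inner \<mu> g f = 0" if f: "f \<in> M" for f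
  proof -
    have "(\<lambda>n. l2_inner \<mu> (X n) f) \<longlonglongrightarrow> l2_inner \<mu> g f" by (rule A2.tendsto_ip[OF L_sub[OF X] g lim M_sub[OF f]])
    then show ?thesis using L_M_orth[OF X f] by (simp add: LIMSEQ_const_iff)
  qed
  then show "\<exists>g\<in>L. (\<lambda>n. l2_norm \<mu> (\<lambda>z. X n z - g z)) \<longlonglongrightarrow> 0" using L_I[OF g] lim by blast
next
  fix f g assume fg: "f \<in> L" "g \<in> L"
  show "(\<lambda>z. f z + g z) \<in> L"
    by (rule L_I) (use fg in \<open>simp_all add: A2.ip_add_left L_sub M_sub L_M_orth\<close>)
next
  fix f a assume f: "f \<in> L"
  show "(\<lambda>z. a * f z) \<in> L"
    by (rule L_I) (use f in \<open>simp_all add: A2.ip_scale_left L_sub L_M_orth\<close>)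
next
  show "(\<lambda>z. 0) \<in> L" by (rule L_I) simp_all
next
  fix f assume "f \<in> L"
  note f = L_sub[OF this]
  show "f \<in> borel_measurable \<mu>" "integrable \<mu> (\<lambda>z. (cmod (f z))\<^sup>2)"
    "(LINT z|\<mu>. (cmod (f z))\<^sup>2) = 0 \<Longrightarrow> f = (\<lambda>z. 0)"
    by (rule A2.L_meas[OF f], rule A2.L_int[OF f], rule A2.L_definite[OF f])
qed

text \<open>Point evaluations at the points of \<open>V\<close> are represented by elements of \<open>L\<close>.\<close>
lemma perp_perp:
  assumes u: "u \<in> A2" and orth: "\<And>k. k \<in> L \<Longrightarrow> l2_inner \<mu> u k = 0"
  shows "u \<in> M"
proof -
  have "u z = 0" if z: "z \<in> V" for z
  proof -
    have "z \<in> \<Omega>" using z V_sub by blast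
    then obtain r C where r: "r > 0" and C: "\<And>f x. f \<in> A2 \<Longrightarrow> x \<in> cball z r \<Longrightarrow> cmod (f x) \<le> C * l2_norm \<mu> f"
      using point_estimate by blast
    have "\<exists>k\<in>A2. \<forall>f\<in>A2. f z = l2_inner \<mu> f k"
      by (rule A2.riesz_representation[where C = C]) (use C r in auto)
    then obtain k where k: "k \<in> A2" "\<And>f. f \<in> A2 \<Longrightarrow> f z = l2_inner \<mu> f k" by blast
    have "l2_inner \<mu> k f = 0" if f: "f \<in> M" for f
      using k(2)[OF M_sub[OF f]] A2.ip_cnj[of k f] f z by (simp add: variety_submodule_def)
    then have "k \<in> L" by (rule L_I[OF k(1)])
    then show ?thesis using k(2)[OF u] orth by simp
  qed
  then show ?thesis using u by (simp add: variety_submodule_def)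
qed

text \<open>Brings the orthogonality condition of \<open>orth_proj\<close> into the form in which
  Riesz representation delivers the projection: equality of two functionals of
  \<open>k\<close>.\<close>

lemma proj_condition:
  assumes u: "u \<in> A2" and g: "g \<in> L"
  shows "(\<forall>k\<in>L. l2_inner \<mu> (\<lambda>z. u z - g z) k = 0) \<longleftrightarrow> (\<forall>k\<in>L. l2_inner \<mu> k u = l2_inner \<mu> k g)"
proof -
  have "l2_inner \<mu> (\<lambda>z. u z - g z) k = 0 \<longleftrightarrow> l2_inner \<mu> k u = l2_inner \<mu> k g" if "k \<in> L" for k
    using A2.ip_diff_left[OF u L_sub[OF g] L_sub[OF that]] A2.ip_cnj[of u k] A2.ip_cnj[of g k] by auto
  then show ?thesis by blast
qed

lemma orth_proj_eqI:
  assumes u: "u \<in> A2" and g: "g \<in> L" and eq: "\<And>k. k \<in> L \<Longrightarrow> l2_inner \<mu> k u = l2_inner \<mu> k g"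
  shows "orth_proj \<mu> L u = g"
  unfolding orth_proj_def
proof (rule the_equality)
  show "g \<in> L \<and> (\<forall>k\<in>L. l2_inner \<mu> (\<lambda>z. u z - g z) k = 0)" using g eq proj_condition[OF u g] by blast
  fix g' assume "g' \<in> L \<and> (\<forall>k\<in>L. l2_inner \<mu> (\<lambda>z. u z - g' z) k = 0)"
  then have "g' \<in> L" "\<And>k. k \<in> L \<Longrightarrow> l2_inner \<mu> k u = l2_inner \<mu> k g'" using proj_condition[OF u] by auto
  then show "g' = g" using eq by (intro P.ip_eqI g) auto
qed

lemma
  assumes u: "u \<in> A2"
  shows orth_proj_mem: "orth_proj \<mu> L u \<in> L"
    and orth_proj_ip: "k \<in> L \<Longrightarrow> l2_inner \<mu> k (orth_proj \<mu> L u) = l2_inner \<mu> k u"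
proof -
  have "\<exists>g\<in>L. \<forall>k\<in>L. l2_inner \<mu> k u = l2_inner \<mu> k g"
  proof (rule P.riesz_representation[where C = "l2_norm \<mu> u"])
    fix f assume "f \<in> L"
    then show "cmod (l2_inner \<mu> f u) \<le> l2_norm \<mu> u * l2_norm \<mu> f"
      using A2.cauchy_schwarz[OF L_sub u, of f] by (simp add: mult.commute)
  qed (use u in \<open>simp_all add: A2.ip_add_left A2.ip_scale_left L_sub\<close>)
  then obtain g where g: "g \<in> L" "\<And>k. k \<in> L \<Longrightarrow> l2_inner \<mu> k u = l2_inner \<mu> k g" by blast
  from orth_proj_eqI[OF u g] g show "orth_proj \<mu> L u \<in> L" "k \<in> L \<Longrightarrow> l2_inner \<mu> k (orth_proj \<mu> L u) = l2_inner \<mu> k u"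
    by auto
qed

lemma orth_proj_norm:
  assumes u: "u \<in> A2"
  shows "l2_norm \<mu> (orth_proj \<mu> L u) \<le> l2_norm \<mu> u"
proof -
  let ?g = "orth_proj \<mu> L u"
  have g: "?g \<in> L" by (rule orth_proj_mem[OF u])
  have "(l2_norm \<mu> ?g)\<^sup>2 = Re (l2_inner \<mu> ?g u)"
    using orth_proj_ip[OF u g] A2.Re_ip_self[of ?g] by simp
  also have "\<dots> \<le> l2_norm \<mu> ?g * l2_norm \<mu> u"
    using A2.cauchy_schwarz[OF L_sub[OF g] u] complex_Re_le_cmod[of "l2_inner \<mu> ?g u"] by linarith
  finally have le: "l2_norm \<mu> ?g * l2_norm \<mu> ?g \<le> l2_norm \<mu> ?g * l2_norm \<mu> u" by (simp add: power2_eq_square)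
  show ?thesis
  proof (cases "l2_norm \<mu> ?g = 0")
    case False
    then have "0 < l2_norm \<mu> ?g" using A2.nm_nonneg[of ?g] by linarith
    then show ?thesis using le by (simp add: mult_le_cancel_left_pos)
  qed simp
qed

abbreviation toep where "toep \<equiv> truncated_toeplitz \<mu> L"

lemma bounded_holo_mult: "f \<in> bounded_holo \<Omega> \<Longrightarrow> h \<in> A2 \<Longrightarrow> (\<lambda>z. f z * h z) \<in> A2"
  unfolding bounded_holo_def using A2_mult(1) by blast

lemma toep_mem: "f \<in> bounded_holo \<Omega> \<Longrightarrow> h \<in> L \<Longrightarrow> toep f h \<in> L"
  unfolding truncated_toeplitz_def by (intro orth_proj_mem bounded_holo_mult L_sub)

lemma toep_ip: "f \<in> bounded_holo \<Omega> \<Longrightarrow> h \<in> L \<Longrightarrow> k \<in> L \<Longrightarrow> l2_inner \<mu> k (toep f h) = l2_inner \<mu> k (\<lambda>z. f z * h z)"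
  unfolding truncated_toeplitz_def by (intro orth_proj_ip bounded_holo_mult L_sub)

lemma toep_eqI:
  "f \<in> bounded_holo \<Omega> \<Longrightarrow> h \<in> L \<Longrightarrow> g \<in> L \<Longrightarrow> (\<And>k. k \<in> L \<Longrightarrow> l2_inner \<mu> k (\<lambda>z. f z * h z) = l2_inner \<mu> k g) \<Longrightarrow> toep f h = g"
  unfolding truncated_toeplitz_def by (intro orth_proj_eqI bounded_holo_mult L_sub)

lemma toep_bop:
  assumes f: "f \<in> bounded_holo \<Omega>"
  shows "P.bop (toep f)"
proof -
  obtain B where hol: "holo_fun f \<Omega>" and B: "\<And>z. z \<in> \<Omega> \<Longrightarrow> cmod (f z) \<le> B" using f by (auto simp: bounded_holo_def)
  note m = bounded_holo_mult[OF f L_sub]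
  show ?thesis
  proof (rule P.bopI[where C = "\<bar>B\<bar>"])
    fix h assume h: "h \<in> L"
    show "toep f h \<in> L" by (rule toep_mem[OF f h])
    have "l2_norm \<mu> (toep f h) \<le> l2_norm \<mu> (\<lambda>z. f z * h z)"
      unfolding truncated_toeplitz_def by (rule orth_proj_norm[OF m[OF h]])
    also have "\<dots> \<le> \<bar>B\<bar> * l2_norm \<mu> h" by (rule A2_mult(2)[OF L_sub[OF h] hol B])
    finally show "l2_norm \<mu> (toep f h) \<le> \<bar>B\<bar> * l2_norm \<mu> h" .
    show "toep f (\<lambda>z. a * h z) = (\<lambda>z. a * toep f h z)" for a
    proof (rule toep_eqI[OF f P.L_scale[OF h] P.L_scale[OF toep_mem[OF f h]]])
      fix k assume k: "k \<in> L"
      have "(\<lambda>z. f z * (a * h z)) = (\<lambda>z. a * (f z * h z))" by (simp add: mult_ac)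
      then show "l2_inner \<mu> k (\<lambda>z. f z * (a * h z)) = l2_inner \<mu> k (\<lambda>z. a * toep f h z)"
        by (simp add: A2.ip_scale_right toep_ip[OF f h k])
    qed
    fix k assume k: "k \<in> L"
    show "toep f (\<lambda>z. h z + k z) = (\<lambda>z. toep f h z + toep f k z)"
    proof (rule toep_eqI[OF f P.L_add[OF h k] P.L_add[OF toep_mem[OF f h] toep_mem[OF f k]]])
      fix l assume l: "l \<in> L"
      show "l2_inner \<mu> l (\<lambda>z. f z * (h z + k z)) = l2_inner \<mu> l (\<lambda>z. toep f h z + toep f k z)"
        using A2.ip_add_right[OF m[OF h] m[OF k] L_sub[OF l]] P.ip_add_right[OF toep_mem[OF f h] toep_mem[OF f k] l]
          toep_ip[OF f h l] toep_ip[OF f k l] by (simp add: distrib_left)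
    qed
  qed
qed

lemma toep_cong:
  assumes h: "h \<in> L" and eq: "\<And>z. z \<in> \<Omega> \<Longrightarrow> f z = g z"
  shows "toep f h = toep g h"
proof -
  have "(\<lambda>z. f z * h z) = (\<lambda>z. g z * h z)" using eq A2_outside[OF L_sub[OF h]] by (auto simp: fun_eq_iff)
  then show ?thesis by (simp add: truncated_toeplitz_def)
qed

lemma const_bounded_holo: "(\<lambda>z. a) \<in> bounded_holo \<Omega>"
  by (auto simp: bounded_holo_def holo_fun_const)

lemma toep_const: "h \<in> L \<Longrightarrow> toep (\<lambda>z. a) h = (\<lambda>z. a * h z)"
  by (rule toep_eqI[OF const_bounded_holo]) auto

text \<open>An instance of \<open>gen_bounded_holo\<close>: with all bounded holomorphic functions
  as generators, the generated algebra contains the sum.\<close>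

lemma bounded_holo_add: "f \<in> bounded_holo \<Omega> \<Longrightarrow> g \<in> bounded_holo \<Omega> \<Longrightarrow> (\<lambda>z. f z + g z) \<in> bounded_holo \<Omega>"
  by (rule gen_bounded_holo[OF open_\<Omega> order_refl]) (intro gen_add gen_base)

lemma bounded_holo_times: "f \<in> bounded_holo \<Omega> \<Longrightarrow> g \<in> bounded_holo \<Omega> \<Longrightarrow> (\<lambda>z. f z * g z) \<in> bounded_holo \<Omega>"
  by (rule gen_bounded_holo[OF open_\<Omega> order_refl]) (intro gen_mult gen_base)

lemma toep_add:
  assumes f: "f \<in> bounded_holo \<Omega>" and g: "g \<in> bounded_holo \<Omega>" and h: "h \<in> L"
  shows "toep (\<lambda>z. f z + g z) h = (\<lambda>z. toep f h z + toep g h z)"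
proof (rule toep_eqI[OF bounded_holo_add[OF f g] h P.L_add[OF toep_mem[OF f h] toep_mem[OF g h]]])
  fix k assume k: "k \<in> L"
  show "l2_inner \<mu> k (\<lambda>z. (f z + g z) * h z) = l2_inner \<mu> k (\<lambda>z. toep f h z + toep g h z)"
    using A2.ip_add_right[OF bounded_holo_mult[OF f L_sub[OF h]] bounded_holo_mult[OF g L_sub[OF h]] L_sub[OF k]]
      P.ip_add_right[OF toep_mem[OF f h] toep_mem[OF g h] k] toep_ip[OF f h k] toep_ip[OF g h k] by (simp add: distrib_right)
qed

text \<open>The difference of \<open>g h\<close> and its projection lies in \<open>M\<close>, and \<open>M\<close> is invariant under multiplication by \<open>f\<close>.\<close>
lemma toep_mult:
  assumes f: "f \<in> bounded_holo \<Omega>" and g: "g \<in> bounded_holo \<Omega>" and h: "h \<in> L"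
  shows "toep (\<lambda>z. f z * g z) h = toep f (toep g h)"
proof (rule toep_eqI[OF bounded_holo_times[OF f g] h toep_mem[OF f toep_mem[OF g h]]])
  fix k assume k: "k \<in> L"
  have gh: "(\<lambda>z. g z * h z) \<in> A2" by (rule bounded_holo_mult[OF g L_sub[OF h]])
  have tg: "toep g h \<in> A2" by (rule L_sub[OF toep_mem[OF g h]])
  define u where "u = (\<lambda>z. g z * h z - toep g h z)"
  have u: "u \<in> A2" unfolding u_def by (rule A2.L_diff[OF gh tg])
  have "u \<in> M"
  proof (rule perp_perp[OF u])
    fix k assume k: "k \<in> L"
    have "l2_inner \<mu> k u = 0"
      unfolding u_def using A2.ip_diff_right[OF gh tg L_sub[OF k]] toep_ip[OF g h k] by simp
    then show "l2_inner \<mu> u k = 0" using A2.ip_cnj[of u k] by simp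
  qed
  then have "(\<lambda>z. f z * u z) \<in> M" using bounded_holo_mult[OF f u] by (simp add: variety_submodule_def)
  then have 0: "l2_inner \<mu> k (\<lambda>z. f z * u z) = 0" by (rule L_M_orth[OF k])
  have "(\<lambda>z. f z * g z * h z) = (\<lambda>z. f z * u z + f z * toep g h z)" by (simp add: u_def algebra_simps)
  then have "l2_inner \<mu> k (\<lambda>z. f z * g z * h z) = l2_inner \<mu> k (\<lambda>z. f z * toep g h z)"
    using A2.ip_add_right[OF bounded_holo_mult[OF f u] bounded_holo_mult[OF f tg] L_sub[OF k]] 0 by simp
  then show "l2_inner \<mu> k (\<lambda>z. f z * g z * h z) = l2_inner \<mu> k (toep f (toep g h))"
    using toep_ip[OF f toep_mem[OF g h] k] by simp
qed

lemma toep_commute: "f \<in> bounded_holo \<Omega> \<Longrightarrow> g \<in> bounded_holo \<Omega> \<Longrightarrow> h \<in> L \<Longrightarrow> toep f (toep g h) = toep g (toep f h)"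
  using toep_mult[of f g h] toep_mult[of g f h] by (simp add: mult.commute)

text \<open>The two symbols are extended one after the other. With \<open>g\<close> still a
  generator, the left operator runs through the algebra; then the commutator is turned around,
  \<open>f\<close> is held fixed, and the adjoint runs through it.\<close>

lemma toep_gen_comm_in:
  assumes F: "F \<subseteq> bounded_holo \<Omega>" and base: "\<And>f g. f \<in> F \<Longrightarrow> g \<in> F \<Longrightarrow> P.comm_in p (toep f) (P.adj (toep g))"
    and f: "f \<in> gen \<Omega> F" and g: "g \<in> gen \<Omega> F"
  shows "P.comm_in p (toep f) (P.adj (toep g))"
proof -
  note FH = subsetD[OF F]
  have 1: "P.comm_in p (toep f) (P.adj (toep g))" if "f \<in> gen \<Omega> F" "g \<in> F" for f g
    by (rule P.gen_comm_in[where R = toep and \<kappa> = "\<lambda>a. a", OF open_\<Omega> F P.bop_adj[OF toep_bop[OF FH[OF that(2)]]]])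
      (use base that in \<open>auto intro: toep_bop toep_const toep_add toep_mult toep_cong\<close>)
  have fH: "f \<in> bounded_holo \<Omega>" by (rule gen_bounded_holo[OF open_\<Omega> F f])
  have "P.comm_in p (P.adj (toep g)) (toep f)"
  proof (rule P.gen_comm_in[where R = "\<lambda>f. P.adj (toep f)" and \<kappa> = cnj, OF open_\<Omega> F toep_bop[OF fH]])
    show "P.bop (P.adj (toep f))" if "f \<in> bounded_holo \<Omega>" for f by (rule P.bop_adj[OF toep_bop[OF that]])
    show "P.adj (toep (\<lambda>z. a)) h = (\<lambda>z. cnj a * h z)" if h: "h \<in> L" for a h
      using P.adj_cong[OF P.bop_mult, of a "toep (\<lambda>z. a)" h] toep_const h P.adj_mult[OF h] by simp
    show "P.adj (toep (\<lambda>z. f z + g z)) h = (\<lambda>z. P.adj (toep f) h z + P.adj (toep g) h z)"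
      if fg: "f \<in> bounded_holo \<Omega>" "g \<in> bounded_holo \<Omega>" and h: "h \<in> L" for f g h
      using P.adj_cong[OF P.bop_plus[OF toep_bop[OF fg(1)] toep_bop[OF fg(2)]], of "toep (\<lambda>z. f z + g z)" h]
        toep_add[OF fg] h P.adj_plus[OF toep_bop[OF fg(1)] toep_bop[OF fg(2)] h] by simp
    \<comment> \<open>The adjoint reverses products, but the symbols commute, so the map from
      symbols to adjoints is multiplicative in the stated order.\<close>
    show "P.adj (toep (\<lambda>z. f z * g z)) h = P.adj (toep f) (P.adj (toep g) h)"
      if fg: "f \<in> bounded_holo \<Omega>" "g \<in> bounded_holo \<Omega>" and h: "h \<in> L" for f g h
      using P.adj_cong[OF P.bop_comp[OF toep_bop[OF fg(2)] toep_bop[OF fg(1)]], of "toep (\<lambda>z. f z * g z)" h]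
        toep_mult[OF fg(2,1)] h P.adj_comp[OF toep_bop[OF fg(2)] toep_bop[OF fg(1)] h] by (simp add: mult.commute)
    show "P.adj (toep f) h = P.adj (toep g) h"
      if f: "f \<in> bounded_holo \<Omega>" and h: "h \<in> L" and eq: "\<And>z. z \<in> \<Omega> \<Longrightarrow> f z = g z" for f g h
      by (rule P.adj_cong[OF toep_bop[OF f] _ h, symmetric]) (rule toep_cong[OF _ eq])
    show "P.comm_in p (P.adj (toep g)) (toep f)" if "g \<in> F" for g
      by (rule P.comm_in_swap[OF 1[OF f that]])
  qed (use g in auto)
  then show ?thesis by (rule P.comm_in_swap)
qed

end

section \<open>The algebra generated by the components of an automorphism\<close>

lemma gen_sum: "finite S \<Longrightarrow> (\<And>k. k \<in> S \<Longrightarrow> f k \<in> gen \<Omega> F) \<Longrightarrow> (\<lambda>z. \<Sum>k\<in>S. f k z) \<in> gen \<Omega> F"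
  by (induction S rule: finite_induct) (auto intro: gen_const gen_add)

lemma gen_prod: "finite S \<Longrightarrow> (\<And>k. k \<in> S \<Longrightarrow> f k \<in> gen \<Omega> F) \<Longrightarrow> (\<lambda>z. \<Prod>k\<in>S. f k z) \<in> gen \<Omega> F"
  by (induction S rule: finite_induct) (auto intro: gen_const gen_mult)

lemma gen_power: "f \<in> gen \<Omega> F \<Longrightarrow> (\<lambda>z. f z ^ n) \<in> gen \<Omega> F"
  by (induction n) (auto intro: gen_const gen_mult)

lemma (in sesqui_polynomial) gen_polynomial:
  assumes "\<And>i. (\<lambda>z. g z $ i) \<in> gen \<Omega> F"
  shows "(\<lambda>z. \<Delta> (g z) u) \<in> gen \<Omega> F"
  unfolding \<Delta>_eq monomial_def using assms
  by (intro gen_sum fin_A gen_mult gen_const gen_prod gen_power) auto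

text \<open>By \<open>coordinate_in_span\<close> it suffices to treat
  \<open>\<Delta> (\<eta> (g z)) u\<close>. Writing \<open>u = \<eta> u'\<close>, the transformation
  rule expresses it as a polynomial in \<open>g z\<close> divided by
  \<open>\<Delta> (g z) a\<close>, up to a constant. The parameter \<open>g\<close> allows both the
  identity and an automorphism, the latter for recovering the coordinates.\<close>

lemma (in circular_kernel) gen_automorphism:
  assumes b: "automorphism \<Omega> \<eta>" and g: "\<And>z. z \<in> \<Omega> \<Longrightarrow> g z \<in> \<Omega>" and F: "F \<subseteq> bounded_holo \<Omega>"
    and gen: "\<And>i. (\<lambda>z. g z $ i) \<in> gen \<Omega> F"
  shows "(\<lambda>z. \<eta> (g z) $ i) \<in> gen \<Omega> F"
proof (rule coordinate_in_span[where P = "\<lambda>f. f \<in> gen \<Omega> F" and g = "\<lambda>z. \<eta> (g z)"])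
  fix u assume u: "u \<in> \<Omega>"
  define a where "a = the_inv_into \<Omega> \<eta> 0"
  define u' where "u' = the_inv_into \<Omega> \<eta> u"
  have a: "a \<in> \<Omega>" and u': "u' \<in> \<Omega>" "\<eta> u' = u"
    unfolding a_def u'_def using biholoD(6,8)[OF b] u zero_in by auto
  obtain \<delta> where \<delta>: "\<delta> > 0" "\<And>z. z \<in> \<Omega> \<Longrightarrow> \<delta> \<le> cmod (\<Delta> z a)"
    using denominator_bounded_below[OF b] unfolding a_def by blast
  define q where "q z = inverse (\<Delta> (g z) a)" for z
  have den: "(\<lambda>z. \<Delta> (g z) a) \<in> gen \<Omega> F" by (rule gen_polynomial[OF gen])
  have "q \<in> bounded_holo \<Omega>"
    unfolding bounded_holo_def q_def
  proof (intro CollectI conjI exI ballI)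
    have "(\<lambda>z. \<Delta> (g z) a) \<in> bounded_holo \<Omega>" by (rule gen_bounded_holo[OF open_\<Omega>' F den])
    then show "holo_fun (\<lambda>z. inverse (\<Delta> (g z) a)) \<Omega>"
      by (intro holo_fun_inverse) (use \<Delta>_nz[OF g a] in \<open>auto simp: bounded_holo_def\<close>)
    fix z assume "z \<in> \<Omega>"
    then show "cmod (inverse (\<Delta> (g z) a)) \<le> inverse \<delta>"
      unfolding norm_inverse using \<delta> g by (intro le_imp_inverse_le) auto
  qed
  then have q: "q \<in> gen \<Omega> F" by (rule gen_inverse[OF den]) (use \<Delta>_nz[OF g a] in \<open>simp add: q_def\<close>)
  have "(\<lambda>z. \<Delta> (g z) u' * q z * (\<Delta> a a / \<Delta> a u')) \<in> gen \<Omega> F"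
    by (intro gen_mult gen_const q gen_polynomial gen)
  then show "(\<lambda>z. \<Delta> (\<eta> (g z)) u) \<in> gen \<Omega> F"
  proof (rule gen_cong)
    fix z assume z: "z \<in> \<Omega>"
    have "\<Delta> (\<eta> (g z)) u * \<Delta> (g z) a * \<Delta> a u' = \<Delta> (g z) u' * \<Delta> a a"
      using determinant_transformation[OF b g[OF z] u'(1)] by (simp add: u' a_def)
    then show "\<Delta> (g z) u' * q z * (\<Delta> a a / \<Delta> a u') = \<Delta> (\<eta> (g z)) u"
      using \<Delta>_nz[OF g[OF z] a] \<Delta>_nz[OF a u'(1)] by (simp add: q_def field_simps)
  qed
next
  show "(\<lambda>z. f z + h z) \<in> gen \<Omega> F" if "f \<in> gen \<Omega> F" "h \<in> gen \<Omega> F" for f h by (rule gen_add[OF that])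
  show "(\<lambda>z. a * f z) \<in> gen \<Omega> F" if "f \<in> gen \<Omega> F" for a f by (rule gen_mult[OF gen_const that])
  show "h \<in> gen \<Omega> F" if "f \<in> gen \<Omega> F" "\<And>z. z \<in> \<Omega> \<Longrightarrow> f z = h z" for f h by (rule gen_cong[OF that])
  show "\<eta> (g z) \<in> \<Omega>" if "z \<in> \<Omega>" for z by (rule biholoD(5)[OF b g[OF that]])
qed

section \<open>The pulled back module\<close>

lemma coordinate_bounded_holo:
  assumes "holo_map \<eta> \<Omega>" "\<eta> ` \<Omega> \<subseteq> W" "bounded W"
  shows "(\<lambda>z. \<eta> z $ i) \<in> bounded_holo \<Omega>"
proof -
  obtain B where B: "\<And>z. z \<in> W \<Longrightarrow> norm z \<le> B" using assms(3) unfolding bounded_iff by blast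
  have "cmod (\<eta> z $ i) \<le> B" if "z \<in> \<Omega>" for z
  proof -
    have "\<eta> z \<in> W" using that assms(2) by blast
    then show ?thesis using order_trans[OF Finite_Cartesian_Product.norm_nth_le B] by blast
  qed
  then show ?thesis using holo_map_coord[OF assms(1)] by (auto simp: bounded_holo_def)
qed

locale pulled_back = variety_quotient \<Omega> \<mu> w V L for \<Omega> :: "(complex^'n) set" and \<mu> w V L +
  fixes \<phi> and \<nu>
  assumes \<phi>_auto: "automorphism \<Omega> \<phi>" and \<nu>_eq: "\<nu> = distr \<mu> \<mu> (the_inv_into \<Omega> \<phi>)"
begin

abbreviation \<psi> where "\<psi> \<equiv> the_inv_into \<Omega> \<phi>"
abbreviation L' where "L' \<equiv> pullback \<Omega> \<phi> ` L"

lemma \<psi>_measurable: "\<psi> \<in> \<mu> \<rightarrow>\<^sub>M \<mu>"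
proof -
  have "\<psi> \<in> \<mu> \<rightarrow>\<^sub>M restrict_space borel \<Omega>"
    by (rule measurable_restrict_space2)
      (use biholoD(6)[OF \<phi>_auto] continuous_measurable[OF holo_map_continuous_on[OF biholoD(3)[OF \<phi>_auto]]] in \<open>auto simp: space_\<mu>\<close>)
  then show ?thesis using measurable_cong_sets[OF refl sets_\<mu>] by blast
qed

text \<open>The integrands that occur are sums and products of pullbacks and of symbols defined off
  \<Omega>. Therefore \<open>F\<close> is only required to agree with the composition on
  \<Omega>.\<close>

lemma
  fixes f F :: "complex^'n \<Rightarrow> 'b::{banach, second_countable_topology}"
  assumes f: "continuous_on \<Omega> f" and F: "\<And>x. x \<in> \<Omega> \<Longrightarrow> F x = f (\<phi> x)"
  shows integral_pull: "(LINT x|\<nu>. F x) = (LINT z|\<mu>. f z)"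
    and integrable_pull: "integrable \<nu> F \<longleftrightarrow> integrable \<mu> f"
    and measurable_pull: "F \<in> borel_measurable \<nu>"
proof -
  have "continuous_on \<Omega> (\<lambda>x. f (\<phi> x))"
    by (rule continuous_on_compose2[OF f holo_map_continuous_on[OF biholoD(2)[OF \<phi>_auto]]]) (use biholoD(5)[OF \<phi>_auto] in auto)
  then have "continuous_on \<Omega> F" using F by (simp cong: continuous_on_cong)
  then have Fm: "F \<in> borel_measurable \<mu>" by (rule continuous_measurable)
  then show "F \<in> borel_measurable \<nu>" by (simp add: \<nu>_eq)
  have eq: "F (\<psi> z) = f z" if "z \<in> space \<mu>" for z
    using F biholoD(6,8)[OF \<phi>_auto] that by (simp add: space_\<mu>)
  have "(LINT x|\<nu>. F x) = (LINT z|\<mu>. F (\<psi> z))" unfolding \<nu>_eq by (rule integral_distr[OF \<psi>_measurable Fm])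
  also have "\<dots> = (LINT z|\<mu>. f z)" by (rule Bochner_Integration.integral_cong[OF refl eq])
  finally show "(LINT x|\<nu>. F x) = (LINT z|\<mu>. f z)" .
  have "integrable \<nu> F \<longleftrightarrow> integrable \<mu> (\<lambda>z. F (\<psi> z))" unfolding \<nu>_eq by (rule integrable_distr_eq[OF \<psi>_measurable Fm])
  also have "\<dots> \<longleftrightarrow> integrable \<mu> f" by (rule Bochner_Integration.integrable_cong[OF refl eq])
  finally show "integrable \<nu> F \<longleftrightarrow> integrable \<mu> f" .
qed

lemma l2_inner_pull:
  assumes "continuous_on \<Omega> f" "continuous_on \<Omega> g" "\<And>x. x \<in> \<Omega> \<Longrightarrow> F x = f (\<phi> x)" "\<And>x. x \<in> \<Omega> \<Longrightarrow> G x = g (\<phi> x)"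
  shows "l2_inner \<nu> F G = l2_inner \<mu> f g"
  unfolding l2_inner_def using assms by (intro integral_pull continuous_on_mult continuous_on_cnj) auto

lemma l2_norm_pull:
  assumes "continuous_on \<Omega> f" "\<And>x. x \<in> \<Omega> \<Longrightarrow> F x = f (\<phi> x)"
  shows "l2_norm \<nu> F = l2_norm \<mu> f"
proof -
  have "(LINT x|\<nu>. (cmod (F x))\<^sup>2) = (LINT z|\<mu>. (cmod (f z))\<^sup>2)"
    using assms by (intro integral_pull continuous_on_power continuous_on_norm) auto
  then show ?thesis by (simp add: l2_norm_def)
qed

lemma L_continuous: "h \<in> L \<Longrightarrow> continuous_on \<Omega> h"
  by (intro holo_fun_continuous_on A2_holo L_sub)

lemma pullback_apply: "x \<in> \<Omega> \<Longrightarrow> pullback \<Omega> \<phi> h x = h (\<phi> x)"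
  by (simp add: pullback_def)

lemma pullback_add: "pullback \<Omega> \<phi> (\<lambda>z. f z + g z) = (\<lambda>z. pullback \<Omega> \<phi> f z + pullback \<Omega> \<phi> g z)"
  and pullback_scale: "pullback \<Omega> \<phi> (\<lambda>z. a * f z) = (\<lambda>z. a * pullback \<Omega> \<phi> f z)"
  and pullback_zero: "pullback \<Omega> \<phi> (\<lambda>z. 0) = (\<lambda>z. 0)"
  by (auto simp: pullback_def)

text \<open>The locale \<open>l2_unitary\<close> presupposes that both of its spaces are instances
  of \<open>l2_space\<close>, so integrability and completeness are transferred by hand before it
  becomes available.\<close>

lemma l2_space_pulled_back: "l2_space \<nu> L'"
proof
  fix f assume "f \<in> L'"
  then obtain h where h: "h \<in> L" "f = pullback \<Omega> \<phi> h" by blast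
  have sq: "continuous_on \<Omega> (\<lambda>z. (cmod (h z))\<^sup>2)" using L_continuous[OF h(1)] by (intro continuous_intros)
  show "f \<in> borel_measurable \<nu>"
    by (rule measurable_pull[OF L_continuous[OF h(1)]]) (simp add: h pullback_apply)
  have "integrable \<nu> (\<lambda>z. (cmod (f z))\<^sup>2) \<longleftrightarrow> integrable \<mu> (\<lambda>z. (cmod (h z))\<^sup>2)"
    by (rule integrable_pull[OF sq]) (simp add: h pullback_apply)
  then show "integrable \<nu> (\<lambda>z. (cmod (f z))\<^sup>2)" using A2_integrable[OF L_sub[OF h(1)]] by simp
  have "(LINT z|\<nu>. (cmod (f z))\<^sup>2) = (LINT z|\<mu>. (cmod (h z))\<^sup>2)"
    by (rule integral_pull[OF sq]) (simp add: h pullback_apply)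
  then show "(LINT z|\<nu>. (cmod (f z))\<^sup>2) = 0 \<Longrightarrow> f = (\<lambda>z. 0)"
    using P.L_definite[OF h(1)] h(2) pullback_zero by simp
  show "(\<lambda>z. a * f z) \<in> L'" for a
    unfolding h(2) pullback_scale[symmetric] by (rule imageI[OF P.L_scale[OF h(1)]])
  fix g assume "g \<in> L'"
  then obtain k where k: "k \<in> L" "g = pullback \<Omega> \<phi> k" by blast
  show "(\<lambda>z. f z + g z) \<in> L'" 
    unfolding h(2) k(2) pullback_add[symmetric] by (rule imageI[OF P.L_add[OF h(1) k(1)]])
next
  show "(\<lambda>z. 0) \<in> L'" using P.L_zero pullback_zero by (metis image_eqI)
next
  fix X :: "nat \<Rightarrow> complex^'n \<Rightarrow> complex"
  assume X: "\<And>n. X n \<in> L'" and C: "\<And>e. e > 0 \<Longrightarrow> \<exists>N. \<forall>m\<ge>N. \<forall>n\<ge>N. l2_norm \<nu> (\<lambda>z. X m z - X n z) < e"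
  have "\<forall>n. \<exists>h. h \<in> L \<and> X n = pullback \<Omega> \<phi> h" using X by blast
  then obtain x where x: "\<And>n. x n \<in> L" "\<And>n. X n = pullback \<Omega> \<phi> (x n)" by metis
  have nm: "l2_norm \<nu> (\<lambda>z. X m z - pullback \<Omega> \<phi> g z) = l2_norm \<mu> (\<lambda>z. x m z - g z)" if "g \<in> L" for m g
    by (rule l2_norm_pull) (use L_continuous[OF x(1)] L_continuous[OF that] in \<open>auto intro: continuous_on_diff simp: x(2) pullback_apply\<close>)
  have "\<exists>N. \<forall>m\<ge>N. \<forall>n\<ge>N. l2_norm \<mu> (\<lambda>z. x m z - x n z) < e" if "e > 0" for e
    using C[OF that] nm[OF x(1), folded x(2)] by simp
  from P.L_complete[OF x(1) this] obtain g where g: "g \<in> L" and lim: "(\<lambda>n. l2_norm \<mu> (\<lambda>z. x n z - g z)) \<longlonglongrightarrow> 0" by blast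
  show "\<exists>g\<in>L'. (\<lambda>n. l2_norm \<nu> (\<lambda>z. X n z - g z)) \<longlonglongrightarrow> 0"
    using g lim unfolding nm[OF g, symmetric] by blast
qed

sublocale T: l2_unitary \<mu> L \<nu> L' "pullback \<Omega> \<phi>"
proof (intro l2_unitary.intro l2_unitary_axioms.intro P.l2_space_axioms l2_space_pulled_back)
  show "l2_inner \<nu> (pullback \<Omega> \<phi> f) (pullback \<Omega> \<phi> g) = l2_inner \<mu> f g" if "f \<in> L" "g \<in> L" for f g
    by (rule l2_inner_pull[OF L_continuous[OF that(1)] L_continuous[OF that(2)]]) (simp_all add: pullback_apply)
qed (simp_all add: pullback_add pullback_scale)

text \<open>The projection onto \<open>L'\<close> is a definite description. Pulling back preserves
  inner products, so its defining condition at \<open>pullback \<Omega> \<phi> g\<close> is the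
  condition that characterizes the projection onto \<open>L\<close> at \<open>g\<close>.\<close>

lemma toeplitz_intertwines:
  assumes f: "f \<in> bounded_holo \<Omega>" and F: "\<And>x. x \<in> \<Omega> \<Longrightarrow> F x = f (\<phi> x)"
  shows "T.intertwines (toep f) (truncated_toeplitz \<nu> L' F)"
  unfolding T.intertwines_def
proof
  fix h assume h: "h \<in> L"
  have fh: "(\<lambda>z. f z * h z) \<in> A2" by (rule bounded_holo_mult[OF f L_sub[OF h]])
  have ip: "l2_inner \<nu> (\<lambda>x. F x * pullback \<Omega> \<phi> h x - pullback \<Omega> \<phi> g x) (pullback \<Omega> \<phi> k)
      = l2_inner \<mu> (\<lambda>z. f z * h z - g z) k" if "g \<in> L" "k \<in> L" for g k
    by (rule l2_inner_pull)
      (use holo_fun_continuous_on[OF A2_holo[OF A2_diff[OF fh L_sub[OF that(1)]]]] L_continuous[OF that(2)] F in \<open>auto simp: pullback_apply\<close>)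
  have cond: "(\<forall>k\<in>L'. l2_inner \<nu> (\<lambda>x. F x * pullback \<Omega> \<phi> h x - pullback \<Omega> \<phi> g x) k = 0)
      \<longleftrightarrow> (\<forall>k\<in>L. l2_inner \<mu> k (\<lambda>z. f z * h z) = l2_inner \<mu> k g)" if "g \<in> L" for g
    unfolding proj_condition[OF fh that, symmetric] using ip[OF that] by simp
  show "truncated_toeplitz \<nu> L' F (pullback \<Omega> \<phi> h) = pullback \<Omega> \<phi> (toep f h)"
    unfolding truncated_toeplitz_def[of \<nu>] orth_proj_def[of \<nu>]
  proof (rule the_equality)
    show "pullback \<Omega> \<phi> (toep f h) \<in> L' \<and>
        (\<forall>k\<in>L'. l2_inner \<nu> (\<lambda>z. F z * pullback \<Omega> \<phi> h z - pullback \<Omega> \<phi> (toep f h) z) k = 0)"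
      unfolding cond[OF toep_mem[OF f h]] using toep_mem[OF f h] toep_ip[OF f h] by auto
    fix g' assume g': "g' \<in> L' \<and> (\<forall>k\<in>L'. l2_inner \<nu> (\<lambda>z. F z * pullback \<Omega> \<phi> h z - g' z) k = 0)"
    then obtain g where g: "g \<in> L" "g' = pullback \<Omega> \<phi> g" by blast
    have "\<forall>k\<in>L. l2_inner \<mu> k (\<lambda>z. f z * h z) = l2_inner \<mu> k g"
      unfolding cond[OF g(1), symmetric] using g' unfolding g(2) by blast
    then have "toep f h = g" by (intro toep_eqI[OF f h g(1)]) simp
    then show "g' = pullback \<Omega> \<phi> (toep f h)" using g(2) by simp
  qed
qed

text \<open>On \<Omega> the coordinate \<open>x $ i\<close> is the i-th component of
  \<open>\<psi> (\<phi> x)\<close>, that is, the pullback of the i-th component of \<psi>.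
  Commutators, adjoints and Schatten membership follow the intertwining.\<close>

lemma pulled_back_essentially_normal:
  assumes \<psi>: "\<And>i. (\<lambda>z. \<psi> z $ i) \<in> bounded_holo \<Omega>"
  shows "p_essentially_normal p \<nu> L' (\<lambda>i. truncated_toeplitz \<nu> L' (\<lambda>x. x $ i))
    \<longleftrightarrow> (\<forall>i j. P.comm_in p (toep (\<lambda>z. \<psi> z $ i)) (P.adj (toep (\<lambda>z. \<psi> z $ j))))"
proof -
  let ?S = "\<lambda>i. toep (\<lambda>z. \<psi> z $ i)" and ?S' = "\<lambda>i. truncated_toeplitz \<nu> L' (\<lambda>x. x $ i)"
  have i: "T.intertwines (?S i) (?S' i)" for i
    by (rule toeplitz_intertwines[OF \<psi>]) (simp add: biholoD(7)[OF \<phi>_auto])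
  have bop: "P.bop (?S i)" for i by (rule toep_bop[OF \<psi>])
  have com: "?S' i (?S' j h') = ?S' j (?S' i h')" if "h' \<in> L'" for i j h'
  proof -
    obtain h where h: "h \<in> L" "h' = pullback \<Omega> \<phi> h" using \<open>h' \<in> L'\<close> by blast
    show ?thesis
      using i h P.bop_mem[OF bop h(1)] toep_commute[OF \<psi> \<psi> h(1)] by (simp add: T.intertwines_def)
  qed
  have sch: "T.B.comm_in p (?S' i) (T.B.adj (?S' j)) \<longleftrightarrow> P.comm_in p (?S i) (P.adj (?S j))" for i j
    unfolding T.B.comm_in_def P.comm_in_def
  proof (rule T.intertwines_schatten_iff)
    show "T.intertwines (op_commutator (?S i) (P.adj (?S j))) (op_commutator (?S' i) (T.B.adj (?S' j)))"
      by (intro T.intertwines_commutator T.intertwines_adj bop P.bop_adj i)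
    show "P.bop (op_commutator (?S i) (P.adj (?S j)))"
      using P.bop_minus[OF P.bop_comp[OF bop[of i] P.bop_adj[OF bop[of j]]] P.bop_comp[OF P.bop_adj[OF bop[of j]] bop[of i]]]
      by (simp add: op_commutator_def[abs_def])
  qed
  show ?thesis
    using T.B.p_essentially_normal_iff[OF T.intertwines_bop[OF bop i] com, of p] sch by simp
qed

end

section \<open>Invariance of the spectral norm\<close>

lemma
  assumes T: "positive_hermitian_jordan_triple (T :: 'n::finite triple)"
  shows triple_scale: "T (a *s x) y z = a *s T x y z" "T x (a *s y) z = cnj a *s T x y z" "T x y (a *s z) = a *s T x y z"
    and triple_add: "T (x + x') y z = T x y z + T x' y z" "T x y (z + z') = T x y z + T x y z'"
    and triple_sym: "T x y z = T z y x"
proof -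
  have lin: "Vector_Spaces.linear (*s) (*s) (\<lambda>x. T x y z)" for y z
    using T by (simp add: positive_hermitian_jordan_triple_def)
  show sym: "T x y z = T z y x" for x y z using T unfolding positive_hermitian_jordan_triple_def by blast
  have hom: "module_hom (*s) (*s) (\<lambda>x. T x y z)" for y z using lin[of y z] by (simp add: Vector_Spaces.linear_def)
  show 1: "T (a *s x) y z = a *s T x y z" for x z using module_hom.scale[OF hom] by blast
  show 2: "T (x + x') y z = T x y z + T x' y z" for x x' z using module_hom.add[OF hom] by blast
  show "T x (a *s y) z = cnj a *s T x y z" using T by (simp add: positive_hermitian_jordan_triple_def)
  show "T x y (a *s z) = a *s T x y z" using 1[of z x] sym[of x] by simp
  show "T x y (z + z') = T x y z + T x y z'" using 2[of z z' x] sym[of x] by simp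
qed

lemma spectral_decomposition_unimodular:
  assumes T: "positive_hermitian_jordan_triple (T :: 'n::finite triple)" and u: "cmod u = 1"
    and d: "spectral_decomposition T x k l e"
  shows "spectral_decomposition T (u *s x) k l (\<lambda>i. u *s e i)"
proof -
  have cu: "u * cnj u = 1" using u complex_norm_square[of u] by simp
  have "u *s x = (\<Sum>i<k. l i *\<^sub>R (u *s e i))"
  proof -
    have "u *s (\<Sum>i<k. l i *\<^sub>R e i) = (\<Sum>i<k. u *s (l i *\<^sub>R e i))" by (rule vec.scale_sum_right)
    also have "\<dots> = (\<Sum>i<k. l i *\<^sub>R (u *s e i))" by (simp add: vec_scaleR vector_smult_assoc mult.commute)
    finally show ?thesis using d by (simp add: spectral_decomposition_def)
  qed
  moreover have "u \<noteq> 0" using u by auto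
  moreover have "tripotent T (u *s e i)" if "tripotent T (e i)" for i
    using that cu by (simp add: tripotent_def triple_scale[OF T] vector_smult_assoc mult.assoc[symmetric])
  moreover have "triple_orthogonal T (u *s e i) (u *s e j)" if "triple_orthogonal T (e i) (e j)" for i j
    using that by (simp add: triple_orthogonal_def triple_scale[OF T])
  ultimately show ?thesis using d by (auto simp: spectral_decomposition_def)
qed

text \<open>The spectral norm is a definite description. Decompositions of \<open>x\<close> and
  \<open>u *s x\<close> have the same coefficients, the tripotents being multiplied by
  \<open>u\<close>, so both descriptions are given by the same predicate.\<close>

lemma spectral_norm_unimodular:
  assumes T: "positive_hermitian_jordan_triple (T :: 'n::finite triple)" and u: "cmod u = 1"
  shows "spectral_norm T (u *s x) = spectral_norm T x"
proof -
  have cu: "cnj u * u = 1" "cmod (cnj u) = 1" using u complex_norm_square[of u] by (auto simp: mult.commute)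
  have "(\<exists>e. spectral_decomposition T (u *s x) k l e) \<longleftrightarrow> (\<exists>e. spectral_decomposition T x k l e)" for k l
    using spectral_decomposition_unimodular[OF T u, of x k l] spectral_decomposition_unimodular[OF T cu(2), of "u *s x" k l]
    by (auto simp: vector_smult_assoc cu)
  then have "(\<exists>k l e. spectral_decomposition T (u *s x) k l e \<and> r = Max (insert 0 (l ` {..<k})))
      \<longleftrightarrow> (\<exists>k l e. spectral_decomposition T x k l e \<and> r = Max (insert 0 (l ` {..<k})))" for r
    by blast
  then show ?thesis by (simp add: spectral_norm_def)
qed

text \<open>The zero vector has only the empty decomposition; the \<open>insert 0\<close> in the
  definition then gives the value 0.\<close>

lemma spectral_norm_zero:
  assumes T: "positive_hermitian_jordan_triple (T :: 'n::finite triple)"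
  shows "spectral_norm T 0 = 0"
  unfolding spectral_norm_def
proof (rule the_equality)
  have "spectral_decomposition T 0 0 (\<lambda>_. 0) (\<lambda>_. 0)" by (simp add: spectral_decomposition_def)
  then show "\<exists>k l e. spectral_decomposition T 0 k l e \<and> 0 = Max (insert 0 (l ` {..<k}))"
    by (intro exI[of _ 0] exI[of _ "\<lambda>_. 0"]) auto
  fix r assume "\<exists>k l e. spectral_decomposition T 0 k l e \<and> r = Max (insert 0 (l ` {..<k}))"
  then obtain k l e where d: "spectral_decomposition T 0 k l e" and r: "r = Max (insert 0 (l ` {..<k}))" by blast
  have "k = 0"
  proof (rule ccontr)
    assume "k \<noteq> 0"
    \<comment> \<open>The last index is taken because orthogonality is stated for increasing pairs.
      Applying \<open>T (e m) (e m)\<close> to the sum annihilates all earlier terms, by symmetry in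
      the outer arguments, and leaves \<open>l m *\<^sub>R e m\<close>.\<close>
    then obtain m where k: "k = Suc m" using not0_implies_Suc by blast
    have e: "tripotent T (e m)" "e m \<noteq> 0" "l m > 0" and orth: "\<And>i. i < m \<Longrightarrow> triple_orthogonal T (e i) (e m)"
      and sum: "0 = (\<Sum>i<k. l i *\<^sub>R e i)"
      using d by (auto simp: spectral_decomposition_def k)
    have zero: "T (e m) (e m) 0 = 0" using triple_scale(3)[OF T, of "e m" "e m" 0 0] by simp
    have scale: "T (e m) (e m) (l i *\<^sub>R e i) = l i *\<^sub>R T (e m) (e m) (e i)" for i
      unfolding vec_scaleR by (rule triple_scale(3)[OF T])
    have Tsum: "T (e m) (e m) (\<Sum>i\<in>S. l i *\<^sub>R e i) = (\<Sum>i\<in>S. l i *\<^sub>R T (e m) (e m) (e i))" if "finite S" for S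
      using that by (induction S rule: finite_induct) (simp_all add: zero triple_add(2)[OF T] scale)
    have "T (e m) (e m) (e i) = 0" if "i < m" for i
      using orth[OF that] triple_sym[OF T, of "e m" "e m" "e i"] by (simp add: triple_orthogonal_def)
    then have "T (e m) (e m) (\<Sum>i<k. l i *\<^sub>R e i) = l m *\<^sub>R e m"
      using e(1) by (subst Tsum) (simp_all add: k tripotent_def)
    then show False using sum zero e(2,3) by simp
  qed
  then show "r = 0" using r by simp
qed

theorem theorem2:
  fixes \<Omega> V :: "(complex^'n) set"
    and T :: "('n::finite) triple" and N :: nat
    and \<Delta> :: "complex^'n \<Rightarrow> complex^'n \<Rightarrow> complex"
    and \<gamma> c :: real and p :: ennreal
    and \<phi> :: "complex^'n \<Rightarrow> complex^'n"
    and \<mu> \<nu> :: "(complex^'n) measure"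
    and Mperp :: "(complex^'n \<Rightarrow> complex) set"
  assumes "irreducible_bsd \<Omega>"
    and "positive_hermitian_jordan_triple T"
    and "\<Omega> = {z. spectral_norm T z < 1}"
    and "has_genus T N"
    and "jordan_triple_determinant \<Omega> N \<Delta>"
    and "\<gamma> > -1"
    and "\<mu> = weighted_measure c \<gamma> (\<lambda>w. \<Delta> w w) (normalized_lebesgue \<Omega>)"
    and "prob_space \<mu>"
    and "p \<ge> 1"
    and "analytic_variety \<Omega> V"
    and "Mperp = bergman_perp \<Omega> \<mu> (variety_submodule \<Omega> \<mu> V)"
    and "automorphism \<Omega> \<phi>"
    and "\<nu> = weighted_measure c \<gamma> (\<lambda>w. \<Delta> (\<phi> w) (\<phi> w))
                (pullback_measure \<Omega> \<phi> (normalized_lebesgue \<Omega>))"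
  shows
    "(p_essentially_normal p \<nu> (pullback \<Omega> \<phi> ` Mperp)
        (\<lambda>i. truncated_toeplitz \<nu> (pullback \<Omega> \<phi> ` Mperp) (\<lambda>w. w $ i))
      \<longleftrightarrow>
      p_essentially_normal p \<mu> Mperp
        (\<lambda>i. truncated_toeplitz \<mu> Mperp (\<lambda>z. z $ i)))
     \<and>
     ((\<forall>i j. op_commutator
          (truncated_toeplitz \<mu> Mperp (\<lambda>w. w $ i))
          (op_adjoint \<mu> Mperp (truncated_toeplitz \<mu> Mperp (\<lambda>w. w $ j)))
            \<in> schatten_class p \<mu> Mperp)
      \<longleftrightarrow>
      (\<forall>i j. op_commutator
          (truncated_toeplitz \<mu> Mperp (\<lambda>w. \<phi> w $ i))
          (op_adjoint \<mu> Mperp (truncated_toeplitz \<mu> Mperp (\<lambda>w. \<phi> w $ j)))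
            \<in> schatten_class p \<mu> Mperp))"
proof -
  let ?v = "normalized_lebesgue \<Omega>" and ?\<psi> = "the_inv_into \<Omega> \<phi>"
  have bd: "open \<Omega>" "connected \<Omega>" "bounded \<Omega>" "\<Omega> \<noteq> {}"
    using assms(1) by (auto simp: irreducible_bsd_def bounded_symmetric_domain_def bounded_domain_def)
  obtain A and d :: "('n \<Rightarrow> nat) \<times> ('n \<Rightarrow> nat) \<Rightarrow> complex" where A: "finite A"
    "\<And>z w. \<Delta> z w = (\<Sum>(a, b)\<in>A. d (a, b) * (\<Prod>i\<in>UNIV. (z $ i) ^ a i) * (\<Prod>i\<in>UNIV. cnj (w $ i) ^ b i))"
    using assms(5) unfolding jordan_triple_determinant_def polynomial_in_z_wbar_def by blast
  have \<Delta>: "\<Delta> 0 0 = 1" "\<And>z w. z \<in> \<Omega> \<Longrightarrow> w \<in> \<Omega> \<Longrightarrow> \<Delta> z w \<noteq> 0"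
    "is_bergman_kernel \<Omega> ?v (\<lambda>z w. 1 / \<Delta> z w ^ N)"
    using assms(5) by (auto simp: jordan_triple_determinant_def)
  interpret circular_kernel \<Omega> \<Delta> A d N
  proof
    show "\<Delta> z w = (\<Sum>p\<in>A. d p * monomial (fst p) z * cnj (monomial (snd p) w))" for z w
      unfolding A(2) cnj_monomial monomial_def by (simp add: case_prod_unfold)
    show "N > 0" using assms(4) by (auto simp: has_genus_def)
    show "0 \<in> \<Omega>" using spectral_norm_zero[OF assms(2)] unfolding assms(3) by simp
    show "u *s z \<in> \<Omega>" if "z \<in> \<Omega>" "cmod u = 1" for z u
      using that spectral_norm_unimodular[OF assms(2), of u z] unfolding assms(3) by simp
  qed (use bd \<Delta> A in auto)
  \<comment> \<open>A constant that is not positive would make the density vanish, since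
    \<open>ennreal\<close> cuts off negative values, and \<mu> would not have total mass
    one.\<close>
  have c: "c > 0"
  proof (rule ccontr)
    assume "\<not> c > 0"
    then have "ennreal (c * Re (\<Delta> w w) powr \<gamma>) = 0" for w by (simp add: ennreal_neg mult_nonpos_nonneg)
    then have "emeasure \<mu> (space \<mu>) = 0"
      unfolding assms(7) weighted_measure_def by (simp add: emeasure_density)
    then show False using prob_space.emeasure_space_1[OF assms(8)] by simp
  qed
  \<comment> \<open>The density of \<mu> relative to plain Lebesgue measure on \<Omega>, so that the
    factor \<open>1 / vol\<close> of the normalization is included.\<close>
  define w where "w z = 1 / vol * (c * Re (\<Delta> z z) powr \<gamma>)" for z
  have cont\<Delta>: "continuous_on \<Omega> (\<lambda>z. Re (\<Delta> z z) powr \<gamma>)"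
    using \<Delta>_diagonal_pos(2) by (intro continuous_on_powr continuous_on_Re continuous_\<Delta> continuous_on_id continuous_on_const) force
  have vm: "(\<lambda>z. ennreal (c * Re (\<Delta> z z) powr \<gamma>)) \<in> borel_measurable ?v"
    using N.continuous_measurable[OF cont\<Delta>] by measurable
  have \<mu>_dens: "\<mu> = density (restrict_space lborel \<Omega>) (\<lambda>z. ennreal (w z))"
  proof -
    have m1: "(\<lambda>z. ennreal (c * Re (\<Delta> z z) powr \<gamma>)) \<in> borel_measurable (restrict_space lborel \<Omega>)"
      using vm unfolding normalized_lebesgue_eq by simp
    have "\<mu> = density (restrict_space lborel \<Omega>) (\<lambda>z. ennreal (1 / vol) * ennreal (c * Re (\<Delta> z z) powr \<gamma>))"
      unfolding assms(7) weighted_measure_def normalized_lebesgue_eq by (rule density_density_eq[OF _ m1]) simp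
    then show ?thesis using vol_pos c by (simp add: w_def ennreal_mult'[symmetric])
  qed
  have V: "V \<subseteq> \<Omega>" using assms(10) by (auto simp: analytic_variety_def closedin_def)
  interpret variety_quotient \<Omega> \<mu> w V Mperp
  proof
    show "continuous_on \<Omega> w" unfolding w_def by (intro continuous_on_mult continuous_on_const cont\<Delta>)
    show "w z > 0" if "z \<in> \<Omega>" for z
      unfolding w_def using vol_pos c \<Delta>_diagonal_pos(2)[OF that] by simp
    have "space \<mu> = \<Omega>" unfolding \<mu>_dens by (simp add: space_restrict_space)
    then show "emeasure \<mu> \<Omega> < \<infinity>" using prob_space.emeasure_space_1[OF assms(8)] by simp
  qed (use bd \<mu>_dens V assms(11) in auto)
  note b = assms(12)
  have b': "automorphism \<Omega> ?\<psi>" by (rule biholo_inverse[OF bd(1) b])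
  \<comment> \<open>Weighting after the transport equals transport after weighting with the composed
    density; since \<open>\<phi> (?\<psi> x) = x\<close> on \<Omega>, this composed density is the
    one of \<mu>.\<close>
  have \<nu>: "\<nu> = distr \<mu> \<mu> ?\<psi>"
  proof -
    let ?f = "\<lambda>w. ennreal (c * Re (\<Delta> (\<phi> w) (\<phi> w)) powr \<gamma>)"
    note \<psi>m = automorphism_measurable[OF b']
    have fm: "?f \<in> borel_measurable ?v"
      using measurable_compose[OF automorphism_measurable[OF b] vm] .
    have "\<nu> = distr (density ?v (\<lambda>x. ?f (?\<psi> x))) ?v ?\<psi>"
      unfolding assms(13) weighted_measure_def pullback_measure_def by (rule density_distr[OF fm \<psi>m])
    also have "density ?v (\<lambda>x. ?f (?\<psi> x)) = \<mu>"
      unfolding assms(7) weighted_measure_def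
      by (rule density_cong[OF measurable_compose[OF \<psi>m fm] vm AE_I2]) (simp add: N.space_\<mu> biholoD(8)[OF b])
    also have "distr \<mu> ?v ?\<psi> = distr \<mu> \<mu> ?\<psi>" by (rule distr_cong) (simp_all add: assms(7) weighted_measure_def)
    finally show ?thesis .
  qed
  interpret pulled_back \<Omega> \<mu> w V Mperp \<phi> \<nu>
    by unfold_locales (rule b \<nu>)+
  define Z :: "(complex^'n \<Rightarrow> complex) set" where "Z = range (\<lambda>i z. z $ i)"
  have Z: "Z \<subseteq> bounded_holo \<Omega>" unfolding Z_def using coordinate_bounded_holo[OF _ order_refl, of "\<lambda>z. z"] bd(3)
    by (auto simp: holo_map_def holo_fun_coord)
  have auto_bounded: "(\<lambda>z. \<eta> z $ i) \<in> bounded_holo \<Omega>" if "automorphism \<Omega> \<eta>" for \<eta> i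
    using coordinate_bounded_holo[of \<eta> \<Omega> \<Omega>] biholoD(2,5)[OF that] bd(3) by auto
  have equiv: "(\<forall>i j. P.comm_in p (toep (\<lambda>z. z $ i)) (P.adj (toep (\<lambda>z. z $ j))))
      \<longleftrightarrow> (\<forall>i j. P.comm_in p (toep (\<lambda>z. \<eta> z $ i)) (P.adj (toep (\<lambda>z. \<eta> z $ j))))"
    if b: "automorphism \<Omega> \<eta>" for \<eta>
  proof -
    define G where "G = range (\<lambda>i z. \<eta> z $ i)"
    have G: "G \<subseteq> bounded_holo \<Omega>" unfolding G_def using auto_bounded[OF b] by blast
    have 1: "(\<lambda>z. \<eta> z $ i) \<in> gen \<Omega> Z" for i
      by (rule gen_automorphism[OF b _ Z]) (auto simp: Z_def intro: gen_base)
    \<comment> \<open>Here \<eta> plays the role of \<open>g\<close> and its inverse the role of the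
      automorphism: the components of \<eta> are generators by definition, and composing with the
      inverse returns the coordinates.\<close>
    have "(\<lambda>z. the_inv_into \<Omega> \<eta> (\<eta> z) $ i) \<in> gen \<Omega> G" for i
      by (rule gen_automorphism[OF biholo_inverse[OF bd(1) b] _ G])
        (use biholoD(5)[OF b] in \<open>auto simp: G_def intro: gen_base\<close>)
    then have 2: "(\<lambda>z. z $ i) \<in> gen \<Omega> G" for i
      by (rule gen_cong) (simp add: biholoD(7)[OF b])
    show ?thesis
    proof
      assume "\<forall>i j. P.comm_in p (toep (\<lambda>z. z $ i)) (P.adj (toep (\<lambda>z. z $ j)))"
      then have "P.comm_in p (toep f) (P.adj (toep g))" if "f \<in> Z" "g \<in> Z" for f g using that by (auto simp: Z_def)
      then show "\<forall>i j. P.comm_in p (toep (\<lambda>z. \<eta> z $ i)) (P.adj (toep (\<lambda>z. \<eta> z $ j)))"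
        using toep_gen_comm_in[OF Z _ 1 1] by blast
    next
      assume "\<forall>i j. P.comm_in p (toep (\<lambda>z. \<eta> z $ i)) (P.adj (toep (\<lambda>z. \<eta> z $ j)))"
      then have "P.comm_in p (toep f) (P.adj (toep g))" if "f \<in> G" "g \<in> G" for f g using that by (auto simp: G_def)
      then show "\<forall>i j. P.comm_in p (toep (\<lambda>z. z $ i)) (P.adj (toep (\<lambda>z. z $ j)))"
        using toep_gen_comm_in[OF G _ 2 2] by blast
    qed
  qed
  have Zb: "(\<lambda>z. z $ i) \<in> bounded_holo \<Omega>" for i using Z by (auto simp: Z_def)
  have "p_essentially_normal p \<mu> Mperp (\<lambda>i. toep (\<lambda>z. z $ i))
      \<longleftrightarrow> (\<forall>i j. P.comm_in p (toep (\<lambda>z. z $ i)) (P.adj (toep (\<lambda>z. z $ j))))"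
    by (intro P.p_essentially_normal_iff toep_bop toep_commute Zb)
  moreover have "p_essentially_normal p \<nu> (pullback \<Omega> \<phi> ` Mperp)
        (\<lambda>i. truncated_toeplitz \<nu> (pullback \<Omega> \<phi> ` Mperp) (\<lambda>w. w $ i))
      \<longleftrightarrow> (\<forall>i j. P.comm_in p (toep (\<lambda>z. ?\<psi> z $ i)) (P.adj (toep (\<lambda>z. ?\<psi> z $ j))))"
    by (rule pulled_back_essentially_normal[OF auto_bounded[OF b']])
  ultimately show ?thesis
    using equiv[OF b'] equiv[OF b] unfolding P.comm_in_def by blast
qed



end
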